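(* Let $k$ be a complete, non-trivially valued non-Archimedean field and $\mu$ a probability measure with countable support on $\mathrm{SL}(2,k)$ such that the group generated by $\mathrm{supp}(\mu)$ is non-elementary. Let $\Omega_n=\{\omega:\ r_n(\omega)\text{ is hyperbolic}\}$ and let $\mathrm{att}^n,\mathrm{rep}^n:\Omega_n\to\mathbb{P}^1(k)$ send $\omega$ to the attracting, resp. repelling, fixed point of $r_n(\omega)$. Then $\mathsf{P}(\Omega_n)\to1$, and $(\mathrm{att}^n)_*(\mathsf{P}|_{\Omega_n})\to\nu$ and $(\mathrm{rep}^n)_*(\mathsf{P}|_{\Omega_n})\to\check\nu$ weakly on $\mathbb{P}^{1,an}_k$, where $\nu$ (resp. $\check\nu$) is the unique $\mu$-stationary (resp. $\check\mu$-stationary) probability measure. If moreover $\int\log\|\gamma\|\,d\mu(\gamma)<\infty$, then for every $\varepsilon>0$, $$\mathsf{P}\left(\left|\tfrac1n\log|\mathrm{tr}(r_n(\omega))|-\chi(\mu)\right|<\varepsilon\right)\to1.$$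
   Context: $(\Omega,\mathsf{P})=(\mathrm{SL}(2,k)^{\mathbb{N}^*},\mu^{\mathbb{N}^*})$, $r_n(\omega)=\gamma_1\cdots\gamma_n$ for $\omega=(\gamma_i)$. $\check\mu$ is the image of $\mu$ under $\gamma\mapsto\gamma^{-1}$. An element $\gamma$ is hyperbolic if $|\mathrm{tr}\gamma|>1$; it then has an attracting and a repelling fixed point in $\mathbb{P}^1(k)$. Non-elementary: image in $\mathrm{PGL}(2,k)$ contains a hyperbolic element and has no finite orbit on $\mathbb{P}^1(k)$. $\mathbb{P}^{1,an}_k$ is the Berkovich projective line; stationary means $\nu=\int\gamma_*\nu\,d\mu(\gamma)$ (such $\nu$ exists uniquely here). $\|\gamma\|$ is the maximum absolute value of entries, $\chi(\mu)=\lim_n\frac1n\int\log\|\gamma\|\,d\mu^n(\gamma)$ with $\mu^n$ the $n$-th convolution power. *)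

theory Defs
  imports "HOL-Probability.Probability" "HOL-Computational_Algebra.Polynomial"
begin

definition nonarch_abs :: "('k::field \<Rightarrow> real) \<Rightarrow> bool" where
  "nonarch_abs v \<longleftrightarrow>
     (\<forall>x. 0 \<le> v x) \<and> (\<forall>x. v x = 0 \<longleftrightarrow> x = 0) \<and>
     (\<forall>x y. v (x * y) = v x * v y) \<and> (\<forall>x y. v (x + y) \<le> max (v x) (v y))"

definition complete_nontrivial_nonarch_field :: "('k::field \<Rightarrow> real) \<Rightarrow> bool" where
  "complete_nontrivial_nonarch_field v \<longleftrightarrow>
     nonarch_abs v \<and> (\<exists>x. v x \<noteq> 0 \<and> v x \<noteq> 1) \<and>
     (\<forall>s::nat \<Rightarrow> 'k. (\<forall>e>0. \<exists>N. \<forall>m\<ge>N. \<forall>n\<ge>N. v (s m - s n) < e) \<longrightarrow>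
        (\<exists>l. \<forall>e>0. \<exists>N. \<forall>n\<ge>N. v (s n - l) < e))"

type_synonym 'k mat2 = "'k^2^2"

definition SL2 :: "'k::field mat2 set" where
  "SL2 = {A. det A = 1}"

definition minv :: "'k::field mat2 \<Rightarrow> 'k mat2" where
  "minv A = (THE B. A ** B = mat 1 \<and> B ** A = mat 1)"

definition mnorm :: "('k::field \<Rightarrow> real) \<Rightarrow> 'k mat2 \<Rightarrow> real" where
  "mnorm v A = Max {v (A $ i $ j) | i j. True}"

definition hyperbolic :: "('k::field \<Rightarrow> real) \<Rightarrow> 'k mat2 \<Rightarrow> bool" where
  "hyperbolic v A \<longleftrightarrow> v (trace A) > 1"

text \<open>The projective line P^1(k): Some z is [z:1], None is the point at infinity [1:0].\<close>

definition line_of :: "'k::field^2 \<Rightarrow> 'k option" where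
  "line_of w = (if w $ 2 = 0 then None else Some (w $ 1 / w $ 2))"

definition moebius :: "'k::field mat2 \<Rightarrow> 'k option \<Rightarrow> 'k option" where
  "moebius A p = (case p of
      None \<Rightarrow> (if A$2$1 = 0 then None else Some (A$1$1 / A$2$1))
    | Some z \<Rightarrow> (if A$2$1 * z + A$2$2 = 0 then None
                 else Some ((A$1$1 * z + A$1$2) / (A$2$1 * z + A$2$2))))"

definition att :: "('k::field \<Rightarrow> real) \<Rightarrow> 'k mat2 \<Rightarrow> 'k option" where
  "att v A = (THE p. \<exists>w l. w \<noteq> 0 \<and> A *v w = l *s w \<and> v l > 1 \<and> p = line_of w)"

definition rep :: "('k::field \<Rightarrow> real) \<Rightarrow> 'k mat2 \<Rightarrow> 'k option" where
  "rep v A = (THE p. \<exists>w l. w \<noteq> 0 \<and> A *v w = l *s w \<and> v l < 1 \<and> p = line_of w)"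

inductive_set gen_group :: "'k::field mat2 set \<Rightarrow> 'k mat2 set" for S where
  one: "mat 1 \<in> gen_group S"
| gen: "g \<in> S \<Longrightarrow> h \<in> gen_group S \<Longrightarrow> g ** h \<in> gen_group S"
| geninv: "g \<in> S \<Longrightarrow> h \<in> gen_group S \<Longrightarrow> minv g ** h \<in> gen_group S"

definition non_elementary :: "('k::field \<Rightarrow> real) \<Rightarrow> 'k mat2 set \<Rightarrow> bool" where
  "non_elementary v G \<longleftrightarrow> (\<exists>g\<in>G. hyperbolic v g) \<and>
     \<not> (\<exists>p. finite {moebius g p | g. g \<in> G})"

text \<open>Omega = sequences (gamma_0, gamma_1, ...) (index shifted by one w.r.t. the paper);
  the coordinate spaces are restricted to the (countable) support of mu, a set of full
  measure, so that the discrete sigma-algebra is used on each factor.\<close>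

definition Omega_P :: "'k::field mat2 pmf \<Rightarrow> (nat \<Rightarrow> 'k mat2) measure" where
  "Omega_P \<mu> = PiM UNIV (\<lambda>_. restrict_space (measure_pmf \<mu>) (set_pmf \<mu>))"

fun rprod :: "(nat \<Rightarrow> 'k::field mat2) \<Rightarrow> nat \<Rightarrow> 'k mat2" where
  "rprod \<omega> 0 = mat 1"
| "rprod \<omega> (Suc n) = rprod \<omega> n ** \<omega> n"

fun conv_pow :: "'k::field mat2 pmf \<Rightarrow> nat \<Rightarrow> 'k mat2 pmf" where
  "conv_pow \<mu> 0 = return_pmf (mat 1)"
| "conv_pow \<mu> (Suc n) = bind_pmf (conv_pow \<mu> n) (\<lambda>a. map_pmf (\<lambda>b. a ** b) \<mu>)"

definition lyap :: "('k::field \<Rightarrow> real) \<Rightarrow> 'k mat2 pmf \<Rightarrow> real" where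
  "lyap v \<mu> = lim (\<lambda>n. (1 / real n) *
      measure_pmf.expectation (conv_pow \<mu> n) (\<lambda>g. ln (mnorm v g)))"

definition check_mu :: "'k::field mat2 pmf \<Rightarrow> 'k mat2 pmf" where
  "check_mu \<mu> = map_pmf minv \<mu>"

text \<open>Points of the Berkovich affine line: multiplicative seminorms on k[T] extending
  the absolute value. Berkovich projective line: these together with None (= infinity).\<close>

definition berkA :: "('k::field \<Rightarrow> real) \<Rightarrow> ('k poly \<Rightarrow> real) set" where
  "berkA v = {x. (\<forall>f. 0 \<le> x f) \<and> (\<forall>f g. x (f * g) = x f * x g) \<and>
                 (\<forall>f g. x (f + g) \<le> x f + x g) \<and> (\<forall>c. x [:c:] = v c)}"

definition berkP1 :: "('k::field \<Rightarrow> real) \<Rightarrow> ('k poly \<Rightarrow> real) option set" where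
  "berkP1 v = insert None (Some ` berkA v)"

text \<open>Topology: the weak (Gelfand) topology on the affine part, and neighbourhoods
  of infinity {|T|_x > R} \<union> {infinity}; this is the one-point compactification of
  the Berkovich affine line.\<close>

definition berk_top :: "('k::field \<Rightarrow> real) \<Rightarrow> ('k poly \<Rightarrow> real) option topology" where
  "berk_top v = topology_generated_by
     ({Some ` {x \<in> berkA v. a < x f \<and> x f < b} | f a b. True} \<union>
      {insert None (Some ` {x \<in> berkA v. R < x [:0, 1:]}) | R. True})"

definition borel_of_top :: "'a topology \<Rightarrow> 'a measure" where
  "borel_of_top T = sigma (topspace T) {U. openin T U}"

definition berk_emb :: "('k::field \<Rightarrow> real) \<Rightarrow> 'k option \<Rightarrow> ('k poly \<Rightarrow> real) option" where
  "berk_emb v p = map_option (\<lambda>z f. v (poly f z)) p"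

text \<open>Action of SL(2,k) on the Berkovich line extending the Moebius action:
  [A.x](f) = [ (cT+d)^(deg f) f((aT+b)/(cT+d)) ]_x / [cT+d]_x^(deg f).\<close>

definition moeb_subst :: "'k::field mat2 \<Rightarrow> 'k poly \<Rightarrow> 'k poly" where
  "moeb_subst A f = (\<Sum>i\<le>degree f. smult (coeff f i)
      ([:A$1$2, A$1$1:] ^ i * [:A$2$2, A$2$1:] ^ (degree f - i)))"

definition berk_act :: "('k::field \<Rightarrow> real) \<Rightarrow> 'k mat2 \<Rightarrow> ('k poly \<Rightarrow> real) option
     \<Rightarrow> ('k poly \<Rightarrow> real) option" where
  "berk_act v A p = (case p of
      None \<Rightarrow> berk_emb v (moebius A None)
    | Some x \<Rightarrow> (if x [:A$2$2, A$2$1:] = 0 then None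
                 else Some (\<lambda>f. x (moeb_subst A f) / x [:A$2$2, A$2$1:] ^ degree f)))"

definition stationary :: "('k::field \<Rightarrow> real) \<Rightarrow> 'k mat2 pmf
     \<Rightarrow> ('k poly \<Rightarrow> real) option measure \<Rightarrow> bool" where
  "stationary v \<mu> \<nu> \<longleftrightarrow> prob_space \<nu> \<and> sets \<nu> = sets (borel_of_top (berk_top v)) \<and>
     (\<forall>B\<in>sets \<nu>. emeasure \<nu> B =
        (\<integral>\<^sup>+ g. emeasure \<nu> (berk_act v g -` B \<inter> space \<nu>) \<partial>measure_pmf \<mu>))"

definition weak_conv :: "'a topology \<Rightarrow> (nat \<Rightarrow> 'a measure) \<Rightarrow> 'a measure \<Rightarrow> bool" where
  "weak_conv T M N \<longleftrightarrow> (\<forall>f. continuous_map T euclideanreal f \<and> bounded (f ` topspace T) \<longrightarrow>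
      (\<lambda>n. \<integral>x. f x \<partial>M n) \<longlonglongrightarrow> (\<integral>x. f x \<partial>N))"

end

theory Submission
  imports Defs
begin

text \<open>
  All probabilistic input comes from one maximum principle. Suppose that an event depending on a
  product \<open>g\<close> of \<open>n\<close> random matrices and on a point \<open>x\<close> has asymptotic maximal probability \<open>e > 0\<close>.
  Conditioning on the last \<open>m\<close> factors shows that along with a nearly optimal \<open>x\<close> all points \<open>s x\<close>,
  with \<open>s\<close> in a finite part of the support of the \<open>m\<close>-th convolution power, are nearly optimal.
  The support semigroup contains hyperbolic elements, and with their help one finds arbitrarily
  many \<open>s\<close> for which these events are essentially disjoint, whence \<open>e = 0\<close>. This yields that the
  norm of \<open>g\<close> tends to infinity in probability, and that \<open>|g x| \<ge> d |g| |x|\<close> with probability close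
  to 1, uniformly in \<open>x\<close>.

  Consequently \<open>r\<^sub>n\<close> contracts \<open>P\<^sup>1(k)\<close>: the points \<open>r\<^sub>n x\<close> form a Cauchy sequence in probability, and
  their limit \<open>Z\<close> does not depend on \<open>x\<close>, even for \<open>x\<close> in the Berkovich line. The law of \<open>Z\<close> is
  stationary, and any stationary measure, being an average of the laws of \<open>r\<^sub>n x\<close>, agrees with the law
  of \<open>Z\<close> on continuous functions. The attracting fixed point of \<open>r\<^sub>n\<close> is close to \<open>r\<^sub>n x\<close>, and the
  repelling one is the attracting fixed point of the inverse. Splitting \<open>r\<^sub>n = a b\<close> into independent
  factors, the trace of \<open>a b\<close> is comparable with \<open>|a| |b|\<close>, so the trace grows like the norm, whose
  growth follows from subadditivity and a law of large numbers.
\<close>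

section \<open>The valuation, the norm and the distance on the projective line\<close>

text \<open>The field \<open>k\<close> need not be locally compact, so probability measures on
  \<open>P^1(k)\<close> need not have weak limits there. This obstacle shapes the proof:
  concentration is excluded at finite times, through an asymptotic supremum of probabilities, and
  the limit point \<open>Z\<close> is produced by completeness of \<open>k\<close>. On the Berkovich
  line only convergence towards a classical point ever occurs, and the function \<open>bd\<close>,
  defined between a Berkovich and a classical point, controls it. Two algebraic facts carry the
  estimates. By \<open>v_add_eq\<close> a strictly largest summand decides the absolute value of a
  sum, so lower bounds for determinants and traces reduce to showing that one term dominates. The
  Plucker identity \<open>wedge_plucker\<close> expresses a third vector by two given ones and thus
  transfers size information under a linear map. A trace may be small by cancellation. Independence
  rules this out with high probability: the row and column that matter for \<open>tr (a b)\<close>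
  are read off from \<open>a\<close> before \<open>b\<close> is drawn. Since inverses are needed
  throughout (kernels, rows, repelling points), the whole setting is set up so that it also applies
  to the inverse walk \<open>check_mu\<close>.\<close>

definition wedge :: "'k::field^2 \<Rightarrow> 'k^2 \<Rightarrow> 'k" where
  "wedge x y = x$1 * y$2 - x$2 * y$1"

text \<open>On \<open>SL2\<close> this is the inverse (\<open>minv_eq_adj2\<close>). Unlike
  \<open>minv\<close> it is polynomial in the entries, so identities that contain it reduce to ring
  arithmetic.\<close>

definition adj2 :: "'k::field mat2 \<Rightarrow> 'k mat2" where
  "adj2 A = vector [vector [A$2$2, - A$1$2], vector [- A$2$1, A$1$1]]"

lemma adj2_nth [simp]:
  "adj2 A $ 1 $ 1 = A$2$2" "adj2 A $ 1 $ 2 = - A$1$2"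
  "adj2 A $ 2 $ 1 = - A$2$1" "adj2 A $ 2 $ 2 = A$1$1"
  by (simp_all add: adj2_def)

lemma vec2_eq_iff: "(x::'a^2) = y \<longleftrightarrow> x$1 = y$1 \<and> x$2 = y$2"
  by (auto simp: vec_eq_iff forall_2)

lemma mat2_eq_iff: "(A::'a^2^2) = B \<longleftrightarrow>
    A$1$1 = B$1$1 \<and> A$1$2 = B$1$2 \<and> A$2$1 = B$2$1 \<and> A$2$2 = B$2$2"
  by (auto simp: vec_eq_iff forall_2)

lemma matmul2_nth: "((A::'a::semiring_1^2^2) ** B) $ i $ j = A$i$1 * B$1$j + A$i$2 * B$2$j"
  by (simp add: matrix_matrix_mult_def sum_2)

lemma matvec2_nth: "((A::'a::semiring_1^2^2) *v x) $ i = A$i$1 * x$1 + A$i$2 * x$2"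
  by (simp add: matrix_vector_mult_def sum_2)

lemma trace2: "trace (A::'a::semiring_1^2^2) = A$1$1 + A$2$2"
  by (simp add: trace_def sum_2)

lemma mat1_nth2: "(mat 1 :: 'a::{zero,one}^2^2) $ 1 $ 1 = 1" "(mat 1 :: 'a^2^2) $ 1 $ 2 = 0"
  "(mat 1 :: 'a^2^2) $ 2 $ 1 = 0" "(mat 1 :: 'a^2^2) $ 2 $ 2 = 1"
  by (simp_all add: mat_def)

lemmas mat2_simps = mat2_eq_iff vec2_eq_iff matmul2_nth matvec2_nth trace2 mat1_nth2 det_2

lemma wedge_matvec: "wedge (A *v x) (A *v y) = det A * wedge x y"
  by (simp add: wedge_def mat2_simps algebra_simps)

lemma wedge_scale [simp]: "wedge (a *s x) y = a * wedge x y" "wedge x (a *s y) = a * wedge x y"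
  by (simp_all add: wedge_def algebra_simps)

lemma wedge_self [simp]: "wedge x x = 0"
  by (simp add: wedge_def)

lemma wedge_commute: "wedge x y = - wedge y x"
  by (simp add: wedge_def)

text \<open>Any three vectors of a plane are linearly dependent; these are the coefficients. The
  identity serves both for the triangle inequality of \<open>vd\<close> and for expanding a test
  vector in two given vectors.\<close>

lemma wedge_plucker: "wedge x z *s y = wedge x y *s z + wedge y z *s x"
  by (simp add: wedge_def vec2_eq_iff algebra_simps)

lemma wedge_eq_0_iff_parallel:
  assumes "y \<noteq> 0"
  shows "wedge x y = 0 \<longleftrightarrow> (\<exists>c. x = c *s y)"
proof
  assume w: "wedge x y = 0"
  consider "y$1 \<noteq> 0" | "y$2 \<noteq> 0" using assms by (auto simp: vec2_eq_iff)
  then show "\<exists>c. x = c *s y"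
  proof cases
    case 1
    then have "x = (x$1 / y$1) *s y"
      using w by (simp add: wedge_def vec2_eq_iff field_simps)
    then show ?thesis ..
  next
    case 2
    then have "x = (x$2 / y$2) *s y"
      using w by (simp add: wedge_def vec2_eq_iff field_simps)
    then show ?thesis ..
  qed
qed (auto simp: wedge_def)

lemma adj2_mult:
  "A ** adj2 A = mat (det A)" "adj2 A ** A = mat (det A)"
  by (simp_all add: mat2_simps mat_def algebra_simps)

lemma SL2_det: "A \<in> SL2 \<longleftrightarrow> det A = 1"
  by (simp add: SL2_def)

lemma minv_eq_adj2:
  assumes "A \<in> SL2" shows "minv A = adj2 A"
  unfolding minv_def
proof (rule the_equality)
  show "A ** adj2 A = mat 1 \<and> adj2 A ** A = mat 1"
    using assms by (simp add: adj2_mult SL2_det)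
  fix B assume "A ** B = mat 1 \<and> B ** A = mat 1"
  then have "B = B ** (A ** adj2 A)" "B ** A = mat 1"
    using assms by (simp_all add: adj2_mult SL2_det)
  then show "B = adj2 A" by (simp add: matrix_mul_assoc)
qed

lemma adj2_adj2 [simp]: "adj2 (adj2 A) = A"
  by (simp add: mat2_simps)

lemma adj2_matmul: "adj2 (A ** B) = adj2 B ** adj2 A"
  by (simp add: mat2_simps algebra_simps)

lemma det_adj2 [simp]: "det (adj2 A) = det A"
  by (simp add: mat2_simps)

lemma trace_adj2 [simp]: "trace (adj2 A) = trace A"
  by (simp add: mat2_simps)

lemma adj2_SL2 [simp]: "adj2 A \<in> SL2 \<longleftrightarrow> A \<in> SL2"
  by (simp add: SL2_det)

lemma SL2_mult [simp, intro]: "A \<in> SL2 \<Longrightarrow> B \<in> SL2 \<Longrightarrow> A ** B \<in> SL2"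
  by (simp add: SL2_det det_mul)

lemma SL2_one [simp, intro]: "mat 1 \<in> SL2"
  by (simp add: SL2_det)

lemma SL2_matvec_cancel:
  assumes "A \<in> SL2" shows "adj2 A *v (A *v x) = x" "A *v (adj2 A *v x) = x"
  using assms by (simp_all add: matrix_vector_mul_assoc adj2_mult SL2_det)

lemma SL2_matvec_eq_0_iff [simp]:
  assumes "A \<in> SL2" shows "A *v x = 0 \<longleftrightarrow> x = 0"
  using SL2_matvec_cancel(1)[OF assms, of x] by (metis matrix_vector_mult_0_right)

section \<open>Homogeneous coordinates and the Moebius action\<close>

definition pvec :: "'k::field option \<Rightarrow> 'k^2" where
  "pvec p = (case p of None \<Rightarrow> vector [1, 0] | Some z \<Rightarrow> vector [z, 1])"

lemma pvec_simps [simp]: "pvec None $ 1 = 1" "pvec None $ 2 = 0"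
  "pvec (Some z) $ 1 = z" "pvec (Some z) $ 2 = 1"
  by (simp_all add: pvec_def)

lemma pvec_nonzero [simp]: "pvec p \<noteq> 0"
  by (cases p) (auto simp: vec2_eq_iff)

lemma line_of_pvec [simp]: "line_of (pvec p) = p"
  by (cases p) (auto simp: line_of_def)

lemma line_of_scale: "c \<noteq> 0 \<Longrightarrow> line_of (c *s w) = line_of w"
  by (simp add: line_of_def)

lemma pvec_line_of:
  assumes "w \<noteq> 0" shows "\<exists>c. c \<noteq> 0 \<and> w = c *s pvec (line_of w)"
proof (cases "w $ 2 = 0")
  case True
  then show ?thesis using assms
    by (intro exI[of _ "w$1"]) (auto simp: line_of_def vec2_eq_iff)
next
  case False
  then show ?thesis
    by (intro exI[of _ "w$2"]) (auto simp: line_of_def vec2_eq_iff)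
qed

lemma moebius_line_of:
  assumes "A \<in> SL2"
  shows "moebius A p = line_of (A *v pvec p)"
proof (cases p)
  case None
  then show ?thesis by (auto simp: moebius_def line_of_def matvec2_nth)
next
  case (Some z)
  then show ?thesis by (auto simp: moebius_def line_of_def matvec2_nth)
qed

lemma pvec_moebius:
  assumes "A \<in> SL2" shows "\<exists>c. c \<noteq> 0 \<and> A *v pvec p = c *s pvec (moebius A p)"
  using assms pvec_line_of[of "A *v pvec p"] by (simp add: moebius_line_of)

lemma line_of_eq_iff:
  assumes "x \<noteq> 0" "y \<noteq> 0" shows "line_of x = line_of y \<longleftrightarrow> wedge x y = 0"
proof
  assume eq: "line_of x = line_of y"
  from pvec_line_of[OF assms(1)] pvec_line_of[OF assms(2)]
  obtain c d where "x = c *s pvec (line_of x)" "y = d *s pvec (line_of x)" unfolding eq by blast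
  then have "wedge x y = wedge (c *s pvec (line_of x)) (d *s pvec (line_of x))"
    by (rule arg_cong2)
  then show "wedge x y = 0" by simp
next
  assume "wedge x y = 0"
  with assms obtain c where c: "x = c *s y" using wedge_eq_0_iff_parallel by blast
  with assms have "c \<noteq> 0" by auto
  with c show "line_of x = line_of y" by (simp add: line_of_scale)
qed

lemma moebius_mult:
  assumes "A \<in> SL2" "B \<in> SL2"
  shows "moebius (A ** B) p = moebius A (moebius B p)"
proof -
  obtain c where "c \<noteq> 0" "B *v pvec p = c *s pvec (moebius B p)"
    using pvec_moebius[OF assms(2)] by blast
  then have "A *v (B *v pvec p) = c *s (A *v pvec (moebius B p))" "c \<noteq> 0"
    by (simp_all add: vector_scalar_commute)
  then show ?thesis using assms
    by (simp add: moebius_line_of[of "A ** B"] moebius_line_of[of A] line_of_scale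
        flip: matrix_vector_mul_assoc)
qed

lemma moebius_one [simp]: "moebius (mat 1) p = p"
  by (simp add: moebius_line_of)

lemma moebius_adj2_cancel:
  assumes "A \<in> SL2" shows "moebius (adj2 A) (moebius A p) = p" "moebius A (moebius (adj2 A) p) = p"
  using assms by (simp_all add: adj2_mult SL2_det flip: moebius_mult)

lemma inj_moebius: "A \<in> SL2 \<Longrightarrow> inj (moebius A)"
  by (metis injI moebius_adj2_cancel(1))

section \<open>Norms and the chordal distance\<close>

definition vnorm :: "('k::field \<Rightarrow> real) \<Rightarrow> 'k^2 \<Rightarrow> real" where
  "vnorm v x = max (v (x$1)) (v (x$2))"

text \<open>The chordal distance of the lines spanned by the two vectors. It is 0 when a vector is
  0, by the convention for division, which is why \<open>vd_triangle\<close> asks for a nonzero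
  middle vector.\<close>

definition vd :: "('k::field \<Rightarrow> real) \<Rightarrow> 'k^2 \<Rightarrow> 'k^2 \<Rightarrow> real" where
  "vd v x y = v (wedge x y) / (vnorm v x * vnorm v y)"

definition pd :: "('k::field \<Rightarrow> real) \<Rightarrow> 'k option \<Rightarrow> 'k option \<Rightarrow> real" where
  "pd v p q = vd v (pvec p) (pvec q)"

lemma mnorm_eq: "mnorm v A = max (max (v (A$1$1)) (v (A$1$2))) (max (v (A$2$1)) (v (A$2$2)))"
proof -
  have "{v (A $ i $ j) | i j. True} = {v (A$1$1), v (A$1$2), v (A$2$1), v (A$2$2)}"
    (is "?L = ?R")
  proof
    show "?L \<subseteq> ?R"
    proof
      fix t assume "t \<in> ?L"
      then obtain i j where "t = v (A $ i $ j)" by blast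
      then show "t \<in> ?R" using exhaust_2[of i] exhaust_2[of j] by auto
    qed
  qed blast
  then show ?thesis by (simp add: mnorm_def max.assoc)
qed

locale nonarch_val =
  fixes v :: "'k::field \<Rightarrow> real"
  assumes nonarch: "nonarch_abs v"
begin

lemma v_nonneg [simp]: "0 \<le> v x"
  and v_eq_0 [simp]: "v x = 0 \<longleftrightarrow> x = 0"
  and v_mult [simp]: "v (x * y) = v x * v y"
  and v_add_le: "v (x + y) \<le> max (v x) (v y)"
  using nonarch by (auto simp: nonarch_abs_def)

lemma v_0 [simp]: "v 0 = 0" by simp

lemma v_pos [simp]: "0 < v x \<longleftrightarrow> x \<noteq> 0"
  using v_nonneg[of x] v_eq_0[of x] by (auto simp del: v_eq_0 v_nonneg simp: less_le)

lemma v_1 [simp]: "v 1 = 1"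
proof -
  have "v 1 * v 1 = v 1 * 1" "v 1 \<noteq> 0" using v_mult[of 1 1] by simp_all
  then show ?thesis by (metis mult_left_cancel)
qed

lemma v_minus [simp]: "v (- x) = v x"
proof -
  have "v (-1) * v (-1) = 1" using v_mult[of "-1" "-1"] by simp
  then have "(v (-1))\<^sup>2 = 1" by (simp add: power2_eq_square)
  then have "v (-1) = 1" using v_nonneg[of "-1"] by (simp only: power2_eq_1_iff) linarith
  then show ?thesis using v_mult[of "-1" x] by simp
qed

lemma v_diff_le: "v (x - y) \<le> max (v x) (v y)"
  using v_add_le[of x "-y"] by simp

lemma v_power [simp]: "v (x ^ n) = v x ^ n"
  by (induction n) auto

lemma v_inverse [simp]: "v (inverse x) = inverse (v x)"
proof (cases "x = 0")
  case False
  then have "v x * v (inverse x) = 1" using v_mult[of x "inverse x"] by simp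
  then show ?thesis by (simp add: inverse_unique)
qed simp

lemma v_divide [simp]: "v (x / y) = v x / v y"
  by (simp add: divide_inverse)

text \<open>If \<open>x + y\<close> were smaller than \<open>x\<close>, then
  \<open>x = (x + y) - y\<close> would be smaller than itself. This is the source of all lower
  bounds for determinants and traces below.\<close>

lemma v_add_eq: "v y < v x \<Longrightarrow> v (x + y) = v x"
  using v_add_le[of x y] v_diff_le[of "x + y" y] by auto

lemma v_add_le_trans: "v x \<le> B \<Longrightarrow> v y \<le> B \<Longrightarrow> v (x + y) \<le> B"
  using v_add_le[of x y] by auto

lemma v_diff_le_trans: "v x \<le> B \<Longrightarrow> v y \<le> B \<Longrightarrow> v (x - y) \<le> B"
  using v_diff_le[of x y] by auto

lemma vnorm_nonneg [simp]: "0 \<le> vnorm v x"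
  by (simp add: vnorm_def le_max_iff_disj)

lemma v_le_vnorm: "v (x $ i) \<le> vnorm v x"
  using exhaust_2[of i] by (auto simp: vnorm_def)

lemma vnorm_leI: "(\<And>i. v (x $ i) \<le> B) \<Longrightarrow> vnorm v x \<le> B"
  by (simp add: vnorm_def)

lemma vnorm_eq_0 [simp]: "vnorm v x = 0 \<longleftrightarrow> x = 0"
proof -
  have "vnorm v x = 0 \<longleftrightarrow> v (x$1) = 0 \<and> v (x$2) = 0"
    unfolding vnorm_def using v_nonneg[of "x$1"] v_nonneg[of "x$2"] by linarith
  then show ?thesis by (simp add: vec2_eq_iff)
qed

lemma vnorm_pos [simp]: "0 < vnorm v x \<longleftrightarrow> x \<noteq> 0"
  using vnorm_nonneg[of x] vnorm_eq_0[of x] by (auto simp del: vnorm_eq_0 vnorm_nonneg simp: less_le)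

lemma vnorm_scale [simp]: "vnorm v (c *s x) = v c * vnorm v x"
  by (simp add: vnorm_def max_mult_distrib_left)

lemma vnorm_add_le: "vnorm v (x + y) \<le> max (vnorm v x) (vnorm v y)"
proof (rule vnorm_leI)
  fix i show "v ((x + y) $ i) \<le> max (vnorm v x) (vnorm v y)"
    using v_add_le[of "x$i" "y$i"] v_le_vnorm[of x i] v_le_vnorm[of y i] by auto
qed

lemma v_le_mnorm: "v (A $ i $ j) \<le> mnorm v A"
  using exhaust_2[of i] exhaust_2[of j] by (auto simp: mnorm_eq)

lemma mnorm_leI: "(\<And>i j. v (A $ i $ j) \<le> B) \<Longrightarrow> mnorm v A \<le> B"
  by (simp add: mnorm_eq)

lemma mnorm_attained: "\<exists>i j. v (A $ i $ j) = mnorm v A"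
  unfolding mnorm_eq max_def by (auto split: if_splits)

lemma mnorm_nonneg [simp]: "0 \<le> mnorm v A"
  using v_le_mnorm[of A 1 1] v_nonneg[of "A$1$1"] by linarith

lemma vnorm_matvec_le: "vnorm v (A *v x) \<le> mnorm v A * vnorm v x"
proof (rule vnorm_leI)
  fix i
  have "v (A$i$j * x$j) \<le> mnorm v A * vnorm v x" for j
    by (simp add: mult_mono v_le_mnorm v_le_vnorm)
  then show "v ((A *v x) $ i) \<le> mnorm v A * vnorm v x"
    by (auto simp: matvec2_nth intro: v_add_le_trans)
qed

lemma mnorm_mult_le: "mnorm v (A ** B) \<le> mnorm v A * mnorm v B"
proof (rule mnorm_leI)
  fix i j
  have "v (A$i$l * B$l$j) \<le> mnorm v A * mnorm v B" for l
    by (simp add: mult_mono v_le_mnorm)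
  then show "v ((A ** B) $ i $ j) \<le> mnorm v A * mnorm v B"
    by (auto simp: matmul2_nth intro: v_add_le_trans)
qed

lemma mnorm_adj2 [simp]: "mnorm v (adj2 A) = mnorm v A"
  by (simp add: mnorm_eq max.commute max.left_commute max.assoc)

lemma v_trace_le_mnorm: "v (trace A) \<le> mnorm v A"
  by (auto simp: trace2 intro: v_add_le_trans v_le_mnorm)

lemma mnorm_SL2_ge_1:
  assumes "A \<in> SL2" shows "1 \<le> mnorm v A"
proof -
  have "v (A$1$1 * A$2$2) \<le> mnorm v A * mnorm v A" "v (A$1$2 * A$2$1) \<le> mnorm v A * mnorm v A"
    by (simp_all add: mult_mono v_le_mnorm)
  moreover have "A$1$1 * A$2$2 - A$1$2 * A$2$1 = 1" using assms by (simp add: SL2_det det_2)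
  ultimately have "1 \<le> (mnorm v A)\<^sup>2" using v_diff_le_trans by (metis v_1 power2_eq_square)
  then show ?thesis by (metis mnorm_nonneg one_power2 power2_le_imp_le)
qed

lemma mnorm_SL2_pos: "A \<in> SL2 \<Longrightarrow> 0 < mnorm v A"
  using mnorm_SL2_ge_1[of A] by linarith

text \<open>The upper bound applied to the inverse, which has the same norm as
  \<open>A\<close>.\<close>

lemma vnorm_le_matvec:
  assumes "A \<in> SL2" shows "vnorm v x \<le> mnorm v A * vnorm v (A *v x)"
  using vnorm_matvec_le[of "adj2 A" "A *v x"] SL2_matvec_cancel[OF assms, of x] by simp

lemma v_wedge_le: "v (wedge x y) \<le> vnorm v x * vnorm v y"
  unfolding wedge_def by (rule v_diff_le_trans) (simp_all add: mult_mono v_le_vnorm)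

lemma vd_nonneg [simp]: "0 \<le> vd v x y"
  by (simp add: vd_def)

lemma vd_le_1 [simp]: "vd v x y \<le> 1"
proof (cases "vnorm v x * vnorm v y = 0")
  case False
  then show ?thesis using v_wedge_le[of x y]
    by (simp add: vd_def divide_le_eq_1 less_le)
qed (auto simp: vd_def wedge_def)

lemma vd_commute: "vd v x y = vd v y x"
  by (simp add: vd_def wedge_commute[of x y] mult.commute)

lemma vd_scale [simp]:
  "c \<noteq> 0 \<Longrightarrow> vd v (c *s x) y = vd v x y" "c \<noteq> 0 \<Longrightarrow> vd v x (c *s y) = vd v x y"
  by (simp_all add: vd_def)

text \<open>Take norms in the Plucker identity and divide by the product of the three norms.\<close>

lemma vd_triangle:
  assumes "y \<noteq> 0" shows "vd v x z \<le> max (vd v x y) (vd v y z)"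
proof (cases "x = 0 \<or> z = 0")
  case True
  then show ?thesis by (auto simp: vd_def wedge_def le_max_iff_disj)
next
  case False
  with assms have pos: "0 < vnorm v x" "0 < vnorm v y" "0 < vnorm v z" by auto
  have "v (wedge x z) * vnorm v y \<le> max (v (wedge x y) * vnorm v z) (v (wedge y z) * vnorm v x)"
    using vnorm_add_le[of "wedge x y *s z" "wedge y z *s x"]
    unfolding wedge_plucker[of x z y, symmetric] by simp
  then have "v (wedge x z) * vnorm v y / (vnorm v x * vnorm v y * vnorm v z) \<le>
     max (v (wedge x y) * vnorm v z) (v (wedge y z) * vnorm v x) / (vnorm v x * vnorm v y * vnorm v z)"
    using pos by (intro divide_right_mono) auto
  also have "\<dots> = max (v (wedge x y) * vnorm v z / (vnorm v x * vnorm v y * vnorm v z))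
       (v (wedge y z) * vnorm v x / (vnorm v x * vnorm v y * vnorm v z))"
    using pos by (simp add: max_divide_distrib_right)
  finally show ?thesis using pos by (simp add: vd_def field_simps)
qed

lemma vd_matvec:
  assumes "A \<in> SL2"
  shows "vd v (A *v x) (A *v y) = v (wedge x y) / (vnorm v (A *v x) * vnorm v (A *v y))"
  using assms by (simp add: vd_def wedge_matvec SL2_det)

lemma vd_matvec_le:
  assumes "A \<in> SL2" "x \<noteq> 0" "y \<noteq> 0"
  shows "vd v (A *v x) (A *v y) \<le> (mnorm v A)\<^sup>2 * vd v x y"
proof -
  have p: "0 < vnorm v (A *v x)" "0 < vnorm v (A *v y)" "0 < vnorm v x" "0 < vnorm v y"
    using assms by simp_all
  have "vnorm v x * vnorm v y \<le> (mnorm v A * vnorm v (A *v x)) * (mnorm v A * vnorm v (A *v y))"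
    using assms p by (intro mult_mono vnorm_le_matvec) auto
  then have "v (wedge x y) * (vnorm v x * vnorm v y) \<le>
     v (wedge x y) * ((mnorm v A)\<^sup>2 * (vnorm v (A *v x) * vnorm v (A *v y)))"
    by (intro mult_left_mono) (auto simp: power2_eq_square mult_ac)
  then have "v (wedge x y) / (vnorm v (A *v x) * vnorm v (A *v y)) \<le>
      v (wedge x y) * (mnorm v A)\<^sup>2 / (vnorm v x * vnorm v y)"
    using p by (simp add: divide_le_eq le_divide_eq mult_ac)
  then show ?thesis by (simp add: vd_matvec assms) (simp add: vd_def mult_ac)
qed

lemma pd_nonneg [simp]: "0 \<le> pd v p q" and pd_le_1 [simp]: "pd v p q \<le> 1"
  by (simp_all add: pd_def)

lemma pd_commute: "pd v p q = pd v q p"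
  by (simp add: pd_def vd_commute)

lemma pd_triangle: "pd v p r \<le> max (pd v p q) (pd v q r)"
  by (simp add: pd_def vd_triangle)

lemma pd_line_of: "x \<noteq> 0 \<Longrightarrow> y \<noteq> 0 \<Longrightarrow> pd v (line_of x) (line_of y) = vd v x y"
  by (metis pvec_line_of pd_def vd_scale)

lemma pd_eq_0 [simp]: "pd v p q = 0 \<longleftrightarrow> p = q"
  using line_of_eq_iff[of "pvec p" "pvec q"] by (simp add: pd_def vd_def)

lemma pd_moebius: "A \<in> SL2 \<Longrightarrow> pd v (moebius A p) (moebius A q) = vd v (A *v pvec p) (A *v pvec q)"
  by (simp add: moebius_line_of pd_line_of)

lemma pd_moebius_le:
  "A \<in> SL2 \<Longrightarrow> pd v (moebius A p) (moebius A q) \<le> (mnorm v A)\<^sup>2 * pd v p q"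
  using vd_matvec_le[of A "pvec p" "pvec q"] by (simp add: pd_moebius) (simp add: pd_def)

end

section \<open>Hyperbolic elements\<close>

locale complete_nonarch_val = nonarch_val v for v :: "'k::field \<Rightarrow> real" +
  assumes complete: "complete_nontrivial_nonarch_field v"
begin

text \<open>In an ultrametric space a distance over many steps is at most the largest single step,
  so such a sequence is Cauchy.\<close>

lemma convergent_if_steps_tendsto_0:
  fixes s :: "nat \<Rightarrow> 'k"
  assumes "(\<lambda>n. v (s (Suc n) - s n)) \<longlonglongrightarrow> 0"
  shows "\<exists>l. (\<lambda>n. v (s n - l)) \<longlonglongrightarrow> 0"
proof -
  have "\<exists>N. \<forall>m\<ge>N. \<forall>n\<ge>N. v (s m - s n) < e" if "e > 0" for e
  proof -
    from assms that obtain N where N: "\<And>n. n \<ge> N \<Longrightarrow> v (s (Suc n) - s n) < e"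
      by (auto simp: LIMSEQ_def dist_real_def)
    have step: "v (s (N + k) - s N) < e" for k
    proof (induction k)
      case (Suc k)
      have "s (N + Suc k) - s N = (s (Suc (N + k)) - s (N + k)) + (s (N + k) - s N)" by simp
      then show ?case
        using Suc N[of "N + k"] v_add_le[of "s (Suc (N + k)) - s (N + k)" "s (N + k) - s N"]
        by simp
    qed (use that in simp)
    have "v (s m - s n) < e" if "m \<ge> N" "n \<ge> N" for m n
    proof -
      have "s m - s n = (s m - s N) - (s n - s N)" by simp
      moreover have "v (s m - s N) < e" "v (s n - s N) < e"
        using step[of "m - N"] step[of "n - N"] that by simp_all
      ultimately show ?thesis using v_diff_le[of "s m - s N" "s n - s N"] by simp
    qed
    then show ?thesis by blast
  qed
  then obtain l where "\<forall>e>0. \<exists>N. \<forall>n\<ge>N. v (s n - l) < e"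
    using complete unfolding complete_nontrivial_nonarch_field_def by blast
  then show ?thesis by (intro exI[of _ l]) (simp add: LIMSEQ_def dist_real_def)
qed

text \<open>The large root of \<open>l\<^sup>2 - t l + 1\<close> is the limit of the iteration \<open>s \<mapsto> t - 1/s\<close>, which
  contracts distances by \<open>v t\<^sup>-\<^sup>2\<close>.\<close>

lemma hyperbolic_root:
  assumes t: "v t > 1"
  shows "\<exists>l. l * l - t * l + 1 = 0 \<and> v l = v t"
proof -
  define s where "s = rec_nat t (\<lambda>_ x. t - 1 / x)"
  have s0: "s 0 = t" and sS: "\<And>n. s (Suc n) = t - 1 / s n"
    by (simp_all add: s_def)
  have t1: "1 / v t < 1" using t by (subst divide_less_eq_1_pos) linarith+
  have vs: "v (s n) = v t" for n
  proof (induction n)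
    case (Suc n)
    have "v (- (1 / s n)) < v t" using t t1 Suc by (simp only: v_minus v_divide v_1)
    then show ?case using v_add_eq[of "- (1 / s n)" t] by (simp add: sS)
  qed (simp add: s0)
  have snz: "s n \<noteq> 0" for n using vs[of n] t by (metis less_trans v_pos zero_less_one)
  have tnz: "t \<noteq> 0" using t by auto
  have steps: "v (s (Suc n) - s n) \<le> (1 / v t) ^ n" for n
  proof (induction n)
    case 0
    then show ?case using t1 by (simp add: s0 sS)
  next
    case (Suc n)
    have "s (Suc (Suc n)) - s (Suc n) = 1 / s n - 1 / s (Suc n)" by (simp add: sS[of "Suc n"] sS[of n])
    also have "\<dots> = (s (Suc n) - s n) / (s n * s (Suc n))" using snz by (simp add: field_simps)
    finally have "v (s (Suc (Suc n)) - s (Suc n)) = v (s (Suc n) - s n) / (v t * v t)"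
      by (simp add: vs)
    also have "\<dots> \<le> (1 / v t) ^ n / (v t * 1)"
      using Suc t tnz by (intro frac_le mult_left_mono mult_pos_pos) auto
    finally show ?case by (simp add: field_simps)
  qed
  have lim0: "(\<lambda>n. (1 / v t) ^ n) \<longlonglongrightarrow> 0" using t1 by (intro LIMSEQ_realpow_zero) auto
  have "(\<lambda>n. v (s (Suc n) - s n)) \<longlonglongrightarrow> 0"
    by (rule tendsto_sandwich[OF _ _ tendsto_const lim0]) (auto simp: steps)
  then obtain l where l: "(\<lambda>n. v (s n - l)) \<longlonglongrightarrow> 0"
    using convergent_if_steps_tendsto_0 by blast
  then obtain N where N: "v (s N - l) < v t"
    using t unfolding LIMSEQ_def dist_real_def by (metis abs_of_nonneg diff_zero less_trans order_refl v_nonneg zero_less_one)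
  have vl: "v l = v t"
    using v_add_eq[of "- (s N - l)" "s N"] N v_minus[of "s N - l"] by (simp add: vs)
  \<comment> \<open>Substituting \<open>s (Suc n) * s n - t * s n + 1 = 0\<close> writes the value
    of the polynomial at \<open>l\<close> in terms of the distances from \<open>l\<close> to two
    consecutive iterates.\<close>
  have bound: "v (l * l - t * l + 1) \<le> v t * (v (s n - l) + v (s (Suc n) - l))" for n
  proof -
    have "s (Suc n) * s n - t * s n + 1 = 0" using snz[of n] by (simp add: sS field_simps)
    then have "l * l - t * l + 1 = (t * (s n - l) - l * (s n - l)) - s n * (s (Suc n) - l)"
      by (simp add: algebra_simps)
    also have "v \<dots> \<le> max (v (t * (s n - l) - l * (s n - l))) (v (s n * (s (Suc n) - l)))"
      by (rule v_diff_le)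
    also have "\<dots> \<le> max (v t * v (s n - l)) (v t * v (s (Suc n) - l))"
      using v_diff_le[of "t * (s n - l)" "l * (s n - l)"] vl vs[of n] by auto
    also have "\<dots> \<le> v t * (v (s n - l) + v (s (Suc n) - l))"
      by (simp add: distrib_left)
    finally show ?thesis .
  qed
  have "(\<lambda>n. v t * (v (s n - l) + v (s (Suc n) - l))) \<longlonglongrightarrow> v t * (0 + 0)"
    by (intro tendsto_intros l LIMSEQ_Suc)
  then have "v (l * l - t * l + 1) \<le> 0"
    using LIMSEQ_le_const[of "\<lambda>n. v t * (v (s n - l) + v (s (Suc n) - l))" "v t * (0 + 0)"] bound
    by simp
  then have "l * l - t * l + 1 = 0" by (metis v_eq_0 v_nonneg order_antisym)
  with vl show ?thesis by blast
qed

end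

text \<open>By Cayley-Hamilton the columns of the adjugate of \<open>A - l\<close> lie in the
  eigenspace. The first two cases use, up to sign, a column that is nonzero; if both vanish then
  \<open>A\<close> is the scalar \<open>l\<close>.\<close>

lemma eigenvector_exists:
  assumes "A \<in> SL2" and root: "l * l - trace A * l + 1 = 0"
  shows "\<exists>w. w \<noteq> 0 \<and> A *v w = l *s w"
proof -
  have d: "A$1$1 * A$2$2 - A$1$2 * A$2$1 = 1" using assms(1) by (simp add: SL2_det det_2)
  have root': "l * l - (A$1$1 + A$2$2) * l + (A$1$1 * A$2$2 - A$1$2 * A$2$1) = 0"
    using root d by (simp add: trace2)
  have r: "(l - A$1$1) * (l - A$2$2) = A$1$2 * A$2$1"
    using root' by (simp add: algebra_simps)
  consider "A$1$2 \<noteq> 0 \<or> l \<noteq> A$1$1" | "A$2$1 \<noteq> 0 \<or> l \<noteq> A$2$2"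
    | "A$1$2 = 0" "A$2$1 = 0" "l = A$1$1" "l = A$2$2" by blast
  then show ?thesis
  proof cases
    case 1
    have "A *v vector [A$1$2, l - A$1$1] = l *s vector [A$1$2, l - A$1$1]"
      using r by (simp add: vec2_eq_iff matvec2_nth algebra_simps)
    then show ?thesis using 1 by (intro exI[of _ "vector [A$1$2, l - A$1$1]"]) (auto simp: vec2_eq_iff)
  next
    case 2
    have "A *v vector [l - A$2$2, A$2$1] = l *s vector [l - A$2$2, A$2$1]"
      using r by (simp add: vec2_eq_iff matvec2_nth algebra_simps)
    then show ?thesis using 2 by (intro exI[of _ "vector [l - A$2$2, A$2$1]"]) (auto simp: vec2_eq_iff)
  next
    case 3
    then show ?thesis by (intro exI[of _ "vector [1, 0]"]) (auto simp: vec2_eq_iff matvec2_nth)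
  qed
qed

context nonarch_val
begin

text \<open>Justifies the definite description in \<open>att\<close>. If two eigenvectors have
  eigenvalues of absolute value above 1, then \<open>A\<close> multiplies their wedge by a number of
  absolute value above 1, but also by \<open>det A = 1\<close>; so the wedge is 0 and the lines
  agree.\<close>

lemma att_eq_line_of:
  assumes A: "A \<in> SL2" and w: "w \<noteq> 0" "A *v w = l *s w" and l: "v l > 1"
  shows "att v A = line_of w"
  unfolding att_def
proof (rule the_equality)
  show "\<exists>w' l. w' \<noteq> 0 \<and> A *v w' = l *s w' \<and> v l > 1 \<and> line_of w = line_of w'"
    using assms by blast
  fix p assume "\<exists>w l. w \<noteq> 0 \<and> A *v w = l *s w \<and> v l > 1 \<and> p = line_of w"
  then obtain w' l' where w': "w' \<noteq> 0" "A *v w' = l' *s w'" "v l' > 1" "p = line_of w'" by blast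
  have "wedge w' w = (l' * l) * wedge w' w"
    using wedge_matvec[of A w' w] A w w' by (simp add: SL2_det mult.commute)
  moreover have "v (l' * l) \<noteq> 1" using l w'(3)
    by (smt (verit) mult_less_cancel_left1 v_mult)
  then have "l' * l \<noteq> 1" by (metis v_1)
  ultimately have "wedge w' w = 0" by (metis mult_cancel_right2)
  then show "p = line_of w" using w w' line_of_eq_iff by blast
qed

text \<open>A matrix and its inverse share eigenvectors, with inverse eigenvalues. Results on
  repelling points thereby become results on attracting points of the inverse walk.\<close>

lemma rep_eq_att_adj2:
  assumes A: "A \<in> SL2" shows "rep v A = att v (adj2 A)"
proof -
  have *: "A *v w = l *s w \<longleftrightarrow> adj2 A *v w = inverse l *s w" if "w \<noteq> 0" for w l
  proof
    assume h: "A *v w = l *s w"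
    then have "l \<noteq> 0" using that A by (metis SL2_matvec_eq_0_iff vector_smult_lzero)
    moreover have "w = l *s (adj2 A *v w)"
      using SL2_matvec_cancel(1)[OF A, of w] h by (simp add: vector_scalar_commute)
    ultimately show "adj2 A *v w = inverse l *s w"
      by (metis vector_smult_assoc vector_smult_lid left_inverse)
  next
    assume h: "adj2 A *v w = inverse l *s w"
    then have "l \<noteq> 0" using that A
      by (metis SL2_matvec_eq_0_iff adj2_SL2 vector_smult_lzero inverse_zero)
    moreover have "w = inverse l *s (A *v w)"
      using SL2_matvec_cancel(2)[OF A, of w] h by (simp add: vector_scalar_commute)
    ultimately show "A *v w = l *s w"
      by (metis vector_smult_assoc vector_smult_lid right_inverse)
  qed
  have "(\<exists>w l. w \<noteq> 0 \<and> A *v w = l *s w \<and> v l < 1 \<and> p = line_of w) \<longleftrightarrow>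
     (\<exists>w l. w \<noteq> 0 \<and> adj2 A *v w = l *s w \<and> v l > 1 \<and> p = line_of w)" for p
  proof
    assume "\<exists>w l. w \<noteq> 0 \<and> A *v w = l *s w \<and> v l < 1 \<and> p = line_of w"
    then obtain w l where h: "w \<noteq> 0" "A *v w = l *s w" "v l < 1" "p = line_of w" by blast
    then have "l \<noteq> 0" using A by (metis SL2_matvec_eq_0_iff vector_smult_lzero)
    then have "v (inverse l) > 1" using h by (simp add: one_less_inverse)
    then show "\<exists>w l. w \<noteq> 0 \<and> adj2 A *v w = l *s w \<and> v l > 1 \<and> p = line_of w"
      using h * by blast
  next
    assume "\<exists>w l. w \<noteq> 0 \<and> adj2 A *v w = l *s w \<and> v l > 1 \<and> p = line_of w"
    then obtain w l where h: "w \<noteq> 0" "adj2 A *v w = l *s w" "v l > 1" "p = line_of w" by blast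
    then have "v (inverse l) < 1" by (simp add: inverse_less_1_iff)
    moreover have "A *v w = inverse l *s w" using *[of w "inverse l"] h by simp
    ultimately show "\<exists>w l. w \<noteq> 0 \<and> A *v w = l *s w \<and> v l < 1 \<and> p = line_of w"
      using h by blast
  qed
  then show ?thesis by (simp add: rep_def att_def)
qed

end

text \<open>The roots of the characteristic polynomial are \<open>l\<close> and
  \<open>inverse l\<close>. With the normalisation \<open>wedge e f = 1\<close> the coordinates of
  \<open>y\<close> in this basis are simply \<open>wedge y f\<close> and
  \<open>wedge e y\<close>.\<close>

lemma (in complete_nonarch_val) hyperbolic_eigenvectors:
  assumes A: "A \<in> SL2" and hyp: "hyperbolic v A"
  obtains l e f where "v l = v (trace A)" "v l > 1" "A *v e = l *s e" "A *v f = inverse l *s f"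
    "wedge e f = 1" "e \<noteq> 0" "f \<noteq> 0"
proof -
  have t: "v (trace A) > 1" using hyp by (simp add: hyperbolic_def)
  obtain l where l: "l * l - trace A * l + 1 = 0" "v l = v (trace A)"
    using hyperbolic_root[OF t] by blast
  have l0: "l \<noteq> 0" using l t by auto
  have "inverse l * inverse l - trace A * inverse l + 1 = (l * l - trace A * l + 1) * inverse l * inverse l"
    using l0 by (simp add: field_simps)
  then have l': "inverse l * inverse l - trace A * inverse l + 1 = 0" using l by simp
  obtain e where e: "e \<noteq> 0" "A *v e = l *s e" using eigenvector_exists[OF A l(1)] by blast
  obtain f where f: "f \<noteq> 0" "A *v f = inverse l *s f" using eigenvector_exists[OF A l'] by blast
  have "wedge e f \<noteq> 0"
  proof
    assume "wedge e f = 0"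
    then obtain c where c: "e = c *s f" using wedge_eq_0_iff_parallel[OF f(1)] by blast
    then have "c \<noteq> 0" using e by auto
    have "l *s e = inverse l *s e" using e f c by (metis vector_scalar_commute vector_smult_assoc mult.commute)
    then have "l = inverse l" using e(1) by (metis vector_mul_rcancel)
    then have "v l = inverse (v l)" by (metis v_inverse)
    moreover have "inverse (v l) < 1" using l t by (simp add: inverse_less_1_iff)
    ultimately show False using l t by linarith
  qed
  then show ?thesis
    using l e f t
    by (intro that[of l "inverse (wedge e f) *s e" f]) (auto simp: vector_scalar_commute vector_smult_assoc mult.commute)
qed

section \<open>Convolution powers and the support semigroup\<close>

lemma conv_pow_add:
  "conv_pow \<mu> (n + m) = bind_pmf (conv_pow \<mu> n) (\<lambda>a. map_pmf (\<lambda>b. a ** b) (conv_pow \<mu> m))"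
proof (induction m)
  case 0
  show ?case by (simp add: bind_return_pmf')
next
  case (Suc m)
  then show ?case
    by (simp add: bind_assoc_pmf map_bind_pmf map_pmf_comp matrix_mul_assoc bind_map_pmf)
qed

lemma conv_pow_1: "conv_pow \<mu> (Suc 0) = \<mu>"
  by (simp add: bind_return_pmf pmf.map_ident_strong)

lemma set_conv_pow_add:
  "set_pmf (conv_pow \<mu> (n + m)) = {a ** b | a b. a \<in> set_pmf (conv_pow \<mu> n) \<and> b \<in> set_pmf (conv_pow \<mu> m)}"
  by (auto simp: conv_pow_add)

lemma conv_pow_mult_mem:
  "a \<in> set_pmf (conv_pow \<mu> n) \<Longrightarrow> b \<in> set_pmf (conv_pow \<mu> m) \<Longrightarrow> a ** b \<in> set_pmf (conv_pow \<mu> (n + m))"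
  by (auto simp: set_conv_pow_add)

lemma conv_pow_Suc_left:
  "conv_pow \<mu> (Suc n) = bind_pmf \<mu> (\<lambda>a. map_pmf (\<lambda>b. a ** b) (conv_pow \<mu> n))"
  using conv_pow_add[of \<mu> "Suc 0" n] unfolding conv_pow_1 by simp

lemma conv_pow_SL2:
  assumes "set_pmf \<mu> \<subseteq> SL2" shows "set_pmf (conv_pow \<mu> n) \<subseteq> SL2"
proof (induction n)
  case (Suc n)
  then show ?case using assms by fastforce
qed auto

lemma check_mu_SL2: "set_pmf \<mu> \<subseteq> SL2 \<Longrightarrow> set_pmf (check_mu \<mu>) \<subseteq> SL2"
  by (auto simp: check_mu_def minv_eq_adj2)

lemma check_mu_adj2: "set_pmf \<mu> \<subseteq> SL2 \<Longrightarrow> check_mu \<mu> = map_pmf adj2 \<mu>"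
  unfolding check_mu_def by (intro map_pmf_cong) (auto simp: minv_eq_adj2)

text \<open>Inversion reverses the order of the factors, but they are independent and identically
  distributed, so the reversed product has the same law.\<close>

lemma conv_pow_check_mu:
  assumes "set_pmf \<mu> \<subseteq> SL2"
  shows "conv_pow (check_mu \<mu>) n = map_pmf adj2 (conv_pow \<mu> n)"
proof (induction n)
  case 0
  have "adj2 (mat 1) = (mat 1 :: 'a mat2)" by (simp add: mat2_simps)
  then show ?case by simp
next
  case (Suc n)
  have "conv_pow (check_mu \<mu>) (Suc n) = bind_pmf (map_pmf adj2 (conv_pow \<mu> n)) (\<lambda>a. map_pmf (\<lambda>b. a ** b) (map_pmf adj2 \<mu>))"
    using Suc assms by (simp add: check_mu_adj2)
  also have "\<dots> = bind_pmf (conv_pow \<mu> n) (\<lambda>a. bind_pmf \<mu> (\<lambda>b. return_pmf (adj2 (b ** a))))"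
    by (simp add: bind_map_pmf map_pmf_comp adj2_matmul) (simp add: map_pmf_def)
  also have "\<dots> = bind_pmf \<mu> (\<lambda>b. bind_pmf (conv_pow \<mu> n) (\<lambda>a. return_pmf (adj2 (b ** a))))"
    by (rule bind_commute_pmf)
  also have "\<dots> = map_pmf adj2 (conv_pow \<mu> (Suc n))"
    unfolding conv_pow_Suc_left by (simp add: map_bind_pmf map_pmf_comp) (simp add: map_pmf_def)
  finally show ?case .
qed

lemma gen_group_SL2:
  assumes "S \<subseteq> SL2" "g \<in> gen_group S" shows "g \<in> SL2"
  using assms(2)
proof induction
  case (gen g h) then show ?case using assms by blast
next
  case (geninv g h)
  then have "g \<in> SL2" using assms by blast
  then show ?case using geninv by (simp add: minv_eq_adj2 SL2_mult)
qed auto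

lemma gen_group_minv:
  assumes "S \<subseteq> SL2" shows "gen_group S \<subseteq> gen_group (minv ` S)"
proof
  fix g assume "g \<in> gen_group S"
  then show "g \<in> gen_group (minv ` S)"
  proof induction
    case one show ?case by (rule gen_group.one)
  next
    case (gen g h)
    have "minv (minv g) = g" using gen assms by (auto simp: minv_eq_adj2)
    then show ?case using gen gen_group.geninv[of "minv g" "minv ` S" h] by auto
  next
    case (geninv g h)
    then show ?case using gen_group.gen[of "minv g" "minv ` S" h] by auto
  qed
qed

text \<open>A larger group keeps its hyperbolic element and has larger orbits, so one inclusion of
  groups suffices.\<close>

lemma non_elementary_check_mu:
  assumes "set_pmf \<mu> \<subseteq> SL2" "non_elementary v (gen_group (set_pmf \<mu>))"
  shows "non_elementary v (gen_group (set_pmf (check_mu \<mu>)))"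
proof -
  have "gen_group (set_pmf \<mu>) \<subseteq> gen_group (set_pmf (check_mu \<mu>))"
    using gen_group_minv[OF assms(1)] by (simp add: check_mu_def)
  then show ?thesis using assms(2) unfolding non_elementary_def
    by (smt (verit, ccfv_SIG) Collect_mono_iff finite_subset subset_iff)
qed

locale nonelem_walk = complete_nonarch_val v for v :: "'k::field \<Rightarrow> real" +
  fixes \<mu> :: "'k mat2 pmf"
  assumes supp: "set_pmf \<mu> \<subseteq> SL2"
    and nonel: "non_elementary v (gen_group (set_pmf \<mu>))"
begin

lemma conv_in_SL2: "g \<in> set_pmf (conv_pow \<mu> n) \<Longrightarrow> g \<in> SL2"
  using conv_pow_SL2[OF supp] by blast

text \<open>Makes every result of this locale available for the walk of inverses, which governs
  kernels, rows and repelling points.\<close>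

lemma nonelem_walk_check: "nonelem_walk v (check_mu \<mu>)"
  by unfold_locales (use supp nonel in \<open>auto simp: check_mu_SL2 non_elementary_check_mu complete dest: subsetD[OF check_mu_SL2]\<close>)

text \<open>If all traces on the support semigroup \<open>T\<close> are integral then the set of matrices \<open>A\<close>
  with \<open>tr (A t)\<close> integral for all \<open>t \<in> T\<close> is stable under left multiplication by the generators
  and, because \<open>g\<^sup>-\<^sup>1 = tr g - g\<close>, by their inverses; so the whole group has integral traces.\<close>

lemma semigroup_hyperbolic:
  obtains a m where "a \<in> set_pmf (conv_pow \<mu> m)" "m > 0" "hyperbolic v a"
proof -
  have "\<exists>a m. a \<in> set_pmf (conv_pow \<mu> m) \<and> hyperbolic v a"
  proof (rule ccontr)
    assume "\<not> ?thesis"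
    then have T: "v (trace t) \<le> 1" if "t \<in> set_pmf (conv_pow \<mu> m)" for t m
      using that by (force simp: hyperbolic_def)
    have good: "\<forall>t m. t \<in> set_pmf (conv_pow \<mu> m) \<longrightarrow> v (trace (g ** t)) \<le> 1"
      if "g \<in> gen_group (set_pmf \<mu>)" for g
      using that
    proof induction
      case one then show ?case using T by simp
    next
      case (gen g h)
      show ?case
      proof (intro allI impI)
        fix t m assume t: "t \<in> set_pmf (conv_pow \<mu> m)"
        have "t ** g \<in> set_pmf (conv_pow \<mu> (m + Suc 0))"
          by (rule conv_pow_mult_mem[OF t]) (use gen conv_pow_1[of \<mu>] in simp)
        then have "v (trace (h ** (t ** g))) \<le> 1" using gen by blast
        also have "trace (h ** (t ** g)) = trace (g ** h ** t)"
          by (simp add: mat2_simps algebra_simps)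
        finally show "v (trace (g ** h ** t)) \<le> 1" .
      qed
    next
      case (geninv g h)
      then have g: "g \<in> SL2" using supp by auto
      show ?case
      proof (intro allI impI)
        fix t m assume t: "t \<in> set_pmf (conv_pow \<mu> m)"
        have "t ** g \<in> set_pmf (conv_pow \<mu> (m + Suc 0))"
          by (rule conv_pow_mult_mem[OF t]) (use geninv conv_pow_1[of \<mu>] in simp)
        then have 1: "v (trace (h ** (t ** g))) \<le> 1" using geninv by blast
        have "v (trace g) \<le> 1" using T[of g "Suc 0"] geninv conv_pow_1[of \<mu>] by simp
        moreover have "v (trace (h ** t)) \<le> 1" using geninv t by blast
        ultimately have 2: "v (trace g * trace (h ** t)) \<le> 1"
          by (simp add: mult_le_one)
        have "trace (minv g ** h ** t) = trace g * trace (h ** t) - trace (h ** (t ** g))"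
          unfolding minv_eq_adj2[OF g] by (simp add: mat2_simps algebra_simps)
        then show "v (trace (minv g ** h ** t)) \<le> 1" using v_diff_le_trans[OF 2 1] by simp
      qed
    qed
    obtain g where "g \<in> gen_group (set_pmf \<mu>)" "hyperbolic v g"
      using nonel by (auto simp: non_elementary_def)
    \<comment> \<open>The identity is the support at level 0, so \<open>good\<close> bounds the
      trace of \<open>g\<close> itself.\<close>
    then show False using good[of g] spec[of _ "mat 1"] by (force simp: hyperbolic_def intro: exI[of _ 0])
  qed
  then obtain a m where am: "a \<in> set_pmf (conv_pow \<mu> m)" "hyperbolic v a" by blast
  \<comment> \<open>At level 0 only the identity occurs, and its trace \<open>1 + 1\<close> has
    absolute value at most 1.\<close>
  have "m \<noteq> 0"
  proof
    assume "m = 0"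
    then have "v (1 + 1) > 1" using am by (simp add: hyperbolic_def trace2 mat1_nth2)
    then show False using v_add_le[of 1 1] by simp
  qed
  then show ?thesis using am that by blast
qed

text \<open>The maximum principle conditions on a fixed number of steps, so \<open>M\<close>
  elements of one common level are needed, not just \<open>M\<close> elements of the semigroup. As
  \<open>a\<close> fixes \<open>p\<close>, the points reached at level \<open>l\<close> are reached
  again at level \<open>l + m\<close>; along each residue class modulo \<open>m\<close> the orbits
  increase. If all of them had fewer than \<open>M\<close> points, the \<open>m\<close> unions and
  hence the whole semigroup orbit would be finite, and then so would the group orbit.\<close>

lemma large_orbit_level:
  assumes a: "a \<in> set_pmf (conv_pow \<mu> m)" "m > 0" and fix_p: "moebius a p = p"
  shows "\<exists>l c. (\<forall>i<M. c i \<in> set_pmf (conv_pow \<mu> l)) \<and> inj_on (\<lambda>i. moebius (c i) p) {..<M::nat}"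
proof -
  define orb where "orb = (\<lambda>l. (\<lambda>c. moebius c p) ` set_pmf (conv_pow \<mu> l))"
  have "\<exists>l. infinite (orb l) \<or> card (orb l) \<ge> M"
  proof (rule ccontr)
    assume "\<not> ?thesis"
    then have fin: "finite (orb l)" and lt: "card (orb l) < M" for l by (auto simp: not_le)
    have mono1: "orb l \<subseteq> orb (l + m)" for l
    proof
      fix q assume "q \<in> orb l"
      then obtain c where c: "c \<in> set_pmf (conv_pow \<mu> l)" "q = moebius c p" by (auto simp: orb_def)
      then have "q = moebius (c ** a) p" using a fix_p conv_in_SL2 by (simp add: moebius_mult)
      then show "q \<in> orb (l + m)" using conv_pow_mult_mem[OF c(1) a(1)] by (auto simp: orb_def)
    qed
    have mono: "orb (r + i * m) \<subseteq> orb (r + j * m)" if "i \<le> j" for r i j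
      using that
    proof (induction rule: dec_induct)
      case (step n) then show ?case using mono1[of "r + n * m"] by (auto simp: algebra_simps)
    qed auto
    have finU: "finite (\<Union>j. orb (r + j * m))" for r
    proof (rule ccontr)
      assume "infinite (\<Union>j. orb (r + j * m))"
      then obtain T where T: "T \<subseteq> (\<Union>j. orb (r + j * m))" "finite T" "card T = M"
        using infinite_arbitrarily_large by blast
      then have "\<forall>t\<in>T. \<exists>j. t \<in> orb (r + j * m)" by auto
      from bchoice[OF this] obtain J where J: "\<And>t. t \<in> T \<Longrightarrow> t \<in> orb (r + J t * m)" by blast
      have "T \<subseteq> orb (r + Max (J ` T) * m)"
      proof
        fix t assume "t \<in> T"
        then show "t \<in> orb (r + Max (J ` T) * m)"
          using J[of t] mono[of "J t" "Max (J ` T)" r] T(2) by auto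
      qed
      then have "M \<le> card (orb (r + Max (J ` T) * m))" using T fin card_mono by blast
      then show False using lt by (metis not_le)
    qed
    define W where "W = (\<Union>l. orb l)"
    have "W \<subseteq> (\<Union>r<m. \<Union>j. orb (r + j * m))"
    proof
      fix q assume "q \<in> W"
      then obtain l where "q \<in> orb l" by (auto simp: W_def)
      then have "q \<in> orb (l mod m + (l div m) * m)" by simp
      then show "q \<in> (\<Union>r<m. \<Union>j. orb (r + j * m))" using a(2) mod_less_divisor by blast
    qed
    then have finW: "finite W" using finU by (meson finite_UN finite_lessThan finite_subset)
    have stable: "moebius g ` W \<subseteq> W" if g: "g \<in> set_pmf \<mu>" for g
    proof
      fix q assume "q \<in> moebius g ` W"
      then obtain l c where c: "c \<in> set_pmf (conv_pow \<mu> l)" "q = moebius g (moebius c p)"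
        by (auto simp: W_def orb_def)
      then have "q = moebius (g ** c) p" using g supp conv_in_SL2[of c l] by (subst moebius_mult) auto
      moreover have "g ** c \<in> set_pmf (conv_pow \<mu> (Suc 0 + l))"
        using conv_pow_mult_mem[of g \<mu> "Suc 0" c l] c g conv_pow_1[of \<mu>] by simp
      ultimately show "q \<in> W" unfolding W_def orb_def by blast
    qed
    have stable_inv: "moebius (minv g) ` W \<subseteq> W" if g: "g \<in> set_pmf \<mu>" for g
    proof -
      have gS: "g \<in> SL2" using g supp by auto
      \<comment> \<open>An injective self-map of a finite set is onto; this gives invariance under
        the inverse of \<open>g\<close>.\<close>
      have "moebius g ` W = W"
        using stable[OF g] inj_moebius[OF gS] finW
        by (metis card_image card_subset_eq inj_on_subset subset_UNIV)
      then have "moebius (minv g) ` W = moebius (minv g) ` moebius g ` W" by simp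
      also have "\<dots> = W" using gS by (simp add: image_image minv_eq_adj2 moebius_adj2_cancel)
      finally show ?thesis by simp
    qed
    have pW: "p \<in> W" unfolding W_def orb_def by (rule UN_I[of 0]) auto
    have "moebius g p \<in> W" if "g \<in> gen_group (set_pmf \<mu>)" for g
      using that
    proof induction
      case one then show ?case using pW by simp
    next
      case (gen g h)
      then have "moebius (g ** h) p = moebius g (moebius h p)"
        using supp gen_group_SL2[OF supp] by (intro moebius_mult) auto
      then show ?case using stable gen by auto
    next
      case (geninv g h)
      then have "moebius (minv g ** h) p = moebius (minv g) (moebius h p)"
        using supp gen_group_SL2[OF supp] by (intro moebius_mult) (auto simp: minv_eq_adj2 subset_iff)
      then show ?case using stable_inv geninv by auto
    qed
    then have "{moebius g p | g. g \<in> gen_group (set_pmf \<mu>)} \<subseteq> W" by auto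
    then show False using finW nonel finite_subset unfolding non_elementary_def by blast
  qed
  then obtain l where "infinite (orb l) \<or> card (orb l) \<ge> M" by blast
  then obtain T where T: "T \<subseteq> orb l" "finite T" "card T = M"
    by (metis infinite_arbitrarily_large obtain_subset_with_card_n)
  then obtain h where h: "bij_betw h {..<M} T"
    using ex_bij_betw_nat_finite[OF T(2)] by (auto simp: atLeast0LessThan)
  then have "\<forall>i<M. \<exists>c. c \<in> set_pmf (conv_pow \<mu> l) \<and> moebius c p = h i"
  proof (intro allI impI)
    fix i assume "i < M"
    then have "h i \<in> orb l" using T(1) bij_betw_apply[OF h] by auto
    then show "\<exists>c. c \<in> set_pmf (conv_pow \<mu> l) \<and> moebius c p = h i" unfolding orb_def by auto
  qed
  then obtain c where "\<forall>i<M. c i \<in> set_pmf (conv_pow \<mu> l) \<and> moebius (c i) p = h i" by metis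
  then show ?thesis using h by (intro exI[of _ l] exI[of _ c]) (auto simp: bij_betw_def inj_on_def)
qed

end

section \<open>A maximum principle for random products\<close>

lemma finite_pos_lower_bound:
  fixes f :: "'a \<Rightarrow> real"
  assumes "finite S" "\<And>x. x \<in> S \<Longrightarrow> f x > 0"
  shows "\<exists>c>0. \<forall>x\<in>S. c \<le> f x"
  using assms
proof (induction S rule: finite_induct)
  case empty then show ?case by (auto intro: exI[of _ 1])
next
  case (insert x S)
  then obtain c where "c > 0" "\<forall>y\<in>S. c \<le> f y" by auto
  then show ?case using insert.prems[of x] by (intro exI[of _ "min c (f x)"]) (auto simp: min_le_iff_disj)
qed

lemma finite_upper_bound:
  fixes f :: "'a \<Rightarrow> real"
  assumes "finite S" shows "\<exists>c>0. \<forall>x\<in>S. f x \<le> c"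
proof (intro exI conjI ballI)
  show "0 < 1 + (\<Sum>x\<in>S. \<bar>f x\<bar>)" by (simp add: add_pos_nonneg sum_nonneg)
  fix x assume "x \<in> S"
  then have "\<bar>f x\<bar> \<le> (\<Sum>x\<in>S. \<bar>f x\<bar>)" using assms by (intro member_le_sum) auto
  then show "f x \<le> 1 + (\<Sum>x\<in>S. \<bar>f x\<bar>)" by linarith
qed

primrec mpow :: "'k::field mat2 \<Rightarrow> nat \<Rightarrow> 'k mat2" where
  "mpow a 0 = mat 1"
| "mpow a (Suc n) = mpow a n ** a"

lemma mpow_eigen: "a *v e = l *s e \<Longrightarrow> mpow a n *v e = l ^ n *s e"
  by (induction n)
     (simp_all add: vector_scalar_commute vector_smult_assoc flip: matrix_vector_mul_assoc)

lemma mpow_mem_conv_pow: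
  "a \<in> set_pmf (conv_pow \<mu> m) \<Longrightarrow> mpow a n \<in> set_pmf (conv_pow \<mu> (n * m))"
  by (induction n) (simp_all add: conv_pow_mult_mem add.commute[of m])

text \<open>The left side is the polarisation of the determinant, here written on columns. It lets
  one wedge formula handle both the traces and the directions in
  \<open>separating_elements\<close>.\<close>

lemma trace_adj2_mult:
  "trace (adj2 S ** T) = wedge (S *v axis 1 1) (T *v axis 2 1) + wedge (T *v axis 1 1) (S *v axis 2 1)"
  by (simp add: mat2_simps wedge_def axis_def algebra_simps)

lemma wedge_adj2: "wedge (A *v x) y = wedge x (adj2 A *v y)"
  by (simp add: mat2_simps wedge_def algebra_simps)

lemma wedge_add: "wedge (x + y) z = wedge x z + wedge y z" "wedge x (y + z) = wedge x y + wedge x z"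
  by (simp_all add: wedge_def algebra_simps)

text \<open>The argument of \<open>v\<close> has the shape of a wedge of images under matrices
  containing the \<open>N\<close>-th power of a hyperbolic element with eigenvalue \<open>l\<close>:
  once \<open>N\<close> is large the term with \<open>l^(2N)\<close> exceeds the others.\<close>

lemma (in nonarch_val) v_dominant_term:
  assumes "v q \<le> C" "v r \<le> C" "v s \<le> C" "v l \<ge> 1" "\<kappa> \<le> v p" "C < v l ^ (2 * N) * \<kappa>"
  shows "v l ^ (2 * N) * \<kappa> \<le> v (l ^ N * l ^ N * p + q + r + inverse (l ^ N) * inverse (l ^ N) * s)"
proof -
  have l1: "1 \<le> v l ^ N" using assms by simp
  then have "inverse (v l ^ N) \<le> 1" by (simp add: inverse_le_1_iff)
  then have "inverse (v l ^ N) * inverse (v l ^ N) \<le> 1"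
    using l1 by (intro mult_le_one) (auto intro: order_trans[OF zero_le_one])
  then have "v (inverse (l ^ N) * inverse (l ^ N) * s) \<le> 1 * v s"
    unfolding v_mult v_inverse v_power by (intro mult_right_mono) auto
  then have rest: "v (q + r + inverse (l ^ N) * inverse (l ^ N) * s) \<le> C"
    using assms by (intro v_add_le_trans) auto
  have main: "v l ^ (2 * N) * \<kappa> \<le> v (l ^ N * l ^ N * p)"
    using assms l1 by (simp add: mult_2 power_add mult_left_mono)
  then have "v (q + r + inverse (l ^ N) * inverse (l ^ N) * s) < v (l ^ N * l ^ N * p)"
    using rest assms by linarith
  from v_add_eq[OF this] main show ?thesis by (simp add: add.assoc)
qed

context nonelem_walk
begin

text \<open>The matrices are \<open>c\<^sub>i a\<^sup>N d\<^sub>i\<close> with \<open>a\<close> hyperbolic and \<open>N\<close> large: up to a scalar this is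
  nearly the rank one matrix with image \<open>c\<^sub>i att(a)\<close> and kernel \<open>d\<^sub>i\<^sup>-\<^sup>1 rep(a)\<close>, and these
  images and kernels are pairwise distinct.\<close>

lemma separating_elements:
  fixes R :: real and M :: nat
  obtains m s \<delta> where
    "\<And>i. i < M \<Longrightarrow> s i \<in> set_pmf (conv_pow \<mu> m)"
    "\<And>i j. i < M \<Longrightarrow> j < M \<Longrightarrow> i \<noteq> j \<Longrightarrow> v (trace (adj2 (s i) ** s j)) > R"
    "\<delta> > 0"
    "\<And>x. x \<noteq> 0 \<Longrightarrow> \<exists>k. \<forall>i<M. \<forall>j<M. i \<noteq> k \<longrightarrow> j \<noteq> k \<longrightarrow> i \<noteq> j \<longrightarrow> \<delta> \<le> vd v (s i *v x) (s j *v x)"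
proof -
  obtain a m0 where a: "a \<in> set_pmf (conv_pow \<mu> m0)" "m0 > 0" "hyperbolic v a"
    by (rule semigroup_hyperbolic)
  have aS: "a \<in> SL2" using a conv_in_SL2 by blast
  obtain l e f where lef: "v l > 1" "a *v e = l *s e" "a *v f = inverse l *s f"
      "wedge e f = 1" "e \<noteq> 0" "f \<noteq> 0"
    using hyperbolic_eigenvectors[OF aS a(3)] by metis
  have l0: "l \<noteq> 0" using lef(1) by auto
  have fix_e: "moebius a (line_of e) = line_of e"
  proof -
    obtain c where c: "c \<noteq> 0" "e = c *s pvec (line_of e)" using pvec_line_of[OF lef(5)] by blast
    have "c *s (a *v pvec (line_of e)) = a *v e" using c(2) by (metis vector_scalar_commute)
    then have "line_of (a *v e) = moebius a (line_of e)"
      using c(1) aS by (metis line_of_scale moebius_line_of)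
    then show ?thesis using lef(2) l0 by (simp add: line_of_scale)
  qed
  have fix_f: "moebius (adj2 a) (line_of f) = line_of f"
  proof -
    obtain c where c: "c \<noteq> 0" "f = c *s pvec (line_of f)" using pvec_line_of[OF lef(6)] by blast
    have "c *s (a *v pvec (line_of f)) = a *v f" using c(2) by (metis vector_scalar_commute)
    then have "line_of (a *v f) = moebius a (line_of f)"
      using c(1) aS by (metis line_of_scale moebius_line_of)
    then have "moebius a (line_of f) = line_of f" using lef(3) l0 by (simp add: line_of_scale)
    then show ?thesis using moebius_adj2_cancel(1)[OF aS] by metis
  qed
  obtain lc c where c: "\<forall>i<M. c i \<in> set_pmf (conv_pow \<mu> lc)"
      "inj_on (\<lambda>i. moebius (c i) (line_of e)) {..<M}"
    using large_orbit_level[OF a(1,2) fix_e] by blast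
  \<comment> \<open>Kernels are moved by inverses. The line of \<open>f\<close> is fixed by the
    inverse of \<open>a\<close>, so its orbit under the inverse walk supplies the distinct
    kernels.\<close>
  interpret check: nonelem_walk v "check_mu \<mu>" by (rule nonelem_walk_check)
  have "adj2 a \<in> set_pmf (conv_pow (check_mu \<mu>) m0)"
    using a by (simp add: conv_pow_check_mu supp)
  then obtain ld d' where d': "\<forall>i<M. d' i \<in> set_pmf (conv_pow (check_mu \<mu>) ld)"
      "inj_on (\<lambda>i. moebius (d' i) (line_of f)) {..<M}"
    using check.large_orbit_level[OF _ a(2) fix_f] by blast
  define d where "d i = adj2 (d' i)" for i
  have d: "d i \<in> set_pmf (conv_pow \<mu> ld)" if "i < M" for i
    using d'(1) that by (auto simp: d_def conv_pow_check_mu supp)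
  have cS: "c i \<in> SL2" and dS: "d i \<in> SL2" if "i < M" for i
    using c d that conv_in_SL2 by blast+
  \<comment> \<open>\<open>E i\<close> and \<open>F i\<close> are the images of the eigenbasis under
    \<open>c i\<close>. The numbers \<open>wedge x (fi i)\<close> and \<open>wedge (ei i) x\<close>
    are the coordinates of \<open>d i *v x\<close> in the eigenbasis, so the line of
    \<open>fi i\<close> is the limiting kernel.\<close>
  define E F fi ei where "E i = c i *v e" and "F i = c i *v f"
    and "fi i = adj2 (d i) *v f" and "ei i = adj2 (d i) *v e" for i
  have lineE: "moebius (c i) (line_of e) = line_of (E i)" if "i < M" for i
  proof -
    obtain k where "k \<noteq> 0" "e = k *s pvec (line_of e)" using pvec_line_of[OF lef(5)] by blast
    then have "E i = k *s (c i *v pvec (line_of e))" unfolding E_def by (metis vector_scalar_commute)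
    then show ?thesis using cS[OF that] \<open>k \<noteq> 0\<close> by (simp add: moebius_line_of line_of_scale)
  qed
  have linef: "moebius (d' i) (line_of f) = line_of (fi i)" if "i < M" for i
  proof -
    obtain k where "k \<noteq> 0" "f = k *s pvec (line_of f)" using pvec_line_of[OF lef(6)] by blast
    then have "fi i = k *s (d' i *v pvec (line_of f))" unfolding fi_def d_def adj2_adj2
      by (metis vector_scalar_commute)
    then show ?thesis using dS[OF that] \<open>k \<noteq> 0\<close> by (simp add: moebius_line_of line_of_scale d_def)
  qed
  have wE: "wedge (E i) (E j) \<noteq> 0" and wf: "wedge (fi i) (fi j) \<noteq> 0" if "i < M" "j < M" "i \<noteq> j" for i j
  proof -
    have "E i \<noteq> 0" "E j \<noteq> 0" "fi i \<noteq> 0" "fi j \<noteq> 0"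
      using that cS dS lef by (auto simp: E_def fi_def)
    moreover have "line_of (E i) \<noteq> line_of (E j)" "line_of (fi i) \<noteq> line_of (fi j)"
      using that c(2) d'(2) by (auto simp: inj_on_def lineE linef)
    ultimately show "wedge (E i) (E j) \<noteq> 0" "wedge (fi i) (fi j) \<noteq> 0" by (simp_all add: line_of_eq_iff)
  qed
  define pairs where "pairs = {(i,j). i < M \<and> j < M \<and> i \<noteq> j}"
  have finp: "finite pairs" by (rule finite_subset[of _ "{..<M} \<times> {..<M}"]) (auto simp: pairs_def)
  obtain \<kappa>1 where k1: "\<kappa>1 > 0" "\<forall>(i,j)\<in>pairs. \<kappa>1 \<le> v (wedge (E i) (E j))"
    using finite_pos_lower_bound[OF finp, of "\<lambda>(i,j). v (wedge (E i) (E j))"] wE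
    by (auto simp: pairs_def)
  obtain \<kappa>2 where k2: "\<kappa>2 > 0" "\<forall>(i,j)\<in>pairs. \<kappa>2 \<le> v (wedge (fi i) (fi j))"
    using finite_pos_lower_bound[OF finp, of "\<lambda>(i,j). v (wedge (fi i) (fi j))"] wf
    by (auto simp: pairs_def)
  obtain C where C: "C > 0" "\<forall>i\<in>{..<M}. max (max (vnorm v (E i)) (vnorm v (F i))) (max (vnorm v (fi i)) (vnorm v (ei i))) \<le> C"
    using finite_upper_bound[of "{..<M}" "\<lambda>i. max (max (vnorm v (E i)) (vnorm v (F i))) (max (vnorm v (fi i)) (vnorm v (ei i)))"]
    by (metis finite_lessThan)
  define s where "s N i = c i ** (mpow a N ** d i)" for N i
  have s_mem: "s N i \<in> set_pmf (conv_pow \<mu> (lc + (N * m0 + ld)))" if "i < M" for N i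
    unfolding s_def using that c d mpow_mem_conv_pow[OF a(1)] by (intro conv_pow_mult_mem) auto
  have s_vec: "s N i *v x = (l ^ N * wedge x (fi i)) *s E i + (inverse (l ^ N) * wedge (ei i) x) *s F i" for N i x
  proof -
    define y where "y = d i *v x"
    have "y = wedge y f *s e + wedge e y *s f"
      using wedge_plucker[of e f y] lef(4) by (simp add: add.commute)
    then have "mpow a N *v y = mpow a N *v (wedge y f *s e + wedge e y *s f)" by (rule arg_cong)
    also have "\<dots> = (l ^ N * wedge y f) *s e + (inverse (l ^ N) * wedge e y) *s f"
      by (simp add: matrix_vector_right_distrib vector_scalar_commute mpow_eigen[OF lef(2)] mpow_eigen[OF lef(3)]
           vector_smult_assoc mult.commute power_inverse)
    finally have "s N i *v x = c i *v ((l ^ N * wedge y f) *s e + (inverse (l ^ N) * wedge e y) *s f)"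
      by (simp add: s_def y_def flip: matrix_vector_mul_assoc)
    also have "\<dots> = (l ^ N * wedge y f) *s E i + (inverse (l ^ N) * wedge e y) *s F i"
      by (simp add: matrix_vector_right_distrib vector_scalar_commute E_def F_def)
    moreover have "wedge y f = wedge x (fi i)" by (simp add: y_def fi_def wedge_adj2)
    moreover have "wedge e y = wedge (ei i) x"
      by (metis y_def ei_def wedge_adj2 wedge_commute)
    ultimately show ?thesis by simp
  qed
  have s_wedge: "wedge (s N i *v x) (s N j *v y) =
      l ^ N * l ^ N * (wedge x (fi i) * wedge y (fi j) * wedge (E i) (E j))
      + wedge x (fi i) * wedge (ei j) y * wedge (E i) (F j)
      + wedge (ei i) x * wedge y (fi j) * wedge (F i) (E j)
      + inverse (l ^ N) * inverse (l ^ N) * (wedge (ei i) x * wedge (ei j) y * wedge (F i) (F j))" for N i j x y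
    using l0 by (simp add: s_vec wedge_add field_simps)
  have bd: "v (wedge x p) \<le> C * vnorm v x" "v (wedge p x) \<le> C * vnorm v x" if "vnorm v p \<le> C" for x p
    using v_wedge_le[of x p] v_wedge_le[of p x] mult_right_mono[OF that, of "vnorm v x"]
    by (simp_all add: mult.commute)
  have bd2: "v (wedge p q) \<le> C * C" if "vnorm v p \<le> C" "vnorm v q \<le> C" for p q
    using v_wedge_le[of p q] mult_mono[OF that] C(1) by fastforce
  have CC: "vnorm v (E i) \<le> C" "vnorm v (F i) \<le> C" "vnorm v (fi i) \<le> C" "vnorm v (ei i) \<le> C" if "i < M" for i
    using C(2) that by auto
  have tri: "v (p * q * r) \<le> C ^ 4 * (A * B)"
    if "v p \<le> C * A" "v q \<le> C * B" "v r \<le> C * C" "0 \<le> A" "0 \<le> B" for p q r A B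
  proof -
    have "v (p * q * r) \<le> (C * A) * (C * B) * (C * C)"
      unfolding v_mult using that C(1) by (intro mult_mono) auto
    also have "\<dots> = C ^ 4 * (A * B)" by (simp add: power4_eq_xxxx)
    finally show ?thesis .
  qed
  \<comment> \<open>If \<open>x\<close> were \<eta>-close, relative to its norm, to two kernel
    vectors, the Plucker identity would push their wedge below \<open>\<kappa>2\<close>.\<close>
  define \<eta> where "\<eta> = \<kappa>2 / C"
  have \<eta>: "\<eta> > 0" using k2 C by (simp add: \<eta>_def)
  \<comment> \<open>A common lower bound for the coefficient of \<open>l^(2N)\<close>:
    \<open>\<kappa>1 * \<kappa>2\<close> arises for the traces, and
    \<open>\<eta> * \<eta> * \<kappa>1\<close>, relative to the squared norm of \<open>x\<close>,
    for the directions.\<close>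
  define K where "K = min (\<kappa>1 * \<kappa>2) (\<eta> * \<eta> * \<kappa>1)"
  have K: "K > 0" using k1 k2 \<eta> by (simp add: K_def)
  \<comment> \<open>The leading term has to exceed the size \<open>C^4\<close> of the remaining
    terms and, for the traces, also \<open>R\<close>.\<close>
  define B where "B = max R (C ^ 4)"
  have "\<exists>N. B / K < (v l) ^ N" using lef(1) real_arch_pow by blast
  then obtain N where N: "B < v l ^ N * K" using K by (auto simp: divide_less_eq)
  have N2: "B < v l ^ (2 * N) * K"
  proof -
    have "v l ^ N \<le> v l ^ (2 * N)" using lef(1) by (intro power_increasing) auto
    then have "v l ^ N * K \<le> v l ^ (2 * N) * K" using K by (intro mult_right_mono) auto
    then show ?thesis using N by linarith
  qed
  have P1: "v (trace (adj2 (s N i) ** s N j)) > R" if ij: "i < M" "j < M" "i \<noteq> j" for i j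
  proof -
    let ?x = "axis 1 1 :: 'k^2" and ?y = "axis 2 1 :: 'k^2"
    have x1: "vnorm v ?x = 1" "vnorm v ?y = 1" by (simp_all add: vnorm_def axis_def)
    \<comment> \<open>In the sum of the two wedges the leading coefficients combine to the wedge of
      the images times the wedge of the kernels, neither of which vanishes.\<close>
    have main: "wedge ?x (fi i) * wedge ?y (fi j) * wedge (E i) (E j) + wedge ?x (fi j) * wedge ?y (fi i) * wedge (E j) (E i)
       = wedge (E i) (E j) * wedge (fi i) (fi j)"
      by (simp add: wedge_def axis_def algebra_simps)
    let ?q = "wedge ?x (fi i) * wedge (ei j) ?y * wedge (E i) (F j) + wedge ?x (fi j) * wedge (ei i) ?y * wedge (E j) (F i)"
    let ?r = "wedge (ei i) ?x * wedge ?y (fi j) * wedge (F i) (E j) + wedge (ei j) ?x * wedge ?y (fi i) * wedge (F j) (E i)"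
    let ?s = "wedge (ei i) ?x * wedge (ei j) ?y * wedge (F i) (F j) + wedge (ei j) ?x * wedge (ei i) ?y * wedge (F j) (F i)"
    have "trace (adj2 (s N i) ** s N j) = l ^ N * l ^ N * (wedge ?x (fi i) * wedge ?y (fi j) * wedge (E i) (E j) + wedge ?x (fi j) * wedge ?y (fi i) * wedge (E j) (E i))
      + ?q + ?r + inverse (l ^ N) * inverse (l ^ N) * ?s"
      unfolding trace_adj2_mult s_wedge by (simp add: algebra_simps)
    then have eq: "trace (adj2 (s N i) ** s N j) = l ^ N * l ^ N * (wedge (E i) (E j) * wedge (fi i) (fi j))
      + ?q + ?r + inverse (l ^ N) * inverse (l ^ N) * ?s" unfolding main .
    have kap: "K \<le> v (wedge (E i) (E j) * wedge (fi i) (fi j))"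
    proof -
      have "\<kappa>1 * \<kappa>2 \<le> v (wedge (E i) (E j)) * v (wedge (fi i) (fi j))"
        using k1 k2 ij by (intro mult_mono) (auto simp: pairs_def)
      then show ?thesis by (simp add: K_def)
    qed
    have b: "v (wedge ?x (fi k)) \<le> C * 1" "v (wedge ?y (fi k)) \<le> C * 1" "v (wedge (ei k) ?x) \<le> C * 1" "v (wedge (ei k) ?y) \<le> C * 1"
      if "k < M" for k
      using bd[of "fi k" ?x] bd[of "fi k" ?y] bd[of "ei k" ?x] bd[of "ei k" ?y] CC[OF that] by (simp_all add: x1)
    have q: "v ?q \<le> C ^ 4 * (1 * 1)"
      by (intro v_add_le_trans tri b bd2 CC ij) auto
    have r: "v ?r \<le> C ^ 4 * (1 * 1)"
      by (intro v_add_le_trans tri b bd2 CC ij) auto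
    have s: "v ?s \<le> C ^ 4 * (1 * 1)"
      by (intro v_add_le_trans tri b bd2 CC ij) auto
    have "C ^ 4 * (1 * 1) < v l ^ (2 * N) * K" using N2 by (simp add: B_def)
    from v_dominant_term[OF q r s _ kap this] lef(1)
    have "v l ^ (2 * N) * K \<le> v (trace (adj2 (s N i) ** s N j))" unfolding eq by simp
    then show ?thesis using N2 by (simp add: B_def)
  qed
  obtain D where D: "D > 0" "\<forall>i\<in>{..<M}. mnorm v (s N i) \<le> D"
    using finite_upper_bound[of "{..<M}" "\<lambda>i. mnorm v (s N i)"] by (metis finite_lessThan)
  define \<delta> where "\<delta> = v l ^ (2 * N) * K / (D * D)"
  have dp: "\<delta> > 0" using K D lef(1) l0 by (simp add: \<delta>_def)
  have P2: "\<exists>k. \<forall>i<M. \<forall>j<M. i \<noteq> k \<longrightarrow> j \<noteq> k \<longrightarrow> i \<noteq> j \<longrightarrow> \<delta> \<le> vd v (s N i *v x) (s N j *v x)"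
    if x: "x \<noteq> 0" for x
  proof -
    define X where "X = vnorm v x"
    have X: "X > 0" using x by (simp add: X_def)
    have uniq: "i = j" if ij: "i < M" "j < M" and small: "v (wedge x (fi i)) < \<eta> * X" "v (wedge x (fi j)) < \<eta> * X" for i j
    proof (rule ccontr)
      assume "i \<noteq> j"
      have "v (wedge (fi i) (fi j)) * X \<le> max (v (wedge (fi i) x) * vnorm v (fi j)) (v (wedge x (fi j)) * vnorm v (fi i))"
        using vnorm_add_le[of "wedge (fi i) x *s fi j" "wedge x (fi j) *s fi i"]
        unfolding wedge_plucker[of "fi i" "fi j" x, symmetric] by (simp add: X_def)
      also have "v (wedge (fi i) x) = v (wedge x (fi i))" by (metis v_minus wedge_commute)
      also have "max (v (wedge x (fi i)) * vnorm v (fi j)) (v (wedge x (fi j)) * vnorm v (fi i)) \<le>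
          max (v (wedge x (fi i)) * C) (v (wedge x (fi j)) * C)"
        using CC ij by (intro max.mono mult_left_mono) auto
      also have "\<dots> < \<eta> * X * C" using small C(1) by auto
      also have "\<dots> = \<kappa>2 * X" using C(1) by (simp add: \<eta>_def)
      finally have "v (wedge (fi i) (fi j)) < \<kappa>2" using X by simp
      then show False using k2 ij \<open>i \<noteq> j\<close> by (force simp: pairs_def)
    qed
    \<comment> \<open>At most one kernel is close to \<open>x\<close>; \<open>k\<close> is its
      index, and any number will do if there is none.\<close>
    then obtain k where k: "\<And>i. i < M \<Longrightarrow> i \<noteq> k \<Longrightarrow> \<eta> * X \<le> v (wedge x (fi i))"
      by (metis not_le)
    show ?thesis
    proof (intro exI[of _ k] allI impI)
      fix i j assume ij: "i < M" "j < M" "i \<noteq> k" "j \<noteq> k" "i \<noteq> j"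
      have kap: "K * (X * X) \<le> v (wedge x (fi i) * wedge x (fi j) * wedge (E i) (E j))"
      proof -
        have "K * (X * X) \<le> \<eta> * \<eta> * \<kappa>1 * (X * X)" using X by (intro mult_right_mono) (auto simp: K_def)
        also have "\<dots> = (\<eta> * X) * (\<eta> * X) * \<kappa>1" by simp
        also have "\<dots> \<le> v (wedge x (fi i)) * v (wedge x (fi j)) * v (wedge (E i) (E j))"
          using k[of i] k[of j] k1 ij X \<eta> by (intro mult_mono) (auto simp: pairs_def)
        finally show ?thesis by simp
      qed
      have b: "v (wedge x (fi i)) \<le> C * X" "v (wedge (ei i) x) \<le> C * X" if "i < M" for i
        using bd[of "fi i" x] bd[of "ei i" x] CC[OF that] by (simp_all add: X_def)
      have q: "v (wedge x (fi i) * wedge (ei j) x * wedge (E i) (F j)) \<le> C ^ 4 * (X * X)"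
        by (intro tri b bd2 CC ij) (use X in auto)
      have r: "v (wedge (ei i) x * wedge x (fi j) * wedge (F i) (E j)) \<le> C ^ 4 * (X * X)"
        by (intro tri b bd2 CC ij) (use X in auto)
      have s: "v (wedge (ei i) x * wedge (ei j) x * wedge (F i) (F j)) \<le> C ^ 4 * (X * X)"
        by (intro tri b bd2 CC ij) (use X in auto)
      have "C ^ 4 * (X * X) < v l ^ (2 * N) * (K * (X * X))"
        using N2 X mult_strict_right_mono[of "C ^ 4" "v l ^ (2 * N) * K" "X * X"] by (simp add: B_def mult.assoc)
      from v_dominant_term[OF q r s _ kap this] lef(1)
      have big: "v l ^ (2 * N) * (K * (X * X)) \<le> v (wedge (s N i *v x) (s N j *v x))" unfolding s_wedge by simp
      have iS: "s N i \<in> SL2" "s N j \<in> SL2" using s_mem ij conv_in_SL2 by blast+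
      have up: "vnorm v (s N i *v x) \<le> D * X" if "i < M" for i
        using order_trans[OF vnorm_matvec_le[of "s N i" x] mult_right_mono[of "mnorm v (s N i)" D "vnorm v x"]] D that X
        by (simp add: X_def)
      have pos: "0 < vnorm v (s N i *v x)" "0 < vnorm v (s N j *v x)" using iS x by simp_all
      have "\<delta> = v l ^ (2 * N) * (K * (X * X)) / ((D * X) * (D * X))" using X D by (simp add: \<delta>_def)
      also have "\<dots> \<le> v (wedge (s N i *v x) (s N j *v x)) / (vnorm v (s N i *v x) * vnorm v (s N j *v x))"
        using big pos up ij D X by (intro frac_le mult_mono mult_pos_pos) auto
      finally show "\<delta> \<le> vd v (s N i *v x) (s N j *v x)" by (simp add: vd_def)
    qed
  qed
  show ?thesis
    by (rule that[of "s N" "lc + (N * m0 + ld)" \<delta>]) (use s_mem P1 P2 dp in auto)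
qed

end

text \<open>The deficit \<open>U - f\<close> is nonnegative with mean at most \<open>U - L\<close>,
  and the atom \<open>s\<close> contributes at least \<open>w\<close> times its own deficit to that
  mean.\<close>

lemma pmf_expectation_lower_at:
  fixes f :: "'a \<Rightarrow> real"
  assumes f: "\<And>x. x \<in> set_pmf p \<Longrightarrow> 0 \<le> f x \<and> f x \<le> U" and s: "w \<le> pmf p s" "w > 0"
    and lower: "L \<le> measure_pmf.expectation p f"
  shows "U - (U - L) / w \<le> f s"
proof -
  have sp: "s \<in> set_pmf p" using s by (auto simp: set_pmf_iff)
  have f0: "integrable p f"
    using f by (intro measure_pmf.integrable_const_bound[where B=U]) (auto simp: AE_measure_pmf_iff)
  have i0: "integrable p (\<lambda>x. (U - f s) * indicator {s} x :: real)"
    by (rule measure_pmf.integrable_const_bound[where B="\<bar>U - f s\<bar>"]) (auto simp: AE_measure_pmf_iff indicator_def)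
  have "(U - f s) * pmf p s = measure_pmf.expectation p (\<lambda>x. (U - f s) * indicator {s} x)"
    by (simp add: pmf.rep_eq measure_pmf.emeasure_eq_measure)
  also have "\<dots> \<le> measure_pmf.expectation p (\<lambda>x. U - f x)"
    using f f0 i0 by (intro integral_mono_AE) (auto simp: AE_measure_pmf_iff indicator_def)
  also have "\<dots> = U - measure_pmf.expectation p f" using f0 by simp
  also have "\<dots> \<le> U - L" using lower by simp
  finally have "(U - f s) * pmf p s \<le> U - L" .
  moreover have "(U - f s) * w \<le> (U - f s) * pmf p s"
    using s f[OF sp] by (intro mult_left_mono) auto
  ultimately have "U - f s \<le> (U - L) / w" using s by (simp add: le_divide_eq)
  then show ?thesis by simp
qed

lemma measure_bind_pmf:
  "measure (bind_pmf p N) X = measure_pmf.expectation p (\<lambda>x. measure (N x) X)"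
proof -
  have "ennreal (measure (bind_pmf p N) X) = (\<integral>\<^sup>+x. ennreal (measure (N x) X) \<partial>p)"
    by (simp flip: measure_pmf.emeasure_eq_measure)
  also have "\<dots> = ennreal (measure_pmf.expectation p (\<lambda>x. measure (N x) X))"
    by (intro nn_integral_eq_integral measure_pmf.integrable_const_bound[where B=1]) auto
  finally show ?thesis by (simp add: integral_nonneg)
qed

lemma measure_conv_pow_add:
  "measure (conv_pow \<mu> (n + m)) {g. Q g} =
     measure_pmf.expectation (conv_pow \<mu> n) (\<lambda>a. measure (conv_pow \<mu> m) {b. Q (a ** b)})"
  by (simp add: conv_pow_add measure_bind_pmf vimage_def)

text \<open>Conditioning on the last \<open>m\<close> factors; the two independent draws may be
  exchanged.\<close>

lemma measure_conv_pow_add_right: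
  "measure (conv_pow \<mu> (n + m)) {g. Q g} =
     measure_pmf.expectation (conv_pow \<mu> m) (\<lambda>b. measure (conv_pow \<mu> n) {a. Q (a ** b)})"
proof -
  have "conv_pow \<mu> (n + m) = bind_pmf (conv_pow \<mu> m) (\<lambda>h. map_pmf (\<lambda>g. g ** h) (conv_pow \<mu> n))"
    unfolding conv_pow_add by (simp add: map_pmf_def bind_commute_pmf[of "conv_pow \<mu> n"])
  then show ?thesis by (simp add: measure_bind_pmf vimage_def)
qed

lemma integrable_indicator_pmf [simp, intro]: "integrable (measure_pmf p) (indicat_real A)"
  by (intro measure_pmf.integrable_const_bound[where B=1]) auto

lemma pmf_finite_approx:
  assumes "\<epsilon> > 0" shows "\<exists>F. finite F \<and> F \<subseteq> set_pmf p \<and> measure p (- F) \<le> \<epsilon>"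
proof -
  have "pmf p summable_on UNIV"
    by (rule abs_summable_summable[OF iffD2[OF abs_summable_equivalent pmf_abs_summable]])
  moreover have "infsum (pmf p) UNIV = 1"
    using infsetsum_pmf_eq_1[of p UNIV] by (simp add: infsetsum_infsum pmf_abs_summable)
  ultimately have "((pmf p) has_sum 1) UNIV" using has_sum_infsum by metis
  then have "eventually (\<lambda>F. dist (sum (pmf p) F) 1 < \<epsilon>) (finite_subsets_at_top UNIV)"
    using assms unfolding has_sum_def by (auto simp: tendsto_iff)
  then obtain F where F: "finite F" "dist (sum (pmf p) F) 1 < \<epsilon>"
    by (auto simp: eventually_finite_subsets_at_top)
  have "measure p (- (F \<inter> set_pmf p)) = 1 - measure p (F \<inter> set_pmf p)"
    using measure_pmf.prob_compl[of "F \<inter> set_pmf p" p] by (simp add: Compl_eq_Diff_UNIV)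
  also have "measure p (F \<inter> set_pmf p) = sum (pmf p) F"
    using F by (simp add: measure_Int_set_pmf measure_measure_pmf_finite)
  also have "1 - sum (pmf p) F \<le> \<epsilon>" using F by (auto simp: dist_real_def)
  finally show ?thesis using F(1) by (intro exI[of _ "F \<inter> set_pmf p"]) auto
qed

text \<open>If \<open>e\<close> is the asymptotic supremum over \<open>x\<close> of the probability of \<open>E d g x\<close>, then conditioning
  on the last steps of the walk shows that at a nearly optimal \<open>x\<close> every \<open>act (s i) x\<close> is nearly
  optimal as well. As all but one of the corresponding events are disjoint, \<open>e\<close> must vanish.\<close>

lemma (in nonelem_walk) maximum_principle:
  fixes E :: "real \<Rightarrow> 'k mat2 \<Rightarrow> 'x \<Rightarrow> bool" and act :: "'k mat2 \<Rightarrow> 'x \<Rightarrow> 'x" and X :: "'x set"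
  assumes mono: "\<And>d d' g x. d \<le> d' \<Longrightarrow> g \<in> SL2 \<Longrightarrow> x \<in> X \<Longrightarrow> E d g x \<Longrightarrow> E d' g x"
    and equiv: "\<And>h. h \<in> SL2 \<Longrightarrow> \<exists>C\<ge>1. \<forall>d>0. \<forall>g\<in>SL2. \<forall>x\<in>X. E (d / C) (g ** h) x \<longrightarrow> E d g (act h x)"
    and X: "\<And>h x. h \<in> SL2 \<Longrightarrow> x \<in> X \<Longrightarrow> act h x \<in> X"
    and sep: "\<And>M::nat. \<exists>m s d. d > 0 \<and> (\<forall>i<M. s i \<in> set_pmf (conv_pow \<mu> m)) \<and>
       (\<forall>x\<in>X. \<exists>k. \<forall>i<M. \<forall>j<M. i \<noteq> k \<longrightarrow> j \<noteq> k \<longrightarrow> i \<noteq> j \<longrightarrow>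
          (\<forall>g\<in>SL2. \<not> (E d g (act (s i) x) \<and> E d g (act (s j) x))))"
    and \<eta>: "\<eta> > 0"
  shows "\<exists>d>0. \<exists>n0. \<forall>n\<ge>n0. \<forall>x\<in>X. measure (conv_pow \<mu> n) {g. E d g x} \<le> \<eta>"
proof (rule ccontr)
  assume contr: "\<not> ?thesis"
  \<comment> \<open>\<open>H\<close> holds the bounds that are valid for all large times, uniformly
    in \<open>x\<close>, for some threshold \<open>d\<close>. It is upward closed, so failure of the
    claim puts its infimum \<open>e\<close> at or above \<eta>.\<close>
  define H where "H = {\<eta>. 0 \<le> \<eta> \<and> (\<exists>d>0. \<exists>n0. \<forall>n\<ge>n0. \<forall>x\<in>X. measure (conv_pow \<mu> n) {g. E d g x} \<le> \<eta>)}"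
  have H1: "1 \<in> H" by (auto simp: H_def intro: exI[of _ 1])
  have bdd: "bdd_below H" by (rule bdd_belowI[of _ 0]) (auto simp: H_def)
  have up: "b \<in> H" if "a \<in> H" "a \<le> b" for a b
    using that unfolding H_def by (smt (verit) mem_Collect_eq)
  define e where "e = Inf H"
  have "\<eta> \<le> e" unfolding e_def
  proof (rule cInf_greatest)
    show "H \<noteq> {}" using H1 by auto
    fix a assume a: "a \<in> H"
    show "\<eta> \<le> a"
    proof (rule ccontr)
      assume "\<not> \<eta> \<le> a"
      then have "\<eta> \<in> H" using up[OF a] by simp
      then show False using contr by (auto simp: H_def)
    qed
  qed
  then have e: "e > 0" using \<eta> by simp
  \<comment> \<open>Then \<open>M - 1\<close> disjoint events of probability at least
    \<open>e / 2\<close> have total mass above 1.\<close>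
  obtain M :: nat where M: "2 / e + 1 < real M" using reals_Archimedean2 by blast
  obtain m s d0 where d0: "d0 > 0" and s: "\<forall>i<M. s i \<in> set_pmf (conv_pow \<mu> m)"
    and sepx: "\<forall>x\<in>X. \<exists>k. \<forall>i<M. \<forall>j<M. i \<noteq> k \<longrightarrow> j \<noteq> k \<longrightarrow> i \<noteq> j \<longrightarrow>
          (\<forall>g\<in>SL2. \<not> (E d0 g (act (s i) x) \<and> E d0 g (act (s j) x)))"
    using sep[of M] by blast
  let ?p = "conv_pow \<mu> m"
  obtain w0 where w0: "w0 > 0" "\<forall>i\<in>{..<M}. w0 \<le> pmf ?p (s i)"
    using finite_pos_lower_bound[of "{..<M}" "\<lambda>i. pmf ?p (s i)"] s by (auto simp: pmf_positive)
  define w where "w = min w0 1"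
  have w: "w > 0" "w \<le> 1" "\<And>i. i < M \<Longrightarrow> w \<le> pmf ?p (s i)" using w0 by (auto simp: w_def min_le_iff_disj)
  \<comment> \<open>Tuned for \<open>pmf_expectation_lower_at\<close>: the gap
    \<open>3 * \<epsilon>\<close> between the upper bound \<open>e + \<epsilon>\<close> and the mean
    \<open>e - 2 * \<epsilon>\<close>, divided by the weight \<open>w\<close>, equals
    \<open>e / 4\<close>.\<close>
  define \<epsilon> where "\<epsilon> = w * e / 12"
  have eps: "\<epsilon> > 0" "\<epsilon> \<le> e" using w e mult_right_mono[of w 1 e] by (auto simp: \<epsilon>_def)
  \<comment> \<open>The constant in \<open>equiv\<close> depends on the matrix. A finite set
    carrying all but \<epsilon> of the mass gives one constant \<open>C\<close>, and the rest costs
    \<epsilon>.\<close>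
  obtain F where F: "finite F" "F \<subseteq> set_pmf ?p" "measure ?p (- F) \<le> \<epsilon>"
    using pmf_finite_approx[OF eps(1), of ?p] by (elim exE conjE)
  have "\<forall>h\<in>F. \<exists>C\<ge>1. \<forall>d>0. \<forall>g\<in>SL2. \<forall>x\<in>X. E (d / C) (g ** h) x \<longrightarrow> E d g (act h x)"
    using equiv F(2) conv_in_SL2 by blast
  then obtain Ch where Ch: "\<And>h. h \<in> F \<Longrightarrow> Ch h \<ge> (1::real)"
     "\<And>h d g x. h \<in> F \<Longrightarrow> d > 0 \<Longrightarrow> g \<in> SL2 \<Longrightarrow> x \<in> X \<Longrightarrow> E (d / Ch h) (g ** h) x \<Longrightarrow> E d g (act h x)"
    by metis
  obtain C where C: "C > 0" "\<forall>h\<in>F. Ch h \<le> C" using finite_upper_bound[OF F(1), of Ch] by blast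
  have "\<exists>a\<in>H. a < e + \<epsilon>" unfolding e_def
    using cInf_less_iff[OF _ bdd, of "Inf H + \<epsilon>"] H1 eps by auto
  then have "e + \<epsilon> \<in> H" using up by fastforce
  then obtain d1 n0 where d1: "d1 > 0" "\<And>n x. n \<ge> n0 \<Longrightarrow> x \<in> X \<Longrightarrow> measure (conv_pow \<mu> n) {g. E d1 g x} \<le> e + \<epsilon>"
    by (auto simp: H_def)
  define d where "d = min d1 d0"
  have d: "d > 0" "d \<le> d1" "d \<le> d0" using d0 d1 by (auto simp: d_def)
  have dbound: "measure (conv_pow \<mu> n) {g. E d g x} \<le> e + \<epsilon>" if "n \<ge> n0" "x \<in> X" for n x
  proof -
    have "measure (conv_pow \<mu> n) {g. E d g x} \<le> measure (conv_pow \<mu> n) {g. E d1 g x}"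
      using mono[OF d(2)] that conv_in_SL2
      by (intro measure_pmf.finite_measure_mono_AE) (auto simp: AE_measure_pmf_iff)
    then show ?thesis using d1(2)[OF that] by linarith
  qed
  \<comment> \<open>This is applied with the threshold \<open>d / C\<close>, so that after the loss
    of a factor in \<open>equiv\<close> the events still have threshold \<open>d\<close>.\<close>
  have "e - \<epsilon> \<notin> H" using cInf_lower[OF _ bdd, of "e - \<epsilon>"] eps by (auto simp: e_def)
  then have "\<exists>n\<ge>n0 + m. \<exists>x\<in>X. measure (conv_pow \<mu> n) {g. E (d / C) g x} > e - \<epsilon>"
    using eps d C(1) unfolding H_def by (simp add: not_le)
  then obtain n' x where n': "n' \<ge> n0 + m" and x: "x \<in> X"
    and big: "measure (conv_pow \<mu> n') {g. E (d / C) g x} > e - \<epsilon>" by blast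
  define n where "n = n' - m"
  have n: "n \<ge> n0" "n' = n + m" using n' by (auto simp: n_def)
  let ?f = "\<lambda>h. measure (conv_pow \<mu> n) {g. E d g (act h x)}"
  have if_: "integrable ?p ?f" by (intro measure_pmf.integrable_const_bound[where B=1]) auto
  have "measure (conv_pow \<mu> n') {g. E (d / C) g x} = measure_pmf.expectation ?p (\<lambda>h. measure (conv_pow \<mu> n) {g. E (d / C) (g ** h) x})"
    unfolding n(2) by (rule measure_conv_pow_add_right)
  also have "\<dots> \<le> measure_pmf.expectation ?p (\<lambda>h. ?f h + indicator (- F) h)"
  proof (rule integral_mono_AE)
    show "integrable ?p (\<lambda>h. measure (conv_pow \<mu> n) {g. E (d / C) (g ** h) x})"
      by (intro measure_pmf.integrable_const_bound[where B=1]) auto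
    show "integrable ?p (\<lambda>h. ?f h + indicator (- F) h)"
      using if_ by (intro Bochner_Integration.integrable_add) auto
    show "AE h in ?p. measure (conv_pow \<mu> n) {g. E (d / C) (g ** h) x} \<le> ?f h + indicator (- F) h"
    proof (rule AE_I2)
      fix h
      show "measure (conv_pow \<mu> n) {g. E (d / C) (g ** h) x} \<le> ?f h + indicator (- F) h"
      proof (cases "h \<in> F")
        case True
        then have hS: "h \<in> SL2" using F conv_in_SL2 by blast
        have "d / C \<le> d / Ch h" using Ch(1)[OF True] C True d by (intro divide_left_mono) auto
        then have "E d g (act h x)" if "E (d / C) (g ** h) x" "g \<in> SL2" for g
          using mono[of "d / C" "d / Ch h" "g ** h" x] Ch(2)[OF True d(1) that(2) x] that hS x by blast
        then have "measure (conv_pow \<mu> n) {g. E (d / C) (g ** h) x} \<le> ?f h"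
          using conv_in_SL2
          by (intro measure_pmf.finite_measure_mono_AE) (auto simp: AE_measure_pmf_iff)
        then show ?thesis by (rule order_trans) simp
      next
        case False
        have "measure (conv_pow \<mu> n) {g. E (d / C) (g ** h) x} \<le> 1" by simp
        then show ?thesis using False by (simp add: add_increasing)
      qed
    qed
  qed
  also have "\<dots> = measure_pmf.expectation ?p ?f + measure ?p (- F)"
    using if_ by (subst Bochner_Integration.integral_add) auto
  finally have Ef: "e - 2 * \<epsilon> \<le> measure_pmf.expectation ?p ?f" using big F(3) by simp
  have each: "e / 2 \<le> ?f (s i)" if i: "i < M" for i
  proof -
    have "(e + \<epsilon>) - ((e + \<epsilon>) - (e - 2 * \<epsilon>)) / w \<le> ?f (s i)"
    proof (rule pmf_expectation_lower_at[OF _ w(3)[OF i] w(1) Ef])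
      fix h assume "h \<in> set_pmf ?p"
      then show "0 \<le> ?f h \<and> ?f h \<le> e + \<epsilon>" using dbound[OF n(1)] X[OF _ x] conv_in_SL2 by auto
    qed
    moreover have "((e + \<epsilon>) - (e - 2 * \<epsilon>)) / w = e / 4" using w by (simp add: \<epsilon>_def)
    ultimately show ?thesis using eps e by linarith
  qed
  from bspec[OF sepx x] obtain k where kk: "\<forall>i<M. \<forall>j<M. i \<noteq> k \<longrightarrow> j \<noteq> k \<longrightarrow> i \<noteq> j \<longrightarrow>
      (\<forall>g\<in>SL2. \<not> (E d0 g (act (s i) x) \<and> E d0 g (act (s j) x)))" ..
  have k: "\<And>i j g. i < M \<Longrightarrow> j < M \<Longrightarrow> i \<noteq> k \<Longrightarrow> j \<noteq> k \<Longrightarrow> i \<noteq> j \<Longrightarrow> g \<in> SL2 \<Longrightarrow>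
      \<not> (E d0 g (act (s i) x) \<and> E d0 g (act (s j) x))"
    using kk by simp
  \<comment> \<open>Intersecting with the support keeps the probability and places the elements in
    \<open>SL2\<close>, where disjointness is known.\<close>
  define A where "A i = {g. E d g (act (s i) x)} \<inter> set_pmf (conv_pow \<mu> n)" for i
  have disj: "disjoint_family_on A ({..<M} - {k})"
  proof -
    have big: "E d0 g (act (s i) x)" "g \<in> SL2" if "g \<in> A i" "i < M" for g i
    proof -
      show g: "g \<in> SL2" using that conv_in_SL2 by (auto simp: A_def)
      have "s i \<in> SL2" using s that(2) by (intro conv_in_SL2[of _ m]) simp
      from X[OF this x] have "act (s i) x \<in> X" .
      then show "E d0 g (act (s i) x)" using mono[OF d(3) g, of "act (s i) x"] that by (auto simp: A_def)
    qed
    show ?thesis unfolding disjoint_family_on_def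
    proof (intro ballI impI)
      fix i j assume ij: "i \<in> {..<M} - {k}" "j \<in> {..<M} - {k}" "i \<noteq> j"
      show "A i \<inter> A j = {}"
      proof (rule ccontr)
        assume "A i \<inter> A j \<noteq> {}"
        then obtain g where "g \<in> A i" "g \<in> A j" by blast
        then show False using big[of g i] big[of g j] k[of i j g] ij by simp
      qed
    qed
  qed
  have "(\<Sum>i\<in>{..<M} - {k}. e / 2) \<le> (\<Sum>i\<in>{..<M} - {k}. measure (conv_pow \<mu> n) (A i))"
    using each by (intro sum_mono) (auto simp: A_def measure_Int_set_pmf)
  also have "\<dots> = measure (conv_pow \<mu> n) (\<Union>i\<in>{..<M} - {k}. A i)"
    using disj by (subst measure_pmf.finite_measure_finite_Union) auto
  also have "\<dots> \<le> 1" by simp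
  finally have "real (card ({..<M} - {k})) * (e / 2) \<le> 1" by simp
  moreover have "real M - 1 \<le> real (card ({..<M} - {k}))"
    using diff_card_le_card_Diff[of "{k}" "{..<M}"] by simp
  ultimately have "(real M - 1) * (e / 2) \<le> 1"
    using e mult_right_mono[of "real M - 1" "real (card ({..<M} - {k}))" "e / 2"] by linarith
  moreover have "2 / e * (e / 2) < (real M - 1) * (e / 2)"
    using M e by (intro mult_strict_right_mono) auto
  ultimately show False using e by simp
qed

section \<open>Escape of norms and absence of concentration\<close>

context nonarch_val
begin

text \<open>Some basis vector realises the norm of \<open>g\<close>; expand it in \<open>y\<close>
  and \<open>z\<close> by the Plucker identity. Consequently two vectors that are both strongly
  contracted, relative to the norm of \<open>g\<close>, must be nearly parallel.\<close>

lemma mnorm_wedge_le: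
  "mnorm v g * v (wedge y z) \<le> max (vnorm v (g *v y) * vnorm v z) (vnorm v (g *v z) * vnorm v y)"
proof -
  obtain i j where ij: "v (g $ i $ j) = mnorm v g" using mnorm_attained by blast
  let ?x = "axis j 1 :: 'k^2"
  have x1: "vnorm v ?x = 1" using exhaust_2[of j] by (auto simp: vnorm_def axis_def)
  have "(g *v ?x) $ i = g $ i $ j" using exhaust_2[of j] by (auto simp: matvec2_nth axis_def)
  then have 1: "mnorm v g \<le> vnorm v (g *v ?x)" using v_le_vnorm[of "g *v ?x" i] ij by simp
  have "g *v (wedge y z *s ?x) = g *v (wedge y ?x *s z + wedge ?x z *s y)"
    by (rule arg_cong[OF wedge_plucker])
  then have eq: "wedge y z *s (g *v ?x) = wedge y ?x *s (g *v z) + wedge ?x z *s (g *v y)"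
    by (simp add: matrix_vector_right_distrib vector_scalar_commute)
  have "mnorm v g * v (wedge y z) \<le> vnorm v (wedge y z *s (g *v ?x))"
    using mult_right_mono[OF 1, of "v (wedge y z)"] by (simp add: mult.commute)
  also have "\<dots> \<le> max (v (wedge y ?x) * vnorm v (g *v z)) (v (wedge ?x z) * vnorm v (g *v y))"
    unfolding eq using vnorm_add_le[of "wedge y ?x *s (g *v z)" "wedge ?x z *s (g *v y)"] by simp
  also have "\<dots> \<le> max (vnorm v y * vnorm v (g *v z)) (vnorm v z * vnorm v (g *v y))"
    using v_wedge_le[of y ?x] v_wedge_le[of ?x z] x1 by (intro max.mono mult_right_mono) auto
  finally show ?thesis by (simp add: max.commute mult.commute)
qed

end

context nonelem_walk
begin

text \<open>The maximum principle is used on \<open>SL2\<close> acting on itself by left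
  multiplication. If \<open>g s_i x\<close> and \<open>g s_j x\<close> both have norm at most
  \<open>R\<close>, then the inverse of the first times the second is conjugate to
  \<open>s_i^-1 s_j\<close>, whose trace would then be at most \<open>R^2\<close>; the separating
  elements are chosen to violate this.\<close>

lemma norm_escape:
  assumes "\<eta> > 0"
  shows "\<exists>n0. \<forall>n\<ge>n0. measure (conv_pow \<mu> n) {g. mnorm v g \<le> R} \<le> \<eta>"
proof -
  have "\<exists>d>0::real. \<exists>n0. \<forall>n\<ge>n0. \<forall>h\<in>SL2. measure (conv_pow \<mu> n) {g. mnorm v (g ** h) \<le> R} \<le> \<eta>"
  proof (rule maximum_principle[where act = "\<lambda>h x. h ** x" and E = "\<lambda>d g h. mnorm v (g ** h) \<le> R"])
    show "\<exists>C\<ge>1::real. \<forall>d>0::real. \<forall>g\<in>SL2. \<forall>x\<in>SL2. mnorm v (g ** h ** x) \<le> R \<longrightarrow> mnorm v (g ** (h ** x)) \<le> R" for h :: "'k mat2"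
      by (intro exI[of _ 1]) (simp add: matrix_mul_assoc)
    fix M :: nat
    obtain m s d where s: "\<And>i. i < M \<Longrightarrow> s i \<in> set_pmf (conv_pow \<mu> m)"
      "\<And>i j. i < M \<Longrightarrow> j < M \<Longrightarrow> i \<noteq> j \<Longrightarrow> v (trace (adj2 (s i) ** s j)) > R * R"
      using separating_elements[of M "R * R"] by metis
    have "\<not> (mnorm v (g ** (s i ** x)) \<le> R \<and> mnorm v (g ** (s j ** x)) \<le> R)"
      if "x \<in> SL2" "g \<in> SL2" "i < M" "j < M" "i \<noteq> j" for x g i j
    proof
      assume a: "mnorm v (g ** (s i ** x)) \<le> R \<and> mnorm v (g ** (s j ** x)) \<le> R"
      let ?P = "g ** (s i ** x)" and ?Q = "g ** (s j ** x)"
      have "adj2 ?P ** ?Q = adj2 x ** adj2 (s i) ** (adj2 g ** g) ** (s j ** x)"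
        by (simp add: adj2_matmul matrix_mul_assoc)
      also have "\<dots> = adj2 x ** ((adj2 (s i) ** s j) ** x)"
        using that by (simp add: adj2_mult SL2_det matrix_mul_assoc)
      also have "trace \<dots> = trace (((adj2 (s i) ** s j) ** x) ** adj2 x)" by (rule trace_mul_sym)
      also have "((adj2 (s i) ** s j) ** x) ** adj2 x = adj2 (s i) ** s j"
        using that by (simp add: adj2_mult SL2_det flip: matrix_mul_assoc)
      finally have "v (trace (adj2 (s i) ** s j)) = v (trace (adj2 ?P ** ?Q))" by simp
      also have "\<dots> \<le> mnorm v ?P * mnorm v ?Q"
        using order_trans[OF v_trace_le_mnorm mnorm_mult_le[of "adj2 ?P" ?Q]] by simp
      also have "\<dots> \<le> R * R" using a mnorm_nonneg order_trans by (intro mult_mono) blast+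
      finally show False using s(2)[OF that(3-5)] by simp
    qed
    then have sep: "\<forall>x\<in>SL2. \<exists>k. \<forall>i<M. \<forall>j<M. i \<noteq> k \<longrightarrow> j \<noteq> k \<longrightarrow> i \<noteq> j \<longrightarrow>
          (\<forall>g\<in>SL2. \<not> (mnorm v (g ** (s i ** x)) \<le> R \<and> mnorm v (g ** (s j ** x)) \<le> R))"
      by blast
    show "\<exists>m s d::real. 0 < d \<and> (\<forall>i<M. s i \<in> set_pmf (conv_pow \<mu> m)) \<and>
        (\<forall>x\<in>SL2. \<exists>k. \<forall>i<M. \<forall>j<M. i \<noteq> k \<longrightarrow> j \<noteq> k \<longrightarrow> i \<noteq> j \<longrightarrow>
          (\<forall>g\<in>SL2. \<not> (mnorm v (g ** (s i ** x)) \<le> R \<and> mnorm v (g ** (s j ** x)) \<le> R)))"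
      by (rule exI[of _ m], rule exI[of _ s], rule exI[of _ 1]) (use s(1) sep in simp)
  qed (use assms in auto)
  then obtain n0 where "\<forall>n\<ge>n0. \<forall>h\<in>SL2. measure (conv_pow \<mu> n) {g. mnorm v (g ** h) \<le> R} \<le> \<eta>" by blast
  then show ?thesis using SL2_one by (metis (no_types, lifting) Collect_cong matrix_mul_rid)
qed

text \<open>The event says that \<open>x\<close> lies near the direction contracted most by
  \<open>g\<close>. By \<open>mnorm_wedge_le\<close> two points at distance at least \<delta> cannot
  both satisfy it with threshold \<open>\<delta> / 2\<close>, which is the disjointness required by
  the maximum principle.\<close>

lemma contraction_nonconcentrated:
  assumes "\<eta> > 0"
  shows "\<exists>d>0. \<exists>n0. \<forall>n\<ge>n0. \<forall>x. x \<noteq> 0 \<longrightarrow>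
    measure (conv_pow \<mu> n) {g. vnorm v (g *v x) \<le> d * mnorm v g * vnorm v x} \<le> \<eta>"
proof -
  have "\<exists>d>0. \<exists>n0. \<forall>n\<ge>n0. \<forall>x\<in>{x. x \<noteq> 0}.
    measure (conv_pow \<mu> n) {g. vnorm v (g *v x) \<le> d * mnorm v g * vnorm v x} \<le> \<eta>"
  proof (rule maximum_principle[where act = "\<lambda>h x. h *v x"
        and E = "\<lambda>d g x. vnorm v (g *v x) \<le> d * mnorm v g * vnorm v x"])
    show "vnorm v (g *v x) \<le> d' * mnorm v g * vnorm v x"
      if "d \<le> d'" "vnorm v (g *v x) \<le> d * mnorm v g * vnorm v x" for d d' g x
    proof -
      have "d * mnorm v g * vnorm v x \<le> d' * mnorm v g * vnorm v x"
        using that by (intro mult_right_mono) auto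
      then show ?thesis using that by linarith
    qed
    show "\<exists>C\<ge>1. \<forall>d>0. \<forall>g\<in>SL2. \<forall>x\<in>{x. x \<noteq> 0}.
        vnorm v (g ** h *v x) \<le> d / C * mnorm v (g ** h) * vnorm v x \<longrightarrow>
        vnorm v (g *v (h *v x)) \<le> d * mnorm v g * vnorm v (h *v x)" if h: "h \<in> SL2" for h
    \<comment> \<open>One factor \<open>mnorm v h\<close> compares the norms of
      \<open>g ** h\<close> and \<open>g\<close>, the other compares \<open>x\<close> with
      \<open>h *v x\<close>.\<close>
    proof (intro exI[of _ "(mnorm v h)\<^sup>2"] conjI allI impI ballI)
      show "1 \<le> (mnorm v h)\<^sup>2" using mnorm_SL2_ge_1[OF h] by simp
      fix d :: real and g x
      assume d: "0 < d" and le: "vnorm v (g ** h *v x) \<le> d / (mnorm v h)\<^sup>2 * mnorm v (g ** h) * vnorm v x"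
      have hp: "mnorm v h > 0" using mnorm_SL2_pos[OF h] .
      have "d / (mnorm v h)\<^sup>2 * mnorm v (g ** h) * vnorm v x \<le>
         d / (mnorm v h)\<^sup>2 * (mnorm v g * mnorm v h) * (mnorm v h * vnorm v (h *v x))"
        using d mnorm_mult_le[of g h] vnorm_le_matvec[OF h, of x] hp
        by (intro mult_mono) auto
      also have "\<dots> = d * mnorm v g * vnorm v (h *v x)" using hp by (simp add: power2_eq_square)
      finally show "vnorm v (g *v (h *v x)) \<le> d * mnorm v g * vnorm v (h *v x)"
        using le by (simp add: matrix_vector_mul_assoc)
    qed
    fix M :: nat
    obtain m s \<delta> where s: "\<And>i. i < M \<Longrightarrow> s i \<in> set_pmf (conv_pow \<mu> m)" "\<delta> > 0"
      "\<And>x. x \<noteq> 0 \<Longrightarrow> \<exists>k. \<forall>i<M. \<forall>j<M. i \<noteq> k \<longrightarrow> j \<noteq> k \<longrightarrow> i \<noteq> j \<longrightarrow> \<delta> \<le> vd v (s i *v x) (s j *v x)"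
      using separating_elements[of M 0] by metis
    have no: "\<not> (vnorm v (g *v y) \<le> \<delta> / 2 * mnorm v g * vnorm v y \<and> vnorm v (g *v z) \<le> \<delta> / 2 * mnorm v g * vnorm v z)"
      if "g \<in> SL2" "y \<noteq> 0" "z \<noteq> 0" "\<delta> \<le> vd v y z" for g y z
    proof
      assume a: "vnorm v (g *v y) \<le> \<delta> / 2 * mnorm v g * vnorm v y \<and> vnorm v (g *v z) \<le> \<delta> / 2 * mnorm v g * vnorm v z"
      have p: "0 < vnorm v y" "0 < vnorm v z" "0 < mnorm v g" using that mnorm_SL2_pos by auto
      have "mnorm v g * v (wedge y z) \<le> max (vnorm v (g *v y) * vnorm v z) (vnorm v (g *v z) * vnorm v y)"
        by (rule mnorm_wedge_le)
      also have "\<dots> \<le> max (\<delta> / 2 * mnorm v g * vnorm v y * vnorm v z) (\<delta> / 2 * mnorm v g * vnorm v z * vnorm v y)"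
        using a by (intro max.mono mult_right_mono) auto
      also have "\<dots> = mnorm v g * (\<delta> / 2 * (vnorm v y * vnorm v z))" by (simp add: mult_ac)
      finally have "v (wedge y z) \<le> \<delta> / 2 * (vnorm v y * vnorm v z)" using p(3) by (simp only: mult_le_cancel_left_pos)
      then have "vd v y z \<le> \<delta> / 2" using p by (simp add: vd_def divide_le_eq)
      then show False using that s(2) by simp
    qed
    show "\<exists>m s d. 0 < d \<and> (\<forall>i<M. s i \<in> set_pmf (conv_pow \<mu> m)) \<and>
        (\<forall>x\<in>{x. x \<noteq> 0}. \<exists>k. \<forall>i<M. \<forall>j<M. i \<noteq> k \<longrightarrow> j \<noteq> k \<longrightarrow> i \<noteq> j \<longrightarrow>
          (\<forall>g\<in>SL2. \<not> (vnorm v (g *v (s i *v x)) \<le> d * mnorm v g * vnorm v (s i *v x) \<and>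
             vnorm v (g *v (s j *v x)) \<le> d * mnorm v g * vnorm v (s j *v x))))"
    proof (rule exI[of _ m], rule exI[of _ s], rule exI[of _ "\<delta> / 2"], intro conjI ballI)
      show "0 < \<delta> / 2" "\<forall>i<M. s i \<in> set_pmf (conv_pow \<mu> m)" using s by simp_all
      fix x :: "'k^2" assume "x \<in> {x. x \<noteq> 0}"
      then have x: "x \<noteq> 0" by simp
      obtain k where k: "\<forall>i<M. \<forall>j<M. i \<noteq> k \<longrightarrow> j \<noteq> k \<longrightarrow> i \<noteq> j \<longrightarrow> \<delta> \<le> vd v (s i *v x) (s j *v x)"
        using s(3)[OF x] by blast
      have nz: "s i *v x \<noteq> 0" if "i < M" for i using s(1)[OF that] x conv_in_SL2 by simp
      show "\<exists>k. \<forall>i<M. \<forall>j<M. i \<noteq> k \<longrightarrow> j \<noteq> k \<longrightarrow> i \<noteq> j \<longrightarrow>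
          (\<forall>g\<in>SL2. \<not> (vnorm v (g *v (s i *v x)) \<le> \<delta> / 2 * mnorm v g * vnorm v (s i *v x) \<and>
             vnorm v (g *v (s j *v x)) \<le> \<delta> / 2 * mnorm v g * vnorm v (s j *v x)))"
        using k no nz by (intro exI[of _ k]) blast
    qed
  qed (use assms in auto)
  then show ?thesis by simp
qed

text \<open>Combines the two preceding estimates. The time \<open>n0\<close> does not depend on
  \<open>x\<close>, which later allows \<open>x\<close> to be the outcome of further independent
  steps.\<close>

lemma vector_norm_escape:
  assumes "\<eta> > 0"
  shows "\<exists>n0. \<forall>n\<ge>n0. \<forall>x. x \<noteq> 0 \<longrightarrow> measure (conv_pow \<mu> n) {g. vnorm v (g *v x) \<le> K * vnorm v x} \<le> \<eta>"
proof -
  obtain d n0 where d: "d > 0" "\<And>n x. n \<ge> n0 \<Longrightarrow> x \<noteq> 0 \<Longrightarrow>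
      measure (conv_pow \<mu> n) {g. vnorm v (g *v x) \<le> d * mnorm v g * vnorm v x} \<le> \<eta> / 2"
    using contraction_nonconcentrated[of "\<eta> / 2"] assms by auto
  obtain n1 where n1: "\<And>n. n \<ge> n1 \<Longrightarrow> measure (conv_pow \<mu> n) {g. mnorm v g \<le> K / d} \<le> \<eta> / 2"
    using norm_escape[of "\<eta> / 2" "K / d"] assms by auto
  have "measure (conv_pow \<mu> n) {g. vnorm v (g *v x) \<le> K * vnorm v x} \<le> \<eta>"
    if n: "n \<ge> max n0 n1" and x: "x \<noteq> 0" for n x
  proof -
    have "{g. vnorm v (g *v x) \<le> K * vnorm v x} \<subseteq>
       {g. vnorm v (g *v x) \<le> d * mnorm v g * vnorm v x} \<union> {g. mnorm v g \<le> K / d}"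
    proof
      fix g assume g: "g \<in> {g. vnorm v (g *v x) \<le> K * vnorm v x}"
      show "g \<in> {g. vnorm v (g *v x) \<le> d * mnorm v g * vnorm v x} \<union> {g. mnorm v g \<le> K / d}"
      proof (cases "mnorm v g \<le> K / d")
        case False
        then have "K \<le> d * mnorm v g" using d(1) by (simp add: not_le divide_less_eq mult.commute)
        then have "K * vnorm v x \<le> d * mnorm v g * vnorm v x" by (intro mult_right_mono) auto
        then show ?thesis using g by auto
      qed auto
    qed
    then have "measure (conv_pow \<mu> n) {g. vnorm v (g *v x) \<le> K * vnorm v x} \<le>
       measure (conv_pow \<mu> n) ({g. vnorm v (g *v x) \<le> d * mnorm v g * vnorm v x} \<union> {g. mnorm v g \<le> K / d})"
      by (intro measure_pmf.finite_measure_mono) auto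
    also have "\<dots> \<le> measure (conv_pow \<mu> n) {g. vnorm v (g *v x) \<le> d * mnorm v g * vnorm v x}
        + measure (conv_pow \<mu> n) {g. mnorm v g \<le> K / d}"
      by (rule measure_Un_le) auto
    also have "\<dots> \<le> \<eta> / 2 + \<eta> / 2" using d(2)[OF _ x] n1 n by (intro add_mono) auto
    finally show ?thesis by simp
  qed
  then show ?thesis by blast
qed

end

section \<open>Traces of random products\<close>

context nonarch_val
begin

text \<open>With \<open>z = b\<^sup>-\<^sup>1 q\<close> one has \<open>q \<and> b y = z \<and> y\<close>; the vector \<open>z\<close> is strongly contracted by \<open>b\<close>
  whereas \<open>y\<close> is not, so they cannot be nearly parallel.\<close>

lemma wedge_lower_bound:
  assumes b: "b \<in> SL2" and y: "y \<noteq> 0" and q: "q \<noteq> 0" and d: "d > 0" "d * mnorm v b > 1"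
    and by_: "d * mnorm v b * vnorm v y < vnorm v (b *v y)"
    and bq: "d * mnorm v b * vnorm v q < vnorm v (adj2 b *v q)"
  shows "d * d * mnorm v b * vnorm v q * vnorm v y \<le> v (wedge q (b *v y))"
proof -
  define z where "z = adj2 b *v q"
  have bz: "b *v z = q" using b by (simp add: z_def SL2_matvec_cancel)
  have z0: "z \<noteq> 0" using b q by (simp add: z_def)
  have wz: "wedge q (b *v y) = wedge z y"
    using bz wedge_matvec[of b z y] b by (simp add: SL2_det)
  define B Y Z Q where "B = mnorm v b" and "Y = vnorm v y" and "Z = vnorm v z" and "Q = vnorm v q"
  have pos: "B > 0" "Y > 0" "Z > 0" "Q > 0"
    using mnorm_SL2_pos[OF b] y q z0 by (simp_all add: B_def Y_def Z_def Q_def)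
  \<comment> \<open>A standard basis vector at maximal distance from \<open>z\<close>.\<close>
  obtain x :: "'k^2" where x: "vnorm v x = 1" "v (wedge x z) = Z"
  proof (cases "v (z$1) \<le> v (z$2)")
    case True
    then show ?thesis by (intro that[of "axis 1 1"]) (auto simp: vnorm_def axis_def wedge_def Z_def)
  next
    case False
    then show ?thesis by (intro that[of "axis 2 1"]) (auto simp: vnorm_def axis_def wedge_def Z_def)
  qed
  have "b *v (wedge y z *s x) = b *v (wedge y x *s z + wedge x z *s y)"
    by (rule arg_cong[OF wedge_plucker])
  then have "wedge x z *s (b *v y) = wedge y z *s (b *v x) + (- wedge y x) *s q"
    by (simp add: matrix_vector_right_distrib vector_scalar_commute bz)
  then have "Z * vnorm v (b *v y) \<le> max (v (wedge y z) * vnorm v (b *v x)) (v (wedge y x) * Q)"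
    using vnorm_add_le[of "wedge y z *s (b *v x)" "(- wedge y x) *s q"] x(2)
    by (metis vnorm_scale v_minus Q_def)
  also have "\<dots> \<le> max (v (wedge y z) * B) (Y * Q)"
    using vnorm_matvec_le[of b x] v_wedge_le[of y x] x(1) pos
    by (intro max.mono mult_left_mono mult_right_mono) (auto simp: B_def Y_def)
  finally have le: "Z * vnorm v (b *v y) \<le> max (v (wedge y z) * B) (Y * Q)" .
  have ZQ: "d * B * Q < Z" using bq by (simp add: z_def B_def Q_def Z_def)
  \<comment> \<open>The second entry of the maximum in \<open>le\<close> is too small, so the first
    entry bounds the left side.\<close>
  have "Y * Q < Z * vnorm v (b *v y)"
  proof -
    have "1 < (d * B) * (d * B)" using d(2) by (simp add: B_def less_1_mult)
    then have "1 * (Y * Q) < (d * B) * (d * B) * (Y * Q)" using pos by (intro mult_strict_right_mono) auto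
    also have "\<dots> = (d * B * Q) * (d * B * Y)" by simp
    also have "\<dots> \<le> Z * vnorm v (b *v y)"
      using ZQ by_ pos d by (intro mult_mono) (auto simp: B_def Y_def)
    finally show ?thesis by simp
  qed
  then have "Z * vnorm v (b *v y) \<le> v (wedge y z) * B" using le by linarith
  moreover have "(d * B * Q) * (d * B * Y) \<le> Z * vnorm v (b *v y)"
    using ZQ by_ pos d by (intro mult_mono) (auto simp: B_def Y_def)
  ultimately have "(d * d * B * Q * Y) * B \<le> v (wedge y z) * B" by (simp add: mult_ac)
  then have "d * d * B * Q * Y \<le> v (wedge y z)" using pos by (metis mult_le_cancel_right_pos)
  then show ?thesis unfolding wz by (metis B_def Q_def Y_def v_minus wedge_commute)
qed

text \<open>If \<open>a\<^sub>i\<^sub>j\<close> is an entry of maximal absolute value then \<open>a\<^sub>i\<^sub>j a\<close> differs from the product of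
  the \<open>j\<close>-th column and the \<open>i\<close>-th row by a matrix with a single nonzero entry \<open>\<plusminus>1\<close>.\<close>

lemma trace_rank_one_approx:
  assumes a: "a \<in> SL2"
  obtains t y q where "v t = mnorm v a" "vnorm v y = mnorm v a" "vnorm v q = mnorm v a"
    "\<And>b. v (t * trace (a ** b) - wedge q (b *v y)) \<le> mnorm v b"
proof -
  have d: "a$1$1 * a$2$2 - a$1$2 * a$2$1 = 1" using a by (simp add: SL2_det det_2)
  obtain i j where ij: "v (a $ i $ j) = mnorm v a" using mnorm_attained by blast
  define t y q where "t = a$i$j" and "y = (vector [a$1$j, a$2$j] :: 'k^2)"
    and "q = (vector [a$i$2, - a$i$1] :: 'k^2)"
  have "v (a$i$j) \<le> vnorm v y" "vnorm v y \<le> mnorm v a"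
    using exhaust_2[of i] v_le_mnorm[of a] by (auto simp: y_def vnorm_def)
  then have ny: "vnorm v y = mnorm v a" using ij by simp
  have "v (a$i$j) \<le> vnorm v q" "vnorm v q \<le> mnorm v a"
    using exhaust_2[of j] v_le_mnorm[of a] by (auto simp: q_def vnorm_def)
  then have nq: "vnorm v q = mnorm v a" using ij by simp
  have "v (t * trace (a ** b) - wedge q (b *v y)) \<le> mnorm v b" for b
  proof -
    have "\<exists>k m. t * trace (a ** b) - wedge q (b *v y) = (a$1$1 * a$2$2 - a$1$2 * a$2$1) * (b$k$m)
       \<or> t * trace (a ** b) - wedge q (b *v y) = - ((a$1$1 * a$2$2 - a$1$2 * a$2$1) * (b$k$m))"
    proof -
      consider "i = 1" "j = 1" | "i = 1" "j = 2" | "i = 2" "j = 1" | "i = 2" "j = 2"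
        using exhaust_2[of i] exhaust_2[of j] by auto
      then show ?thesis
      proof cases
        case 1
        show ?thesis unfolding t_def q_def y_def 1
          by (rule exI[of _ 2], rule exI[of _ 2], rule disjI1)
             (simp add: wedge_def mat2_simps algebra_simps)
      next
        case 2
        show ?thesis unfolding t_def q_def y_def 2
          by (rule exI[of _ 1], rule exI[of _ 2], rule disjI2)
             (simp add: wedge_def mat2_simps algebra_simps)
      next
        case 3
        show ?thesis unfolding t_def q_def y_def 3
          by (rule exI[of _ 2], rule exI[of _ 1], rule disjI2)
             (simp add: wedge_def mat2_simps algebra_simps)
      next
        case 4
        show ?thesis unfolding t_def q_def y_def 4
          by (rule exI[of _ 1], rule exI[of _ 1], rule disjI1)
             (simp add: wedge_def mat2_simps algebra_simps)
      qed
    qed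
    then obtain k m where "t * trace (a ** b) - wedge q (b *v y) = b$k$m \<or> t * trace (a ** b) - wedge q (b *v y) = - (b$k$m)"
      unfolding d by auto
    then have "v (t * trace (a ** b) - wedge q (b *v y)) = v (b$k$m)" by (auto simp del: v_eq_0)
    then show ?thesis using v_le_mnorm[of b k m] by simp
  qed
  then show ?thesis using that[of t y q] ny nq ij by (simp add: t_def)
qed

text \<open>The vectors \<open>y\<close> and \<open>q\<close>, a column and a rotated row of
  \<open>a\<close>, are fixed before \<open>b\<close>; the conditions on \<open>b\<close> then have
  high probability for independent \<open>b\<close>. The hypothesis \<open>d * mnorm v a > 1\<close>
  makes the main term larger than the rank one error.\<close>

lemma trace_lower_bound:
  assumes a: "a \<in> SL2"
  obtains y q where "y \<noteq> 0" "q \<noteq> 0"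
    "\<And>b d. b \<in> SL2 \<Longrightarrow> d > 0 \<Longrightarrow> d * mnorm v a > 1 \<Longrightarrow> d * mnorm v b > 1 \<Longrightarrow>
      d * mnorm v b * vnorm v y < vnorm v (b *v y) \<Longrightarrow>
      d * mnorm v b * vnorm v q < vnorm v (adj2 b *v q) \<Longrightarrow>
      d * d * mnorm v (a ** b) \<le> v (trace (a ** b))"
proof -
  obtain t y q where tyq: "v t = mnorm v a" "vnorm v y = mnorm v a" "vnorm v q = mnorm v a"
    "\<And>b. v (t * trace (a ** b) - wedge q (b *v y)) \<le> mnorm v b"
    by (rule trace_rank_one_approx[OF a]) blast
  define A where "A = mnorm v a"
  have A: "A > 0" using mnorm_SL2_pos[OF a] by (simp add: A_def)
  have y: "y \<noteq> 0" and q: "q \<noteq> 0" using A tyq by (auto simp: A_def simp flip: vnorm_pos)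
  show ?thesis
  proof (rule that[OF y q])
    fix b d assume b: "b \<in> SL2" and d: "d > 0" "d * mnorm v a > 1" "d * mnorm v b > 1"
      and h: "d * mnorm v b * vnorm v y < vnorm v (b *v y)" "d * mnorm v b * vnorm v q < vnorm v (adj2 b *v q)"
    define B where "B = mnorm v b"
    have B: "B > 0" using mnorm_SL2_pos[OF b] by (simp add: B_def)
    have low: "d * d * B * A * A \<le> v (wedge q (b *v y))"
      using wedge_lower_bound[OF b y q d(1,3) h] tyq by (simp add: A_def B_def)
    have "1 < (d * A) * (d * A)" using d(2) by (simp add: A_def less_1_mult)
    then have "1 * B < (d * A) * (d * A) * B" using B by (intro mult_strict_right_mono) auto
    then have "B < d * d * B * A * A" by (simp add: mult_ac)
    then have "v (t * trace (a ** b) - wedge q (b *v y)) < v (wedge q (b *v y))"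
      using low tyq(4)[of b] by (simp add: B_def)
    from v_add_eq[OF this] have "v (t * trace (a ** b)) = v (wedge q (b *v y))" by simp
    then have "d * d * B * A * A \<le> A * v (trace (a ** b))" using low tyq(1) by (simp add: A_def)
    then have "A * (d * d * B * A) \<le> A * v (trace (a ** b))" by (simp add: mult_ac)
    then have "d * d * B * A \<le> v (trace (a ** b))" using A by (metis mult_le_cancel_left_pos)
    moreover have "d * d * mnorm v (a ** b) \<le> d * d * (A * B)"
      using mnorm_mult_le[of a b] d(1) by (intro mult_left_mono) (auto simp: A_def B_def)
    ultimately show "d * d * mnorm v (a ** b) \<le> v (trace (a ** b))" by (simp add: mult_ac)
  qed
qed

end

context nonelem_walk
begin

text \<open>Split the product as \<open>a b\<close> with independent factors. Four events of
  probability at most \<open>\<eta> / 4\<close> are discarded: \<open>a\<close> has small norm,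
  \<open>b\<close> has small norm, \<open>b\<close> contracts \<open>y\<close>, or the inverse of
  \<open>b\<close> contracts \<open>q\<close>.\<close>

lemma trace_comparable_norm:
  assumes "\<eta> > 0"
  shows "\<exists>d>0. d \<le> 1 \<and> (\<exists>n0. \<forall>n\<ge>n0. measure (conv_pow \<mu> n) {g. v (trace g) < d * mnorm v g} \<le> \<eta>)"
proof -
  interpret check: nonelem_walk v "check_mu \<mu>" by (rule nonelem_walk_check)
  have \<eta>4: "\<eta> / 4 > 0" using assms by simp
  obtain d1 n1 where d1: "d1 > 0" "\<And>n x. n \<ge> n1 \<Longrightarrow> x \<noteq> 0 \<Longrightarrow>
      measure (conv_pow \<mu> n) {g. vnorm v (g *v x) \<le> d1 * mnorm v g * vnorm v x} \<le> \<eta> / 4"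
    using contraction_nonconcentrated[OF \<eta>4] by auto
  obtain d2 n2 where d2: "d2 > 0" "\<And>n x. n \<ge> n2 \<Longrightarrow> x \<noteq> 0 \<Longrightarrow>
      measure (conv_pow (check_mu \<mu>) n) {g. vnorm v (g *v x) \<le> d2 * mnorm v g * vnorm v x} \<le> \<eta> / 4"
    using check.contraction_nonconcentrated[OF \<eta>4] by auto
  define d where "d = min 1 (min d1 d2)"
  have d: "d > 0" "d \<le> d1" "d \<le> d2" "d \<le> 1" using d1 d2 by (auto simp: d_def)
  obtain n3 where n3: "\<And>n. n \<ge> n3 \<Longrightarrow> measure (conv_pow \<mu> n) {g. mnorm v g \<le> 1 / d} \<le> \<eta> / 4"
    using norm_escape[OF \<eta>4, of "1 / d"] by auto
  define k0 where "k0 = max n1 (max n2 n3)"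
  have dm: "d * mnorm v g * vnorm v x \<le> d1 * mnorm v g * vnorm v x"
     "d * mnorm v g * vnorm v x \<le> d2 * mnorm v g * vnorm v x" for g x
    using d by (auto intro!: mult_right_mono)
  have inner: "measure (conv_pow \<mu> k) {b. v (trace (a ** b)) < d * d * mnorm v (a ** b)}
      \<le> 3 * (\<eta> / 4) + indicator {a. mnorm v a \<le> 1 / d} a" if k: "k \<ge> k0" and a: "a \<in> SL2" for k a
  proof (cases "mnorm v a \<le> 1 / d")
    case True
    have "measure (conv_pow \<mu> k) {b. v (trace (a ** b)) < d * d * mnorm v (a ** b)} \<le> 1" by simp
    then show ?thesis using True \<eta>4 by (simp add: add_increasing)
  next
    case False
    then have da: "d * mnorm v a > 1" using d by (simp add: not_le divide_less_eq mult.commute)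
    obtain y q where yq: "y \<noteq> 0" "q \<noteq> 0"
      "\<And>b d. b \<in> SL2 \<Longrightarrow> d > 0 \<Longrightarrow> d * mnorm v a > 1 \<Longrightarrow> d * mnorm v b > 1 \<Longrightarrow>
        d * mnorm v b * vnorm v y < vnorm v (b *v y) \<Longrightarrow>
        d * mnorm v b * vnorm v q < vnorm v (adj2 b *v q) \<Longrightarrow>
        d * d * mnorm v (a ** b) \<le> v (trace (a ** b))"
      by (rule trace_lower_bound[OF a]) blast
    let ?S1 = "{b. vnorm v (b *v y) \<le> d1 * mnorm v b * vnorm v y}"
    let ?S2 = "{b. vnorm v (adj2 b *v q) \<le> d2 * mnorm v (adj2 b) * vnorm v q}"
    let ?S3 = "{b. mnorm v b \<le> 1 / d}"
    let ?m = "measure (conv_pow \<mu> k)"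
    have "?m {b. v (trace (a ** b)) < d * d * mnorm v (a ** b)} \<le> ?m (?S1 \<union> ?S2 \<union> ?S3)"
    proof (intro measure_pmf.finite_measure_mono_AE)
      have "b \<in> ?S1 \<union> ?S2 \<union> ?S3" if "b \<in> SL2" "v (trace (a ** b)) < d * d * mnorm v (a ** b)" for b
      proof (rule ccontr)
        assume n: "b \<notin> ?S1 \<union> ?S2 \<union> ?S3"
        then have "d * mnorm v b > 1" using d by (simp add: not_le divide_less_eq mult.commute)
        moreover have "d * mnorm v b * vnorm v y < vnorm v (b *v y)"
          using n dm(1)[of b y] by (simp add: not_le)
        moreover have "d * mnorm v b * vnorm v q < vnorm v (adj2 b *v q)"
          using n dm(2)[of b q] by (simp add: not_le)
        ultimately show False using yq(3)[OF that(1) d(1) da] that(2) by simp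
      qed
      then show "AE b in conv_pow \<mu> k. b \<in> {b. v (trace (a ** b)) < d * d * mnorm v (a ** b)} \<longrightarrow> b \<in> ?S1 \<union> ?S2 \<union> ?S3"
        using conv_in_SL2 by (simp add: AE_measure_pmf_iff)
    qed auto
    also have "\<dots> \<le> ?m ?S1 + ?m ?S2 + ?m ?S3"
      by (rule order_trans[OF measure_Un_le]) (auto intro: measure_Un_le)
    \<comment> \<open>This event concerns the inverse of \<open>b\<close>, so it is estimated by
      non-concentration for the inverse walk.\<close>
    also have "?m ?S2 = measure (conv_pow (check_mu \<mu>) k) {g. vnorm v (g *v q) \<le> d2 * mnorm v g * vnorm v q}"
      by (simp add: conv_pow_check_mu[OF supp] vimage_def)
    also have "?m ?S1 + \<dots> + ?m ?S3 \<le> \<eta> / 4 + \<eta> / 4 + \<eta> / 4"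
      using d1(2)[OF _ yq(1)] d2(2)[OF _ yq(2)] n3 k by (intro add_mono) (auto simp: k0_def)
    finally show ?thesis using False by simp
  qed
  \<comment> \<open>The first factor always has \<open>n3\<close> steps, enough for its norm to be
    large; the second takes all remaining steps.\<close>
  have "measure (conv_pow \<mu> n) {g. v (trace g) < d * d * mnorm v g} \<le> \<eta>" if n: "n \<ge> n3 + k0" for n
  proof -
    have n': "n = n3 + (n - n3)" "n - n3 \<ge> k0" using n by auto
    have "measure (conv_pow \<mu> n) {g. v (trace g) < d * d * mnorm v g} =
      measure_pmf.expectation (conv_pow \<mu> n3) (\<lambda>a. measure (conv_pow \<mu> (n - n3)) {b. v (trace (a ** b)) < d * d * mnorm v (a ** b)})"
      by (subst n'(1)) (rule measure_conv_pow_add)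
    also have "\<dots> \<le> measure_pmf.expectation (conv_pow \<mu> n3) (\<lambda>a. 3 * (\<eta> / 4) + indicator {a. mnorm v a \<le> 1 / d} a)"
    proof (rule integral_mono_AE)
      show "AE a in conv_pow \<mu> n3. measure (conv_pow \<mu> (n - n3)) {b. v (trace (a ** b)) < d * d * mnorm v (a ** b)}
          \<le> 3 * (\<eta> / 4) + indicator {a. mnorm v a \<le> 1 / d} a"
        using inner[OF n'(2)] conv_in_SL2 by (simp add: AE_measure_pmf_iff)
    qed (auto intro!: measure_pmf.integrable_const_bound[where B=1] Bochner_Integration.integrable_add)
    also have "\<dots> = 3 * (\<eta> / 4) + measure (conv_pow \<mu> n3) {a. mnorm v a \<le> 1 / d}"
      by (subst Bochner_Integration.integral_add) auto
    also have "\<dots> \<le> \<eta>" using n3[of n3] by simp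
    finally show ?thesis .
  qed
  moreover have "d * d \<le> 1" using d by (simp add: mult_le_one)
  ultimately show ?thesis using d by (intro exI[of _ "d * d"]) auto
qed

lemma hyperbolic_prob:
  assumes "\<eta> > 0"
  shows "\<exists>n0. \<forall>n\<ge>n0. measure (conv_pow \<mu> n) {g. v (trace g) \<le> K} \<le> \<eta>"
proof -
  have \<eta>2: "\<eta> / 2 > 0" using assms by simp
  obtain d n0 where d: "d > 0" "\<And>n. n \<ge> n0 \<Longrightarrow> measure (conv_pow \<mu> n) {g. v (trace g) < d * mnorm v g} \<le> \<eta> / 2"
    using trace_comparable_norm[OF \<eta>2] by auto
  obtain n1 where n1: "\<And>n. n \<ge> n1 \<Longrightarrow> measure (conv_pow \<mu> n) {g. mnorm v g \<le> K / d} \<le> \<eta> / 2"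
    using norm_escape[OF \<eta>2, of "K / d"] by auto
  have "measure (conv_pow \<mu> n) {g. v (trace g) \<le> K} \<le> \<eta>" if "n \<ge> max n0 n1" for n
  proof -
    have "{g. v (trace g) \<le> K} \<subseteq> {g. v (trace g) < d * mnorm v g} \<union> {g. mnorm v g \<le> K / d}"
      using d(1) by (auto simp: not_less le_divide_eq mult.commute)
    then have "measure (conv_pow \<mu> n) {g. v (trace g) \<le> K} \<le>
       measure (conv_pow \<mu> n) ({g. v (trace g) < d * mnorm v g} \<union> {g. mnorm v g \<le> K / d})"
      by (intro measure_pmf.finite_measure_mono) auto
    also have "\<dots> \<le> measure (conv_pow \<mu> n) {g. v (trace g) < d * mnorm v g} + measure (conv_pow \<mu> n) {g. mnorm v g \<le> K / d}"
      by (rule measure_Un_le) auto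
    also have "\<dots> \<le> \<eta> / 2 + \<eta> / 2" using d n1 that by (intro add_mono) auto
    finally show ?thesis by simp
  qed
  then show ?thesis by blast
qed

end

section \<open>The limit point of the random walk\<close>

lemma rprod_comb_seq_le: "k \<le> n \<Longrightarrow> rprod (comb_seq n \<omega> \<omega>') k = rprod \<omega> k"
  by (induction k) (auto simp: comb_seq_less)

lemma rprod_comb_seq: "rprod (comb_seq n \<omega> \<omega>') (n + k) = rprod \<omega> n ** rprod \<omega>' k"
proof (induction k)
  case 0 then show ?case by (simp add: rprod_comb_seq_le)
next
  case (Suc k)
  have "comb_seq n \<omega> \<omega>' (n + k) = \<omega>' k" using comb_seq_add[of n \<omega> \<omega>' k] by (simp add: add.commute)
  then show ?case using Suc by (simp add: matrix_mul_assoc)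
qed

lemma rprod_case_nat: "rprod (case_nat g \<omega>) (Suc n) = g ** rprod \<omega> n"
  by (induction n) (auto simp: matrix_mul_assoc)

lemma nn_integral_pmf_swap:
  "(\<integral>\<^sup>+a. \<integral>\<^sup>+b. F a b \<partial>measure_pmf q \<partial>measure_pmf p) = (\<integral>\<^sup>+b. \<integral>\<^sup>+a. F a b \<partial>measure_pmf p \<partial>measure_pmf q)"
proof -
  have "(\<integral>\<^sup>+x. (\<lambda>(a, b). F a b) x \<partial>bind_pmf p (\<lambda>a. bind_pmf q (\<lambda>b. return_pmf (a, b)))) =
        (\<integral>\<^sup>+x. (\<lambda>(a, b). F a b) x \<partial>bind_pmf q (\<lambda>b. bind_pmf p (\<lambda>a. return_pmf (a, b))))"
    by (subst bind_commute_pmf) simp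
  then show ?thesis by simp
qed

section \<open>The space of trajectories and the law of the products\<close>

context
  fixes \<mu> :: "'k::field mat2 pmf"
begin

lemma sequence_space_supp: "sequence_space (restrict_space (measure_pmf \<mu>) (set_pmf \<mu>))"
proof -
  interpret p: prob_space "restrict_space (measure_pmf \<mu>) (set_pmf \<mu>)"
    by (intro prob_space_restrict_space measure_pmf.emeasure_eq_1_AE) (auto simp: AE_measure_pmf_iff)
  show ?thesis by unfold_locales
qed

lemma prob_space_Omega_P: "prob_space (Omega_P \<mu>)"
proof -
  interpret S: sequence_space "restrict_space (measure_pmf \<mu>) (set_pmf \<mu>)" by (rule sequence_space_supp)
  show ?thesis unfolding Omega_P_def by (rule S.P.prob_space_axioms)
qed

lemma nn_integral_Omega_P_component:
  fixes h :: "'k mat2 \<Rightarrow> ennreal"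
  shows "(\<integral>\<^sup>+\<omega>. h (\<omega> 0) \<partial>Omega_P \<mu>) = (\<integral>\<^sup>+g. h g \<partial>\<mu>)"
proof -
  let ?M = "restrict_space (measure_pmf \<mu>) (set_pmf \<mu>)"
  interpret S: sequence_space ?M by (rule sequence_space_supp)
  have hm: "h \<in> borel_measurable ?M" by (rule measurable_restrict_space1) simp
  have "(\<integral>\<^sup>+\<omega>. h (\<omega> 0) \<partial>Omega_P \<mu>) = (\<integral>\<^sup>+g. h g \<partial>distr (Omega_P \<mu>) ?M (\<lambda>\<omega>. \<omega> 0))"
    by (rule nn_integral_distr[symmetric]) (simp_all add: Omega_P_def hm)
  also have "distr (Omega_P \<mu>) ?M (\<lambda>\<omega>. \<omega> 0) = ?M"
    unfolding Omega_P_def by (rule S.PiM_component) simp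
  also have "(\<integral>\<^sup>+g. h g \<partial>?M) = (\<integral>\<^sup>+g. h g * indicator (set_pmf \<mu>) g \<partial>\<mu>)"
    by (rule nn_integral_restrict_space) simp
  also have "\<dots> = (\<integral>\<^sup>+g. h g \<partial>\<mu>)"
    by (rule nn_integral_cong_AE) (simp add: AE_measure_pmf_iff)
  finally show ?thesis .
qed

text \<open>Independent restart after \<open>n\<close> steps.\<close>

lemma nn_integral_Omega_P_comb_seq:
  assumes F: "F \<in> borel_measurable (Omega_P \<mu>)"
  shows "(\<integral>\<^sup>+\<omega>. F \<omega> \<partial>Omega_P \<mu>) = (\<integral>\<^sup>+\<omega>. \<integral>\<^sup>+\<omega>'. F (comb_seq n \<omega> \<omega>') \<partial>Omega_P \<mu> \<partial>Omega_P \<mu>)"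
proof -
  let ?P = "Omega_P \<mu>"
  interpret S: sequence_space "restrict_space (measure_pmf \<mu>) (set_pmf \<mu>)" by (rule sequence_space_supp)
  interpret Q: prob_space ?P by (rule prob_space_Omega_P)
  have m: "(\<lambda>(\<omega>, \<omega>'). comb_seq n \<omega> \<omega>') \<in> ?P \<Otimes>\<^sub>M ?P \<rightarrow>\<^sub>M ?P"
    unfolding Omega_P_def by (rule measurable_comb_seq)
  have "(\<integral>\<^sup>+\<omega>. F \<omega> \<partial>?P) = (\<integral>\<^sup>+\<omega>. F \<omega> \<partial>distr (?P \<Otimes>\<^sub>M ?P) ?P (\<lambda>(\<omega>, \<omega>'). comb_seq n \<omega> \<omega>'))"
    using S.PiM_comb_seq[of n] by (simp add: Omega_P_def)
  also have "\<dots> = (\<integral>\<^sup>+x. F (case x of (\<omega>, \<omega>') \<Rightarrow> comb_seq n \<omega> \<omega>') \<partial>(?P \<Otimes>\<^sub>M ?P))"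
    using F by (intro nn_integral_distr[OF m]) simp
  also have "\<dots> = (\<integral>\<^sup>+\<omega>. \<integral>\<^sup>+\<omega>'. F (comb_seq n \<omega> \<omega>') \<partial>?P \<partial>?P)"
    using Q.nn_integral_fst[OF measurable_compose[OF m F]] by simp
  finally show ?thesis .
qed

text \<open>Splits off the first increment; stationarity of the law of the limit point is checked in
  this form.\<close>

lemma nn_integral_Omega_P_case_nat:
  assumes F: "F \<in> borel_measurable (Omega_P \<mu>)"
  shows "(\<integral>\<^sup>+\<omega>. F \<omega> \<partial>Omega_P \<mu>) = (\<integral>\<^sup>+g. \<integral>\<^sup>+\<omega>. F (case_nat g \<omega>) \<partial>Omega_P \<mu> \<partial>\<mu>)"
proof -
  let ?P = "Omega_P \<mu>" and ?M = "restrict_space (measure_pmf \<mu>) (set_pmf \<mu>)"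
  interpret S: sequence_space ?M by (rule sequence_space_supp)
  interpret Q: prob_space ?P by (rule prob_space_Omega_P)
  have m: "(\<lambda>(s, \<omega>). case_nat s \<omega>) \<in> ?M \<Otimes>\<^sub>M ?P \<rightarrow>\<^sub>M ?P"
    unfolding Omega_P_def by measurable
  have "(\<integral>\<^sup>+\<omega>. F \<omega> \<partial>?P) = (\<integral>\<^sup>+\<omega>. F \<omega> \<partial>distr (?M \<Otimes>\<^sub>M ?P) ?P (\<lambda>(s, \<omega>). case_nat s \<omega>))"
    using S.PiM_iter by (simp add: Omega_P_def)
  also have "\<dots> = (\<integral>\<^sup>+x. F (case x of (s, \<omega>) \<Rightarrow> case_nat s \<omega>) \<partial>(?M \<Otimes>\<^sub>M ?P))"
    using F by (intro nn_integral_distr[OF m]) simp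
  also have "\<dots> = (\<integral>\<^sup>+g. \<integral>\<^sup>+\<omega>. F (case_nat g \<omega>) \<partial>?P \<partial>?M)"
    using Q.nn_integral_fst[OF measurable_compose[OF m F]] by simp
  also have "\<dots> = (\<integral>\<^sup>+g. (\<integral>\<^sup>+\<omega>. F (case_nat g \<omega>) \<partial>?P) * indicator (set_pmf \<mu>) g \<partial>\<mu>)"
    by (rule nn_integral_restrict_space) simp
  also have "\<dots> = (\<integral>\<^sup>+g. \<integral>\<^sup>+\<omega>. F (case_nat g \<omega>) \<partial>?P \<partial>\<mu>)"
    by (rule nn_integral_cong_AE) (simp add: AE_measure_pmf_iff)
  finally show ?thesis .
qed

lemma case_nat_measurable_Omega_P:
  "g \<in> set_pmf \<mu> \<Longrightarrow> (\<lambda>\<omega>. case_nat g \<omega>) \<in> Omega_P \<mu> \<rightarrow>\<^sub>M Omega_P \<mu>"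
  unfolding Omega_P_def
  by (rule measurable_case_nat'[OF measurable_const]) (auto simp: space_restrict_space)

text \<open>The target is the discrete space on a countable support. Afterwards arbitrary functions
  of \<open>rprod\<close> are measurable, whatever happens to the matrices outside it.\<close>

lemma rprod_measurable:
  "(\<lambda>\<omega>. rprod \<omega> n) \<in> Omega_P \<mu> \<rightarrow>\<^sub>M count_space (set_pmf (conv_pow \<mu> n))"
proof (induction n)
  case 0 then show ?case by simp
next
  case (Suc n)
  let ?P = "Omega_P \<mu>"
  have comp: "(\<lambda>\<omega>. \<omega> n) \<in> ?P \<rightarrow>\<^sub>M restrict_space (measure_pmf \<mu>) (set_pmf \<mu>)"
    unfolding Omega_P_def by (rule measurable_component_singleton) simp
  have comp': "(\<lambda>\<omega>. \<omega> n) \<in> ?P \<rightarrow>\<^sub>M count_space (set_pmf \<mu>)"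
    by (rule measurable_compose[OF comp]) (auto intro!: measurable_restrict_mono simp: measurable_def space_restrict_space sets_restrict_space)
  have "(\<lambda>\<omega>. (\<lambda>b. rprod \<omega> n ** b) (\<omega> n)) \<in> ?P \<rightarrow>\<^sub>M count_space (set_pmf (conv_pow \<mu> (Suc n)))"
  proof (rule measurable_compose_countable'[where f = "\<lambda>b \<omega>. rprod \<omega> n ** b", OF _ comp'])
    fix b assume "b \<in> set_pmf \<mu>"
    then show "(\<lambda>\<omega>. rprod \<omega> n ** b) \<in> ?P \<rightarrow>\<^sub>M count_space (set_pmf (conv_pow \<mu> (Suc n)))"
      by (intro measurable_compose[OF Suc]) (auto intro!: bexI[of _ b])
  qed simp
  then show ?case by simp
qed

lemma rprod_mem: "\<omega> \<in> space (Omega_P \<mu>) \<Longrightarrow> rprod \<omega> n \<in> set_pmf (conv_pow \<mu> n)"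
  using measurable_space[OF rprod_measurable, of \<omega> n] by simp

lemma rprod_measurable_fun:
  "(\<And>g. g \<in> set_pmf (conv_pow \<mu> n) \<Longrightarrow> F g \<in> space N) \<Longrightarrow> (\<lambda>\<omega>. F (rprod \<omega> n)) \<in> Omega_P \<mu> \<rightarrow>\<^sub>M N"
  by (rule measurable_compose[OF rprod_measurable]) auto

lemma rprod_measurable_fun2:
  fixes F :: "'k mat2 \<Rightarrow> 'k mat2 \<Rightarrow> 'b::topological_space"
  shows "(\<lambda>\<omega>. F (rprod \<omega> n) (rprod \<omega> m)) \<in> borel_measurable (Omega_P \<mu>)"
  by (rule measurable_compose_countable'[OF _ rprod_measurable]) (auto intro: rprod_measurable_fun)

lemma nn_integral_rprod:
  fixes F :: "'k mat2 \<Rightarrow> ennreal"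
  shows "(\<integral>\<^sup>+\<omega>. F (rprod \<omega> n) \<partial>Omega_P \<mu>) = (\<integral>\<^sup>+g. F g \<partial>conv_pow \<mu> n)"
proof (induction n arbitrary: F)
  case 0
  interpret Q: prob_space "Omega_P \<mu>" by (rule prob_space_Omega_P)
  show ?case by (simp add: Q.emeasure_space_1)
next
  case (Suc n)
  have "(\<integral>\<^sup>+\<omega>. F (rprod \<omega> (Suc n)) \<partial>Omega_P \<mu>) =
      (\<integral>\<^sup>+\<omega>. \<integral>\<^sup>+\<omega>'. F (rprod (comb_seq n \<omega> \<omega>') (n + Suc 0)) \<partial>Omega_P \<mu> \<partial>Omega_P \<mu>)"
    by (subst nn_integral_Omega_P_comb_seq[of _ n]) (auto intro: rprod_measurable_fun simp del: rprod.simps)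
  also have "\<dots> = (\<integral>\<^sup>+\<omega>. \<integral>\<^sup>+\<omega>'. F (rprod \<omega> n ** \<omega>' 0) \<partial>Omega_P \<mu> \<partial>Omega_P \<mu>)"
    unfolding rprod_comb_seq by simp
  also have "\<dots> = (\<integral>\<^sup>+\<omega>. (\<integral>\<^sup>+b. F (rprod \<omega> n ** b) \<partial>\<mu>) \<partial>Omega_P \<mu>)"
    by (intro nn_integral_cong nn_integral_Omega_P_component)
  also have "\<dots> = (\<integral>\<^sup>+a. (\<integral>\<^sup>+b. F (a ** b) \<partial>\<mu>) \<partial>conv_pow \<mu> n)"
    by (rule Suc)
  finally show ?case by simp
qed

text \<open>The later increment \<open>h\<close> is integrated on the outside, so that in the inner
  integral \<open>a\<close> acts on two fixed points, as the contraction estimate requires.\<close>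

lemma nn_integral_rprod2:
  fixes F :: "'k mat2 \<Rightarrow> 'k mat2 \<Rightarrow> ennreal"
  shows "(\<integral>\<^sup>+\<omega>. F (rprod \<omega> n) (rprod \<omega> (n + k)) \<partial>Omega_P \<mu>) =
     (\<integral>\<^sup>+h. \<integral>\<^sup>+a. F a (a ** h) \<partial>conv_pow \<mu> n \<partial>conv_pow \<mu> k)"
proof -
  have "(\<integral>\<^sup>+\<omega>. F (rprod \<omega> n) (rprod \<omega> (n + k)) \<partial>Omega_P \<mu>) =
     (\<integral>\<^sup>+\<omega>. \<integral>\<^sup>+\<omega>'. F (rprod (comb_seq n \<omega> \<omega>') n) (rprod (comb_seq n \<omega> \<omega>') (n + k)) \<partial>Omega_P \<mu> \<partial>Omega_P \<mu>)"
    by (subst nn_integral_Omega_P_comb_seq[of _ n]) (auto intro: rprod_measurable_fun2)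
  also have "\<dots> = (\<integral>\<^sup>+\<omega>. \<integral>\<^sup>+\<omega>'. F (rprod \<omega> n) (rprod \<omega> n ** rprod \<omega>' k) \<partial>Omega_P \<mu> \<partial>Omega_P \<mu>)"
    by (simp add: rprod_comb_seq rprod_comb_seq_le)
  also have "\<dots> = (\<integral>\<^sup>+\<omega>. (\<integral>\<^sup>+h. F (rprod \<omega> n) (rprod \<omega> n ** h) \<partial>conv_pow \<mu> k) \<partial>Omega_P \<mu>)"
    by (intro nn_integral_cong nn_integral_rprod)
  also have "\<dots> = (\<integral>\<^sup>+a. (\<integral>\<^sup>+h. F a (a ** h) \<partial>conv_pow \<mu> k) \<partial>conv_pow \<mu> n)"
    by (rule nn_integral_rprod)
  also have "\<dots> = (\<integral>\<^sup>+h. \<integral>\<^sup>+a. F a (a ** h) \<partial>conv_pow \<mu> n \<partial>conv_pow \<mu> k)"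
    by (rule nn_integral_pmf_swap)
  finally show ?thesis .
qed

lemma measure_rprod:
  "measure (Omega_P \<mu>) {\<omega> \<in> space (Omega_P \<mu>). Q (rprod \<omega> n)} = measure (conv_pow \<mu> n) {g. Q g}"
proof -
  interpret P: prob_space "Omega_P \<mu>" by (rule prob_space_Omega_P)
  have m: "{\<omega> \<in> space (Omega_P \<mu>). Q (rprod \<omega> n)} \<in> sets (Omega_P \<mu>)"
    using measurable_sets[OF rprod_measurable, of "{g \<in> set_pmf (conv_pow \<mu> n). Q g}" n]
    by (rule back_subst[of "\<lambda>A. A \<in> sets (Omega_P \<mu>)"]) (auto simp: rprod_mem)
  have "emeasure (Omega_P \<mu>) {\<omega> \<in> space (Omega_P \<mu>). Q (rprod \<omega> n)} = (\<integral>\<^sup>+\<omega>. indicator {\<omega> \<in> space (Omega_P \<mu>). Q (rprod \<omega> n)} \<omega> \<partial>Omega_P \<mu>)"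
    using m by simp
  also have "\<dots> = (\<integral>\<^sup>+\<omega>. indicator {g. Q g} (rprod \<omega> n) \<partial>Omega_P \<mu>)"
    by (rule nn_integral_cong) (auto simp: indicator_def)
  also have "\<dots> = emeasure (conv_pow \<mu> n) {g. Q g}" unfolding nn_integral_rprod by simp
  finally show ?thesis by (simp add: measure_def)
qed

end

section \<open>Completeness of the projective line and measurability of limits\<close>

context complete_nonarch_val
begin

lemma vd_vector_le: "vd v (vector [z, 1]) (vector [w, 1]) \<le> v (z - w)"
  "vd v (vector [1, z]) (vector [1, w]) \<le> v (z - w)"
proof -
  have 1: "1 \<le> max (v z) 1 * max (v w) 1" for z w by (simp add: mult_ge1_I)
  have 2: "1 \<le> max 1 (v z) * max 1 (v w)" for z w by (simp add: mult_ge1_I)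
  have "v (z - w) / (max (v z) 1 * max (v w) 1) \<le> v (z - w) / 1"
    using 1[of z w] by (intro divide_left_mono) auto
  then show "vd v (vector [z, 1]) (vector [w, 1]) \<le> v (z - w)"
    by (simp add: vd_def wedge_def vnorm_def)
  have "v (w - z) / (max 1 (v z) * max 1 (v w)) \<le> v (w - z) / 1"
    using 2[of z w] by (intro divide_left_mono) auto
  moreover have "v (w - z) = v (z - w)" by (metis minus_diff_eq v_minus)
  ultimately show "vd v (vector [1, z]) (vector [1, w]) \<le> v (z - w)"
    by (simp add: vd_def wedge_def vnorm_def)
qed

text \<open>\<open>P\<^sup>1(k)\<close> is the union of two unit discs at mutual distance 1.\<close>

lemma pd_convergent_if_steps_tendsto_0:
  assumes "(\<lambda>j. pd v (p (Suc j)) (p j)) \<longlonglongrightarrow> 0"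
  shows "\<exists>z. (\<lambda>j. pd v (p j) z) \<longlonglongrightarrow> 0"
proof -
  obtain N where N: "\<And>j. j \<ge> N \<Longrightarrow> pd v (p (Suc j)) (p j) < 1"
    using order_tendstoD(2)[OF assms, of 1] by (auto simp: eventually_sequentially)
  have close: "pd v (p (N + j)) (p N) < 1" for j
  proof (induction j)
    case 0
    have "pd v (p N) (p N) = 0" by (simp only: pd_eq_0)
    then show ?case by (simp del: pd_eq_0)
  next
    case (Suc j)
    then show ?case using N[of "N + j"] pd_triangle[of "p (Suc (N + j))" "p N" "p (N + j)"] by simp
  qed
  have steps: "(\<lambda>j. pd v (p (N + Suc j)) (p (N + j))) \<longlonglongrightarrow> 0"
    using LIMSEQ_ignore_initial_segment[OF assms, of N] by (simp add: add.commute)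
  \<comment> \<open>The closed unit disc; its complement is the open unit disc around infinity in
    the coordinate \<open>1 / z\<close>.\<close>
  define small where "small q \<longleftrightarrow> (\<exists>z. q = line_of (vector [z, 1]) \<and> v z \<le> 1)" for q :: "'k option"
  have big: "\<exists>t. q = line_of (vector [1, t]) \<and> v t < 1" if "\<not> small q" for q
  proof (cases q)
    case None
    then show ?thesis by (intro exI[of _ 0]) (simp add: line_of_def)
  next
    case (Some z)
    have "\<not> v z \<le> 1" using that Some unfolding small_def by (auto simp: line_of_def)
    then have "1 / v z < 1" "z \<noteq> 0" by (auto simp: divide_less_eq_1)
    then show ?thesis using Some by (intro exI[of _ "1 / z"]) (auto simp: line_of_def)
  qed
  have far: "pd v q q' = 1" if sm: "small q" and ns: "\<not> small q'" for q q'
  proof -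
    obtain z where z: "q = line_of (vector [z, 1])" "v z \<le> 1" using sm unfolding small_def by blast
    obtain t where t: "q' = line_of (vector [1, t])" "v t < 1" using big[OF ns] by blast
    have "v (z * t) < 1" using z t mult_right_mono[of "v z" 1 "v t"] by simp
    then have "v (1 + - (z * t)) = v 1" by (intro v_add_eq) simp
    then have "v (- (1 + - (z * t))) = 1" by (simp only: v_minus v_1)
    then have "v (z * t - 1) = 1" by (simp only: minus_add_distrib minus_minus) (simp add: algebra_simps)
    moreover have "(vector [z, 1] :: 'k^2) \<noteq> 0" "(vector [1, t] :: 'k^2) \<noteq> 0" by (auto simp: vec2_eq_iff)
    ultimately show ?thesis using z t by (simp add: pd_line_of vd_def wedge_def vnorm_def)
  qed
  have nz: "(vector [z, 1] :: 'k^2) \<noteq> 0" "(vector [1, z] :: 'k^2) \<noteq> 0" for z by (auto simp: vec2_eq_iff)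
  \<comment> \<open>From time \<open>N\<close> on the sequence stays in one of the two discs. There
    the chordal distance is the absolute value of the difference of coordinates, and completeness of
    \<open>k\<close> applies.\<close>
  have same: "small (p (N + j)) \<longleftrightarrow> small (p N)" for j
    using close[of j] far[of "p (N + j)" "p N"] far[of "p N" "p (N + j)"] by (auto simp: pd_commute)
  have "\<exists>z. (\<lambda>j. pd v (p (N + j)) z) \<longlonglongrightarrow> 0"
  proof (cases "small (p N)")
    case True
    then have "\<forall>j. \<exists>z. p (N + j) = line_of (vector [z, 1]) \<and> v z \<le> 1" using same by (auto simp: small_def)
    then obtain s where s: "\<And>j. p (N + j) = line_of (vector [s j, 1])" "\<And>j. v (s j) \<le> 1" by metis
    have "pd v (p (N + Suc j)) (p (N + j)) = v (s (Suc j) - s j)" for j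
      unfolding s(1) using s(2)[of j] s(2)[of "Suc j"] by (simp add: pd_line_of nz vd_def wedge_def vnorm_def)
    then obtain l where l: "(\<lambda>j. v (s j - l)) \<longlonglongrightarrow> 0" using steps convergent_if_steps_tendsto_0 by auto
    have "(\<lambda>j. pd v (p (N + j)) (line_of (vector [l, 1]))) \<longlonglongrightarrow> 0"
      by (rule tendsto_sandwich[OF _ _ tendsto_const l]) (auto simp: s(1) pd_line_of nz vd_vector_le)
    then show ?thesis by blast
  next
    case False
    then have "\<forall>j. \<exists>z. p (N + j) = line_of (vector [1, z]) \<and> v z < 1" using same big by blast
    then obtain s where s: "\<And>j. p (N + j) = line_of (vector [1, s j])" "\<And>j. v (s j) < 1" by metis
    have "v (s j - s (Suc j)) = v (s (Suc j) - s j)" for j by (metis minus_diff_eq v_minus)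
    then have "pd v (p (N + Suc j)) (p (N + j)) = v (s (Suc j) - s j)" for j
      unfolding s(1) using s(2)[of j] s(2)[of "Suc j"] by (simp add: pd_line_of nz vd_def wedge_def vnorm_def max_def)
    then obtain l where l: "(\<lambda>j. v (s j - l)) \<longlonglongrightarrow> 0" using steps convergent_if_steps_tendsto_0 by auto
    have "(\<lambda>j. pd v (p (N + j)) (line_of (vector [1, l]))) \<longlonglongrightarrow> 0"
      by (rule tendsto_sandwich[OF _ _ tendsto_const l]) (auto simp: s(1) pd_line_of nz vd_vector_le)
    then show ?thesis by blast
  qed
  then obtain z where "(\<lambda>j. pd v (p (j + N)) z) \<longlonglongrightarrow> 0" by (auto simp: add.commute)
  then have "(\<lambda>j. pd v (p j) z) \<longlonglongrightarrow> 0" by (rule LIMSEQ_offset[where k = N])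
  then show ?thesis ..
qed

text \<open>Open sets of the chordal distance. Measurability of a limit point is tested on these
  only, which suffices because Berkovich open sets pull back to such sets
  (\<open>pd_open_berk_emb\<close>).\<close>

definition pd_open :: "'k option set \<Rightarrow> bool" where
  "pd_open V \<longleftrightarrow> (\<forall>z\<in>V. \<exists>e>0. \<forall>w. pd v z w < e \<longrightarrow> w \<in> V)"

lemma pd_open_ball: "pd_open {z. pd v p z < c}"
  unfolding pd_open_def
proof (intro ballI)
  fix z assume z: "z \<in> {z. pd v p z < c}"
  have "pd v p w < c" if "pd v z w < c" for w using pd_triangle[of p w z] that z by simp
  moreover have "c > 0" using z le_less_trans[OF pd_nonneg] by blast
  ultimately show "\<exists>e>0. \<forall>w. pd v z w < e \<longrightarrow> w \<in> {z. pd v p z < c}" by auto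
qed

text \<open>The limit lies in \<open>V\<close> exactly if, for some radius, all late terms are
  centres of balls of that radius inside \<open>V\<close>. The sets of such centres are arbitrary,
  hence the hypothesis on all sets \<open>A\<close>; the ultrametric inequality allows the same
  radius on both sides.\<close>

lemma pd_limit_measurable:
  assumes X: "\<And>j A. {\<omega> \<in> space M. X j \<omega> \<in> A} \<in> sets M"
    and lim: "\<And>\<omega>. \<omega> \<in> space M \<Longrightarrow> (\<lambda>j. pd v (X j \<omega>) (Z \<omega>)) \<longlonglongrightarrow> 0"
    and V: "pd_open V"
  shows "{\<omega> \<in> space M. Z \<omega> \<in> V} \<in> sets M"
proof -
  define W where "W m = {z. \<forall>y. pd v z y < 1 / real (Suc m) \<longrightarrow> y \<in> V}" for m
  have "{\<omega> \<in> space M. Z \<omega> \<in> V} = (\<Union>m. \<Union>J. \<Inter>j\<in>{J..}. {\<omega> \<in> space M. X j \<omega> \<in> W m})"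
  proof (intro set_eqI iffI)
    fix \<omega> assume w: "\<omega> \<in> {\<omega> \<in> space M. Z \<omega> \<in> V}"
    then obtain e where e: "e > 0" "\<And>y. pd v (Z \<omega>) y < e \<Longrightarrow> y \<in> V" using V by (auto simp: pd_open_def)
    obtain m where m: "1 / real (Suc m) < e" using e(1) nat_approx_posE by metis
    have "\<forall>\<^sub>F j in sequentially. pd v (X j \<omega>) (Z \<omega>) < 1 / real (Suc m)"
      using w by (intro order_tendstoD(2)[OF lim]) auto
    then obtain J where J: "\<And>j. j \<ge> J \<Longrightarrow> pd v (X j \<omega>) (Z \<omega>) < 1 / real (Suc m)" by (auto simp: eventually_sequentially)
    have "X j \<omega> \<in> W m" if "j \<ge> J" for j
      unfolding W_def
    proof (intro CollectI allI impI)
      fix y assume "pd v (X j \<omega>) y < 1 / real (Suc m)"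
      then have "pd v (Z \<omega>) y < 1 / real (Suc m)"
        using J[OF that] pd_triangle[of "Z \<omega>" y "X j \<omega>"] by (simp add: pd_commute)
      then show "y \<in> V" using e m by simp
    qed
    then show "\<omega> \<in> (\<Union>m. \<Union>J. \<Inter>j\<in>{J..}. {\<omega> \<in> space M. X j \<omega> \<in> W m})" using w by auto
  next
    fix \<omega> assume "\<omega> \<in> (\<Union>m. \<Union>J. \<Inter>j\<in>{J..}. {\<omega> \<in> space M. X j \<omega> \<in> W m})"
    then obtain m J where h: "\<And>j. j \<ge> J \<Longrightarrow> \<omega> \<in> space M \<and> X j \<omega> \<in> W m" by auto
    then have sp: "\<omega> \<in> space M" by blast
    have "\<forall>\<^sub>F j in sequentially. pd v (X j \<omega>) (Z \<omega>) < 1 / real (Suc m)"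
      by (intro order_tendstoD(2)[OF lim[OF sp]]) auto
    then obtain J' where "\<And>j. j \<ge> J' \<Longrightarrow> pd v (X j \<omega>) (Z \<omega>) < 1 / real (Suc m)" by (auto simp: eventually_sequentially)
    then have "pd v (X (max J J') \<omega>) (Z \<omega>) < 1 / real (Suc m)" by simp
    then have "Z \<omega> \<in> V" using h[of "max J J'"] by (auto simp: W_def)
    then show "\<omega> \<in> {\<omega> \<in> space M. Z \<omega> \<in> V}" using sp by simp
  qed
  also have "\<dots> \<in> sets M" using X by (intro sets.countable_UN sets.countable_INT') auto
  finally show ?thesis .
qed

end

lemma (in nonarch_val) pd_triangle_ennreal:
  "ennreal (pd v p r) \<le> ennreal (pd v p q) + ennreal (pd v q r)"
proof -
  have "pd v p r \<le> pd v p q + pd v q r"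
    using pd_triangle[of p r q] pd_nonneg[of p q] pd_nonneg[of q r] by linarith
  then show ?thesis by (simp add: ennreal_leI flip: ennreal_plus)
qed

section \<open>The orbit of a point and its limit\<close>

context nonelem_walk
begin

text \<open>A matrix of determinant 1 preserves \<open>wedge x y\<close>, so the distance of the
  images shrinks as soon as one image vector is long and the other is not shortened.
  \<open>K\<close> is at least \<open>3 / \<eta>\<close> so that the generic part and the two
  exceptional sets cost \<open>\<eta> / 3\<close> each.\<close>

lemma contraction_mean:
  assumes "\<eta> > 0"
  shows "\<exists>n0. \<forall>n\<ge>n0. \<forall>x y. x \<noteq> 0 \<longrightarrow> y \<noteq> 0 \<longrightarrow>
    (\<integral>\<^sup>+a. ennreal (vd v (a *v x) (a *v y)) \<partial>conv_pow \<mu> n) \<le> ennreal \<eta>"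
proof -
  define K where "K = max 1 (3 / \<eta>)"
  have K: "K \<ge> 1" by (simp add: K_def)
  have "3 / \<eta> \<le> K" by (simp add: K_def)
  then have "3 \<le> K * \<eta>" using assms by (simp add: divide_le_eq)
  then have K2: "1 / K \<le> \<eta> / 3" using K by (simp add: divide_le_eq mult.commute)
  have e3: "\<eta> / 3 > 0" using assms by simp
  obtain n0 where n0: "\<And>n x. n \<ge> n0 \<Longrightarrow> x \<noteq> 0 \<Longrightarrow> measure (conv_pow \<mu> n) {g. vnorm v (g *v x) \<le> K * vnorm v x} \<le> \<eta> / 3"
    using vector_norm_escape[OF e3, of K] by auto
  have "(\<integral>\<^sup>+a. ennreal (vd v (a *v x) (a *v y)) \<partial>conv_pow \<mu> n) \<le> ennreal \<eta>"
    if n: "n \<ge> n0" and x: "x \<noteq> 0" and y: "y \<noteq> 0" for n x y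
  proof -
    let ?A = "\<lambda>x. {g. vnorm v (g *v x) \<le> K * vnorm v x}"
    have pt: "vd v (a *v x) (a *v y) \<le> \<eta> / 3 + indicator (?A x) a + indicator (?A y) a" if a: "a \<in> SL2" for a
    proof (cases "a \<in> ?A x \<or> a \<in> ?A y")
      case True
      have "vd v (a *v x) (a *v y) \<le> 1" by simp
      then show ?thesis using True e3 by (auto simp: indicator_def simp del: vd_le_1)
    next
      case False
      then have h: "K * vnorm v x < vnorm v (a *v x)" "K * vnorm v y < vnorm v (a *v y)" by auto
      have p: "vnorm v x > 0" "vnorm v y > 0" using x y by auto
      have hy: "vnorm v y \<le> vnorm v (a *v y)" using mult_right_mono[OF K, of "vnorm v y"] h(2) p by linarith
      have "vd v (a *v x) (a *v y) \<le> (vnorm v x * vnorm v y) / ((K * vnorm v x) * vnorm v y)"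
        unfolding vd_matvec[OF a] using v_wedge_le[of x y] h hy p K
        by (intro frac_le mult_mono) (auto intro: less_imp_le mult_pos_pos)
      also have "\<dots> = 1 / K" using p K by simp
      also have "\<dots> \<le> \<eta> / 3" by (rule K2)
      finally show ?thesis using False by simp
    qed
    have "(\<integral>\<^sup>+a. ennreal (vd v (a *v x) (a *v y)) \<partial>conv_pow \<mu> n) \<le>
       (\<integral>\<^sup>+a. ennreal (\<eta> / 3) + (indicator (?A x) a + indicator (?A y) a) \<partial>conv_pow \<mu> n)"
    proof (rule nn_integral_mono_AE)
      have "ennreal (vd v (a *v x) (a *v y)) \<le> ennreal (\<eta> / 3) + (indicator (?A x) a + indicator (?A y) a)"
        if "a \<in> SL2" for a
      proof -
        have "ennreal (vd v (a *v x) (a *v y)) \<le> ennreal (\<eta> / 3 + (indicator (?A x) a + indicator (?A y) a))"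
          using pt[OF that] by (intro ennreal_leI) simp
        also have "\<dots> = ennreal (\<eta> / 3) + (indicator (?A x) a + indicator (?A y) a)"
          using e3 by (simp add: ennreal_plus ennreal_indicator)
        finally show ?thesis .
      qed
      then show "AE a in conv_pow \<mu> n. ennreal (vd v (a *v x) (a *v y)) \<le> ennreal (\<eta> / 3) + (indicator (?A x) a + indicator (?A y) a)"
        using conv_in_SL2 by (auto simp: AE_measure_pmf_iff)
    qed
    also have "\<dots> = ennreal (\<eta> / 3) + (emeasure (conv_pow \<mu> n) (?A x) + emeasure (conv_pow \<mu> n) (?A y))"
      by (subst nn_integral_add, simp, simp, subst nn_integral_add) (simp_all add: measure_pmf.emeasure_space_1)
    also have "\<dots> \<le> ennreal (\<eta> / 3) + (ennreal (\<eta> / 3) + ennreal (\<eta> / 3))"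
      using n0[OF n x] n0[OF n y] by (intro add_mono) (auto simp: measure_pmf.emeasure_eq_measure intro!: ennreal_leI)
    also have "\<dots> = ennreal \<eta>" using e3 by (simp flip: ennreal_plus)
    finally show ?thesis .
  qed
  then show ?thesis by blast
qed

abbreviation orbit_pt :: "nat \<Rightarrow> (nat \<Rightarrow> 'k mat2) \<Rightarrow> 'k option" where
  "orbit_pt n \<omega> \<equiv> moebius (rprod \<omega> n) None"

text \<open>With \<open>h\<close> the product of the increments from \<open>n\<close> to
  \<open>m\<close>, both points are images under \<open>r_n\<close>, of infinity and of
  \<open>h\<close> applied to infinity. The contraction estimate is uniform over the latter.\<close>

lemma orbit_pt_cauchy:
  assumes "\<eta> > 0"
  shows "\<exists>n0. \<forall>n\<ge>n0. \<forall>m\<ge>n. (\<integral>\<^sup>+\<omega>. ennreal (pd v (orbit_pt n \<omega>) (orbit_pt m \<omega>)) \<partial>Omega_P \<mu>) \<le> ennreal \<eta>"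
proof -
  obtain n0 where n0: "\<And>n x y. n \<ge> n0 \<Longrightarrow> x \<noteq> 0 \<Longrightarrow> y \<noteq> 0 \<Longrightarrow>
    (\<integral>\<^sup>+a. ennreal (vd v (a *v x) (a *v y)) \<partial>conv_pow \<mu> n) \<le> ennreal \<eta>"
    using contraction_mean[OF assms] by auto
  have "(\<integral>\<^sup>+\<omega>. ennreal (pd v (orbit_pt n \<omega>) (orbit_pt (n + k) \<omega>)) \<partial>Omega_P \<mu>) \<le> ennreal \<eta>"
    if n: "n \<ge> n0" for n k
  proof -
    have "(\<integral>\<^sup>+\<omega>. ennreal (pd v (orbit_pt n \<omega>) (orbit_pt (n + k) \<omega>)) \<partial>Omega_P \<mu>) =
      (\<integral>\<^sup>+h. \<integral>\<^sup>+a. ennreal (pd v (moebius a None) (moebius (a ** h) None)) \<partial>conv_pow \<mu> n \<partial>conv_pow \<mu> k)"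
      by (rule nn_integral_rprod2)
    also have "\<dots> \<le> (\<integral>\<^sup>+h. ennreal \<eta> \<partial>conv_pow \<mu> k)"
    proof (rule nn_integral_mono_AE, simp only: AE_measure_pmf_iff, intro ballI)
      fix h assume "h \<in> set_pmf (conv_pow \<mu> k)"
      then have h: "h \<in> SL2" by (rule conv_in_SL2)
      have "(\<integral>\<^sup>+a. ennreal (pd v (moebius a None) (moebius (a ** h) None)) \<partial>conv_pow \<mu> n) =
        (\<integral>\<^sup>+a. ennreal (vd v (a *v pvec None) (a *v (h *v pvec None))) \<partial>conv_pow \<mu> n)"
        using h conv_in_SL2
        by (intro nn_integral_cong_AE)
           (auto simp: AE_measure_pmf_iff moebius_line_of pd_line_of matrix_vector_mul_assoc)
      also have "\<dots> \<le> ennreal \<eta>" using h by (intro n0[OF n]) auto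
      finally show "(\<integral>\<^sup>+a. ennreal (pd v (moebius a None) (moebius (a ** h) None)) \<partial>conv_pow \<mu> n) \<le> ennreal \<eta>" .
    qed
    also have "\<dots> = ennreal \<eta>" by (simp add: measure_pmf.emeasure_space_1)
    finally show ?thesis .
  qed
  note main = this
  show ?thesis
  proof (intro exI[of _ n0] allI impI)
    fix n m assume "n \<ge> n0" "m \<ge> n"
    then show "(\<integral>\<^sup>+\<omega>. ennreal (pd v (orbit_pt n \<omega>) (orbit_pt m \<omega>)) \<partial>Omega_P \<mu>) \<le> ennreal \<eta>"
      using main[of n "m - n"] by simp
  qed
qed

text \<open>Convergence in mean is all that laws require; almost sure convergence is extracted along
  subsequences when needed.\<close>

definition is_limit_pt :: "((nat \<Rightarrow> 'k mat2) \<Rightarrow> 'k option) \<Rightarrow> bool" where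
  "is_limit_pt Z \<longleftrightarrow> (\<forall>V. pd_open V \<longrightarrow> {\<omega> \<in> space (Omega_P \<mu>). Z \<omega> \<in> V} \<in> sets (Omega_P \<mu>)) \<and>
     (\<lambda>n. \<integral>\<^sup>+\<omega>. ennreal (pd v (orbit_pt n \<omega>) (Z \<omega>)) \<partial>Omega_P \<mu>) \<longlonglongrightarrow> 0"

lemma orbit_pt_sets: "{\<omega> \<in> space (Omega_P \<mu>). orbit_pt n \<omega> \<in> A} \<in> sets (Omega_P \<mu>)"
proof -
  have "{\<omega> \<in> space (Omega_P \<mu>). orbit_pt n \<omega> \<in> A} = (\<lambda>\<omega>. orbit_pt n \<omega>) -` A \<inter> space (Omega_P \<mu>)" by auto
  also have "\<dots> \<in> sets (Omega_P \<mu>)"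
    by (rule measurable_sets[OF rprod_measurable_fun[where N = "count_space UNIV"]]) auto
  finally show ?thesis .
qed

text \<open>Completeness of a space of random points: along a subsequence the mean steps are at most
  \<open>(1/2)^j\<close>, so the steps are almost surely summable, and the tail sum bounds the
  distance to the limit. The Cauchy property then covers all \<open>n\<close>.\<close>

lemma limit_pt_exists: "\<exists>Z. is_limit_pt Z"
proof -
  let ?P = "Omega_P \<mu>"
  interpret P: prob_space ?P by (rule prob_space_Omega_P)
  have "\<forall>j::nat. \<exists>n0. \<forall>n\<ge>n0. \<forall>m\<ge>n. (\<integral>\<^sup>+\<omega>. ennreal (pd v (orbit_pt n \<omega>) (orbit_pt m \<omega>)) \<partial>?P) \<le> ennreal ((1/2) ^ j)"
    by (intro allI orbit_pt_cauchy) simp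
  from choice[OF this] obtain b where b: "\<And>j n m. n \<ge> b j \<Longrightarrow> m \<ge> n \<Longrightarrow>
      (\<integral>\<^sup>+\<omega>. ennreal (pd v (orbit_pt n \<omega>) (orbit_pt m \<omega>)) \<partial>?P) \<le> ennreal ((1/2) ^ j)" by blast
  \<comment> \<open>Partial sums make the chosen times increasing while staying above
    \<open>b j\<close>.\<close>
  define nj where "nj j = (\<Sum>i\<le>j. b i)" for j
  have nj_b: "b j \<le> nj j" for j unfolding nj_def by (rule member_le_sum) auto
  have nj_Suc: "nj j \<le> nj (Suc j)" for j by (simp add: nj_def)
  define Y where "Y j \<omega> = orbit_pt (nj j) \<omega>" for j \<omega>
  define st where "st j \<omega> = pd v (Y j \<omega>) (Y (Suc j) \<omega>)" for j \<omega>
  have st_m: "st j \<in> borel_measurable ?P" for j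
    unfolding st_def Y_def by (rule rprod_measurable_fun2)
  have st_int: "(\<integral>\<^sup>+\<omega>. ennreal (st j \<omega>) \<partial>?P) \<le> ennreal ((1/2) ^ j)" for j
    unfolding st_def Y_def by (rule b[OF nj_b nj_Suc])
  define G where "G = {\<omega> \<in> space ?P. (\<Sum>j. ennreal (st j \<omega>)) \<noteq> \<infinity>}"
  have Gm: "G \<in> sets ?P" unfolding G_def using st_m by measurable
  have tail: "(\<integral>\<^sup>+\<omega>. (\<Sum>i. ennreal (st (i + j) \<omega>)) \<partial>?P) \<le> ennreal (2 * (1/2) ^ j)" for j
  proof -
    have "(\<integral>\<^sup>+\<omega>. (\<Sum>i. ennreal (st (i + j) \<omega>)) \<partial>?P) = (\<Sum>i. \<integral>\<^sup>+\<omega>. ennreal (st (i + j) \<omega>) \<partial>?P)"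
      using st_m by (intro nn_integral_suminf) auto
    also have "\<dots> \<le> (\<Sum>i. ennreal ((1/2) ^ (i + j)))" by (intro suminf_le st_int) auto
    also have "\<dots> = ennreal (\<Sum>i. (1/2) ^ (i + j))"
      by (intro suminf_ennreal2) (auto simp: power_add summable_mult2)
    also have "(\<Sum>i. (1/2 :: real) ^ (i + j)) = 2 * (1/2) ^ j"
      by (simp add: power_add suminf_mult2[symmetric] suminf_geometric)
    finally show ?thesis .
  qed
  have AEG: "AE \<omega> in ?P. \<omega> \<in> G"
  proof -
    have "AE \<omega> in ?P. (\<Sum>j. ennreal (st j \<omega>)) \<noteq> \<infinity>"
      using tail[of 0] st_m by (intro nn_integral_noteq_infinite) (auto simp: top_unique)
    then show ?thesis by (auto simp: G_def)
  qed
  have limG: "\<exists>z. (\<lambda>j. pd v (Y j \<omega>) z) \<longlonglongrightarrow> 0" if w: "\<omega> \<in> G" for \<omega>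
  proof (rule pd_convergent_if_steps_tendsto_0)
    have "summable (\<lambda>j. st j \<omega>)" using w by (intro summable_suminf_not_top) (auto simp: G_def st_def)
    then have "(\<lambda>j. st j \<omega>) \<longlonglongrightarrow> 0" by (rule summable_LIMSEQ_zero)
    then show "(\<lambda>j. pd v (Y (Suc j) \<omega>) (Y j \<omega>)) \<longlonglongrightarrow> 0" by (simp add: st_def pd_commute)
  qed
  define Z where "Z \<omega> = (if \<omega> \<in> G then SOME z. (\<lambda>j. pd v (Y j \<omega>) z) \<longlonglongrightarrow> 0 else None)" for \<omega>
  have ZG: "(\<lambda>j. pd v (Y j \<omega>) (Z \<omega>)) \<longlonglongrightarrow> 0" if "\<omega> \<in> G" for \<omega>
    using someI_ex[OF limG[OF that]] that by (simp add: Z_def)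
  have meas: "{\<omega> \<in> space ?P. Z \<omega> \<in> V} \<in> sets ?P" if "pd_open V" for V
  \<comment> \<open>Off the full-measure set \<open>G\<close> both the approximants and
    \<open>Z\<close> are set to infinity, so that convergence holds at every point.\<close>
  proof (rule pd_limit_measurable[OF _ _ that, where X = "\<lambda>j \<omega>. if \<omega> \<in> G then Y j \<omega> else None"])
    fix j A
    have "{\<omega> \<in> space ?P. (if \<omega> \<in> G then Y j \<omega> else None) \<in> A} =
       (G \<inter> {\<omega> \<in> space ?P. Y j \<omega> \<in> A}) \<union> (if None \<in> A then space ?P - G else {})"
      using sets.sets_into_space[OF Gm] by auto
    also have "\<dots> \<in> sets ?P" using Gm orbit_pt_sets[of "nj j" A] by (auto simp: Y_def)
    finally show "{\<omega> \<in> space ?P. (if \<omega> \<in> G then Y j \<omega> else None) \<in> A} \<in> sets ?P" .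
  next
    fix \<omega>
    show "(\<lambda>j. pd v (if \<omega> \<in> G then Y j \<omega> else None) (Z \<omega>)) \<longlonglongrightarrow> 0"
    proof (cases "\<omega> \<in> G")
      case False
      have "pd v None None = 0" by (simp only: pd_eq_0)
      then show ?thesis using False by (simp add: Z_def del: pd_eq_0)
    qed (simp add: ZG)
  qed
  have ZY: "ennreal (pd v (Y j \<omega>) (Z \<omega>)) \<le> (\<Sum>i. ennreal (st (i + j) \<omega>))" if w: "\<omega> \<in> G" for j \<omega>
  proof -
    have fin: "ennreal (pd v (Y j \<omega>) (Y (m + j) \<omega>)) \<le> (\<Sum>i<m. ennreal (st (i + j) \<omega>))" for m
    proof (induction m)
      case 0
      have "pd v (Y j \<omega>) (Y j \<omega>) = 0" by (simp only: pd_eq_0)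
      then show ?case by (simp del: pd_eq_0)
    next
      case (Suc m)
      have "ennreal (pd v (Y j \<omega>) (Y (Suc m + j) \<omega>)) \<le> ennreal (pd v (Y j \<omega>) (Y (m + j) \<omega>)) + ennreal (st (m + j) \<omega>)"
        using pd_triangle_ennreal[of "Y j \<omega>" "Y (Suc m + j) \<omega>" "Y (m + j) \<omega>"] by (simp add: st_def)
      also have "\<dots> \<le> (\<Sum>i<m. ennreal (st (i + j) \<omega>)) + ennreal (st (m + j) \<omega>)"
        using Suc by (intro add_mono) auto
      finally show ?case by (simp add: add.commute)
    qed
    have "ennreal (pd v (Y j \<omega>) (Z \<omega>)) \<le> (\<Sum>i. ennreal (st (i + j) \<omega>)) + ennreal (pd v (Y (m + j) \<omega>) (Z \<omega>))" for m
    proof -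
      have "ennreal (pd v (Y j \<omega>) (Z \<omega>)) \<le> ennreal (pd v (Y j \<omega>) (Y (m + j) \<omega>)) + ennreal (pd v (Y (m + j) \<omega>) (Z \<omega>))"
        by (rule pd_triangle_ennreal)
      also have "\<dots> \<le> (\<Sum>i. ennreal (st (i + j) \<omega>)) + ennreal (pd v (Y (m + j) \<omega>) (Z \<omega>))"
        using order_trans[OF fin[of m] sum_le_suminf[of "\<lambda>i. ennreal (st (i + j) \<omega>)" "{..<m}"]] by (intro add_mono) auto
      finally show ?thesis .
    qed
    moreover have "(\<lambda>m. (\<Sum>i. ennreal (st (i + j) \<omega>)) + ennreal (pd v (Y (m + j) \<omega>) (Z \<omega>))) \<longlonglongrightarrow> (\<Sum>i. ennreal (st (i + j) \<omega>)) + ennreal 0"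
      by (intro tendsto_add tendsto_const tendsto_ennrealI LIMSEQ_ignore_initial_segment ZG[OF w])
    ultimately show ?thesis using LIMSEQ_le_const by fastforce
  qed
  have ZYint: "(\<integral>\<^sup>+\<omega>. ennreal (pd v (Y j \<omega>) (Z \<omega>)) \<partial>?P) \<le> ennreal (2 * (1/2) ^ j)" for j
  proof -
    have "(\<integral>\<^sup>+\<omega>. ennreal (pd v (Y j \<omega>) (Z \<omega>)) \<partial>?P) \<le> (\<integral>\<^sup>+\<omega>. (\<Sum>i. ennreal (st (i + j) \<omega>)) \<partial>?P)"
      using AEG ZY by (intro nn_integral_mono_AE) auto
    also note tail
    finally show ?thesis .
  qed
  have Ym: "(\<lambda>\<omega>. pd v (orbit_pt n \<omega>) (Z \<omega>)) \<in> borel_measurable ?P" for n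
  proof (rule measurable_compose_countable'[where f = "\<lambda>g \<omega>. pd v (moebius g None) (Z \<omega>)", OF _ rprod_measurable])
    show "(\<lambda>\<omega>. pd v (moebius g None) (Z \<omega>)) \<in> borel_measurable ?P" for g
      unfolding borel_measurable_iff_less using meas[OF pd_open_ball] by simp
  qed simp
  have bound: "(\<integral>\<^sup>+\<omega>. ennreal (pd v (orbit_pt n \<omega>) (Z \<omega>)) \<partial>?P) \<le> ennreal (3 * (1/2) ^ j)" if n: "n \<ge> nj j" for n j
  proof -
    have "(\<integral>\<^sup>+\<omega>. ennreal (pd v (orbit_pt n \<omega>) (Z \<omega>)) \<partial>?P) \<le>
      (\<integral>\<^sup>+\<omega>. ennreal (pd v (orbit_pt (nj j) \<omega>) (orbit_pt n \<omega>)) + ennreal (pd v (orbit_pt (nj j) \<omega>) (Z \<omega>)) \<partial>?P)"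
    proof (rule nn_integral_mono)
      fix \<omega>
      show "ennreal (pd v (orbit_pt n \<omega>) (Z \<omega>)) \<le> ennreal (pd v (orbit_pt (nj j) \<omega>) (orbit_pt n \<omega>)) + ennreal (pd v (orbit_pt (nj j) \<omega>) (Z \<omega>))"
        using pd_triangle_ennreal[of "orbit_pt n \<omega>" "Z \<omega>" "orbit_pt (nj j) \<omega>"]
        unfolding pd_commute[of "orbit_pt n \<omega>" "orbit_pt (nj j) \<omega>"] .
    qed
    also have "\<dots> = (\<integral>\<^sup>+\<omega>. ennreal (pd v (orbit_pt (nj j) \<omega>) (orbit_pt n \<omega>)) \<partial>?P) + (\<integral>\<^sup>+\<omega>. ennreal (pd v (orbit_pt (nj j) \<omega>) (Z \<omega>)) \<partial>?P)"
    proof (rule nn_integral_add)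
      show "(\<lambda>\<omega>. ennreal (pd v (orbit_pt (nj j) \<omega>) (orbit_pt n \<omega>))) \<in> borel_measurable ?P"
        by (rule measurable_compose[OF rprod_measurable_fun2 measurable_ennreal])
      show "(\<lambda>\<omega>. ennreal (pd v (orbit_pt (nj j) \<omega>) (Z \<omega>))) \<in> borel_measurable ?P"
        by (rule measurable_compose[OF Ym measurable_ennreal])
    qed
    also have "\<dots> \<le> ennreal ((1/2) ^ j) + ennreal (2 * (1/2) ^ j)"
      using b[OF nj_b n] ZYint[of j] by (intro add_mono) (auto simp: Y_def)
    also have "\<dots> = ennreal (3 * (1/2) ^ j)" by (simp flip: ennreal_plus)
    finally show ?thesis .
  qed
  have "(\<lambda>n. \<integral>\<^sup>+\<omega>. ennreal (pd v (orbit_pt n \<omega>) (Z \<omega>)) \<partial>?P) \<longlonglongrightarrow> 0"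
  proof (rule order_tendstoI)
    fix a :: ennreal assume "a > 0"
    have "(\<lambda>j. ennreal (3 * (1/2) ^ j)) \<longlonglongrightarrow> ennreal (3 * 0)"
      by (intro tendsto_ennrealI tendsto_mult tendsto_const LIMSEQ_realpow_zero) auto
    then have "\<forall>\<^sub>F j in sequentially. ennreal (3 * (1/2) ^ j) < a" using \<open>a > 0\<close> by (intro order_tendstoD(2)) auto
    then obtain j where j: "ennreal (3 * (1/2) ^ j) < a" by (auto simp: eventually_sequentially)
    show "\<forall>\<^sub>F n in sequentially. (\<integral>\<^sup>+\<omega>. ennreal (pd v (orbit_pt n \<omega>) (Z \<omega>)) \<partial>?P) < a"
      using bound[of j] j by (intro eventually_sequentiallyI[of "nj j"]) (auto intro: le_less_trans)
  qed simp
  then show ?thesis using meas unfolding is_limit_pt_def by blast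
qed

lemma limit_pt_sets:
  assumes "is_limit_pt Z" "pd_open V" shows "{\<omega> \<in> space (Omega_P \<mu>). Z \<omega> \<in> V} \<in> sets (Omega_P \<mu>)"
  using assms by (auto simp: is_limit_pt_def)

lemma limit_pt_dist_measurable:
  assumes "is_limit_pt Z"
  shows "(\<lambda>\<omega>. pd v (orbit_pt n \<omega>) (Z \<omega>)) \<in> borel_measurable (Omega_P \<mu>)"
proof (rule measurable_compose_countable'[where f = "\<lambda>g \<omega>. pd v (moebius g None) (Z \<omega>)", OF _ rprod_measurable])
  show "(\<lambda>\<omega>. pd v (moebius g None) (Z \<omega>)) \<in> borel_measurable (Omega_P \<mu>)" for g
    unfolding borel_measurable_iff_less using limit_pt_sets[OF assms pd_open_ball] by simp
qed simp

text \<open>Prepending \<open>g\<close> multiplies every product by \<open>g\<close> on the left,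
  and \<open>g\<close> is Lipschitz for the chordal distance. The bound \<open>u n\<close> on the
  distance between the two sides tends to 0 in mean, hence almost surely along a
  subsequence.\<close>

lemma limit_pt_equivariant:
  assumes Z: "is_limit_pt Z" and g: "g \<in> set_pmf \<mu>"
  shows "AE \<omega> in Omega_P \<mu>. Z (case_nat g \<omega>) = moebius g (Z \<omega>)"
proof -
  let ?P = "Omega_P \<mu>"
  interpret P: prob_space ?P by (rule prob_space_Omega_P)
  have gS: "g \<in> SL2" using g supp by blast
  define B where "B = (mnorm v g)\<^sup>2"
  have B0: "B \<ge> 0" by (simp add: B_def)
  define A where "A n \<omega> = pd v (orbit_pt (Suc n) (case_nat g \<omega>)) (Z (case_nat g \<omega>))" for n \<omega>
  define u where "u n \<omega> = A n \<omega> + B * pd v (orbit_pt n \<omega>) (Z \<omega>)" for n \<omega>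
  have Am: "A n \<in> borel_measurable ?P" for n
    unfolding A_def by (rule measurable_compose[OF case_nat_measurable_Omega_P[OF g] limit_pt_dist_measurable[OF Z]])
  have um: "u n \<in> borel_measurable ?P" for n
    unfolding u_def using Am limit_pt_dist_measurable[OF Z] by measurable
  have u0: "0 \<le> u n \<omega>" for n \<omega> using B0 by (simp add: u_def A_def)
  have ub: "u n \<omega> \<le> 1 + B" for n \<omega>
    unfolding u_def A_def using B0 by (intro add_mono mult_left_le) auto
  \<comment> \<open>As \<open>g\<close> is an atom, the law of the sequences beginning with
    \<open>g\<close> is at most \<open>1 / pmf \<mu> g\<close> times the full law; mean convergence
    is therefore inherited.\<close>
  have Aint: "(\<integral>\<^sup>+\<omega>. ennreal (A n \<omega>) \<partial>?P) \<le> ennreal (1 / pmf \<mu> g) * (\<integral>\<^sup>+\<omega>. ennreal (pd v (orbit_pt (Suc n) \<omega>) (Z \<omega>)) \<partial>?P)" for n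
  proof -
    have pg: "pmf \<mu> g > 0" using g by (simp add: pmf_positive)
    let ?I = "\<lambda>h. \<integral>\<^sup>+\<omega>. ennreal (pd v (orbit_pt (Suc n) (case_nat h \<omega>)) (Z (case_nat h \<omega>))) \<partial>?P"
    have "?I g * ennreal (pmf \<mu> g) = (\<integral>\<^sup>+h. ?I h * indicator {g} h \<partial>\<mu>)"
      by (simp add: emeasure_pmf_single)
    also have "\<dots> \<le> (\<integral>\<^sup>+h. ?I h \<partial>\<mu>)"
      by (intro nn_integral_mono) (auto simp: indicator_def)
    also have "\<dots> = (\<integral>\<^sup>+\<omega>. ennreal (pd v (orbit_pt (Suc n) \<omega>) (Z \<omega>)) \<partial>?P)"
      by (rule nn_integral_Omega_P_case_nat[symmetric]) (rule measurable_compose[OF limit_pt_dist_measurable[OF Z] measurable_ennreal])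
    finally have "ennreal (1 / pmf \<mu> g) * (?I g * ennreal (pmf \<mu> g)) \<le> ennreal (1 / pmf \<mu> g) * (\<integral>\<^sup>+\<omega>. ennreal (pd v (orbit_pt (Suc n) \<omega>) (Z \<omega>)) \<partial>?P)"
      by (rule mult_left_mono) simp
    moreover have "ennreal (1 / pmf \<mu> g) * (?I g * ennreal (pmf \<mu> g)) = ?I g * ennreal (1 / pmf \<mu> g * pmf \<mu> g)"
      using pg by (subst ennreal_mult) (auto simp: mult_ac)
    ultimately show ?thesis using pg by (simp add: A_def)
  qed
  have int: "integrable ?P (u n)" for n
    using um u0 ub by (intro P.integrable_const_bound[where B = "1 + B"]) auto
  have lim0: "(\<lambda>n. \<integral>\<^sup>+\<omega>. ennreal (pd v (orbit_pt n \<omega>) (Z \<omega>)) \<partial>?P) \<longlonglongrightarrow> 0"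
    using Z by (simp add: is_limit_pt_def)
  have nn: "(\<integral>\<^sup>+\<omega>. ennreal (u n \<omega>) \<partial>?P) \<le> ennreal (1 / pmf \<mu> g) * (\<integral>\<^sup>+\<omega>. ennreal (pd v (orbit_pt (Suc n) \<omega>) (Z \<omega>)) \<partial>?P)
      + ennreal B * (\<integral>\<^sup>+\<omega>. ennreal (pd v (orbit_pt n \<omega>) (Z \<omega>)) \<partial>?P)" for n
  proof -
    have "(\<integral>\<^sup>+\<omega>. ennreal (u n \<omega>) \<partial>?P) = (\<integral>\<^sup>+\<omega>. ennreal (A n \<omega>) + ennreal B * ennreal (pd v (orbit_pt n \<omega>) (Z \<omega>)) \<partial>?P)"
      using B0 by (intro nn_integral_cong) (simp add: u_def A_def ennreal_plus ennreal_mult)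
    also have "\<dots> = (\<integral>\<^sup>+\<omega>. ennreal (A n \<omega>) \<partial>?P) + ennreal B * (\<integral>\<^sup>+\<omega>. ennreal (pd v (orbit_pt n \<omega>) (Z \<omega>)) \<partial>?P)"
      using Am limit_pt_dist_measurable[OF Z] by (subst nn_integral_add) (auto simp: nn_integral_cmult)
    also have "\<dots> \<le> ennreal (1 / pmf \<mu> g) * (\<integral>\<^sup>+\<omega>. ennreal (pd v (orbit_pt (Suc n) \<omega>) (Z \<omega>)) \<partial>?P)
      + ennreal B * (\<integral>\<^sup>+\<omega>. ennreal (pd v (orbit_pt n \<omega>) (Z \<omega>)) \<partial>?P)"
      using Aint by (intro add_mono) auto
    finally show ?thesis .
  qed
  have rhs: "(\<lambda>n. ennreal (1 / pmf \<mu> g) * (\<integral>\<^sup>+\<omega>. ennreal (pd v (orbit_pt (Suc n) \<omega>) (Z \<omega>)) \<partial>?P)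
      + ennreal B * (\<integral>\<^sup>+\<omega>. ennreal (pd v (orbit_pt n \<omega>) (Z \<omega>)) \<partial>?P)) \<longlonglongrightarrow> ennreal (1 / pmf \<mu> g) * 0 + ennreal B * 0"
    by (intro tendsto_add ennreal_tendsto_cmult lim0 LIMSEQ_Suc[OF lim0]) auto
  have "(\<lambda>n. \<integral>\<^sup>+\<omega>. ennreal (u n \<omega>) \<partial>?P) \<longlonglongrightarrow> 0"
    by (rule tendsto_sandwich[OF _ _ tendsto_const rhs[unfolded mult_zero_right add_0_right]])
       (rule always_eventually, simp only: zero_le simp_thms, rule always_eventually, rule allI, rule nn)
  then have "(\<lambda>n. enn2real (\<integral>\<^sup>+\<omega>. ennreal (u n \<omega>) \<partial>?P)) \<longlonglongrightarrow> enn2real 0"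
    by (intro tendsto_enn2real) auto
  moreover have "enn2real (\<integral>\<^sup>+\<omega>. ennreal (u n \<omega>) \<partial>?P) = (\<integral>\<omega>. norm (u n \<omega>) \<partial>?P)" for n
    using u0 um integral_eq_nn_integral[of "\<lambda>\<omega>. norm (u n \<omega>)" ?P] by simp
  ultimately have "(\<lambda>n. \<integral>\<omega>. norm (u n \<omega>) \<partial>?P) \<longlonglongrightarrow> 0" by simp
  from tendsto_L1_AE_subseq[OF int this] obtain r where r: "AE \<omega> in ?P. (\<lambda>n. u (r n) \<omega>) \<longlonglongrightarrow> 0" by blast
  show ?thesis
  proof (rule AE_mp[OF r], rule AE_I2, rule impI)
    fix \<omega> assume w: "\<omega> \<in> space ?P" and lim: "(\<lambda>n. u (r n) \<omega>) \<longlonglongrightarrow> 0"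
    have "pd v (Z (case_nat g \<omega>)) (moebius g (Z \<omega>)) \<le> u n \<omega>" for n
    proof -
      have rS: "rprod \<omega> n \<in> SL2" using rprod_mem[OF w] conv_in_SL2 by blast
      have eq: "orbit_pt (Suc n) (case_nat g \<omega>) = moebius g (orbit_pt n \<omega>)"
        unfolding rprod_case_nat using gS rS by (simp add: moebius_mult)
      have "pd v (Z (case_nat g \<omega>)) (moebius g (Z \<omega>)) \<le> max (A n \<omega>) (pd v (moebius g (orbit_pt n \<omega>)) (moebius g (Z \<omega>)))"
        unfolding A_def eq using pd_triangle[of "Z (case_nat g \<omega>)" "moebius g (Z \<omega>)" "moebius g (orbit_pt n \<omega>)"] by (simp add: pd_commute)
      also have "\<dots> \<le> max (A n \<omega>) (B * pd v (orbit_pt n \<omega>) (Z \<omega>))"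
        using pd_moebius_le[OF gS] by (intro max.mono) (auto simp: B_def)
      also have "\<dots> \<le> u n \<omega>" using B0 by (auto simp: u_def A_def)
      finally show ?thesis .
    qed
    then have "pd v (Z (case_nat g \<omega>)) (moebius g (Z \<omega>)) \<le> 0"
      using LIMSEQ_le_const[OF lim] by blast
    then have "pd v (Z (case_nat g \<omega>)) (moebius g (Z \<omega>)) = 0" using pd_nonneg by (meson order_antisym)
    then show "Z (case_nat g \<omega>) = moebius g (Z \<omega>)" by (simp only: pd_eq_0)
  qed
qed

end

section \<open>The action on the Berkovich projective line\<close>

abbreviation num_form :: "'k::field mat2 \<Rightarrow> 'k poly" where "num_form A \<equiv> [:A$1$2, A$1$1:]"
abbreviation den_form :: "'k::field mat2 \<Rightarrow> 'k poly" where "den_form A \<equiv> [:A$2$2, A$2$1:]"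

text \<open>\<open>hsub d A f\<close> is the substitution of \<open>A\<close> into \<open>f\<close> viewed as a binary form of degree \<open>d\<close>.\<close>

definition hsub :: "nat \<Rightarrow> 'k::field mat2 \<Rightarrow> 'k poly \<Rightarrow> 'k poly" where
  "hsub d A f = (\<Sum>i\<le>d. smult (coeff f i) (num_form A ^ i * den_form A ^ (d - i)))"

lemma moeb_subst_eq_hsub: "moeb_subst A f = hsub (degree f) A f"
  by (simp add: moeb_subst_def hsub_def)

lemma degree_linear_power_mult:
  "degree ([:b, a:] ^ i * [:d, c:] ^ j) \<le> i + j"
proof -
  have "degree ([:b, a:] ^ i * [:d, c:] ^ j) \<le> degree ([:b, a:] ^ i) + degree ([:d, c:] ^ j)"
    by (rule degree_mult_le)
  also have "degree ([:b, a:] ^ i) \<le> degree [:b, a:] * i" by (rule degree_power_le)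
  also have "degree ([:d, c:] ^ j) \<le> degree [:d, c:] * j" by (rule degree_power_le)
  finally have "degree ([:b, a:] ^ i * [:d, c:] ^ j) \<le> degree [:b, a:] * i + degree [:d, c:] * j" by simp
  also have "\<dots> \<le> 1 * i + 1 * j" by (intro add_mono mult_le_mono1) auto
  finally show ?thesis by simp
qed

lemma degree_hsub: "degree (hsub d A f) \<le> d"
  unfolding hsub_def
proof (rule degree_sum_le)
  fix i assume "i \<in> {..d}"
  then have "degree (num_form A ^ i * den_form A ^ (d - i)) \<le> d"
    using degree_linear_power_mult[of "A$1$2" "A$1$1" i "A$2$2" "A$2$1" "d - i"] by simp
  then show "degree (smult (coeff f i) (num_form A ^ i * den_form A ^ (d - i))) \<le> d"
    using degree_smult_le order_trans by blast
qed simp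

lemma hsub_raise_degree:
  assumes "degree f \<le> d"
  shows "hsub d A f = moeb_subst A f * den_form A ^ (d - degree f)"
proof -
  have "hsub d A f = (\<Sum>i\<le>degree f. smult (coeff f i) (num_form A ^ i * den_form A ^ (d - i)))"
    unfolding hsub_def using assms by (intro sum.mono_neutral_right) (auto simp: coeff_eq_0)
  also have "\<dots> = (\<Sum>i\<le>degree f. smult (coeff f i) (num_form A ^ i * den_form A ^ (degree f - i)) * den_form A ^ (d - degree f))"
  proof (rule sum.cong[OF refl])
    fix i assume "i \<in> {..degree f}"
    then have "d - i = (degree f - i) + (d - degree f)" using assms by auto
    then show "smult (coeff f i) (num_form A ^ i * den_form A ^ (d - i)) =
       smult (coeff f i) (num_form A ^ i * den_form A ^ (degree f - i)) * den_form A ^ (d - degree f)"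
      by (simp only: power_add mult_smult_left mult.assoc)
  qed
  finally show ?thesis by (simp only: moeb_subst_def sum_distrib_right)
qed

lemma poly_altdef_le:
  fixes f :: "'k::field poly"
  shows "degree f \<le> d \<Longrightarrow> poly f x = (\<Sum>i\<le>d. coeff f i * x ^ i)"
  unfolding poly_altdef by (intro sum.mono_neutral_left) (auto simp: coeff_eq_0)

lemma poly_hsub:
  assumes "poly (den_form A) t \<noteq> 0" "degree f \<le> d"
  shows "poly (hsub d A f) t = poly (den_form A) t ^ d * poly f (poly (num_form A) t / poly (den_form A) t)"
proof -
  let ?n = "poly (num_form A) t" and ?m = "poly (den_form A) t"
  have "poly (hsub d A f) t = (\<Sum>i\<le>d. coeff f i * (?n ^ i * ?m ^ (d - i)))"
    unfolding hsub_def by (simp only: poly_sum poly_smult poly_mult poly_power)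
  also have "\<dots> = (\<Sum>i\<le>d. ?m ^ d * (coeff f i * (?n / ?m) ^ i))"
  proof (rule sum.cong[OF refl])
    fix i assume "i \<in> {..d}"
    then have "?m ^ d = ?m ^ i * ?m ^ (d - i)" by (simp flip: power_add)
    then show "coeff f i * (?n ^ i * ?m ^ (d - i)) = ?m ^ d * (coeff f i * (?n / ?m) ^ i)"
      using assms(1) by (simp only: power_divide) (simp add: field_simps)
  qed
  also have "\<dots> = ?m ^ d * poly f (?n / ?m)"
    unfolding poly_altdef_le[OF assms(2)] by (simp only: sum_distrib_left)
  finally show ?thesis .
qed

lemma hsub_add: "hsub d A (f + g) = hsub d A f + hsub d A g"
  by (simp add: hsub_def smult_add_left sum.distrib)

lemma hsub_1_pCons: "hsub 1 A [:b, a:] = smult b (den_form A) + smult a (num_form A)"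
  by (simp add: hsub_def)

lemma coeff_mult_top:
  assumes "degree f \<le> n" "degree g \<le> m"
  shows "coeff (f * g) (n + m) = coeff f n * coeff g m"
proof -
  have "coeff (f * g) (n + m) = (\<Sum>i\<le>n + m. coeff f i * coeff g (n + m - i))" by (simp add: coeff_mult)
  also have "\<dots> = (\<Sum>i\<in>{n}. coeff f i * coeff g (n + m - i))"
  proof (rule sum.mono_neutral_right)
    show "\<forall>i\<in>{..n + m} - {n}. coeff f i * coeff g (n + m - i) = 0"
    proof
      fix i assume "i \<in> {..n + m} - {n}"
      then have "i > n \<or> n + m - i > m" by auto
      then show "coeff f i * coeff g (n + m - i) = 0" using assms by (auto simp: coeff_eq_0)
    qed
  qed auto
  finally show ?thesis by simp
qed

lemma coeff_linear_power_top: "coeff ([:b, a:] ^ n) n = a ^ n"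
proof (induction n)
  case (Suc n)
  have "degree ([:b, a:] ^ n) \<le> n" using degree_linear_power_mult[of b a n 0 0 0] by simp
  then have "coeff ([:b, a:] * [:b, a:] ^ n) (1 + n) = coeff [:b, a:] 1 * coeff ([:b, a:] ^ n) n"
    by (intro coeff_mult_top) auto
  then show ?case using Suc by simp
qed simp

text \<open>The coefficient in the formal degree is the value at infinity of a form, so the right
  side is the value of \<open>f\<close> at the image of infinity under \<open>A\<close>.\<close>

lemma coeff_hsub_top: "coeff (hsub d A f) d = (\<Sum>i\<le>d. coeff f i * (A$1$1 ^ i * A$2$1 ^ (d - i)))"
  unfolding hsub_def coeff_sum
proof (rule sum.cong[OF refl])
  fix i assume "i \<in> {..d}"
  then have d: "d = i + (d - i)" by simp
  have deg: "degree ([:b, a:] ^ n) \<le> n" for a b :: 'a and n using degree_linear_power_mult[of b a n 0 0 0] by simp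
  have "coeff (num_form A ^ i * den_form A ^ (d - i)) (i + (d - i)) = A$1$1 ^ i * A$2$1 ^ (d - i)"
    by (subst coeff_mult_top[OF deg deg]) (simp only: coeff_linear_power_top)
  then show "coeff (smult (coeff f i) (num_form A ^ i * den_form A ^ (d - i))) d = coeff f i * (A$1$1 ^ i * A$2$1 ^ (d - i))"
    using d by simp
qed

lemma den_form_nonzero: "A \<in> SL2 \<Longrightarrow> den_form A \<noteq> 0"
  by (auto simp: SL2_det det_2)

text \<open>The value at \<open>p\<close> of \<open>f\<close>, viewed as a binary form of degree \<open>d\<close>. A point only determines these
  values up to the \<open>d\<close>-th power of a positive scale; the convention chosen here is \<open>hs v p 1 1 = 1\<close> on the
  affine part.\<close>

definition hs :: "('k::field \<Rightarrow> real) \<Rightarrow> ('k poly \<Rightarrow> real) option \<Rightarrow> nat \<Rightarrow> 'k poly \<Rightarrow> real" where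
  "hs v p d f = (case p of None \<Rightarrow> v (coeff f d) | Some x \<Rightarrow> x f)"

text \<open>The larger of the values of the two homogeneous coordinates; it plays the part that
  \<open>vnorm\<close> plays for vectors.\<close>

definition hn :: "('k::field \<Rightarrow> real) \<Rightarrow> ('k poly \<Rightarrow> real) option \<Rightarrow> real" where
  "hn v p = max (hs v p 1 [:1:]) (hs v p 1 [:0, 1:])"

section \<open>Berkovich points as homogeneous seminorms and the action on them\<close>

context complete_nonarch_val
begin

text \<open>The powers of an element with absolute value above 1 are distinct. Polynomial identities
  can then be verified at points.\<close>

lemma infinite_field: "infinite (UNIV :: 'k set)"
proof
  assume fin: "finite (UNIV :: 'k set)"
  obtain y where y: "v y \<noteq> 0" "v y \<noteq> 1" using complete unfolding complete_nontrivial_nonarch_field_def by blast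
  obtain x where x: "v x > 1"
  proof (cases "v y > 1")
    case False
    then have "v (inverse y) > 1" using y by (simp add: one_less_inverse_iff)
    then show ?thesis using that by blast
  qed (use that in blast)
  have "finite (range (\<lambda>n::nat. x ^ n))" by (rule finite_subset[OF subset_UNIV fin])
  then have "\<not> inj (\<lambda>n::nat. x ^ n)" using finite_imageD[of "\<lambda>n. x ^ n" UNIV] by auto
  then obtain m n :: nat where mn: "m \<noteq> n" "x ^ m = x ^ n" by (auto simp: inj_on_def)
  then have "v x ^ m = v x ^ n" unfolding v_power[symmetric] by (simp only:)
  then show False using mn(1) power_inject_exp[OF x, of m n] by simp
qed

lemma poly_eq_if_agree:
  fixes f g L :: "'k poly"
  assumes "L \<noteq> 0" "\<And>t. poly L t \<noteq> 0 \<Longrightarrow> poly f t = poly g t"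
  shows "f = g"
proof (rule ccontr)
  assume "f \<noteq> g"
  then have "(f - g) * L \<noteq> 0" using assms(1) by simp
  then have "finite {t. poly ((f - g) * L) t = 0}" by (rule poly_roots_finite)
  moreover have "{t. poly ((f - g) * L) t = 0} = UNIV" using assms(2) by auto
  ultimately show False using infinite_field by (simp only:)
qed

lemma hsub_mult:
  fixes A :: "'k mat2"
  assumes A: "A \<in> SL2" and "degree f \<le> d" "degree g \<le> e"
  shows "hsub (d + e) A (f * g) = hsub d A f * hsub e A g"
proof (rule poly_eq_if_agree[OF den_form_nonzero[OF A]])
  fix t assume t: "poly (den_form A) t \<noteq> 0"
  have "degree (f * g) \<le> d + e" using assms degree_mult_le[of f g] by linarith
  then show "poly (hsub (d + e) A (f * g)) t = poly (hsub d A f * hsub e A g) t"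
    unfolding poly_mult poly_hsub[OF t assms(2)] poly_hsub[OF t assms(3)]
    by (subst poly_hsub[OF t]) (simp_all only: poly_mult power_add mult_ac)
qed

lemma hsub_hsub:
  fixes A :: "'k mat2"
  assumes A: "A \<in> SL2" and B: "B \<in> SL2" and f: "degree f \<le> d"
  shows "hsub d B (hsub d A f) = hsub d (A ** B) f"
proof (rule poly_eq_if_agree)
  show "den_form B * den_form (A ** B) \<noteq> 0" using den_form_nonzero assms by (metis SL2_mult mult_eq_0_iff)
  fix t assume "poly (den_form B * den_form (A ** B)) t \<noteq> 0"
  then have t: "poly (den_form B) t \<noteq> 0" "poly (den_form (A ** B)) t \<noteq> 0" unfolding poly_mult by auto
  define s where "s = poly (num_form B) t / poly (den_form B) t"
  have den: "poly (den_form (A ** B)) t = poly (den_form B) t * poly (den_form A) s"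
    and num: "poly (num_form (A ** B)) t = poly (den_form B) t * poly (num_form A) s"
    using t(1) unfolding s_def by (simp_all add: matmul2_nth field_simps)
  have s0: "poly (den_form A) s \<noteq> 0" using t den by auto
  have "poly (hsub d B (hsub d A f)) t = poly (den_form B) t ^ d * poly (hsub d A f) s"
    unfolding s_def by (rule poly_hsub[OF t(1) degree_hsub])
  also have "\<dots> = poly (den_form B) t ^ d * (poly (den_form A) s ^ d * poly f (poly (num_form A) s / poly (den_form A) s))"
    by (simp only: poly_hsub[OF s0 f])
  also have "\<dots> = poly (den_form (A ** B)) t ^ d * poly f (poly (num_form (A ** B)) t / poly (den_form (A ** B)) t)"
    unfolding den num using t(1) by (simp only: power_mult_distrib mult.assoc mult_divide_mult_cancel_left simp_thms)
  also have "\<dots> = poly (hsub d (A ** B) f) t" by (rule poly_hsub[OF t(2) f, symmetric])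
  finally show "poly (hsub d B (hsub d A f)) t = poly (hsub d (A ** B) f) t" .
qed

lemma berkA_D:
  assumes "x \<in> berkA v"
  shows berkA_nonneg: "0 \<le> x f" and berkA_mult: "x (f * g) = x f * x g"
    and berkA_add: "x (f + g) \<le> x f + x g" and berkA_const: "x [:c:] = v c"
  using assms by (auto simp: berkA_def)

lemma berkA_0: "x \<in> berkA v \<Longrightarrow> x 0 = 0" and berkA_1: "x \<in> berkA v \<Longrightarrow> x 1 = 1"
  using berkA_const[of x 0] berkA_const[of x 1] by (simp_all add: one_pCons)

lemma berkA_smult: "x \<in> berkA v \<Longrightarrow> x (smult c f) = v c * x f"
  using berkA_mult[of x "[:c:]" f] berkA_const[of x c] by simp

lemma berkA_minus: "x \<in> berkA v \<Longrightarrow> x (- f) = x f"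
  using berkA_smult[of x "-1" f] by simp

lemma berkA_power: "x \<in> berkA v \<Longrightarrow> x (f ^ n) = x f ^ n"
  by (induction n) (auto simp: berkA_1 berkA_mult)

lemma berkA_sum: "x \<in> berkA v \<Longrightarrow> x (\<Sum>i\<in>I. f i) \<le> (\<Sum>i\<in>I. x (f i))"
  by (induction I rule: infinite_finite_induct) (auto simp: berkA_0 intro: order_trans[OF berkA_add])

lemma berkA_diff_le: "x \<in> berkA v \<Longrightarrow> \<bar>x (f + g) - x f\<bar> \<le> x g"
  using berkA_add[of x f g] berkA_add[of x "f + g" "- g"] berkA_minus[of x g] by simp

lemma berkP1_cases:
  assumes "p \<in> berkP1 v"
  obtains "p = None" | x where "p = Some x" "x \<in> berkA v"
  using assms by (auto simp: berkP1_def)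

lemma berk_emb_mem: "berk_emb v z \<in> berkP1 v"
proof (cases z)
  case (Some a)
  have "(\<lambda>f. v (poly f a)) \<in> berkA v"
    unfolding berkA_def
  proof (intro CollectI conjI allI)
    fix f g :: "'k poly"
    have "v (poly f a + poly g a) \<le> max (v (poly f a)) (v (poly g a))" by (rule v_add_le)
    also have "\<dots> \<le> v (poly f a) + v (poly g a)" by simp
    finally show "v (poly (f + g) a) \<le> v (poly f a) + v (poly g a)" by simp
  qed auto
  then show ?thesis using Some by (simp add: berk_emb_def berkP1_def)
qed (simp add: berk_emb_def berkP1_def)

lemma hs_nonneg: "p \<in> berkP1 v \<Longrightarrow> 0 \<le> hs v p d f"
  by (erule berkP1_cases) (auto simp: hs_def berkA_nonneg)

lemma hs_smult: "p \<in> berkP1 v \<Longrightarrow> hs v p d (smult c f) = v c * hs v p d f"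
  by (erule berkP1_cases) (auto simp: hs_def berkA_smult)

lemma hs_add: "p \<in> berkP1 v \<Longrightarrow> hs v p d (f + g) \<le> hs v p d f + hs v p d g"
proof (erule berkP1_cases)
  assume "p = None"
  moreover have "v (coeff f d + coeff g d) \<le> v (coeff f d) + v (coeff g d)"
    by (rule order_trans[OF v_add_le]) simp
  ultimately show ?thesis by (simp add: hs_def)
qed (auto simp: hs_def berkA_add)

lemma hn_simps: "hn v None = 1" "x \<in> berkA v \<Longrightarrow> hn v (Some x) = max 1 (x [:0, 1:])"
  using berkA_const[of x 1] by (simp_all add: hn_def hs_def)

lemma hn_pos: "p \<in> berkP1 v \<Longrightarrow> 0 < hn v p"
  by (erule berkP1_cases) (auto simp: hn_simps)

lemma hs_linear_le:
  assumes "p \<in> berkP1 v" shows "hs v p 1 [:b, a:] \<le> (v a + v b) * hn v p"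
proof -
  have "[:b, a:] = smult b [:1:] + smult a [:0, 1:]" by simp
  then have "hs v p 1 [:b, a:] \<le> v b * hs v p 1 [:1:] + v a * hs v p 1 [:0, 1:]"
    using hs_add[OF assms, of 1 "smult b [:1:]" "smult a [:0, 1:]"] by (simp only: hs_smult[OF assms])
  also have "\<dots> \<le> v b * hn v p + v a * hn v p"
    by (intro add_mono mult_left_mono) (auto simp: hn_def)
  finally show ?thesis by (simp add: algebra_simps)
qed

text \<open>In homogeneous values the action is plain substitution up to a scale, which removes the
  case distinctions at infinity. The scale is the value at \<open>p\<close> of the denominator form,
  or of the numerator form where the denominator vanishes.\<close>

lemma berk_act_hs:
  assumes p: "p \<in> berkP1 v" and A: "A \<in> SL2"
  shows "\<exists>\<kappa>>0. \<forall>d f. degree f \<le> d \<longrightarrow> hs v (berk_act v A p) d f = hs v p d (hsub d A f) / \<kappa> ^ d"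
  using p
proof (cases rule: berkP1_cases)
  case 1
  show ?thesis
  proof (cases "A$2$1 = 0")
    case True
    then have a: "A$1$1 \<noteq> 0" using A by (auto simp: SL2_det det_2)
    have "hs v (berk_act v A p) d f = hs v p d (hsub d A f) / v (A$1$1) ^ d" if "degree f \<le> d" for d f
    proof -
      have "coeff (hsub d A f) d = (\<Sum>i\<in>{d}. coeff f i * (A$1$1 ^ i * A$2$1 ^ (d - i)))"
        unfolding coeff_hsub_top using True by (intro sum.mono_neutral_right) (auto simp: power_0_left)
      then show ?thesis using 1 True a by (simp add: hs_def berk_act_def moebius_def berk_emb_def)
    qed
    then show ?thesis using a by (intro exI[of _ "v (A$1$1)"]) auto
  next
    case False
    have "hs v (berk_act v A p) d f = hs v p d (hsub d A f) / v (A$2$1) ^ d" if f: "degree f \<le> d" for d f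
    proof -
      have "coeff (hsub d A f) d = (\<Sum>i\<le>d. A$2$1 ^ d * (coeff f i * (A$1$1 / A$2$1) ^ i))"
        unfolding coeff_hsub_top
      proof (rule sum.cong[OF refl])
        fix i assume "i \<in> {..d}"
        then have "A$2$1 ^ d = A$2$1 ^ i * A$2$1 ^ (d - i)" by (simp flip: power_add)
        then show "coeff f i * (A$1$1 ^ i * A$2$1 ^ (d - i)) = A$2$1 ^ d * (coeff f i * (A$1$1 / A$2$1) ^ i)"
          using False by (simp add: power_divide)
      qed
      also have "\<dots> = A$2$1 ^ d * poly f (A$1$1 / A$2$1)"
        unfolding poly_altdef_le[OF f] by (simp only: sum_distrib_left)
      finally show ?thesis using 1 False by (simp add: hs_def berk_act_def moebius_def berk_emb_def)
    qed
    then show ?thesis using False by (intro exI[of _ "v (A$2$1)"]) auto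
  qed
next
  case (2 x)
  note x = 2(2)
  show ?thesis
  proof (cases "x (den_form A) = 0")
    case False
    have "hs v (berk_act v A p) d f = hs v p d (hsub d A f) / x (den_form A) ^ d" if f: "degree f \<le> d" for d f
    proof -
      have "x (den_form A) ^ d = x (den_form A) ^ degree f * x (den_form A) ^ (d - degree f)"
        using f by (simp flip: power_add)
      then show ?thesis using 2 False unfolding hsub_raise_degree[OF f]
        by (simp add: hs_def berk_act_def berkA_mult[OF x] berkA_power[OF x])
    qed
    moreover have "x (den_form A) > 0" using False berkA_nonneg[OF x, of "den_form A"] by simp
    ultimately show ?thesis by blast
  next
    case True
    \<comment> \<open>Since \<open>det A = 1\<close> the two forms generate the constant 1 and
      cannot both have value 0 at \<open>x\<close>. With the denominator of value 0, only the term
      \<open>i = d\<close> of the substitution survives.\<close>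
    have "smult (A$1$1) (den_form A) + smult (- A$2$1) (num_form A) = [:1:]"
      using A by (simp add: SL2_det det_2 algebra_simps)
    then have "1 \<le> v (A$1$1) * x (den_form A) + v (A$2$1) * x (num_form A)"
      using berkA_add[OF x, of "smult (A$1$1) (den_form A)" "smult (- A$2$1) (num_form A)"] berkA_const[OF x, of 1]
      by (simp only: berkA_smult[OF x] v_minus v_1)
    then have "x (num_form A) \<noteq> 0" using True by auto
    then have pos: "x (num_form A) > 0" using berkA_nonneg[OF x, of "num_form A"] by simp
    have "hs v (berk_act v A p) d f = hs v p d (hsub d A f) / x (num_form A) ^ d" if f: "degree f \<le> d" for d f
    proof -
      let ?t = "\<lambda>i. smult (coeff f i) (num_form A ^ i * den_form A ^ (d - i))"
      have sp: "hsub d A f = ?t d + (\<Sum>i<d. ?t i)"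
        unfolding hsub_def by (simp add: lessThan_Suc_atMost[symmetric] add.commute)
      have "x (?t i) = 0" if "i < d" for i
        using that True by (simp only: berkA_smult[OF x] berkA_mult[OF x] berkA_power[OF x]) (simp add: power_0_left)
      then have "x (\<Sum>i<d. ?t i) \<le> 0" using berkA_sum[OF x, of ?t "{..<d}"] by simp
      then have "x (\<Sum>i<d. ?t i) = 0" using berkA_nonneg[OF x] by (meson order_antisym)
      then have "x (hsub d A f) = x (?t d)"
        using berkA_diff_le[OF x, of "?t d" "\<Sum>i<d. ?t i"] unfolding sp by simp
      also have "\<dots> = v (coeff f d) * x (num_form A) ^ d"
        by (simp add: berkA_smult[OF x] berkA_power[OF x])
      finally show ?thesis using 2 True pos by (simp add: hs_def berk_act_def)
    qed
    then show ?thesis using pos by blast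
  qed
qed

text \<open>Homogeneous values determine the point even when known only up to a scale: the degree
  one form \<open>1\<close> vanishes exactly at infinity, and at an affine point its value 1 fixes
  the scale.\<close>

lemma berkP1_eqI:
  assumes p: "p \<in> berkP1 v" and q: "q \<in> berkP1 v" and "\<kappa> > 0"
    and eq: "\<And>d f. degree f \<le> d \<Longrightarrow> hs v p d f = hs v q d f / \<kappa> ^ d"
  shows "p = q"
proof -
  have e1: "hs v p 1 [:1:] = hs v q 1 [:1:] / \<kappa>" using eq[of "[:1:]" 1] by simp
  show ?thesis using p
  proof (cases rule: berkP1_cases)
    case 1
    then have h: "hs v q 1 [:1:] = 0" using e1 assms(3) by (simp add: hs_def)
    from q show ?thesis by (cases rule: berkP1_cases) (use 1 h in \<open>auto simp: hs_def berkA_const\<close>)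
  next
    case (2 x)
    then have h: "hs v q 1 [:1:] = \<kappa>" using e1 assms(3) by (simp add: hs_def berkA_const field_simps)
    from q obtain y where y: "q = Some y" "y \<in> berkA v"
      by (cases rule: berkP1_cases) (use assms(3) h in \<open>auto simp: hs_def\<close>)
    then have "\<kappa> = 1" using h by (simp add: hs_def berkA_const)
    then have "x f = y f" for f using eq[of f "degree f"] 2 y by (simp add: hs_def)
    then show ?thesis using 2 y by auto
  qed
qed

lemma berk_act_mem:
  assumes p: "p \<in> berkP1 v" and A: "A \<in> SL2" shows "berk_act v A p \<in> berkP1 v"
  using p
proof (cases rule: berkP1_cases)
  case 1 then show ?thesis by (simp add: berk_act_def berk_emb_mem)
next
  case (2 x)
  note x = 2(2)
  show ?thesis
  proof (cases "x (den_form A) = 0")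
    case True then show ?thesis using 2 by (simp add: berk_act_def berkP1_def)
  next
    case False
    define L where "L = x (den_form A)"
    have L: "L > 0" using False berkA_nonneg[OF x, of "den_form A"] by (simp add: L_def)
    define y where "y f = x (moeb_subst A f) / L ^ degree f" for f
    have y: "y f = x (hsub d A f) / L ^ d" if f: "degree f \<le> d" for d f
    proof -
      have "L ^ d = L ^ degree f * L ^ (d - degree f)" using f by (simp flip: power_add)
      then show ?thesis unfolding hsub_raise_degree[OF f] y_def using L
        by (simp add: berkA_mult[OF x] berkA_power[OF x] L_def)
    qed
    have "y \<in> berkA v" unfolding berkA_def
    proof (intro CollectI conjI allI)
      fix f g :: "'k poly" and c
      show "0 \<le> y f" using L berkA_nonneg[OF x] by (simp add: y_def)
      show "y (f * g) = y f * y g"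
        using y[OF degree_mult_le[of f g]] hsub_mult[OF A order_refl order_refl, of f g] y[of f "degree f"] y[of g "degree g"]
        by (simp add: berkA_mult[OF x] power_add)
      show "y [:c:] = v c" by (simp add: y_def moeb_subst_def berkA_const[OF x])
      \<comment> \<open>A common formal degree puts both values over the same denominator.\<close>
      let ?d = "max (degree f) (degree g)"
      have "y (f + g) = x (hsub ?d A f + hsub ?d A g) / L ^ ?d"
        using y[OF degree_add_le_max[of f g]] by (simp add: hsub_add)
      also have "\<dots> \<le> (x (hsub ?d A f) + x (hsub ?d A g)) / L ^ ?d"
        using L berkA_add[OF x] by (intro divide_right_mono) auto
      also have "\<dots> = y f + y g" using y[of f ?d] y[of g ?d] by (simp add: add_divide_distrib)
      finally show "y (f + g) \<le> y f + y g" .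
    qed
    moreover have "berk_act v A p = Some y" using 2 False by (simp add: berk_act_def y_def[abs_def] L_def)
    ultimately show ?thesis by (simp add: berkP1_def)
  qed
qed

text \<open>Substitutions compose by \<open>hsub_hsub\<close> and the three scales combine into one,
  which \<open>berkP1_eqI\<close> absorbs.\<close>

lemma berk_act_mult:
  assumes p: "p \<in> berkP1 v" and A: "A \<in> SL2" and B: "B \<in> SL2"
  shows "berk_act v (A ** B) p = berk_act v A (berk_act v B p)"
proof -
  have Bp: "berk_act v B p \<in> berkP1 v" by (rule berk_act_mem[OF p B])
  obtain k1 where k1: "k1 > 0" "\<And>d f. degree f \<le> d \<Longrightarrow> hs v (berk_act v (A ** B) p) d f = hs v p d (hsub d (A ** B) f) / k1 ^ d"
    using berk_act_hs[OF p SL2_mult[OF A B]] by blast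
  obtain k2 where k2: "k2 > 0" "\<And>d f. degree f \<le> d \<Longrightarrow> hs v (berk_act v B p) d f = hs v p d (hsub d B f) / k2 ^ d"
    using berk_act_hs[OF p B] by blast
  obtain k3 where k3: "k3 > 0" "\<And>d f. degree f \<le> d \<Longrightarrow> hs v (berk_act v A (berk_act v B p)) d f = hs v (berk_act v B p) d (hsub d A f) / k3 ^ d"
    using berk_act_hs[OF Bp A] by blast
  show ?thesis
  proof (rule berkP1_eqI[where \<kappa> = "k1 / (k2 * k3)"])
    fix d and f :: "'k poly" assume f: "degree f \<le> d"
    have "hs v (berk_act v A (berk_act v B p)) d f = hs v p d (hsub d (A ** B) f) / k2 ^ d / k3 ^ d"
      using k3(2)[OF f] k2(2)[OF degree_hsub] hsub_hsub[OF A B f] by simp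
    then show "hs v (berk_act v (A ** B) p) d f = hs v (berk_act v A (berk_act v B p)) d f / (k1 / (k2 * k3)) ^ d"
      using k1 k2(1) k3(1) f by (simp add: power_divide power_mult_distrib)
  qed (use k1 k2 k3 berk_act_mem p A B Bp in auto)
qed

lemma berk_act_emb:
  assumes A: "A \<in> SL2" shows "berk_act v A (berk_emb v z) = berk_emb v (moebius A z)"
proof (cases z)
  case None then show ?thesis by (simp add: berk_act_def berk_emb_def)
next
  case (Some a)
  have den: "poly (den_form A) a = A$2$1 * a + A$2$2" and num: "poly (num_form A) a = A$1$1 * a + A$1$2"
    by (simp_all add: algebra_simps)
  show ?thesis
  proof (cases "A$2$1 * a + A$2$2 = 0")
    case True then show ?thesis using Some den by (simp add: berk_act_def berk_emb_def moebius_def)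
  next
    case False
    then have d0: "poly (den_form A) a \<noteq> 0" unfolding den .
    have "v (poly (moeb_subst A f) a) / v (poly (den_form A) a) ^ degree f =
        v (poly f ((A$1$1 * a + A$1$2) / (A$2$1 * a + A$2$2)))" for f
      unfolding moeb_subst_eq_hsub poly_hsub[OF d0 order_refl] using d0 unfolding den num by simp
    then show ?thesis using Some False d0 unfolding berk_act_def berk_emb_def moebius_def
      by (simp del: poly_pCons)
  qed
qed

end

lemma continuous_map_realI:
  assumes "\<And>a. openin X {p \<in> topspace X. a < f p}" "\<And>a. openin X {p \<in> topspace X. f p < a}"
  shows "continuous_map X euclideanreal f"
  using assms continuous_map_upper_lower_semicontinuous_lt by blast

lemma openin_real_less:
  assumes "continuous_map X euclideanreal f" "continuous_map X euclideanreal g"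
  shows "openin X {p \<in> topspace X. f p < g p}"
proof -
  have "openin X {p \<in> topspace X. g p - f p \<in> {0<..}}"
    using assms by (intro openin_continuous_map_preimage[where Y = euclideanreal] continuous_intros) auto
  then show ?thesis by simp
qed

lemma space_borel_of_top [simp]: "space (borel_of_top T) = topspace T"
  unfolding borel_of_top_def by (rule space_measure_of) (auto dest: openin_subset)

lemma sets_borel_of_top: "sets (borel_of_top T) = sigma_sets (topspace T) {U. openin T U}"
  unfolding borel_of_top_def by (rule sets_measure_of) (auto dest: openin_subset)

lemma measurable_borel_of_topI:
  assumes "\<And>x. x \<in> space M \<Longrightarrow> f x \<in> topspace T"
    and "\<And>U. openin T U \<Longrightarrow> {x \<in> space M. f x \<in> U} \<in> sets M"
  shows "f \<in> M \<rightarrow>\<^sub>M borel_of_top T"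
  unfolding borel_of_top_def
proof (rule measurable_measure_of)
  show "{U. openin T U} \<subseteq> Pow (topspace T)" by (auto dest: openin_subset)
  show "f \<in> space M \<rightarrow> topspace T" using assms(1) by auto
  fix U assume "U \<in> {U. openin T U}"
  then have "{x \<in> space M. f x \<in> U} \<in> sets M" using assms(2) by simp
  moreover have "f -` U \<inter> space M = {x \<in> space M. f x \<in> U}" by auto
  ultimately show "f -` U \<inter> space M \<in> sets M" by simp
qed

lemma continuous_map_measurable:
  assumes "continuous_map T T' f" shows "f \<in> borel_of_top T \<rightarrow>\<^sub>M borel_of_top T'"
proof (rule measurable_borel_of_topI)
  show "f x \<in> topspace T'" if "x \<in> space (borel_of_top T)" for x
    using that assms continuous_map_image_subset_topspace by (auto simp: continuous_map_def)
  show "{x \<in> space (borel_of_top T). f x \<in> U} \<in> sets (borel_of_top T)" if "openin T' U" for U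
    using openin_continuous_map_preimage[OF assms that] by (auto simp: sets_borel_of_top)
qed

lemma continuous_real_measurable:
  assumes "continuous_map T euclideanreal f" shows "f \<in> borel_measurable (borel_of_top T)"
proof -
  have "sets (borel_of_top euclideanreal) = (sets borel :: real set set)"
    by (simp add: sets_borel_of_top borel_def)
  from measurable_cong_sets[OF refl this] continuous_map_measurable[OF assms]
  show ?thesis by (rule eqset_imp_iff[THEN iffD1])
qed

definition berk_form :: "('k::field)^2 \<Rightarrow> 'k poly" where
  "berk_form u = [:- u$1, u$2:]"

text \<open>Extends the distance \<open>pd\<close> to a Berkovich point and a classical point: \<open>berk_form (pvec z)\<close> is
  the linear form vanishing at \<open>z\<close>.\<close>

definition bd :: "('k::field \<Rightarrow> real) \<Rightarrow> ('k poly \<Rightarrow> real) option \<Rightarrow> 'k option \<Rightarrow> real" where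
  "bd v p z = hs v p 1 (berk_form (pvec z)) / (hn v p * vnorm v (pvec z))"

section \<open>Distance from Berkovich points to classical points\<close>

context complete_nonarch_val
begin

lemma bd_nonneg: "p \<in> berkP1 v \<Longrightarrow> 0 \<le> bd v p z"
  using hs_nonneg[of p] hn_pos[of p] by (simp add: bd_def)

text \<open>The Plucker identity for linear forms, with an auxiliary \<open>w\<close> chosen far
  from \<open>u\<close>. A sum stands in place of a maximum because \<open>berkA\<close> postulates
  only the ordinary triangle inequality.\<close>

lemma bd_triangle:
  assumes p: "p \<in> berkP1 v" shows "bd v p z' \<le> bd v p z + pd v z z'"
proof -
  define u u' where "u = pvec z" and "u' = pvec z'"
  have pos: "vnorm v u > 0" "vnorm v u' > 0" "hn v p > 0" using hn_pos[OF p] by (simp_all add: u_def u'_def)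
  obtain w :: "'k^2" where w: "v (wedge u w) = vnorm v u" "vnorm v w = 1" "hs v p 1 (berk_form w) \<le> hn v p"
  proof (cases "v (u$1) \<le> v (u$2)")
    case True
    have "berk_form (axis 1 1 :: 'k^2) = smult (-1) [:1:]" by (simp add: berk_form_def axis_def)
    then have "hs v p 1 (berk_form (axis 1 1)) = hs v p 1 [:1:]" by (simp only: hs_smult[OF p] v_minus v_1 mult_1)
    then show ?thesis using True
      by (intro that[of "axis 1 1"]) (auto simp: vnorm_def axis_def wedge_def hn_def)
  next
    case False
    have "berk_form (axis 2 1 :: 'k^2) = [:0, 1:]" by (simp add: berk_form_def axis_def)
    then show ?thesis using False
      by (intro that[of "axis 2 1"]) (auto simp: vnorm_def axis_def wedge_def hn_def)
  qed
  have "smult (wedge u w) (berk_form u') = smult (wedge u u') (berk_form w) + smult (wedge u' w) (berk_form u)"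
    using wedge_plucker[of u w u'] by (simp add: berk_form_def vec2_eq_iff)
  then have "vnorm v u * hs v p 1 (berk_form u') \<le> v (wedge u u') * hs v p 1 (berk_form w) + v (wedge u' w) * hs v p 1 (berk_form u)"
    using hs_add[OF p, of 1 "smult (wedge u u') (berk_form w)" "smult (wedge u' w) (berk_form u)"] w(1)
    by (metis hs_smult[OF p])
  also have "\<dots> \<le> v (wedge u u') * hn v p + vnorm v u' * hs v p 1 (berk_form u)"
    using w v_wedge_le[of u' w] hs_nonneg[OF p] by (intro add_mono mult_left_mono mult_right_mono) auto
  finally have "vnorm v u * hs v p 1 (berk_form u') / (hn v p * vnorm v u * vnorm v u') \<le>
     (v (wedge u u') * hn v p + vnorm v u' * hs v p 1 (berk_form u)) / (hn v p * vnorm v u * vnorm v u')"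
    using pos by (intro divide_right_mono) auto
  then show ?thesis using pos by (simp add: bd_def pd_def vd_def u_def[symmetric] u'_def[symmetric] add_divide_distrib)
qed

lemma bd_emb: "bd v (berk_emb v z) z' = pd v z z'"
proof (cases z)
  case None
  then show ?thesis by (simp add: bd_def berk_emb_def hs_def hn_simps berk_form_def pd_def vd_def wedge_def vnorm_def)
next
  case (Some a)
  have h: "hn v (Some (\<lambda>f. v (poly f a))) = max 1 (v a)"
    by (simp add: hn_def hs_def)
  have "pvec z' $ 2 * a - pvec z' $ 1 = wedge (pvec z) (pvec z')" using Some by (simp add: wedge_def)
  then show ?thesis using Some h
    by (simp add: bd_def berk_emb_def hs_def berk_form_def pd_def vd_def vnorm_def[of v "pvec (Some a)"] mult.commute max.commute)
qed

text \<open>On linear forms every Berkovich point dominates, up to a factor 3, a classical one; this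
  lets escape of vector norms control Berkovich points. Let \<open>r\<close> be the infimum of the
  values of \<open>T - a\<close>. If \<open>r > 0\<close>, take \<open>a\<close> with value below
  \<open>2 * r\<close>, which adds at most twice the value of the form; if \<open>r = 0\<close>,
  completeness yields \<open>a\<close> with value 0.\<close>

lemma berk_lower_bound:
  assumes "p \<in> berkP1 v"
  shows "\<exists>w :: 'k^2. w \<noteq> 0 \<and> (\<forall>a b. v (a * w$1 + b * w$2) \<le> 3 * hs v p 1 [:b, a:])"
  using assms
proof (cases rule: berkP1_cases)
  case 1
  then show ?thesis by (intro exI[of _ "vector [1, 0]"]) (auto simp: hs_def vec2_eq_iff)
next
  case (2 x)
  note x = 2(2)
  define D where "D a = x [:- a, 1:]" for a
  have D0: "0 \<le> D a" for a using berkA_nonneg[OF x] by (simp add: D_def)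
  have bdd: "bdd_below (range D)" using D0 by (intro bdd_belowI[of _ 0]) auto
  define r where "r = Inf (range D)"
  have r0: "0 \<le> r" unfolding r_def using D0 by (intro cInf_greatest) auto
  have rD: "r \<le> D a" for a unfolding r_def using bdd by (intro cInf_lower) auto
  have lin: "x [:b, a:] = v a * D (- b / a)" if "a \<noteq> 0" for a b
  proof -
    have "[:b, a:] = smult a [:- (- b / a), 1:]" using that by simp
    then show ?thesis unfolding D_def using berkA_smult[OF x] by metis
  qed
  have key: "v (\<alpha> * a + b) \<le> x [:b, \<alpha>:] + v \<alpha> * D a" for \<alpha> a b
  proof -
    have "[:\<alpha> * a + b:] = [:b, \<alpha>:] + smult (- \<alpha>) [:- a, 1:]" by (simp add: algebra_simps)
    then have "x [:\<alpha> * a + b:] \<le> x [:b, \<alpha>:] + x (smult (- \<alpha>) [:- a, 1:])" by (metis berkA_add[OF x])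
    then show ?thesis unfolding berkA_const[OF x] berkA_smult[OF x] v_minus D_def .
  qed
  have "\<exists>a. \<forall>\<alpha> b. v (\<alpha> * a + b) \<le> 3 * x [:b, \<alpha>:]"
  proof (cases "r = 0")
    case False
    then have "\<exists>y\<in>range D. y < 2 * r" using r0 cInf_less_iff[OF _ bdd, of "2 * r"] by (auto simp: r_def)
    then obtain a where a: "D a < 2 * r" by blast
    have "v (\<alpha> * a + b) \<le> 3 * x [:b, \<alpha>:]" for \<alpha> b
    proof (cases "\<alpha> = 0")
      case True
      then show ?thesis using berkA_const[OF x, of b] by simp
    next
      case False
      have "v \<alpha> * D a \<le> v \<alpha> * (2 * D (- b / \<alpha>))" using a rD[of "- b / \<alpha>"] by (intro mult_left_mono) auto
      also have "\<dots> = 2 * x [:b, \<alpha>:]" using lin[OF False, of b] by simp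
      finally show ?thesis using key[of \<alpha> a b] by simp
    qed
    then show ?thesis by blast
  next
    case True
    have "\<forall>n::nat. \<exists>a. D a < (1/2) ^ n"
    proof
      fix n :: nat
      have "\<exists>y\<in>range D. y < (1/2) ^ n" using True cInf_less_iff[OF _ bdd, of "(1/2) ^ n"] by (auto simp: r_def)
      then show "\<exists>a. D a < (1/2) ^ n" by blast
    qed
    then obtain a where a: "\<And>n. D (a n) < (1/2) ^ n" by metis
    have diff: "v (s - t) \<le> D s + D t" for s t
    proof -
      have "[:s - t:] = [:- t, 1:] + - [:- s, 1:]" by simp
      then have "x [:s - t:] \<le> x [:- t, 1:] + x (- [:- s, 1:])" by (metis berkA_add[OF x])
      then show ?thesis unfolding berkA_minus[OF x] berkA_const[OF x] by (simp add: D_def)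
    qed
    have half: "(\<lambda>n. (1/2 :: real) ^ n) \<longlonglongrightarrow> 0" by (intro LIMSEQ_realpow_zero) auto
    have "(\<lambda>n. (1/2 :: real) ^ Suc n + (1/2) ^ n) \<longlonglongrightarrow> 0 + 0" by (intro tendsto_add half LIMSEQ_Suc[OF half])
    then have l2: "(\<lambda>n. (1/2 :: real) ^ Suc n + (1/2) ^ n) \<longlonglongrightarrow> 0" by simp
    have "v (a (Suc n) - a n) \<le> (1/2) ^ Suc n + (1/2) ^ n" for n
      using diff[of "a (Suc n)" "a n"] a[of n] a[of "Suc n"] by linarith
    then have "(\<lambda>n. v (a (Suc n) - a n)) \<longlonglongrightarrow> 0"
      by (intro tendsto_sandwich[OF _ _ tendsto_const l2]) auto
    then obtain l where l: "(\<lambda>n. v (a n - l)) \<longlonglongrightarrow> 0" using convergent_if_steps_tendsto_0 by blast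
    have Dl: "D l \<le> (1/2) ^ n + v (a n - l)" for n
    proof -
      have "[:- l, 1:] = [:- a n, 1:] + [:a n - l:]" by simp
      then have "D l \<le> D (a n) + x [:a n - l:]" unfolding D_def by (metis berkA_add[OF x])
      then show ?thesis using a[of n] by (simp add: berkA_const[OF x])
    qed
    have "(\<lambda>n. (1/2) ^ n + v (a n - l)) \<longlonglongrightarrow> 0 + 0" by (intro tendsto_add half l)
    then have "D l \<le> 0" using LIMSEQ_le_const[of "\<lambda>n. (1/2) ^ n + v (a n - l)" "0 + 0" "D l"] Dl by simp
    then have "D l = 0" using D0[of l] by simp
    then have "v (\<alpha> * l + b) \<le> 3 * x [:b, \<alpha>:]" for \<alpha> b
      using key[of \<alpha> l b] berkA_nonneg[OF x, of "[:b, \<alpha>:]"] by simp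
    then show ?thesis by blast
  qed
  then obtain a where "\<forall>\<alpha> b. v (\<alpha> * a + b) \<le> 3 * x [:b, \<alpha>:]" by blast
  then show ?thesis using 2 by (intro exI[of _ "vector [a, 1]"]) (auto simp: hs_def vec2_eq_iff)
qed

lemma hn_berk_act:
  assumes p: "p \<in> berkP1 v" and A: "A \<in> SL2" and "\<kappa> > 0"
    and k: "\<And>d f. degree f \<le> d \<Longrightarrow> hs v (berk_act v A p) d f = hs v p d (hsub d A f) / \<kappa> ^ d"
  shows "hn v (berk_act v A p) = max (hs v p 1 (den_form A)) (hs v p 1 (num_form A)) / \<kappa>"
proof -
  have "hs v (berk_act v A p) 1 [:1:] = hs v p 1 (den_form A) / \<kappa>"
    using k[of "[:1:]" 1] hsub_1_pCons[of A 1 0] by simp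
  moreover have "hs v (berk_act v A p) 1 [:0, 1:] = hs v p 1 (num_form A) / \<kappa>"
    using k[of "[:0, 1:]" 1] hsub_1_pCons[of A 0 1] by simp
  ultimately show ?thesis using assms(3) by (simp add: hn_def max_divide_distrib_right)
qed

text \<open>The counterpart of \<open>vd_matvec\<close> for a Berkovich point: the vector
  \<open>w\<close> from \<open>berk_lower_bound\<close> represents \<open>p\<close>, and the
  constant, 3 times the value at \<open>p\<close> of the form vanishing at \<open>y\<close>, is the
  same for all \<open>A\<close>.\<close>

lemma bd_berk_act_le:
  assumes p: "p \<in> berkP1 v"
  shows "\<exists>C w. w \<noteq> 0 \<and> C \<ge> 0 \<and> (\<forall>A\<in>SL2. bd v (berk_act v A p) (moebius A y) \<le> C / (vnorm v (A *v w) * vnorm v (A *v pvec y)))"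
proof -
  obtain w :: "'k^2" where w: "w \<noteq> 0" "\<And>a b. v (a * w$1 + b * w$2) \<le> 3 * hs v p 1 [:b, a:]"
    using berk_lower_bound[OF p] by auto
  define N where "N = hs v p 1 (berk_form (pvec y))"
  have N: "N \<ge> 0" using hs_nonneg[OF p] by (simp add: N_def)
  have "bd v (berk_act v A p) (moebius A y) \<le> 3 * N / (vnorm v (A *v w) * vnorm v (A *v pvec y))" if A: "A \<in> SL2" for A
  proof -
    obtain k where k: "k > 0" "\<And>d f. degree f \<le> d \<Longrightarrow> hs v (berk_act v A p) d f = hs v p d (hsub d A f) / k ^ d"
      using berk_act_hs[OF p A] by blast
    obtain c where c: "c \<noteq> 0" "A *v pvec y = c *s pvec (moebius A y)" using pvec_moebius[OF A] by blast
    let ?z = "pvec (moebius A y)"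
    have hn: "hn v (berk_act v A p) = max (hs v p 1 (den_form A)) (hs v p 1 (num_form A)) / k"
      by (rule hn_berk_act[OF p A k])
    have zz: "adj2 A *v (c *s ?z) = pvec y" using c(2) SL2_matvec_cancel(1)[OF A, of "pvec y"] by simp
    \<comment> \<open>The form vanishing at the image of \<open>y\<close> pulls back to the one
      vanishing at \<open>y\<close>, up to the factor \<open>c\<close>.\<close>
    have "smult c (hsub 1 A (berk_form ?z)) = berk_form (adj2 A *v (c *s ?z))"
      unfolding berk_form_def hsub_1_pCons by (simp add: matvec2_nth algebra_simps)
    then have h1: "v c * hs v p 1 (hsub 1 A (berk_form ?z)) = N"
      unfolding zz N_def using hs_smult[OF p, of 1 c] by metis
    have "hs v (berk_act v A p) 1 (berk_form ?z) = hs v p 1 (hsub 1 A (berk_form ?z)) / k"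
      using k(2)[of "berk_form ?z" 1] by (simp add: berk_form_def)
    then have h: "hs v (berk_act v A p) 1 (berk_form ?z) = N / (v c * k)"
      unfolding h1[symmetric] using c(1) by simp
    define H where "H = max (hs v p 1 (den_form A)) (hs v p 1 (num_form A))"
    have "vnorm v (A *v w) \<le> 3 * H"
      using w(2)[of "A$1$1" "A$1$2"] w(2)[of "A$2$1" "A$2$2"] by (simp add: vnorm_def matvec2_nth H_def) linarith
    then have HA: "vnorm v (A *v w) / 3 \<le> H" by simp
    have Aw: "vnorm v (A *v w) > 0" using w A by simp
    then have H0: "H > 0" using HA by linarith
    have z0: "vnorm v ?z > 0" by simp
    have nAy: "vnorm v (A *v pvec y) = v c * vnorm v ?z" using c by simp
    have "bd v (berk_act v A p) (moebius A y) = (N / (v c * k)) / ((H / k) * vnorm v ?z)"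
      unfolding bd_def h hn H_def ..
    also have "\<dots> = N / (H * vnorm v (A *v pvec y))"
      using k(1) c(1) z0 H0 unfolding nAy by (simp add: field_simps)
    also have "\<dots> \<le> N / (vnorm v (A *v w) / 3 * vnorm v (A *v pvec y))"
      using HA Aw N H0 A by (intro divide_left_mono mult_right_mono mult_pos_pos) auto
    finally show ?thesis by (simp add: field_simps)
  qed
  then show ?thesis using w N by (intro exI[of _ "3 * N"] exI[of _ w]) auto
qed

subsection \<open>Topology\<close>

lemma topspace_berk_top: "topspace (berk_top v) = berkP1 v"
  unfolding berk_top_def topology_generated_by_topspace
proof (intro equalityI subsetI)
  fix p assume "p \<in> \<Union> ({Some ` {x \<in> berkA v. a < x f \<and> x f < b} | f a b. True} \<union>
      {insert None (Some ` {x \<in> berkA v. R < x [:0, 1:]}) | R. True})"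
  then show "p \<in> berkP1 v" by (auto simp: berkP1_def)
next
  fix p assume "p \<in> berkP1 v"
  then show "p \<in> \<Union> ({Some ` {x \<in> berkA v. a < x f \<and> x f < b} | f a b. True} \<union>
      {insert None (Some ` {x \<in> berkA v. R < x [:0, 1:]}) | R. True})"
  proof (cases rule: berkP1_cases)
    case 1
    then have "p \<in> insert None (Some ` {x \<in> berkA v. 0 < x [:0, 1:]})" by simp
    then show ?thesis by (rule UnionI[rotated]) blast
  next
    case (2 x)
    then have "p \<in> Some ` {x \<in> berkA v. 0 < x [:1:] \<and> x [:1:] < 2}" by (simp add: berkA_const)
    then show ?thesis by (rule UnionI[rotated]) blast
  qed
qed

lemma openin_berk_ball: "openin (berk_top v) (Some ` {x \<in> berkA v. a < x f \<and> x f < b})"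
  unfolding berk_top_def by (rule topology_generated_by_Basis) blast

lemma openin_berk_infinity: "openin (berk_top v) (insert None (Some ` {x \<in> berkA v. R < x [:0, 1:]}))"
  unfolding berk_top_def by (rule topology_generated_by_Basis) blast

lemma openin_berk_greater: "openin (berk_top v) (Some ` {x \<in> berkA v. a < x f})"
proof (subst openin_subopen, intro ballI)
  fix p assume "p \<in> Some ` {x \<in> berkA v. a < x f}"
  then obtain y where "p = Some y" "y \<in> berkA v" "a < y f" by blast
  then show "\<exists>T. openin (berk_top v) T \<and> p \<in> T \<and> T \<subseteq> Some ` {x \<in> berkA v. a < x f}"
    using openin_berk_ball[of a f "y f + 1"]
    by (intro exI[of _ "Some ` {x \<in> berkA v. a < x f \<and> x f < y f + 1}"]) auto
qed

lemma openin_berk_less: "openin (berk_top v) (Some ` {x \<in> berkA v. x f < b})"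
proof (subst openin_subopen, intro ballI)
  fix p assume "p \<in> Some ` {x \<in> berkA v. x f < b}"
  then obtain y where "p = Some y" "y \<in> berkA v" "y f < b" by blast
  then show "\<exists>T. openin (berk_top v) T \<and> p \<in> T \<and> T \<subseteq> Some ` {x \<in> berkA v. x f < b}"
    using openin_berk_ball[of "y f - 1" f b]
    by (intro exI[of _ "Some ` {x \<in> berkA v. y f - 1 < x f \<and> x f < b}"]) auto
qed

lemma openin_berkA: "openin (berk_top v) (Some ` berkA v)"
proof -
  have "Some ` berkA v = Some ` {x \<in> berkA v. 0 < x [:1:] \<and> x [:1:] < 2}"
    by (auto simp: berkA_const)
  then show ?thesis using openin_berk_ball[of 0 "[:1:]" 2] by (simp only:)
qed

text \<open>The sets \<open>R < x [:0, 1:]\<close> are neighbourhoods of infinity, so continuity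
  there is a limit as the value of \<open>T\<close> grows.\<close>

lemma continuous_berk_realI:
  assumes c: "continuous_map (subtopology (berk_top v) (Some ` berkA v)) euclideanreal f"
    and inf: "\<And>e. e > 0 \<Longrightarrow> \<exists>R. \<forall>x\<in>berkA v. R < x [:0, 1:] \<longrightarrow> \<bar>f (Some x) - f None\<bar> < e"
  shows "continuous_map (berk_top v) euclideanreal f"
proof -
  have op: "openin (berk_top v) {p \<in> topspace (berk_top v). f p \<in> U}" if U: "open U" for U
  proof (subst openin_subopen, intro ballI)
    fix p assume p: "p \<in> {p \<in> topspace (berk_top v). f p \<in> U}"
    then have pP: "p \<in> berkP1 v" by (simp add: topspace_berk_top)
    then show "\<exists>T. openin (berk_top v) T \<and> p \<in> T \<and> T \<subseteq> {p \<in> topspace (berk_top v). f p \<in> U}"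
    proof (cases rule: berkP1_cases)
      case 1
      then have "f None \<in> U" using p by simp
      then obtain e where e: "e > 0" "\<And>y. dist y (f None) < e \<Longrightarrow> y \<in> U" using U open_dist by metis
      obtain R where R: "\<forall>x\<in>berkA v. R < x [:0, 1:] \<longrightarrow> \<bar>f (Some x) - f None\<bar> < e" using inf[OF e(1)] by blast
      have "insert None (Some ` {x \<in> berkA v. R < x [:0, 1:]}) \<subseteq> {p \<in> topspace (berk_top v). f p \<in> U}"
        using R e \<open>f None \<in> U\<close> by (auto simp: topspace_berk_top berkP1_def dist_real_def)
      then show ?thesis using 1 openin_berk_infinity[of R]
        by (intro exI[of _ "insert None (Some ` {x \<in> berkA v. R < x [:0, 1:]})"]) auto
    next
      case (2 x)
      let ?W = "{p \<in> topspace (subtopology (berk_top v) (Some ` berkA v)). f p \<in> U}"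
      have "openin (subtopology (berk_top v) (Some ` berkA v)) ?W"
        using U by (intro openin_continuous_map_preimage[OF c]) auto
      then have "openin (berk_top v) ?W" using openin_berkA openin_trans_full by blast
      moreover have "p \<in> ?W" using 2 p by simp
      ultimately show ?thesis by (intro exI[of _ ?W]) auto
    qed
  qed
  show ?thesis unfolding continuous_map_def using op by auto
qed

lemma continuous_berkA_eval:
  "continuous_map (subtopology (berk_top v) (Some ` berkA v)) euclideanreal (\<lambda>p. hs v p d f)"
proof (rule continuous_map_realI)
  have sp: "topspace (subtopology (berk_top v) (Some ` berkA v)) = Some ` berkA v"
    by (auto simp: topspace_berk_top berkP1_def)
  fix a
  have 1: "{p \<in> Some ` berkA v. a < hs v p d f} = Some ` {x \<in> berkA v. a < x f}" by (auto simp: hs_def)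
  have 2: "{p \<in> Some ` berkA v. hs v p d f < a} = Some ` {x \<in> berkA v. x f < a}" by (auto simp: hs_def)
  show "openin (subtopology (berk_top v) (Some ` berkA v)) {p \<in> topspace (subtopology (berk_top v) (Some ` berkA v)). a < hs v p d f}"
    unfolding sp 1 openin_open_subtopology[OF openin_berkA] using openin_berk_greater by auto
  show "openin (subtopology (berk_top v) (Some ` berkA v)) {p \<in> topspace (subtopology (berk_top v) (Some ` berkA v)). hs v p d f < a}"
    unfolding sp 2 openin_open_subtopology[OF openin_berkA] using openin_berk_less by auto
qed

text \<open>For large value of \<open>T\<close> the leading monomial dominates; this is continuity
  of \<open>Phi\<close> at infinity.\<close>

lemma berkA_leading_term:
  assumes x: "x \<in> berkA v" and f: "degree f \<le> d" and r: "x [:0, 1:] \<ge> 1"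
  shows "\<bar>x f / x [:0, 1:] ^ d - v (coeff f d)\<bar> \<le> (\<Sum>i<d. v (coeff f i)) / x [:0, 1:]"
proof -
  define r where "r = x [:0, 1:]"
  have r1: "r \<ge> 1" using assms by (simp add: r_def)
  have mon: "monom c i = smult c ([:0, 1:] ^ i)" for c :: 'k and i by (simp add: monom_altdef)
  have xm: "x (monom c i) = v c * r ^ i" for c i by (simp add: mon berkA_smult[OF x] berkA_power[OF x] r_def)
  have "f = (\<Sum>i\<le>d. monom (coeff f i) i)" using f by (rule poly_as_sum_of_monoms'[symmetric])
  then have feq: "f = monom (coeff f d) d + (\<Sum>i<d. monom (coeff f i) i)"
    by (simp add: lessThan_Suc_atMost[symmetric] add.commute)
  have "\<bar>x f - v (coeff f d) * r ^ d\<bar> \<le> x (\<Sum>i<d. monom (coeff f i) i)"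
    using berkA_diff_le[OF x, of "monom (coeff f d) d" "\<Sum>i<d. monom (coeff f i) i"] feq xm by metis
  also have "\<dots> \<le> (\<Sum>i<d. v (coeff f i) * r ^ i)"
    using berkA_sum[OF x, of "\<lambda>i. monom (coeff f i) i" "{..<d}"] by (simp add: xm)
  also have "\<dots> \<le> (\<Sum>i<d. v (coeff f i) * (r ^ d / r))"
  proof (intro sum_mono mult_left_mono)
    fix i assume i: "i \<in> {..<d}"
    have "r ^ i * r = r ^ Suc i" by simp
    also have "\<dots> \<le> r ^ d" using i r1 by (intro power_increasing) auto
    finally show "r ^ i \<le> r ^ d / r" using r1 by (simp add: le_divide_eq)
  qed simp
  also have "\<dots> = (\<Sum>i<d. v (coeff f i)) / r * r ^ d" by (simp add: sum_distrib_right sum_divide_distrib)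
  finally have "\<bar>x f - v (coeff f d) * r ^ d\<bar> / r ^ d \<le> (\<Sum>i<d. v (coeff f i)) / r"
    using r1 by (simp add: divide_le_eq)
  moreover have "\<bar>x f - v (coeff f d) * r ^ d\<bar> / r ^ d = \<bar>x f / r ^ d - v (coeff f d)\<bar>"
  proof -
    have rp: "r ^ d > 0" using r1 by simp
    then have "x f / r ^ d - v (coeff f d) = (x f - v (coeff f d) * r ^ d) / r ^ d"
      using r1 by (auto simp: diff_divide_distrib)
    then show ?thesis using rp by (simp only: abs_divide abs_of_pos)
  qed
  ultimately show ?thesis by (simp add: r_def)
qed

text \<open>The normalised value is independent of the scale of the homogeneous values. These
  functions serve as continuous coordinates on the whole line, infinity included.\<close>

definition Phi :: "nat \<Rightarrow> 'k poly \<Rightarrow> ('k poly \<Rightarrow> real) option \<Rightarrow> real" where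
  "Phi d f p = hs v p d f / hn v p ^ d"

lemma continuous_Phi:
  assumes f: "degree f \<le> d" shows "continuous_map (berk_top v) euclideanreal (Phi d f)"
proof (rule continuous_berk_realI)
  have "hn v p \<noteq> 0" if "p \<in> topspace (subtopology (berk_top v) (Some ` berkA v))" for p
    using that hn_pos[of p] by (auto simp: topspace_berk_top)
  then show "continuous_map (subtopology (berk_top v) (Some ` berkA v)) euclideanreal (Phi d f)"
    unfolding Phi_def[abs_def] hn_def
    by (intro continuous_map_real_divide continuous_map_real_pow continuous_map_real_max continuous_berkA_eval)
       (auto simp: hn_def)
  fix e :: real assume e: "e > 0"
  define C where "C = (\<Sum>i<d. v (coeff f i))"
  have C: "C \<ge> 0" unfolding C_def by (intro sum_nonneg) auto
  show "\<exists>R. \<forall>x\<in>berkA v. R < x [:0, 1:] \<longrightarrow> \<bar>Phi d f (Some x) - Phi d f None\<bar> < e"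
  proof (intro exI[of _ "max 1 (C / e)"] ballI impI)
    fix x assume x: "x \<in> berkA v" and R: "max 1 (C / e) < x [:0, 1:]"
    then have "\<bar>Phi d f (Some x) - Phi d f None\<bar> \<le> C / x [:0, 1:]"
      using berkA_leading_term[OF x f] by (simp add: Phi_def hs_def hn_simps C_def)
    also have "\<dots> < e" using R e by (simp add: divide_less_eq mult.commute)
    finally show "\<bar>Phi d f (Some x) - Phi d f None\<bar> < e" .
  qed
qed

text \<open>Subbasic open sets are described by strict inequalities between the functions
  \<open>Phi\<close>. Composing these with the action gives the quotients \<open>G\<close>, which
  are continuous because numerator and denominator forms have no common zero.\<close>

lemma continuous_berk_act:
  assumes A: "A \<in> SL2" shows "continuous_map (berk_top v) (berk_top v) (berk_act v A)"
proof -
  define G where "G d f p = Phi d (hsub d A f) p / (max (Phi 1 (den_form A) p) (Phi 1 (num_form A) p)) ^ d" for d f p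
  have deg: "degree (den_form A) \<le> 1" "degree (num_form A) \<le> 1" by simp_all
  have Gpos: "max (Phi 1 (den_form A) p) (Phi 1 (num_form A) p) > 0"
    and Geq: "\<And>d f. degree f \<le> d \<Longrightarrow> Phi d f (berk_act v A p) = G d f p" if p: "p \<in> berkP1 v" for p
  proof -
    obtain k where k: "k > 0" "\<And>d f. degree f \<le> d \<Longrightarrow> hs v (berk_act v A p) d f = hs v p d (hsub d A f) / k ^ d"
      using berk_act_hs[OF p A] by blast
    define H where "H = max (hs v p 1 (den_form A)) (hs v p 1 (num_form A))"
    have hn: "hn v (berk_act v A p) = H / k" unfolding H_def by (rule hn_berk_act[OF p A k])
    have "H / k > 0" using hn hn_pos[OF berk_act_mem[OF p A]] by simp
    then have H: "H > 0" using k(1) by (simp add: zero_less_divide_iff)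
    have hp: "hn v p > 0" by (rule hn_pos[OF p])
    have mx: "max (Phi 1 (den_form A) p) (Phi 1 (num_form A) p) = H / hn v p"
      using hp by (simp add: Phi_def H_def max_divide_distrib_right)
    then show "max (Phi 1 (den_form A) p) (Phi 1 (num_form A) p) > 0" using H hp by simp
    show "Phi d f (berk_act v A p) = G d f p" if f: "degree f \<le> d" for d f
      unfolding G_def mx unfolding Phi_def hn k(2)[OF f] using k(1) hp H by (simp add: power_divide)
  qed
  have Gc: "continuous_map (berk_top v) euclideanreal (G d f)" for d f
    unfolding G_def[abs_def]
    using Gpos by (intro continuous_map_real_divide continuous_map_real_pow continuous_map_real_max continuous_Phi deg degree_hsub)
       (force simp: topspace_berk_top)
  have Gc1: "continuous_map (berk_top v) euclideanreal (\<lambda>p. c * G 1 f p ^ n)" for c f n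
    by (intro continuous_map_real_mult continuous_map_real_pow Gc) simp
  have zc: "continuous_map (berk_top v) euclideanreal (\<lambda>p. 0)" by simp
  have mem: "berk_act v A p \<in> berkP1 v" if "p \<in> berkP1 v" for p using berk_act_mem[OF that A] .
  \<comment> \<open>The homogenised inequalities; \<open>0 < Phi 1 [:1:] q\<close> says that
    \<open>q\<close> is not infinity.\<close>
  have finite_iff: "(\<exists>x\<in>berkA v. q = Some x \<and> a < x f \<and> x f < b) \<longleftrightarrow>
      0 < Phi 1 [:1:] q \<and> a * Phi 1 [:1:] q ^ degree f < Phi (degree f) f q \<and> Phi (degree f) f q < b * Phi 1 [:1:] q ^ degree f"
    if q: "q \<in> berkP1 v" for q a b f
    using q
  proof (cases rule: berkP1_cases)
    case 1 then show ?thesis by (simp add: Phi_def hs_def)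
  next
    case (2 x)
    have "hn v q > 0" by (rule hn_pos[OF q])
    then show ?thesis using 2 by (auto simp: Phi_def hs_def berkA_const power_divide divide_less_cancel)
  qed
  have inf_iff: "(q = None \<or> (\<exists>x\<in>berkA v. q = Some x \<and> R < x [:0, 1:])) \<longleftrightarrow> R * Phi 1 [:1:] q ^ 1 < Phi 1 [:0, 1:] q"
    if q: "q \<in> berkP1 v" for q R
    using q
  proof (cases rule: berkP1_cases)
    case 1 then show ?thesis by (simp add: Phi_def hs_def hn_simps)
  next
    case (2 x)
    have "hn v q > 0" by (rule hn_pos[OF q])
    then show ?thesis using 2 by (auto simp: Phi_def hs_def berkA_const divide_less_cancel)
  qed
  have "openin (berk_top v) (berk_act v A -` U \<inter> topspace (berk_top v))"
    if U: "U \<in> {Some ` {x \<in> berkA v. a < x f \<and> x f < b} | f a b. True} \<union> {insert None (Some ` {x \<in> berkA v. R < x [:0, 1:]}) | R. True}" for U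
  proof -
    consider (ball) f a b where "U = Some ` {x \<in> berkA v. a < x f \<and> x f < b}"
      | (inf) R where "U = insert None (Some ` {x \<in> berkA v. R < x [:0, 1:]})" using U by blast
    then show ?thesis
    proof cases
      case (ball f a b)
      let ?S = "{p \<in> topspace (berk_top v). 0 < G 1 [:1:] p} \<inter>
        ({p \<in> topspace (berk_top v). a * G 1 [:1:] p ^ degree f < G (degree f) f p} \<inter>
         {p \<in> topspace (berk_top v). G (degree f) f p < b * G 1 [:1:] p ^ degree f})"
      have "openin (berk_top v) ?S" by (intro openin_Int openin_real_less Gc Gc1 zc)
      moreover have "berk_act v A -` U \<inter> topspace (berk_top v) = ?S"
      proof (intro set_eqI)
        fix p
        show "p \<in> berk_act v A -` U \<inter> topspace (berk_top v) \<longleftrightarrow> p \<in> ?S"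
        proof (cases "p \<in> berkP1 v")
          case True
          have "p \<in> berk_act v A -` U \<longleftrightarrow> (\<exists>x\<in>berkA v. berk_act v A p = Some x \<and> a < x f \<and> x f < b)"
            unfolding ball by auto
          then show ?thesis using True unfolding finite_iff[OF mem[OF True]] by (simp add: topspace_berk_top Geq)
        qed (simp add: topspace_berk_top)
      qed
      ultimately show ?thesis by simp
    next
      case (inf R)
      let ?S = "{p \<in> topspace (berk_top v). R * G 1 [:1:] p ^ 1 < G 1 [:0, 1:] p}"
      have "openin (berk_top v) ?S" by (intro openin_real_less Gc Gc1)
      moreover have "berk_act v A -` U \<inter> topspace (berk_top v) = ?S"
      proof (intro set_eqI)
        fix p
        show "p \<in> berk_act v A -` U \<inter> topspace (berk_top v) \<longleftrightarrow> p \<in> ?S"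
        proof (cases "p \<in> berkP1 v")
          case True
          have "p \<in> berk_act v A -` U \<longleftrightarrow> (berk_act v A p = None \<or> (\<exists>x\<in>berkA v. berk_act v A p = Some x \<and> R < x [:0, 1:]))"
            unfolding inf by auto
          then show ?thesis using True unfolding inf_iff[OF mem[OF True]] by (simp add: topspace_berk_top Geq)
        qed (simp add: topspace_berk_top)
      qed
      ultimately show ?thesis by simp
    qed
  qed
  moreover have "berk_act v A ` topspace (berk_top v) \<subseteq> topspace (berk_top v)"
    using mem by (auto simp: topspace_berk_top)
  ultimately show ?thesis
    unfolding berk_top_def continuous_on_generated_topo_iff by (simp add: topology_generated_by_topspace)
qed

text \<open>Near a finite point \<open>a0\<close> the value of \<open>T - a0\<close> tends to 0
  together with \<open>bd\<close>, and dividing \<open>f\<close> by \<open>T - a0\<close> shows that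
  the values of all polynomials converge. At infinity \<open>bd\<close> is the reciprocal of
  \<open>max 1\<close> of the value of \<open>T\<close>.\<close>

lemma bd_tendsto_subbasic:
  assumes p: "\<And>n. p n \<in> berkP1 v" and lim: "(\<lambda>n. bd v (p n) z) \<longlonglongrightarrow> 0"
    and W: "W \<in> {Some ` {x \<in> berkA v. a < x f \<and> x f < b} | f a b. True} \<union> {insert None (Some ` {x \<in> berkA v. R < x [:0, 1:]}) | R. True}"
    and z: "berk_emb v z \<in> W"
  shows "\<forall>\<^sub>F n in sequentially. p n \<in> W"
proof (cases z)
  case None
  then obtain R where R: "W = insert None (Some ` {x \<in> berkA v. R < x [:0, 1:]})"
    using W z by (auto simp: berk_emb_def)
  have "\<forall>\<^sub>F n in sequentially. bd v (p n) z < 1 / (max 1 R)" by (rule order_tendstoD(2)[OF lim]) simp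
  then show ?thesis
  proof eventually_elim
    case (elim n)
    from p[of n] show ?case
    proof (cases rule: berkP1_cases)
      case 1 then show ?thesis using R by simp
    next
      case (2 x)
      have "bd v (p n) z = 1 / max 1 (x [:0, 1:])"
        using 2 None berkA_const[OF 2(2), of "-1"] by (simp add: bd_def hs_def hn_simps berk_form_def vnorm_def)
      then have "1 / max 1 (x [:0, 1:]) < 1 / max 1 R" using elim by simp
      then have "max 1 R < max 1 (x [:0, 1:])" by (simp add: divide_less_cancel frac_less2 field_simps)
      then have "R < x [:0, 1:]" by (auto simp: max_def split: if_splits)
      then show ?thesis using 2 R by simp
    qed
  qed
next
  case (Some a0)
  define A where "A = max (v a0) 1"
  have A: "A \<ge> 1" by (simp add: A_def)
  have some: "\<forall>\<^sub>F n in sequentially. p n \<noteq> None"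
  proof -
    have "bd v None z = 1 / A" using Some by (simp add: bd_def hs_def hn_simps berk_form_def vnorm_def A_def)
    then have "bd v None z > 0" using A by simp
    then have "\<forall>\<^sub>F n in sequentially. bd v (p n) z < bd v None z" by (rule order_tendstoD(2)[OF lim])
    then show ?thesis by (rule eventually_mono) (metis less_irrefl)
  qed
  define X where "X n = the (p n)" for n
  have pX: "p n = Some (X n)" "X n \<in> berkA v" if "p n \<noteq> None" for n
    using that p[of n] by (auto simp: X_def berkP1_def)
  define t where "t n = X n [:- a0, 1:]" for n
  \<comment> \<open>The definition of \<open>bd\<close> gives only
    \<open>t n <= bd * (t n + A) * A\<close>; smallness of \<open>bd\<close> lets the occurrence of
    \<open>t n\<close> on the right be absorbed.\<close>
  have tb: "t n \<le> 4 * A * A * bd v (p n) z" if n: "p n \<noteq> None" and small: "bd v (p n) z < 1 / (2 * A)" for n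
  proof -
    note x = pX(2)[OF n]
    have t0: "0 \<le> t n" using berkA_nonneg[OF x] by (simp add: t_def)
    have b0: "0 \<le> bd v (p n) z" by (rule bd_nonneg[OF p])
    have "[:0, 1:] = [:- a0, 1:] + [:a0:]" by simp
    then have "X n [:0, 1:] \<le> t n + v a0" using berkA_add[OF x, of "[:- a0, 1:]" "[:a0:]"] berkA_const[OF x, of a0] by (simp add: t_def)
    then have m: "max 1 (X n [:0, 1:]) \<le> t n + A" using t0 A by (auto simp: A_def)
    have bdeq: "bd v (p n) z = t n / (max 1 (X n [:0, 1:]) * A)"
      using pX(1)[OF n] x Some by (simp add: bd_def hs_def hn_simps berk_form_def vnorm_def A_def t_def)
    have mp: "max 1 (X n [:0, 1:]) > 0" by simp
    then have "t n = bd v (p n) z * (max 1 (X n [:0, 1:]) * A)" unfolding bdeq using A by simp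
    also have "\<dots> \<le> bd v (p n) z * ((t n + A) * A)" using m b0 A by (intro mult_left_mono mult_right_mono) auto
    also have "\<dots> = bd v (p n) z * A * t n + bd v (p n) z * A * A" by (simp add: algebra_simps)
    finally have 1: "t n \<le> bd v (p n) z * A * t n + bd v (p n) z * A * A" .
    have "bd v (p n) z * A \<le> 1 / 2" using small A by (simp add: field_simps)
    then have "bd v (p n) z * A * t n \<le> 1 / 2 * t n" using t0 by (intro mult_right_mono) auto
    then have "t n \<le> 2 * (bd v (p n) z * A * A)" using 1 by linarith
    also have "\<dots> \<le> 4 * A * A * bd v (p n) z" using b0 A by simp
    finally show ?thesis .
  qed
  have smallev: "\<forall>\<^sub>F n in sequentially. bd v (p n) z < 1 / (2 * A)"
    using A by (intro order_tendstoD(2)[OF lim]) simp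
  have limu: "(\<lambda>n. 4 * A * A * bd v (p n) z) \<longlonglongrightarrow> 4 * A * A * 0" by (intro tendsto_mult tendsto_const lim)
  have limt: "(\<lambda>n. t n) \<longlonglongrightarrow> 0"
  proof (rule tendsto_sandwich[OF _ _ tendsto_const])
    show "\<forall>\<^sub>F n in sequentially. 0 \<le> t n" using some by eventually_elim (simp add: t_def berkA_nonneg pX)
    show "\<forall>\<^sub>F n in sequentially. t n \<le> 4 * A * A * bd v (p n) z"
      using some smallev by eventually_elim (rule tb)
    show "(\<lambda>n. 4 * A * A * bd v (p n) z) \<longlonglongrightarrow> 0" using limu by simp
  qed
  have ev: "(\<lambda>n. X n f) \<longlonglongrightarrow> v (poly f a0)" for f
  proof -
    define h where "h = synthetic_div f a0"
    have f: "f = [:poly f a0:] + [:- a0, 1:] * h"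
      using synthetic_div_correct'[of a0 f] by (simp add: h_def add.commute)
    define B where "B = (\<Sum>i\<le>degree h. v (coeff h i) * (1 + A) ^ i)"
    have bound: "\<bar>X n f - v (poly f a0)\<bar> \<le> t n * B" if n: "p n \<noteq> None" and tn: "t n < 1" for n
    proof -
      note x = pX(2)[OF n]
      have "[:0, 1:] = [:- a0, 1:] + [:a0:]" by simp
      then have "X n [:0, 1:] \<le> t n + v a0" using berkA_add[OF x, of "[:- a0, 1:]" "[:a0:]"] berkA_const[OF x, of a0] by (simp add: t_def)
      then have xT: "X n [:0, 1:] \<le> 1 + A" using tn by (simp add: A_def)
      have "h = (\<Sum>i\<le>degree h. monom (coeff h i) i)" by (rule poly_as_sum_of_monoms[symmetric])
      then have "X n h \<le> (\<Sum>i\<le>degree h. X n (monom (coeff h i) i))" using berkA_sum[OF x] by metis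
      also have "\<dots> = (\<Sum>i\<le>degree h. v (coeff h i) * X n [:0, 1:] ^ i)"
        by (simp add: monom_altdef berkA_smult[OF x] berkA_power[OF x])
      also have "\<dots> \<le> B" unfolding B_def using xT berkA_nonneg[OF x] by (intro sum_mono mult_left_mono power_mono) auto
      finally have hB: "X n h \<le> B" .
      have "\<bar>X n ([:poly f a0:] + [:- a0, 1:] * h) - X n [:poly f a0:]\<bar> \<le> X n ([:- a0, 1:] * h)"
        by (rule berkA_diff_le[OF x])
      also have "\<dots> = t n * X n h" by (simp only: berkA_mult[OF x] t_def)
      also have "\<dots> \<le> t n * B" using hB berkA_nonneg[OF x] by (intro mult_left_mono) (auto simp: t_def)
      finally show ?thesis unfolding f[symmetric] berkA_const[OF x] .
    qed
    have "\<forall>\<^sub>F n in sequentially. t n < 1" by (rule order_tendstoD(2)[OF limt]) simp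
    then have "\<forall>\<^sub>F n in sequentially. \<bar>X n f - v (poly f a0)\<bar> \<le> t n * B"
      using some by eventually_elim (rule bound)
    moreover have "(\<lambda>n. t n * B) \<longlonglongrightarrow> 0" using tendsto_mult[OF limt tendsto_const[of B]] by simp
    ultimately have "(\<lambda>n. X n f - v (poly f a0)) \<longlonglongrightarrow> 0"
      using Lim_null_comparison[of "\<lambda>n. X n f - v (poly f a0)" "\<lambda>n. t n * B" sequentially] by (simp only: real_norm_def)
    then show ?thesis by (simp add: LIM_zero_iff)
  qed
  consider (ball) f a b where "W = Some ` {x \<in> berkA v. a < x f \<and> x f < b}"
    | (inf) R where "W = insert None (Some ` {x \<in> berkA v. R < x [:0, 1:]})" using W by blast
  then show ?thesis
  proof cases
    case (ball f a b)
    then have "a < v (poly f a0)" "v (poly f a0) < b" using z Some by (auto simp: berk_emb_def)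
    then have "\<forall>\<^sub>F n in sequentially. a < X n f" "\<forall>\<^sub>F n in sequentially. X n f < b"
      using order_tendstoD[OF ev[of f]] by auto
    then show ?thesis using some by eventually_elim (use ball pX in auto)
  next
    case (inf R)
    then have "R < v (poly [:0, 1:] a0)" using z Some by (auto simp: berk_emb_def)
    then have "\<forall>\<^sub>F n in sequentially. R < X n [:0, 1:]" by (rule order_tendstoD(1)[OF ev])
    then show ?thesis using some by eventually_elim (use inf pX in auto)
  qed
qed

lemma bd_tendsto_open:
  assumes p: "\<And>n. p n \<in> berkP1 v" and lim: "(\<lambda>n. bd v (p n) z) \<longlonglongrightarrow> 0"
    and U: "openin (berk_top v) U" "berk_emb v z \<in> U"
  shows "\<forall>\<^sub>F n in sequentially. p n \<in> U"
proof -
  have "generate_topology_on ({Some ` {x \<in> berkA v. a < x f \<and> x f < b} | f a b. True} \<union> {insert None (Some ` {x \<in> berkA v. R < x [:0, 1:]}) | R. True}) U"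
    using U(1) unfolding berk_top_def by (rule openin_topology_generated_by)
  then show ?thesis using U(2)
  proof induction
    case (Int a b)
    then show ?case by (simp add: eventually_conj)
  next
    case (UN K)
    then obtain k where "k \<in> K" "berk_emb v z \<in> k" by auto
    then have "\<forall>\<^sub>F n in sequentially. p n \<in> k" using UN by blast
    then show ?case by eventually_elim (use \<open>k \<in> K\<close> in auto)
  next
    case (Basis s)
    then show ?case by (intro bd_tendsto_subbasic[OF p lim]) auto
  qed simp
qed

lemma bd_tendsto_continuous:
  assumes "\<And>n. p n \<in> berkP1 v" and "(\<lambda>n. bd v (p n) z) \<longlonglongrightarrow> 0"
    and f: "continuous_map (berk_top v) euclideanreal f"
  shows "(\<lambda>n. f (p n)) \<longlonglongrightarrow> f (berk_emb v z)"
proof (rule topological_tendstoI)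
  fix S assume S: "open S" "f (berk_emb v z) \<in> S"
  have "openin (berk_top v) {q \<in> topspace (berk_top v). f q \<in> S}"
    using S by (intro openin_continuous_map_preimage[OF f]) auto
  then have "\<forall>\<^sub>F n in sequentially. p n \<in> {q \<in> topspace (berk_top v). f q \<in> S}"
    using S berk_emb_mem by (intro bd_tendsto_open[OF assms(1,2)]) (auto simp: topspace_berk_top)
  then show "\<forall>\<^sub>F n in sequentially. f (p n) \<in> S" by eventually_elim auto
qed

lemma pd_open_berk_emb:
  assumes U: "openin (berk_top v) U" shows "pd_open {z. berk_emb v z \<in> U}"
  unfolding pd_open_def
proof (rule ccontr)
  assume "\<not> (\<forall>z\<in>{z. berk_emb v z \<in> U}. \<exists>e>0. \<forall>w. pd v z w < e \<longrightarrow> w \<in> {z. berk_emb v z \<in> U})"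
  then obtain z where z: "berk_emb v z \<in> U" "\<And>e. e > 0 \<Longrightarrow> \<exists>w. pd v z w < e \<and> berk_emb v w \<notin> U" by auto
  have "\<forall>n. \<exists>w. pd v z w < (1/2) ^ n \<and> berk_emb v w \<notin> U" using z(2) by simp
  then obtain w where w: "\<And>n. pd v z (w n) < (1/2) ^ n" "\<And>n. berk_emb v (w n) \<notin> U" by metis
  have half: "(\<lambda>n. (1/2 :: real) ^ n) \<longlonglongrightarrow> 0" by (intro LIMSEQ_realpow_zero) auto
  have "(\<lambda>n. bd v (berk_emb v (w n)) z) \<longlonglongrightarrow> 0"
    unfolding bd_emb using w(1) by (intro tendsto_sandwich[OF _ _ tendsto_const half]) (auto simp: pd_commute[of _ z] less_imp_le)
  then have "\<forall>\<^sub>F n in sequentially. berk_emb v (w n) \<in> U"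
    by (rule bd_tendsto_open[OF berk_emb_mem _ U z(1)])
  then show False using w(2) by (auto simp: eventually_sequentially)
qed

end

section \<open>Convergence in law to the stationary measure\<close>

lemma LIMSEQ_subseqI:
  fixes a :: "nat \<Rightarrow> real"
  assumes "\<And>r :: nat \<Rightarrow> nat. strict_mono r \<Longrightarrow> \<exists>s. strict_mono s \<and> (\<lambda>n. a (r (s n))) \<longlonglongrightarrow> L"
  shows "a \<longlonglongrightarrow> L"
proof (rule ccontr)
  assume "\<not> a \<longlonglongrightarrow> L"
  then obtain e where e: "e > 0" "\<And>N. \<exists>n\<ge>N. e \<le> dist (a n) L"
    unfolding LIMSEQ_def by (auto simp: not_less)
  have "infinite {n. e \<le> dist (a n) L}"
    unfolding infinite_nat_iff_unbounded_le using e(2) by auto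
  then obtain r :: "nat \<Rightarrow> nat" where r: "strict_mono r" "\<And>n. e \<le> dist (a (r n)) L"
    using infinite_enumerate by blast
  obtain s where "(\<lambda>n. a (r (s n))) \<longlonglongrightarrow> L" using assms[OF r(1)] by blast
  then obtain N where "\<forall>n\<ge>N. dist (a (r (s n))) L < e" using e(1) unfolding LIMSEQ_def by blast
  then show False using r(2)[of "s N"] by (metis le_refl not_le)
qed

lemma distr_rprod: "distr (Omega_P \<mu>) (count_space UNIV) (\<lambda>\<omega>. rprod \<omega> n) = measure_pmf (conv_pow \<mu> n)"
proof (rule measure_eqI)
  fix A assume "A \<in> sets (distr (Omega_P \<mu>) (count_space UNIV) (\<lambda>\<omega>. rprod \<omega> n))"
  have m: "(\<lambda>\<omega>. rprod \<omega> n) \<in> Omega_P \<mu> \<rightarrow>\<^sub>M count_space UNIV" by (rule rprod_measurable_fun) simp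
  then have ms: "(\<lambda>\<omega>. rprod \<omega> n) -` A \<inter> space (Omega_P \<mu>) \<in> sets (Omega_P \<mu>)" by (rule measurable_sets) simp
  have "emeasure (distr (Omega_P \<mu>) (count_space UNIV) (\<lambda>\<omega>. rprod \<omega> n)) A = emeasure (Omega_P \<mu>) ((\<lambda>\<omega>. rprod \<omega> n) -` A \<inter> space (Omega_P \<mu>))"
    by (rule emeasure_distr[OF m]) simp
  also have "\<dots> = (\<integral>\<^sup>+\<omega>. indicator ((\<lambda>\<omega>. rprod \<omega> n) -` A \<inter> space (Omega_P \<mu>)) \<omega> \<partial>Omega_P \<mu>)" using ms by simp
  also have "\<dots> = (\<integral>\<^sup>+\<omega>. indicator A (rprod \<omega> n) \<partial>Omega_P \<mu>)"
    by (rule nn_integral_cong) (simp add: indicator_def)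
  also have "\<dots> = (\<integral>\<^sup>+g. indicator A g \<partial>conv_pow \<mu> n)" by (rule nn_integral_rprod)
  finally show "emeasure (distr (Omega_P \<mu>) (count_space UNIV) (\<lambda>\<omega>. rprod \<omega> n)) A = emeasure (conv_pow \<mu> n) A" by simp
qed simp

lemma integral_rprod:
  fixes F :: "'k::field mat2 \<Rightarrow> real"
  shows "(\<integral>\<omega>. F (rprod \<omega> n) \<partial>Omega_P \<mu>) = measure_pmf.expectation (conv_pow \<mu> n) F"
proof -
  have m: "(\<lambda>\<omega>. rprod \<omega> n) \<in> Omega_P \<mu> \<rightarrow>\<^sub>M count_space UNIV" by (rule rprod_measurable_fun) simp
  show ?thesis unfolding distr_rprod[symmetric] by (rule integral_distr[OF m, symmetric]) simp
qed

text \<open>The constant is 2, not 1, since two terms are added by the ordinary triangle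
  inequality.\<close>

lemma (in complete_nonarch_val) bd_le_2:
  assumes p: "p \<in> berkP1 v" shows "bd v p z \<le> 2"
proof -
  have pos: "hn v p > 0" "vnorm v (pvec z) > 0" using hn_pos[OF p] by simp_all
  have "hs v p 1 (berk_form (pvec z)) \<le> (v (pvec z $ 2) + v (pvec z $ 1)) * hn v p"
    using hs_linear_le[OF p, of "- (pvec z $ 1)" "pvec z $ 2"] by (simp add: berk_form_def)
  also have "\<dots> \<le> (vnorm v (pvec z) + vnorm v (pvec z)) * hn v p"
    using pos v_le_vnorm by (intro mult_right_mono add_mono) auto
  finally show ?thesis using pos by (simp add: bd_def divide_le_eq mult.commute)
qed

section \<open>Laws of orbits and stationary measures\<close>

context nonelem_walk
begin

abbreviation "berk_borel \<equiv> borel_of_top (berk_top v)"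

lemma limit_pt_measurable:
  assumes "is_limit_pt Z" shows "(\<lambda>\<omega>. berk_emb v (Z \<omega>)) \<in> Omega_P \<mu> \<rightarrow>\<^sub>M berk_borel"
proof (rule measurable_borel_of_topI)
  fix U assume "openin (berk_top v) U"
  then show "{\<omega> \<in> space (Omega_P \<mu>). berk_emb v (Z \<omega>) \<in> U} \<in> sets (Omega_P \<mu>)"
    using limit_pt_sets[OF assms pd_open_berk_emb] by simp
qed (simp add: topspace_berk_top berk_emb_mem)

text \<open>Any random point that is close in mean to \<open>r_n\<close> applied to infinity
  converges in law to \<open>Z\<close>. It is used for images of a Berkovich point and for
  attracting fixed points. Mean convergence gives almost sure convergence along subsequences of
  subsequences, enough by \<open>LIMSEQ_subseqI\<close>.\<close>

lemma tendsto_expectation_limit_pt: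
  assumes Z: "is_limit_pt Z" and X: "\<And>n g. g \<in> SL2 \<Longrightarrow> X n g \<in> berkP1 v"
    and conv: "(\<lambda>n. \<integral>\<^sup>+g. ennreal (bd v (X n g) (moebius g None)) \<partial>conv_pow \<mu> n) \<longlonglongrightarrow> 0"
    and f: "continuous_map (berk_top v) euclideanreal f" and bdd: "\<And>p. p \<in> berkP1 v \<Longrightarrow> \<bar>f p\<bar> \<le> C"
  shows "(\<lambda>n. measure_pmf.expectation (conv_pow \<mu> n) (\<lambda>g. f (X n g))) \<longlonglongrightarrow> (\<integral>\<omega>. f (berk_emb v (Z \<omega>)) \<partial>Omega_P \<mu>)"
proof -
  let ?P = "Omega_P \<mu>"
  interpret P: prob_space ?P by (rule prob_space_Omega_P)
  define u where "u n \<omega> = bd v (X n (rprod \<omega> n)) (orbit_pt n \<omega>) + pd v (orbit_pt n \<omega>) (Z \<omega>)" for n \<omega>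
  have inS: "rprod \<omega> n \<in> SL2" if "\<omega> \<in> space ?P" for \<omega> n using rprod_mem[OF that] conv_in_SL2 by blast
  have m1: "(\<lambda>\<omega>. bd v (X n (rprod \<omega> n)) (orbit_pt n \<omega>)) \<in> borel_measurable ?P" for n
    by (rule rprod_measurable_fun[where F = "\<lambda>g. bd v (X n g) (moebius g None)"]) simp
  have um: "u n \<in> borel_measurable ?P" for n
    unfolding u_def using m1 limit_pt_dist_measurable[OF Z] by measurable
  have u0: "0 \<le> u n \<omega>" and u3: "u n \<omega> \<le> 3" and b0: "0 \<le> bd v (X n (rprod \<omega> n)) (orbit_pt n \<omega>)" if "\<omega> \<in> space ?P" for n \<omega>
    using bd_nonneg[OF X[OF inS[OF that]]] bd_le_2[OF X[OF inS[OF that]], of n n "orbit_pt n \<omega>"] pd_le_1[of "orbit_pt n \<omega>" "Z \<omega>"]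
    by (auto simp: u_def intro: add_mono[of _ 2 _ 1, simplified])
  have int: "integrable ?P (u n)" for n
    using um u0 u3 by (intro P.integrable_const_bound[where B = 3]) auto
  have nn: "(\<integral>\<^sup>+\<omega>. ennreal (u n \<omega>) \<partial>?P) = (\<integral>\<^sup>+g. ennreal (bd v (X n g) (moebius g None)) \<partial>conv_pow \<mu> n)
      + (\<integral>\<^sup>+\<omega>. ennreal (pd v (orbit_pt n \<omega>) (Z \<omega>)) \<partial>?P)" for n
  proof -
    have "(\<integral>\<^sup>+\<omega>. ennreal (u n \<omega>) \<partial>?P) = (\<integral>\<^sup>+\<omega>. ennreal (bd v (X n (rprod \<omega> n)) (orbit_pt n \<omega>)) + ennreal (pd v (orbit_pt n \<omega>) (Z \<omega>)) \<partial>?P)"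
      using b0 by (intro nn_integral_cong) (simp add: u_def ennreal_plus)
    also have "\<dots> = (\<integral>\<^sup>+\<omega>. ennreal (bd v (X n (rprod \<omega> n)) (orbit_pt n \<omega>)) \<partial>?P) + (\<integral>\<^sup>+\<omega>. ennreal (pd v (orbit_pt n \<omega>) (Z \<omega>)) \<partial>?P)"
      using m1 limit_pt_dist_measurable[OF Z] by (intro nn_integral_add) auto
    also have "(\<integral>\<^sup>+\<omega>. ennreal (bd v (X n (rprod \<omega> n)) (orbit_pt n \<omega>)) \<partial>?P) = (\<integral>\<^sup>+g. ennreal (bd v (X n g) (moebius g None)) \<partial>conv_pow \<mu> n)"
      by (rule nn_integral_rprod)
    finally show ?thesis .
  qed
  have "(\<lambda>n. (\<integral>\<^sup>+g. ennreal (bd v (X n g) (moebius g None)) \<partial>conv_pow \<mu> n)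
      + (\<integral>\<^sup>+\<omega>. ennreal (pd v (orbit_pt n \<omega>) (Z \<omega>)) \<partial>?P)) \<longlonglongrightarrow> 0 + 0"
    using Z by (intro tendsto_add conv) (simp add: is_limit_pt_def)
  then have "(\<lambda>n. \<integral>\<^sup>+\<omega>. ennreal (u n \<omega>) \<partial>?P) \<longlonglongrightarrow> 0" unfolding nn by simp
  then have "(\<lambda>n. enn2real (\<integral>\<^sup>+\<omega>. ennreal (u n \<omega>) \<partial>?P)) \<longlonglongrightarrow> enn2real 0"
    by (intro tendsto_enn2real) auto
  moreover have "enn2real (\<integral>\<^sup>+\<omega>. ennreal (u n \<omega>) \<partial>?P) = (\<integral>\<omega>. norm (u n \<omega>) \<partial>?P)" for n
  proof -
    have "(\<integral>\<omega>. norm (u n \<omega>) \<partial>?P) = (\<integral>\<omega>. u n \<omega> \<partial>?P)"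
      using u0 by (intro Bochner_Integration.integral_cong) auto
    also have "\<dots> = enn2real (\<integral>\<^sup>+\<omega>. ennreal (u n \<omega>) \<partial>?P)"
      using um u0 by (intro integral_eq_nn_integral) auto
    finally show ?thesis ..
  qed
  ultimately have L1: "(\<lambda>n. \<integral>\<omega>. norm (u n \<omega>) \<partial>?P) \<longlonglongrightarrow> 0" by simp
  let ?L = "\<integral>\<omega>. f (berk_emb v (Z \<omega>)) \<partial>?P"
  have fm: "f \<in> borel_measurable berk_borel" by (rule continuous_real_measurable[OF f])
  have "(\<lambda>n. \<integral>\<omega>. f (X n (rprod \<omega> n)) \<partial>?P) \<longlonglongrightarrow> ?L"
  proof (rule LIMSEQ_subseqI)
    fix r :: "nat \<Rightarrow> nat" assume r: "strict_mono r"
    have "(\<lambda>n. \<integral>\<omega>. norm (u (r n) \<omega>) \<partial>?P) \<longlonglongrightarrow> 0"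
      using LIMSEQ_subseq_LIMSEQ[OF L1 r] by (simp add: comp_def)
    then obtain s where s: "strict_mono s" "AE \<omega> in ?P. (\<lambda>n. u (r (s n)) \<omega>) \<longlonglongrightarrow> 0"
      using tendsto_L1_AE_subseq[of ?P "\<lambda>n. u (r n)"] int by blast
    have "(\<lambda>n. \<integral>\<omega>. f (X (r (s n)) (rprod \<omega> (r (s n)))) \<partial>?P) \<longlonglongrightarrow> ?L"
    proof (rule integral_dominated_convergence[where w = "\<lambda>_. C"])
      show "(\<lambda>\<omega>. f (berk_emb v (Z \<omega>))) \<in> borel_measurable ?P"
        by (rule measurable_compose[OF limit_pt_measurable[OF Z] fm])
      show "(\<lambda>\<omega>. f (X (r (s n)) (rprod \<omega> (r (s n))))) \<in> borel_measurable ?P" for n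
        by (rule rprod_measurable_fun) simp
      show "integrable ?P (\<lambda>_. C)" by simp
      show "AE \<omega> in ?P. norm (f (X (r (s n)) (rprod \<omega> (r (s n))))) \<le> C" for n
        using bdd X inS by (intro AE_I2) simp
      show "AE \<omega> in ?P. (\<lambda>n. f (X (r (s n)) (rprod \<omega> (r (s n))))) \<longlonglongrightarrow> f (berk_emb v (Z \<omega>))"
      proof (rule AE_mp[OF s(2)], rule AE_I2, rule impI)
        fix \<omega> assume w: "\<omega> \<in> space ?P" and l: "(\<lambda>n. u (r (s n)) \<omega>) \<longlonglongrightarrow> 0"
        have mem: "X n (rprod \<omega> m) \<in> berkP1 v" for n m using X inS[OF w] by blast
        show "(\<lambda>n. f (X (r (s n)) (rprod \<omega> (r (s n))))) \<longlonglongrightarrow> f (berk_emb v (Z \<omega>))"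
        proof (rule bd_tendsto_continuous[OF mem _ f])
          show "(\<lambda>n. bd v (X (r (s n)) (rprod \<omega> (r (s n)))) (Z \<omega>)) \<longlonglongrightarrow> 0"
            using bd_nonneg[OF mem] bd_triangle[OF mem]
            by (intro tendsto_sandwich[OF _ _ tendsto_const l]) (auto simp: u_def)
        qed
      qed
    qed
    then show "\<exists>s. strict_mono s \<and> (\<lambda>n. \<integral>\<omega>. f (X (r (s n)) (rprod \<omega> (r (s n)))) \<partial>?P) \<longlonglongrightarrow> ?L"
      using s(1) by blast
  qed
  moreover have "(\<integral>\<omega>. f (X n (rprod \<omega> n)) \<partial>?P) = measure_pmf.expectation (conv_pow \<mu> n) (\<lambda>g. f (X n g))" for n
    by (rule integral_rprod)
  ultimately show ?thesis by (simp only:)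
qed

text \<open>Condition on the first increment and use the equivariance of \<open>Z\<close>.\<close>

lemma limit_pt_stationary:
  assumes Z: "is_limit_pt Z"
  shows "stationary v \<mu> (distr (Omega_P \<mu>) berk_borel (\<lambda>\<omega>. berk_emb v (Z \<omega>)))"
proof -
  let ?P = "Omega_P \<mu>"
  let ?\<nu> = "distr ?P berk_borel (\<lambda>\<omega>. berk_emb v (Z \<omega>))"
  interpret P: prob_space ?P by (rule prob_space_Omega_P)
  note m = limit_pt_measurable[OF Z]
  have nu: "emeasure ?\<nu> B = (\<integral>\<^sup>+\<omega>. indicator B (berk_emb v (Z \<omega>)) \<partial>?P)" if B: "B \<in> sets berk_borel" for B
  proof -
    have "emeasure ?\<nu> B = (\<integral>\<^sup>+p. indicator B p \<partial>?\<nu>)" using B by simp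
    also have "\<dots> = (\<integral>\<^sup>+\<omega>. indicator B (berk_emb v (Z \<omega>)) \<partial>?P)" using B by (intro nn_integral_distr[OF m]) simp
    finally show ?thesis .
  qed
  show ?thesis unfolding stationary_def
  proof (intro conjI ballI)
    show "prob_space ?\<nu>" by (rule P.prob_space_distr[OF m])
    show "sets ?\<nu> = sets berk_borel" by simp
    fix B assume "B \<in> sets ?\<nu>"
    then have B: "B \<in> sets berk_borel" by simp
    have "emeasure ?\<nu> B = (\<integral>\<^sup>+\<omega>. indicator B (berk_emb v (Z \<omega>)) \<partial>?P)" by (rule nu[OF B])
    also have "\<dots> = (\<integral>\<^sup>+g. \<integral>\<^sup>+\<omega>. indicator B (berk_emb v (Z (case_nat g \<omega>))) \<partial>?P \<partial>\<mu>)"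
      using B by (intro nn_integral_Omega_P_case_nat measurable_compose[OF m]) simp
    also have "\<dots> = (\<integral>\<^sup>+g. emeasure ?\<nu> (berk_act v g -` B \<inter> space ?\<nu>) \<partial>\<mu>)"
    proof (rule nn_integral_cong_AE, simp only: AE_measure_pmf_iff, intro ballI)
      fix g assume g: "g \<in> set_pmf \<mu>"
      then have gS: "g \<in> SL2" using supp by blast
      have gm: "berk_act v g -` B \<inter> space berk_borel \<in> sets berk_borel"
        by (rule measurable_sets[OF continuous_map_measurable[OF continuous_berk_act[OF gS]] B])
      have "(\<integral>\<^sup>+\<omega>. indicator B (berk_emb v (Z (case_nat g \<omega>))) \<partial>?P) =
         (\<integral>\<^sup>+\<omega>. indicator (berk_act v g -` B \<inter> space berk_borel) (berk_emb v (Z \<omega>)) \<partial>?P)"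
        using limit_pt_equivariant[OF Z g]
      proof (intro nn_integral_cong_AE, elim AE_mp, intro AE_I2 impI)
        fix \<omega> assume "Z (case_nat g \<omega>) = moebius g (Z \<omega>)"
        then have "berk_emb v (Z (case_nat g \<omega>)) = berk_act v g (berk_emb v (Z \<omega>))" by (simp add: berk_act_emb[OF gS])
        then show "indicator B (berk_emb v (Z (case_nat g \<omega>))) = (indicator (berk_act v g -` B \<inter> space berk_borel) (berk_emb v (Z \<omega>)) :: ennreal)"
          by (simp add: indicator_def topspace_berk_top berk_emb_mem)
      qed
      also have "\<dots> = emeasure ?\<nu> (berk_act v g -` B \<inter> space berk_borel)" by (rule nu[OF gm, symmetric])
      finally show "(\<integral>\<^sup>+\<omega>. indicator B (berk_emb v (Z (case_nat g \<omega>))) \<partial>?P) = emeasure ?\<nu> (berk_act v g -` B \<inter> space ?\<nu>)" by simp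
    qed
    finally show "emeasure ?\<nu> B = (\<integral>\<^sup>+g. emeasure ?\<nu> (berk_act v g -` B \<inter> space ?\<nu>) \<partial>\<mu>)" .
  qed
qed

lemma stationary_conv_pow:
  assumes st: "stationary v \<mu> \<nu>" shows "stationary v (conv_pow \<mu> (Suc n)) \<nu>"
proof (induction n)
  case 0 show ?case using st unfolding conv_pow_1 .
next
  case (Suc n)
  have sets_eq: "sets \<nu> = sets berk_borel" using st by (simp add: stationary_def)
  then have space_eq: "space \<nu> = berkP1 v" using sets_eq_imp_space_eq[OF sets_eq] by (simp add: topspace_berk_top)
  have "emeasure \<nu> B = (\<integral>\<^sup>+g. emeasure \<nu> (berk_act v g -` B \<inter> space \<nu>) \<partial>conv_pow \<mu> (Suc (Suc n)))" if B: "B \<in> sets \<nu>" for B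
  proof -
    have "emeasure \<nu> B = (\<integral>\<^sup>+a. emeasure \<nu> (berk_act v a -` B \<inter> space \<nu>) \<partial>conv_pow \<mu> (Suc n))"
      using Suc B unfolding stationary_def by blast
    also have "\<dots> = (\<integral>\<^sup>+a. \<integral>\<^sup>+b. emeasure \<nu> (berk_act v (a ** b) -` B \<inter> space \<nu>) \<partial>\<mu> \<partial>conv_pow \<mu> (Suc n))"
    proof (rule nn_integral_cong_AE, simp only: AE_measure_pmf_iff, intro ballI)
      fix a assume "a \<in> set_pmf (conv_pow \<mu> (Suc n))"
      then have a: "a \<in> SL2" by (rule conv_in_SL2)
      have "berk_act v a -` B \<inter> space berk_borel \<in> sets berk_borel"
        using B sets_eq by (intro measurable_sets[OF continuous_map_measurable[OF continuous_berk_act[OF a]]]) simp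
      then have am: "berk_act v a -` B \<inter> space \<nu> \<in> sets \<nu>" using sets_eq space_eq by (simp add: topspace_berk_top)
      have "emeasure \<nu> (berk_act v a -` B \<inter> space \<nu>) = (\<integral>\<^sup>+b. emeasure \<nu> (berk_act v b -` (berk_act v a -` B \<inter> space \<nu>) \<inter> space \<nu>) \<partial>\<mu>)"
        using st am unfolding stationary_def by blast
      also have "\<dots> = (\<integral>\<^sup>+b. emeasure \<nu> (berk_act v (a ** b) -` B \<inter> space \<nu>) \<partial>\<mu>)"
      proof (rule nn_integral_cong_AE, simp only: AE_measure_pmf_iff, intro ballI)
        fix b assume "b \<in> set_pmf \<mu>"
        then have b: "b \<in> SL2" using supp by blast
        have "berk_act v b -` (berk_act v a -` B \<inter> space \<nu>) \<inter> space \<nu> = berk_act v (a ** b) -` B \<inter> space \<nu>"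
          unfolding space_eq using berk_act_mult[OF _ a b] berk_act_mem[OF _ b] by auto
        then show "emeasure \<nu> (berk_act v b -` (berk_act v a -` B \<inter> space \<nu>) \<inter> space \<nu>) = emeasure \<nu> (berk_act v (a ** b) -` B \<inter> space \<nu>)" by simp
      qed
      finally show "emeasure \<nu> (berk_act v a -` B \<inter> space \<nu>) = (\<integral>\<^sup>+b. emeasure \<nu> (berk_act v (a ** b) -` B \<inter> space \<nu>) \<partial>\<mu>)" .
    qed
    also have "\<dots> = (\<integral>\<^sup>+g. emeasure \<nu> (berk_act v g -` B \<inter> space \<nu>) \<partial>conv_pow \<mu> (Suc (Suc n)))"
      unfolding conv_pow.simps(2)[of \<mu> "Suc n"] by simp
    finally show ?thesis .
  qed
  then show ?case using st unfolding stationary_def by blast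
qed

lemma nn_integral_tendsto_0I:
  assumes \<phi>: "\<And>n g. g \<in> SL2 \<Longrightarrow> 0 \<le> \<phi> n g \<and> \<phi> n g \<le> (2::real)"
    and prob: "\<And>e \<eta>. e > 0 \<Longrightarrow> \<eta> > 0 \<Longrightarrow> \<exists>n0. \<forall>n\<ge>n0. measure (conv_pow \<mu> n) {g. \<phi> n g > e} \<le> \<eta>"
  shows "(\<lambda>n. \<integral>\<^sup>+g. ennreal (\<phi> n g) \<partial>conv_pow \<mu> n) \<longlonglongrightarrow> 0"
proof (rule order_tendstoI)
  fix a :: ennreal assume a: "a > 0"
  then obtain b where b: "0 < b" "b < a" using dense by blast
  then have "b < top" using top.extremum less_le_trans by blast
  define c where "c = enn2real b"
  have c: "c > 0" "ennreal c < a" using b \<open>b < top\<close> by (simp_all add: c_def enn2real_positive_iff)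
  have c6: "c / 2 > 0" "c / 4 > 0" using c by auto
  obtain n0 where n0: "\<And>n. n \<ge> n0 \<Longrightarrow> measure (conv_pow \<mu> n) {g. \<phi> n g > c / 2} \<le> c / 4" using prob[OF c6] by blast
  have "(\<integral>\<^sup>+g. ennreal (\<phi> n g) \<partial>conv_pow \<mu> n) < a" if n: "n \<ge> n0" for n
  proof -
    have "(\<integral>\<^sup>+g. ennreal (\<phi> n g) \<partial>conv_pow \<mu> n) \<le> (\<integral>\<^sup>+g. ennreal (c / 2) + 2 * indicator {g. \<phi> n g > c / 2} g \<partial>conv_pow \<mu> n)"
    proof (rule nn_integral_mono_AE, simp only: AE_measure_pmf_iff, intro ballI)
      fix g assume "g \<in> set_pmf (conv_pow \<mu> n)"
      then have "0 \<le> \<phi> n g" "\<phi> n g \<le> 2" using \<phi> conv_in_SL2 by blast+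
      then show "ennreal (\<phi> n g) \<le> ennreal (c / 2) + 2 * indicator {g. \<phi> n g > c / 2} g"
        using ennreal_leI[of "\<phi> n g" 2] ennreal_leI[of "\<phi> n g" "c / 2"]
        by (auto simp: indicator_def intro: order_trans[OF _ add_increasing[OF _ order_refl]])
    qed
    also have "\<dots> = ennreal (c / 2) + 2 * emeasure (conv_pow \<mu> n) {g. \<phi> n g > c / 2}"
      by (subst nn_integral_add) (simp_all add: nn_integral_cmult measure_pmf.emeasure_space_1)
    also have "\<dots> \<le> ennreal (c / 2) + 2 * ennreal (c / 4)"
      using n0[OF n] by (intro add_mono mult_left_mono) (auto simp: measure_pmf.emeasure_eq_measure intro: ennreal_leI)
    also have "\<dots> = ennreal (c / 2) + ennreal (2 * (c / 4))" using c by (subst ennreal_mult) auto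
    also have "\<dots> = ennreal c" using c by (simp flip: ennreal_plus)
    also have "\<dots> < a" by (rule c(2))
    finally show ?thesis .
  qed
  then show "\<forall>\<^sub>F n in sequentially. (\<integral>\<^sup>+g. ennreal (\<phi> n g) \<partial>conv_pow \<mu> n) < a"
    by (rule eventually_sequentiallyI)
qed simp

text \<open>By \<open>bd_berk_act_le\<close> the distance is small once the images of
  \<open>w\<close> and of the base vector are long. \<open>K\<close> is chosen so that the resulting
  bound is at most \<open>e\<close>.\<close>

lemma berk_act_conv:
  assumes p: "p \<in> berkP1 v"
  shows "(\<lambda>n. \<integral>\<^sup>+g. ennreal (bd v (berk_act v g p) (moebius g None)) \<partial>conv_pow \<mu> n) \<longlonglongrightarrow> 0"
proof (rule nn_integral_tendsto_0I)
  fix n :: nat and g :: "'k mat2" assume "g \<in> SL2"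
  then show "0 \<le> bd v (berk_act v g p) (moebius g None) \<and> bd v (berk_act v g p) (moebius g None) \<le> 2"
    using bd_nonneg bd_le_2 berk_act_mem[OF p] by blast
next
  fix e \<eta> :: real assume e: "e > 0" and \<eta>: "\<eta> > 0"
  obtain C w where w: "w \<noteq> 0" "C \<ge> 0" "\<And>A. A \<in> SL2 \<Longrightarrow> bd v (berk_act v A p) (moebius A None) \<le> C / (vnorm v (A *v w) * vnorm v (A *v pvec None))"
    using bd_berk_act_le[OF p, of None] by auto
  let ?y = "pvec None :: 'k^2"
  have y: "?y \<noteq> 0" "vnorm v ?y = 1" by (simp_all add: vnorm_def)
  have W: "vnorm v w > 0" using w by simp
  define K where "K = max 1 (C / (e * vnorm v w))"
  have "C / (e * vnorm v w) \<le> K" by (simp add: K_def)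
  then have "C \<le> K * (e * vnorm v w)" using e W by (subst (asm) pos_divide_le_eq) simp_all
  then have K: "K \<ge> 1" "C \<le> e * (K * vnorm v w)" by (simp_all add: K_def mult_ac)
  have \<eta>2: "\<eta> / 2 > 0" using \<eta> by simp
  obtain n0 where n0: "\<And>n x. n \<ge> n0 \<Longrightarrow> x \<noteq> 0 \<Longrightarrow> measure (conv_pow \<mu> n) {g. vnorm v (g *v x) \<le> K * vnorm v x} \<le> \<eta> / 2"
    using vector_norm_escape[OF \<eta>2, of K] by auto
  have "measure (conv_pow \<mu> n) {g. bd v (berk_act v g p) (moebius g None) > e} \<le> \<eta>" if n: "n \<ge> n0" for n
  proof -
    let ?A = "\<lambda>x. {g. vnorm v (g *v x) \<le> K * vnorm v x}"
    have "g \<in> ?A w \<union> ?A ?y" if g: "g \<in> SL2" and big: "bd v (berk_act v g p) (moebius g None) > e" for g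
    proof (rule ccontr)
      assume "g \<notin> ?A w \<union> ?A ?y"
      then have h: "K * vnorm v w < vnorm v (g *v w)" "K < vnorm v (g *v ?y)" using y by auto
      have "bd v (berk_act v g p) (moebius g None) \<le> C / (vnorm v (g *v w) * vnorm v (g *v ?y))" by (rule w(3)[OF g])
      also have "\<dots> \<le> C / (K * vnorm v w * 1)"
        using h K W w g by (intro divide_left_mono mult_mono mult_pos_pos) (auto intro: less_imp_le)
      also have "\<dots> \<le> e" using K W by (simp add: divide_le_eq)
      finally show False using big by simp
    qed
    then have "measure (conv_pow \<mu> n) {g. bd v (berk_act v g p) (moebius g None) > e} \<le> measure (conv_pow \<mu> n) (?A w \<union> ?A ?y)"
      using conv_in_SL2 by (intro measure_pmf.finite_measure_mono_AE) (auto simp: AE_measure_pmf_iff)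
    also have "\<dots> \<le> measure (conv_pow \<mu> n) (?A w) + measure (conv_pow \<mu> n) (?A ?y)" by (rule measure_Un_le) auto
    also have "\<dots> \<le> \<eta> / 2 + \<eta> / 2" using n0[OF n w(1)] n0[OF n y(1)] by (intro add_mono)
    finally show ?thesis by simp
  qed
  then show "\<exists>n0. \<forall>n\<ge>n0. measure (conv_pow \<mu> n) {g. bd v (berk_act v g p) (moebius g None) > e} \<le> \<eta>" by blast
qed

text \<open>By stationarity \<nu> is the law of \<open>r_n p\<close> with \<open>p\<close> of law
  \<nu> independent of the walk. For each fixed \<open>p\<close> these points converge in law to
  \<open>Z\<close>, and dominated convergence in \<open>p\<close> finishes. Indices are successors
  because stationarity is iterated from one step on.\<close>

lemma stationary_integral:
  assumes Z: "is_limit_pt Z" and st: "stationary v \<mu> \<nu>"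
    and f: "continuous_map (berk_top v) euclideanreal f" and bdd: "\<And>p. p \<in> berkP1 v \<Longrightarrow> \<bar>f p\<bar> \<le> C"
  shows "(\<integral>p. f p \<partial>\<nu>) = (\<integral>\<omega>. f (berk_emb v (Z \<omega>)) \<partial>Omega_P \<mu>)"
proof -
  let ?P = "Omega_P \<mu>"
  let ?L = "\<integral>\<omega>. f (berk_emb v (Z \<omega>)) \<partial>?P"
  interpret P: prob_space ?P by (rule prob_space_Omega_P)
  interpret N: prob_space \<nu> using st by (simp add: stationary_def)
  interpret NP: pair_prob_space \<nu> ?P ..
  have sets_eq [measurable_cong]: "sets \<nu> = sets berk_borel" using st by (simp add: stationary_def)
  have space_eq: "space \<nu> = berkP1 v" using sets_eq_imp_space_eq[OF sets_eq] by (simp add: topspace_berk_top)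
  have fm: "f \<in> borel_measurable \<nu>" using continuous_real_measurable[OF f] measurable_cong_sets[OF sets_eq refl] by blast
  have actm: "berk_act v g \<in> \<nu> \<rightarrow>\<^sub>M \<nu>" if "g \<in> SL2" for g
    using continuous_map_measurable[OF continuous_berk_act[OF that]] measurable_cong_sets[OF sets_eq sets_eq] by blast
  define T where "T n = (\<lambda>(p, \<omega>). berk_act v (rprod \<omega> n) p)" for n
  have Tm: "T n \<in> \<nu> \<Otimes>\<^sub>M ?P \<rightarrow>\<^sub>M \<nu>" for n
  proof -
    have "(\<lambda>x. (\<lambda>g x. berk_act v g (fst x)) (rprod (snd x) n) x) \<in> \<nu> \<Otimes>\<^sub>M ?P \<rightarrow>\<^sub>M \<nu>"
    proof (rule measurable_compose_countable'[where f = "\<lambda>g x. berk_act v g (fst x)" and I = "set_pmf (conv_pow \<mu> n)"])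
      show "(\<lambda>x. berk_act v g (fst x)) \<in> \<nu> \<Otimes>\<^sub>M ?P \<rightarrow>\<^sub>M \<nu>" if "g \<in> set_pmf (conv_pow \<mu> n)" for g
        by (rule measurable_compose[OF measurable_fst actm[OF conv_in_SL2[OF that]]])
      show "(\<lambda>x. rprod (snd x) n) \<in> \<nu> \<Otimes>\<^sub>M ?P \<rightarrow>\<^sub>M count_space (set_pmf (conv_pow \<mu> n))"
        by (rule measurable_compose[OF measurable_snd rprod_measurable])
    qed simp
    then show ?thesis by (simp add: T_def split_beta')
  qed
  have dist: "distr (\<nu> \<Otimes>\<^sub>M ?P) \<nu> (T (Suc n)) = \<nu>" for n
  proof (rule measure_eqI)
    fix B assume "B \<in> sets (distr (\<nu> \<Otimes>\<^sub>M ?P) \<nu> (T (Suc n)))"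
    then have B: "B \<in> sets \<nu>" by simp
    have TB: "T (Suc n) -` B \<inter> space (\<nu> \<Otimes>\<^sub>M ?P) \<in> sets (\<nu> \<Otimes>\<^sub>M ?P)" by (rule measurable_sets[OF Tm B])
    have "emeasure (distr (\<nu> \<Otimes>\<^sub>M ?P) \<nu> (T (Suc n))) B = emeasure (\<nu> \<Otimes>\<^sub>M ?P) (T (Suc n) -` B \<inter> space (\<nu> \<Otimes>\<^sub>M ?P))"
      by (rule emeasure_distr[OF Tm B])
    also have "\<dots> = (\<integral>\<^sup>+\<omega>. emeasure \<nu> ((\<lambda>p. (p, \<omega>)) -` (T (Suc n) -` B \<inter> space (\<nu> \<Otimes>\<^sub>M ?P))) \<partial>?P)"
      by (rule NP.emeasure_pair_measure_alt2[OF TB])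
    also have "\<dots> = (\<integral>\<^sup>+\<omega>. emeasure \<nu> (berk_act v (rprod \<omega> (Suc n)) -` B \<inter> space \<nu>) \<partial>?P)"
      by (intro nn_integral_cong arg_cong[where f = "emeasure \<nu>"]) (auto simp: T_def space_pair_measure)
    also have "\<dots> = (\<integral>\<^sup>+g. emeasure \<nu> (berk_act v g -` B \<inter> space \<nu>) \<partial>conv_pow \<mu> (Suc n))"
      by (rule nn_integral_rprod)
    also have "\<dots> = emeasure \<nu> B" using stationary_conv_pow[OF st, of n] B unfolding stationary_def by metis
    finally show "emeasure (distr (\<nu> \<Otimes>\<^sub>M ?P) \<nu> (T (Suc n))) B = emeasure \<nu> B" .
  qed simp
  have fTm: "(\<lambda>x. f (T n x)) \<in> borel_measurable (\<nu> \<Otimes>\<^sub>M ?P)" for n by (rule measurable_compose[OF Tm fm])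
  have fTb: "\<bar>f (T n x)\<bar> \<le> C" if "x \<in> space (\<nu> \<Otimes>\<^sub>M ?P)" for n x
    using measurable_space[OF Tm that, of n] bdd space_eq by auto
  have int: "integrable (\<nu> \<Otimes>\<^sub>M ?P) (\<lambda>x. f (T n x))" for n
    using fTm fTb by (intro NP.integrable_const_bound[where B = C]) auto
  have const: "(\<integral>p. \<integral>\<omega>. f (T (Suc n) (p, \<omega>)) \<partial>?P \<partial>\<nu>) = (\<integral>p. f p \<partial>\<nu>)" for n
  proof -
    have "(\<integral>p. f p \<partial>\<nu>) = (\<integral>p. f p \<partial>distr (\<nu> \<Otimes>\<^sub>M ?P) \<nu> (T (Suc n)))" by (simp only: dist)
    also have "\<dots> = (\<integral>x. f (T (Suc n) x) \<partial>(\<nu> \<Otimes>\<^sub>M ?P))" by (rule integral_distr[OF Tm fm])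
    also have "\<dots> = (\<integral>p. \<integral>\<omega>. f (T (Suc n) (p, \<omega>)) \<partial>?P \<partial>\<nu>)" by (rule NP.integral_fst'[OF int, symmetric])
    finally show ?thesis ..
  qed
  have "(\<lambda>n. \<integral>p. \<integral>\<omega>. f (T (Suc n) (p, \<omega>)) \<partial>?P \<partial>\<nu>) \<longlonglongrightarrow> (\<integral>p. ?L \<partial>\<nu>)"
  proof (rule integral_dominated_convergence[where w = "\<lambda>_. C"])
    show "(\<lambda>p. \<integral>\<omega>. f (T (Suc n) (p, \<omega>)) \<partial>?P) \<in> borel_measurable \<nu>" for n
      by (rule P.borel_measurable_lebesgue_integral) (use fTm[of "Suc n"] in \<open>simp add: split_beta'\<close>)
    show "AE p in \<nu>. (\<lambda>n. \<integral>\<omega>. f (T (Suc n) (p, \<omega>)) \<partial>?P) \<longlonglongrightarrow> ?L"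
    proof (rule AE_I2)
      fix p assume "p \<in> space \<nu>"
      then have p: "p \<in> berkP1 v" by (simp add: space_eq)
      have "(\<lambda>n. measure_pmf.expectation (conv_pow \<mu> n) (\<lambda>g. f (berk_act v g p))) \<longlonglongrightarrow> ?L"
        by (rule tendsto_expectation_limit_pt[OF Z berk_act_mem[OF p] berk_act_conv[OF p] f bdd])
      moreover have "(\<integral>\<omega>. f (berk_act v (rprod \<omega> n) p) \<partial>?P) = measure_pmf.expectation (conv_pow \<mu> n) (\<lambda>g. f (berk_act v g p))" for n
        by (rule integral_rprod)
      ultimately have "(\<lambda>n. \<integral>\<omega>. f (berk_act v (rprod \<omega> n) p) \<partial>?P) \<longlonglongrightarrow> ?L" by (simp only:)
      from LIMSEQ_Suc[OF this] show "(\<lambda>n. \<integral>\<omega>. f (T (Suc n) (p, \<omega>)) \<partial>?P) \<longlonglongrightarrow> ?L" by (simp add: T_def del: rprod.simps)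
    qed
    show "AE p in \<nu>. norm (\<integral>\<omega>. f (T (Suc n) (p, \<omega>)) \<partial>?P) \<le> C" for n
    proof (rule AE_I2)
      fix p assume p: "p \<in> space \<nu>"
      have b: "\<bar>f (T (Suc n) (p, \<omega>))\<bar> \<le> C" if "\<omega> \<in> space ?P" for \<omega>
        using fTb[of "(p, \<omega>)" "Suc n"] p that by (simp add: space_pair_measure)
      have "norm (\<integral>\<omega>. f (T (Suc n) (p, \<omega>)) \<partial>?P) \<le> (\<integral>\<omega>. norm (f (T (Suc n) (p, \<omega>))) \<partial>?P)" by (rule integral_norm_bound)
      also have "\<dots> \<le> (\<integral>\<omega>. C \<partial>?P)"
      proof (rule integral_mono)
        show "integrable ?P (\<lambda>\<omega>. norm (f (T (Suc n) (p, \<omega>))))"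
          using b fTm[of "Suc n"] p by (intro P.integrable_const_bound[where B = C]) (auto intro!: measurable_compose[OF measurable_Pair1' fTm])
      qed (use b in auto)
      finally show "norm (\<integral>\<omega>. f (T (Suc n) (p, \<omega>)) \<partial>?P) \<le> C" by (simp add: P.prob_space)
    qed
  qed auto
  then have "(\<lambda>n::nat. \<integral>p. f p \<partial>\<nu>) \<longlonglongrightarrow> ?L" unfolding const by (simp add: N.prob_space)
  then show ?thesis using LIMSEQ_unique tendsto_const by blast
qed

text \<open>The attracting point is its own image under \<open>g\<close>, and its eigenvector is not
  shortened by \<open>g\<close>. By \<open>vd_matvec\<close> its distance to the image of infinity
  is then at most the reciprocal of the norm of the image vector.\<close>

lemma att_expectation_tendsto:
  assumes st: "stationary v \<mu> \<nu>"
    and f: "continuous_map (berk_top v) euclideanreal f" and bdd: "\<And>p. p \<in> berkP1 v \<Longrightarrow> \<bar>f p\<bar> \<le> C"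
  shows "(\<lambda>n. measure_pmf.expectation (conv_pow \<mu> n) (\<lambda>g. if hyperbolic v g then f (berk_emb v (att v g)) else 0)) \<longlonglongrightarrow> (\<integral>p. f p \<partial>\<nu>)"
proof -
  obtain Z where Z: "is_limit_pt Z" using limit_pt_exists by blast
  \<comment> \<open>On elements that are not hyperbolic \<open>X\<close> is the image of infinity,
    at distance 0; replacing it by the value 0 afterwards costs at most \<open>C\<close> times the
    probability of these elements.\<close>
  define X where "X g = berk_emb v (if hyperbolic v g then att v g else moebius g None)" for g
  have C0: "C \<ge> 0" using bdd[OF berk_emb_mem[of None]] by linarith
  have Xm: "X g \<in> berkP1 v" for g by (simp add: X_def berk_emb_mem)
  let ?y = "pvec None :: 'k^2"
  have y: "?y \<noteq> 0" "vnorm v ?y = 1" by (simp_all add: vnorm_def)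
  have att: "pd v (att v g) (moebius g None) \<le> 1 / vnorm v (g *v ?y)" if g: "g \<in> SL2" and h: "hyperbolic v g" for g
  proof -
    obtain l e f' where l: "v l > 1" "g *v e = l *s e" "e \<noteq> 0" by (rule hyperbolic_eigenvectors[OF g h]) blast
    have "att v g = line_of e" by (rule att_eq_line_of[OF g l(3,2,1)])
    also have "\<dots> = line_of (g *v e)" unfolding l(2) using l(1) by (intro line_of_scale[symmetric]) auto
    finally have "pd v (att v g) (moebius g None) = vd v (g *v e) (g *v ?y)"
      using pd_line_of[of "g *v e" "g *v ?y"] l(3) g by (simp only: moebius_line_of[OF g] SL2_matvec_eq_0_iff[OF g] pvec_nonzero simp_thms)
    also have "\<dots> = v (wedge e ?y) / (vnorm v (g *v e) * vnorm v (g *v ?y))" by (rule vd_matvec[OF g])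
    also have "\<dots> \<le> vnorm v e / (vnorm v e * vnorm v (g *v ?y))"
    proof (rule frac_le)
      show "v (wedge e ?y) \<le> vnorm v e" using v_wedge_le[of e ?y] y by simp
      show "0 < vnorm v e * vnorm v (g *v ?y)" using l g y by simp
      have "vnorm v e \<le> vnorm v (g *v e)" unfolding l(2) using mult_right_mono[of 1 "v l" "vnorm v e"] l(1) by simp
      then show "vnorm v e * vnorm v (g *v ?y) \<le> vnorm v (g *v e) * vnorm v (g *v ?y)" by (intro mult_right_mono) auto
    qed simp
    also have "\<dots> = 1 / vnorm v (g *v ?y)" using l by simp
    finally show ?thesis .
  qed
  have "(\<lambda>n. \<integral>\<^sup>+g. ennreal (bd v (X g) (moebius g None)) \<partial>conv_pow \<mu> n) \<longlonglongrightarrow> 0"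
  proof (rule nn_integral_tendsto_0I)
    show "0 \<le> bd v (X g) (moebius g None) \<and> bd v (X g) (moebius g None) \<le> 2" for g
      using bd_nonneg[OF Xm] bd_le_2[OF Xm] by blast
    fix e \<eta> :: real assume e: "e > 0" and \<eta>: "\<eta> > 0"
    obtain n0 where n0: "\<And>n x. n \<ge> n0 \<Longrightarrow> x \<noteq> 0 \<Longrightarrow> measure (conv_pow \<mu> n) {g. vnorm v (g *v x) \<le> (1 / e) * vnorm v x} \<le> \<eta>"
      using vector_norm_escape[OF \<eta>, of "1 / e"] by auto
    have sub: "vnorm v (g *v ?y) \<le> 1 / e" if g: "g \<in> SL2" and big: "bd v (X g) (moebius g None) > e" for g
    proof (cases "hyperbolic v g")
      case True
      then have "e < 1 / vnorm v (g *v ?y)" using att[OF g True] big by (simp add: X_def bd_emb)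
      moreover have "vnorm v (g *v ?y) > 0" using g y by simp
      ultimately show ?thesis using e by (simp add: field_simps)
    next
      case False
      have "pd v (moebius g None) (moebius g None) = 0" by (simp only: pd_eq_0)
      then show ?thesis using False big e by (simp add: X_def bd_emb del: pd_eq_0)
    qed
    have "measure (conv_pow \<mu> n) {g. bd v (X g) (moebius g None) > e} \<le> \<eta>" if n: "n \<ge> n0" for n
    proof -
      have "measure (conv_pow \<mu> n) {g. bd v (X g) (moebius g None) > e} \<le> measure (conv_pow \<mu> n) {g. vnorm v (g *v ?y) \<le> (1 / e) * vnorm v ?y}"
        using sub conv_in_SL2 by (intro measure_pmf.finite_measure_mono_AE) (auto simp: AE_measure_pmf_iff y)
      also have "\<dots> \<le> \<eta>" by (rule n0[OF n y(1)])
      finally show ?thesis .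
    qed
    then show "\<exists>n0. \<forall>n\<ge>n0. measure (conv_pow \<mu> n) {g. bd v (X g) (moebius g None) > e} \<le> \<eta>" by blast
  qed
  then have lim: "(\<lambda>n. measure_pmf.expectation (conv_pow \<mu> n) (\<lambda>g. f (X g))) \<longlonglongrightarrow> (\<integral>\<omega>. f (berk_emb v (Z \<omega>)) \<partial>Omega_P \<mu>)"
    using tendsto_expectation_limit_pt[OF Z, of "\<lambda>_. X", OF Xm _ f bdd] by blast
  let ?H = "\<lambda>g. if hyperbolic v g then f (berk_emb v (att v g)) else 0"
  have fb: "\<bar>f (X g)\<bar> \<le> C" "\<bar>?H g\<bar> \<le> C" for g using bdd[OF Xm] bdd[OF berk_emb_mem] C0 by auto
  have i1: "integrable (conv_pow \<mu> n) (\<lambda>g. f (X g))" for n using fb by (intro measure_pmf.integrable_const_bound[where B = C]) auto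
  have i2: "integrable (conv_pow \<mu> n) ?H" for n using fb by (intro measure_pmf.integrable_const_bound[where B = C]) auto
  let ?d = "\<lambda>n. measure_pmf.expectation (conv_pow \<mu> n) (\<lambda>g. ?H g - f (X g))"
  have dle: "\<bar>?d n\<bar> \<le> C * measure (conv_pow \<mu> n) {g. v (trace g) \<le> 1}" for n
  proof -
    have "\<bar>?d n\<bar> \<le> measure_pmf.expectation (conv_pow \<mu> n) (\<lambda>g. \<bar>?H g - f (X g)\<bar>)" by (rule integral_abs_bound)
    also have "\<dots> \<le> measure_pmf.expectation (conv_pow \<mu> n) (\<lambda>g. C * indicator {g. v (trace g) \<le> 1} g)"
    proof (rule integral_mono)
      show "integrable (conv_pow \<mu> n) (\<lambda>g. \<bar>?H g - f (X g)\<bar>)" using i1 i2 by auto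
      show "\<bar>?H g - f (X g)\<bar> \<le> C * indicator {g. v (trace g) \<le> 1} g" for g
        using fb(1)[of g] by (auto simp: X_def hyperbolic_def indicator_def)
    qed auto
    also have "\<dots> = C * measure (conv_pow \<mu> n) {g. v (trace g) \<le> 1}" by simp
    finally show ?thesis .
  qed
  have "(\<lambda>n. measure (conv_pow \<mu> n) {g. v (trace g) \<le> 1}) \<longlonglongrightarrow> 0"
  proof (rule order_tendstoI)
    fix a :: real assume a: "a > 0"
    then have "a / 2 > 0" by simp
    from hyperbolic_prob[OF this, of 1] obtain n0 where "\<And>n. n \<ge> n0 \<Longrightarrow> measure (conv_pow \<mu> n) {g. v (trace g) \<le> 1} \<le> a / 2" by auto
    then show "\<forall>\<^sub>F n in sequentially. measure (conv_pow \<mu> n) {g. v (trace g) \<le> 1} < a"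
      using a by (intro eventually_sequentiallyI[of n0]) fastforce
  qed (auto intro!: always_eventually intro: less_le_trans)
  from tendsto_mult[OF tendsto_const[of C] this] have "(\<lambda>n. C * measure (conv_pow \<mu> n) {g. v (trace g) \<le> 1}) \<longlonglongrightarrow> 0" by simp
  then have "?d \<longlonglongrightarrow> 0"
    by (rule Lim_null_comparison[rotated]) (rule always_eventually, unfold real_norm_def, rule allI, rule dle)
  from tendsto_add[OF lim this] have "(\<lambda>n. measure_pmf.expectation (conv_pow \<mu> n) (\<lambda>g. f (X g)) + ?d n) \<longlonglongrightarrow> (\<integral>\<omega>. f (berk_emb v (Z \<omega>)) \<partial>Omega_P \<mu>)" by simp
  moreover have "measure_pmf.expectation (conv_pow \<mu> n) (\<lambda>g. f (X g)) + ?d n = measure_pmf.expectation (conv_pow \<mu> n) ?H" for n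
    using i1[of n] i2[of n] by (subst Bochner_Integration.integral_diff) auto
  ultimately show ?thesis using stationary_integral[OF Z st f bdd] by simp
qed

end

section \<open>The Lyapunov exponent\<close>

text \<open>Fekete's lemma: the limit is the infimum, by division with remainder of \<open>n\<close>
  by a nearly optimal \<open>m\<close>. Nonnegativity keeps the infimum finite.\<close>

lemma subadditive_limit:
  fixes a :: "nat \<Rightarrow> real"
  assumes sub: "\<And>m n. a (m + n) \<le> a m + a n" and nonneg: "\<And>n. 0 \<le> a n"
  obtains L where "(\<lambda>n. a n / real n) \<longlonglongrightarrow> L" "\<And>n. n > 0 \<Longrightarrow> L \<le> a n / real n"
proof -
  define L where "L = Inf ((\<lambda>n. a n / real n) ` {0<..})"
  have bdd: "bdd_below ((\<lambda>n. a n / real n) ` {0<..})" using nonneg by (intro bdd_belowI[of _ 0]) auto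
  have lower: "L \<le> a n / real n" if "n > 0" for n unfolding L_def using bdd that by (intro cInf_lower) auto
  have "(\<lambda>n. a n / real n) \<longlonglongrightarrow> L"
  proof (rule LIMSEQ_I)
    fix e :: real assume e: "e > 0"
    have "\<exists>y\<in>(\<lambda>n. a n / real n) ` {0<..}. y < L + e / 2"
      unfolding L_def using cInf_less_iff[OF _ bdd, of "L + e / 2"] e by (auto simp: L_def)
    then obtain m where m: "m > 0" "a m / real m < L + e / 2" by auto
    obtain B where B: "B > 0" "\<forall>r\<in>{..<m}. a r \<le> B" using finite_upper_bound[of "{..<m}" a] by auto
    have mult: "a (q * m) \<le> real q * a m + a 0" for q
    proof (induction q)
      case (Suc q)
      have "a (m + q * m) \<le> a m + a (q * m)" by (rule sub)
      then show ?case using Suc by (simp add: algebra_simps)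
    qed simp
    obtain N :: nat where N: "(B + a 0) / (e / 2) < real N" using reals_Archimedean2 by blast
    show "\<exists>N. \<forall>n\<ge>N. norm (a n / real n - L) < e"
    proof (intro exI[of _ "max 1 N"] allI impI)
      fix n assume n: "n \<ge> max 1 N"
      then have n0: "real n > 0" by simp
      define q r where "q = n div m" and "r = n mod m"
      have nqr: "n = q * m + r" "r < m" using m by (simp_all add: q_def r_def)
      have "a n \<le> a (q * m) + a r" unfolding nqr(1) by (rule sub)
      also have "\<dots> \<le> real q * a m + (B + a 0)" using mult[of q] bspec[OF B(2), of r] nqr(2) by simp
      also have "real q * a m = (real q * real m) * (a m / real m)" using m by simp
      also have "\<dots> \<le> real n * (a m / real m)"
        using nqr(1) nonneg[of m] by (intro mult_right_mono) (auto simp flip: of_nat_mult)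
      finally have "a n / real n \<le> (real n * (a m / real m) + (B + a 0)) / real n"
        using n0 by (intro divide_right_mono) auto
      then have "a n / real n \<le> a m / real m + (B + a 0) / real n"
        using n0 by (simp add: add_divide_distrib)
      moreover have "(B + a 0) / real n < e / 2"
      proof -
        have "(B + a 0) / (e / 2) < real n" using N n by linarith
        then show ?thesis using e n0 by (simp add: field_simps)
      qed
      ultimately have "a n / real n < L + e" using m(2) by linarith
      moreover have "L \<le> a n / real n" using lower n by auto
      ultimately show "norm (a n / real n - L) < e" using e by auto
    qed
  qed
  then show ?thesis using lower that by blast
qed

section \<open>A law of large numbers for the norm and the trace\<close>

context nonelem_walk
begin

abbreviation lnorm :: "'k mat2 \<Rightarrow> real" where "lnorm g \<equiv> ln (mnorm v g)"

lemma lnorm_nonneg: "g \<in> SL2 \<Longrightarrow> 0 \<le> lnorm g"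
  using mnorm_SL2_ge_1[of g] by simp

lemma lnorm_mult_le:
  assumes "g \<in> SL2" "h \<in> SL2" shows "lnorm (g ** h) \<le> lnorm g + lnorm h"
proof -
  have p: "mnorm v g > 0" "mnorm v h > 0" "mnorm v (g ** h) > 0" using assms by (auto intro: mnorm_SL2_pos)
  then have "lnorm (g ** h) \<le> ln (mnorm v g * mnorm v h)" using mnorm_mult_le[of g h] by (subst ln_le_cancel_iff) auto
  also have "\<dots> = lnorm g + lnorm h" using p by (simp add: ln_mult)
  finally show ?thesis .
qed

lemma lnorm_one: "lnorm (mat 1) = 0"
  by (simp add: mnorm_eq mat1_nth2)

lemma nn_integral_conv_pow_add:
  "(\<integral>\<^sup>+g. F g \<partial>conv_pow \<mu> (n + m)) = (\<integral>\<^sup>+a. \<integral>\<^sup>+b. F (a ** b) \<partial>conv_pow \<mu> m \<partial>conv_pow \<mu> n)"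
  by (simp add: conv_pow_add)

lemma nn_integral_mono_SL2:
  "(\<And>g. g \<in> SL2 \<Longrightarrow> F g \<le> G g) \<Longrightarrow> (\<integral>\<^sup>+g. F g \<partial>conv_pow \<mu> n) \<le> (\<integral>\<^sup>+g. G g \<partial>conv_pow \<mu> n)"
  using conv_in_SL2 by (intro nn_integral_mono_AE) (auto simp: AE_measure_pmf_iff)

lemma nn_integral_lnorm_subadditive:
  "(\<integral>\<^sup>+g. ennreal (lnorm g) \<partial>conv_pow \<mu> (n + m)) \<le>
     (\<integral>\<^sup>+g. ennreal (lnorm g) \<partial>conv_pow \<mu> n) + (\<integral>\<^sup>+g. ennreal (lnorm g) \<partial>conv_pow \<mu> m)"
proof -
  have "(\<integral>\<^sup>+g. ennreal (lnorm g) \<partial>conv_pow \<mu> (n + m)) \<le>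
     (\<integral>\<^sup>+a. (\<integral>\<^sup>+b. ennreal (lnorm a) + ennreal (lnorm b) \<partial>conv_pow \<mu> m) \<partial>conv_pow \<mu> n)"
    unfolding nn_integral_conv_pow_add
  proof (intro nn_integral_mono_SL2)
    fix a b :: "'k mat2" assume "a \<in> SL2" "b \<in> SL2"
    then show "ennreal (lnorm (a ** b)) \<le> ennreal (lnorm a) + ennreal (lnorm b)"
      using lnorm_mult_le[of a b] lnorm_nonneg by (simp add: ennreal_leI flip: ennreal_plus)
  qed
  also have "\<dots> = (\<integral>\<^sup>+g. ennreal (lnorm g) \<partial>conv_pow \<mu> n) + (\<integral>\<^sup>+g. ennreal (lnorm g) \<partial>conv_pow \<mu> m)"
    by (simp add: nn_integral_add measure_pmf.emeasure_space_1)
  finally show ?thesis .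
qed

text \<open>A one-sided large deviation estimate for \<open>q\<close> independent blocks: the truncated norms are
  handled by an exponential moment, the overshoots by their mean.\<close>

lemma block_deviation:
  assumes t: "t > 0" and K: "K \<ge> 0"
  shows "(\<integral>\<^sup>+g. ennreal (lnorm g + s) \<partial>conv_pow \<mu> (q * m)) \<le>
     ennreal (1 / t * exp (t * s)) * (\<integral>\<^sup>+g. ennreal (exp (t * min (lnorm g) K)) \<partial>conv_pow \<mu> m) ^ q
     + of_nat q * (\<integral>\<^sup>+g. ennreal (lnorm g - min (lnorm g) K) \<partial>conv_pow \<mu> m)"
proof (induction q arbitrary: s)
  case 0
  have "t * s \<le> exp (t * s)" using exp_ge_add_one_self[of "t * s"] by linarith
  then have "s \<le> 1 / t * exp (t * s)" using t by (simp add: field_simps)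
  then have "ennreal s \<le> ennreal (1 / t * exp (t * s))" by (rule ennreal_leI)
  then show ?case by (simp add: lnorm_one)
next
  case (Suc q)
  let ?M = "\<integral>\<^sup>+g. ennreal (exp (t * min (lnorm g) K)) \<partial>conv_pow \<mu> m"
  let ?D = "\<integral>\<^sup>+g. ennreal (lnorm g - min (lnorm g) K) \<partial>conv_pow \<mu> m"
  have "(\<integral>\<^sup>+g. ennreal (lnorm g + s) \<partial>conv_pow \<mu> (Suc q * m)) =
     (\<integral>\<^sup>+a. \<integral>\<^sup>+b. ennreal (lnorm (a ** b) + s) \<partial>conv_pow \<mu> (q * m) \<partial>conv_pow \<mu> m)"
    by (simp add: nn_integral_conv_pow_add)
  also have "\<dots> \<le> (\<integral>\<^sup>+a. ennreal (lnorm a - min (lnorm a) K)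
       + (ennreal (1 / t * exp (t * (s + min (lnorm a) K))) * ?M ^ q + of_nat q * ?D) \<partial>conv_pow \<mu> m)"
  proof (rule nn_integral_mono_SL2)
    fix a :: "'k mat2" assume a: "a \<in> SL2"
    \<comment> \<open>The truncated norm of the first block moves into the shift \<open>s\<close>,
      where the induction hypothesis turns it into an exponential; the overshoot stays as a separate
      summand.\<close>
    have "(\<integral>\<^sup>+b. ennreal (lnorm (a ** b) + s) \<partial>conv_pow \<mu> (q * m)) \<le>
       (\<integral>\<^sup>+b. ennreal (lnorm a - min (lnorm a) K) + ennreal (lnorm b + (s + min (lnorm a) K)) \<partial>conv_pow \<mu> (q * m))"
    proof (rule nn_integral_mono_SL2)
      fix b :: "'k mat2" assume b: "b \<in> SL2"
      have "ennreal (lnorm (a ** b) + s) \<le> ennreal ((lnorm a - min (lnorm a) K) + max 0 (lnorm b + (s + min (lnorm a) K)))"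
        using lnorm_mult_le[OF a b] by (intro ennreal_leI) auto
      also have "\<dots> = ennreal (lnorm a - min (lnorm a) K) + ennreal (max 0 (lnorm b + (s + min (lnorm a) K)))"
        by (rule ennreal_plus) auto
      finally show "ennreal (lnorm (a ** b) + s) \<le> ennreal (lnorm a - min (lnorm a) K) + ennreal (lnorm b + (s + min (lnorm a) K))"
        by (simp add: max.commute)
    qed
    also have "\<dots> = ennreal (lnorm a - min (lnorm a) K) + (\<integral>\<^sup>+b. ennreal (lnorm b + (s + min (lnorm a) K)) \<partial>conv_pow \<mu> (q * m))"
      by (simp add: nn_integral_add measure_pmf.emeasure_space_1)
    also have "\<dots> \<le> ennreal (lnorm a - min (lnorm a) K) + (ennreal (1 / t * exp (t * (s + min (lnorm a) K))) * ?M ^ q + of_nat q * ?D)"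
      by (intro add_left_mono Suc.IH)
    finally show "(\<integral>\<^sup>+b. ennreal (lnorm (a ** b) + s) \<partial>conv_pow \<mu> (q * m)) \<le>
       ennreal (lnorm a - min (lnorm a) K) + (ennreal (1 / t * exp (t * (s + min (lnorm a) K))) * ?M ^ q + of_nat q * ?D)" .
  qed
  also have "\<dots> = ?D + ((\<integral>\<^sup>+a. ennreal (1 / t * exp (t * (s + min (lnorm a) K))) \<partial>conv_pow \<mu> m) * ?M ^ q + of_nat q * ?D)"
    by (simp add: nn_integral_add nn_integral_multc measure_pmf.emeasure_space_1)
  also have "(\<integral>\<^sup>+a. ennreal (1 / t * exp (t * (s + min (lnorm a) K))) \<partial>conv_pow \<mu> m) = ennreal (1 / t * exp (t * s)) * ?M"
  proof -
    have "ennreal (1 / t * exp (t * (s + min (lnorm a) K))) = ennreal (1 / t * exp (t * s)) * ennreal (exp (t * min (lnorm a) K))" for a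
      using t by (subst ennreal_mult[symmetric]) (auto simp: distrib_left exp_add)
    then show ?thesis by (simp add: nn_integral_cmult)
  qed
  finally show ?case by (simp add: algebra_simps)
qed

text \<open>Only the positive part of \<open>lnorm g / n - \<rho>\<close> has to be small in mean:
  the mean of \<open>lnorm g / n\<close> is at least \<rho>, and the absolute value is twice the
  positive part minus the number itself. The positive part is controlled by independent blocks of a
  length \<open>m\<close> whose mean rate is nearly \<rho>.\<close>

lemma lnorm_conv_L1:
  assumes fin: "(\<integral>\<^sup>+g. ennreal (lnorm g) \<partial>\<mu>) < \<infinity>" and \<eta>: "\<eta> > 0"
  shows "\<exists>n0. \<forall>n\<ge>n0. integrable (conv_pow \<mu> n) lnorm \<and>
     measure_pmf.expectation (conv_pow \<mu> n) (\<lambda>g. \<bar>lnorm g / real n - lyap v \<mu>\<bar>) \<le> \<eta>"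
proof -
  let ?I = "\<lambda>n. \<integral>\<^sup>+g. ennreal (lnorm g) \<partial>conv_pow \<mu> n"
  have finI: "?I n < \<infinity>" for n
  proof (induction n)
    case 0 show ?case by (simp add: lnorm_one)
  next
    case (Suc n)
    have "?I (n + Suc 0) \<le> ?I n + ?I (Suc 0)" by (rule nn_integral_lnorm_subadditive)
    also have "\<dots> < \<infinity>" using Suc fin unfolding conv_pow_1 by (simp add: ennreal_add_less_top)
    finally show ?case by simp
  qed
  have AE0: "AE g in conv_pow \<mu> n. 0 \<le> lnorm g" for n
    using conv_in_SL2 lnorm_nonneg by (auto simp: AE_measure_pmf_iff)
  have int: "integrable (conv_pow \<mu> n) lnorm" for n
    using finI[of n] AE0 by (intro integrableI_nonneg) auto
  define a where "a n = measure_pmf.expectation (conv_pow \<mu> n) lnorm" for n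
  have Ia: "?I n = ennreal (a n)" for n
    unfolding a_def by (rule nn_integral_eq_integral[OF int AE0])
  have a0: "0 \<le> a n" for n unfolding a_def using AE0 by (rule integral_nonneg_AE)
  have sub: "a (m + n) \<le> a m + a n" for m n
    using nn_integral_lnorm_subadditive[of m n] a0 unfolding Ia by (simp flip: ennreal_plus)
  obtain \<rho> where chi: "(\<lambda>n. a n / real n) \<longlonglongrightarrow> \<rho>" "\<And>n. n > 0 \<Longrightarrow> \<rho> \<le> a n / real n"
    by (rule subadditive_limit[of a, OF sub a0]) blast
  have "lyap v \<mu> = \<rho>"
    unfolding lyap_def by (rule limI) (use chi(1) in \<open>simp add: a_def\<close>)
  have upper: "\<exists>n0. \<forall>n\<ge>n0. n > 0 \<and> measure_pmf.expectation (conv_pow \<mu> n) (\<lambda>g. max 0 (lnorm g / real n - \<rho>)) \<le> 5 * \<delta>" if \<delta>: "\<delta> > 0" for \<delta>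
  proof -
    have "\<forall>\<^sub>F n in sequentially. a n / real n < \<rho> + \<delta>" using \<delta> by (intro order_tendstoD(2)[OF chi(1)]) simp
    then obtain m0 where "\<And>n. n \<ge> m0 \<Longrightarrow> a n / real n < \<rho> + \<delta>" by (auto simp: eventually_sequentially)
    then obtain m where m: "m > 0" "a m / real m < \<rho> + \<delta>" by (metis le_add1 less_add_same_cancel1 zero_less_one add_pos_nonneg add.commute zero_le le_add2)
    have "(\<lambda>K::nat. measure_pmf.expectation (conv_pow \<mu> m) (\<lambda>g. lnorm g - min (lnorm g) (real K))) \<longlonglongrightarrow> measure_pmf.expectation (conv_pow \<mu> m) (\<lambda>g. 0)"
    proof (rule integral_dominated_convergence[where w = lnorm])
      show "AE g in conv_pow \<mu> m. (\<lambda>K. lnorm g - min (lnorm g) (real K)) \<longlonglongrightarrow> 0"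
      proof (rule AE_I2)
        fix g
        obtain N :: nat where "lnorm g < real N" using reals_Archimedean2 by blast
        then have "\<forall>\<^sub>F K in sequentially. lnorm g - min (lnorm g) (real K) = 0"
          by (intro eventually_sequentiallyI[of N]) (auto simp: min_def)
        then show "(\<lambda>K. lnorm g - min (lnorm g) (real K)) \<longlonglongrightarrow> 0" by (rule tendsto_eventually)
      qed
      show "AE g in conv_pow \<mu> m. norm (lnorm g - min (lnorm g) (real K)) \<le> lnorm g" for K
        using AE0[of m] by eventually_elim (auto simp: min_def)
    qed (use int in auto)
    then have "\<forall>\<^sub>F K in sequentially. measure_pmf.expectation (conv_pow \<mu> m) (\<lambda>g. lnorm g - min (lnorm g) (real K)) < \<delta>"
      using \<delta> by (intro order_tendstoD(2)) auto
    then obtain K0 where tr: "\<And>K. K \<ge> K0 \<Longrightarrow> measure_pmf.expectation (conv_pow \<mu> m) (\<lambda>g. lnorm g - min (lnorm g) (real K)) < \<delta>"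
      by (auto simp: eventually_sequentially)
    have trunc: "measure_pmf.expectation (conv_pow \<mu> m) (\<lambda>g. lnorm g - min (lnorm g) (real (Suc K0))) < \<delta>"
      by (rule tr) simp
    define K where "K = real (Suc K0)"
    have K1: "K \<ge> 1" by (simp add: K_def)
    have imin: "integrable (conv_pow \<mu> m) (\<lambda>g. min (lnorm g) K)" using int by (intro integrable_min) auto
    have D: "(\<integral>\<^sup>+g. ennreal (lnorm g - min (lnorm g) K) \<partial>conv_pow \<mu> m) \<le> ennreal \<delta>"
    proof -
      have "(\<integral>\<^sup>+g. ennreal (lnorm g - min (lnorm g) K) \<partial>conv_pow \<mu> m) = ennreal (measure_pmf.expectation (conv_pow \<mu> m) (\<lambda>g. lnorm g - min (lnorm g) K))"
        using int imin by (intro nn_integral_eq_integral) auto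
      also have "\<dots> \<le> ennreal \<delta>" using trunc by (intro ennreal_leI) (simp add: K_def)
      finally show ?thesis .
    qed
    \<comment> \<open>\<open>t * K <= 1\<close> brings the exponent into the range of
      \<open>exp_bound\<close>; \<open>t * K^2 <= \<delta>\<close> lets the slack \<delta> per block
      absorb the quadratic error.\<close>
    define t where "t = min (1 / K) (\<delta> / K\<^sup>2)"
    have t: "t > 0" "t * K \<le> 1" "t * K\<^sup>2 \<le> \<delta>"
      using K1 \<delta> by (auto simp: t_def min_def field_simps divide_simps)
    have expM: "(\<integral>\<^sup>+g. ennreal (exp (t * min (lnorm g) K)) \<partial>conv_pow \<mu> m) \<le> ennreal (exp (t * a m + t\<^sup>2 * K\<^sup>2))"
    proof -
      have "(\<integral>\<^sup>+g. ennreal (exp (t * min (lnorm g) K)) \<partial>conv_pow \<mu> m) \<le> (\<integral>\<^sup>+g. ennreal (1 + t\<^sup>2 * K\<^sup>2) + ennreal t * ennreal (lnorm g) \<partial>conv_pow \<mu> m)"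
      proof (rule nn_integral_mono_SL2)
        fix g :: "'k mat2" assume "g \<in> SL2"
        then have g0: "0 \<le> lnorm g" by (rule lnorm_nonneg)
        let ?u = "t * min (lnorm g) K"
        have u: "0 \<le> ?u" "?u \<le> t * K" "?u \<le> t * lnorm g" using g0 K1 t by (auto intro: mult_left_mono)
        have "exp ?u \<le> 1 + ?u + ?u\<^sup>2" using u(1) order_trans[OF u(2) t(2)] by (intro exp_bound)
        also have "?u\<^sup>2 \<le> (t * K)\<^sup>2" using u(1,2) by (rule power_mono[rotated])
        finally have "exp ?u \<le> (1 + t\<^sup>2 * K\<^sup>2) + t * lnorm g" using u(3) by (simp add: power_mult_distrib)
        then have "ennreal (exp ?u) \<le> ennreal ((1 + t\<^sup>2 * K\<^sup>2) + t * lnorm g)" by (rule ennreal_leI)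
        also have "\<dots> = ennreal (1 + t\<^sup>2 * K\<^sup>2) + ennreal t * ennreal (lnorm g)"
          using t g0 by (simp add: ennreal_plus ennreal_mult del: ennreal_plus[symmetric])
        finally show "ennreal (exp ?u) \<le> ennreal (1 + t\<^sup>2 * K\<^sup>2) + ennreal t * ennreal (lnorm g)" .
      qed
      also have "\<dots> = ennreal (1 + t\<^sup>2 * K\<^sup>2) + ennreal t * ennreal (a m)"
        by (simp add: nn_integral_add nn_integral_cmult measure_pmf.emeasure_space_1 Ia)
      also have "\<dots> = ennreal ((1 + t\<^sup>2 * K\<^sup>2) + t * a m)"
        using t a0 by (subst ennreal_mult[symmetric]) (auto simp flip: ennreal_plus)
      also have "\<dots> \<le> ennreal (exp (t * a m + t\<^sup>2 * K\<^sup>2))"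
        using exp_ge_add_one_self[of "t * a m + t\<^sup>2 * K\<^sup>2"] by (intro ennreal_leI) linarith
      finally show ?thesis .
    qed
    obtain B where B: "B > 0" "\<forall>r\<in>{..<m}. a r \<le> B" using finite_upper_bound[of "{..<m}" a] by auto
    have key: "(\<integral>\<^sup>+g. ennreal (lnorm g - real q * (a m + \<delta>)) \<partial>conv_pow \<mu> (q * m + r)) \<le> ennreal (1 / t + real q * \<delta> + B)" if r: "r < m" for q r
    proof -
      let ?c = "real q * (a m + \<delta>)"
      have "(\<integral>\<^sup>+g. ennreal (lnorm g - ?c) \<partial>conv_pow \<mu> (q * m + r)) \<le>
        (\<integral>\<^sup>+x. \<integral>\<^sup>+y. ennreal (lnorm x + - ?c) + ennreal (lnorm y) \<partial>conv_pow \<mu> r \<partial>conv_pow \<mu> (q * m))"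
        unfolding nn_integral_conv_pow_add
      proof (intro nn_integral_mono_SL2)
        fix x y :: "'k mat2" assume xy: "x \<in> SL2" "y \<in> SL2"
        have "ennreal (lnorm (x ** y) - ?c) \<le> ennreal (max 0 (lnorm x + - ?c) + lnorm y)"
          using lnorm_mult_le[OF xy] by (intro ennreal_leI) auto
        also have "\<dots> = ennreal (lnorm x + - ?c) + ennreal (lnorm y)"
          using lnorm_nonneg[OF xy(2)] by (subst ennreal_plus) (auto simp: max.commute)
        finally show "ennreal (lnorm (x ** y) - ?c) \<le> ennreal (lnorm x + - ?c) + ennreal (lnorm y)" .
      qed
      also have "\<dots> = (\<integral>\<^sup>+x. ennreal (lnorm x + - ?c) \<partial>conv_pow \<mu> (q * m)) + ennreal (a r)"
        by (simp add: nn_integral_add measure_pmf.emeasure_space_1 Ia)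
      also have "\<dots> \<le> (ennreal (1 / t * exp (t * - ?c)) * (\<integral>\<^sup>+g. ennreal (exp (t * min (lnorm g) K)) \<partial>conv_pow \<mu> m) ^ q
         + of_nat q * (\<integral>\<^sup>+g. ennreal (lnorm g - min (lnorm g) K) \<partial>conv_pow \<mu> m)) + ennreal B"
        using K1 B r by (intro add_mono block_deviation t ennreal_leI) auto
      also have "\<dots> \<le> (ennreal (1 / t * exp (t * - ?c)) * ennreal (exp (t * a m + t\<^sup>2 * K\<^sup>2)) ^ q + of_nat q * ennreal \<delta>) + ennreal B"
        using expM D by (intro add_mono mult_left_mono power_mono) auto
      also have "\<dots> = ennreal (1 / t * exp (t * - ?c) * exp (t * a m + t\<^sup>2 * K\<^sup>2) ^ q + real q * \<delta> + B)"
        using t \<delta> B by (simp add: ennreal_power ennreal_mult[symmetric] ennreal_of_nat_eq_real_of_nat flip: ennreal_plus)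
      also have "\<dots> \<le> ennreal (1 / t + real q * \<delta> + B)"
      proof (intro ennreal_leI add_right_mono)
        \<comment> \<open>The means \<open>a m\<close> cancel, and the choice of \<open>t\<close>
          makes the remaining exponent nonpositive, so the exponential moment contributes only
          \<open>1 / t\<close>, for every number \<open>q\<close> of blocks.\<close>
        have "exp (t * - ?c) * exp (t * a m + t\<^sup>2 * K\<^sup>2) ^ q = exp (real q * t * (t * K\<^sup>2 - \<delta>))"
          by (simp add: exp_of_nat_mult[symmetric] exp_add[symmetric] algebra_simps power2_eq_square)
        also have "\<dots> \<le> exp 0" unfolding exp_le_cancel_iff using t by (intro mult_nonneg_nonpos) auto
        finally have "exp (t * - ?c) * exp (t * a m + t\<^sup>2 * K\<^sup>2) ^ q \<le> 1" by simp
        then have "1 / t * (exp (t * - ?c) * exp (t * a m + t\<^sup>2 * K\<^sup>2) ^ q) \<le> 1 / t * 1"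
          using t by (intro mult_left_mono) auto
        then show "1 / t * exp (t * - ?c) * exp (t * a m + t\<^sup>2 * K\<^sup>2) ^ q \<le> 1 / t" by (simp only: mult.assoc mult_1_right)
      qed
      finally show ?thesis .
    qed
    obtain N :: nat where N: "(1 / t + B) / \<delta> < real N" using reals_Archimedean2 by blast
    have "measure_pmf.expectation (conv_pow \<mu> n) (\<lambda>g. max 0 (lnorm g / real n - \<rho>)) \<le> 5 * \<delta>" if n: "n \<ge> max 1 N" for n
    proof -
      have n0: "real n > 0" using n by simp
      define q r where "q = n div m" and "r = n mod m"
      have nqr: "n = q * m + r" "r < m" using m by (simp_all add: q_def r_def)
      let ?c = "real q * (a m + \<delta>)"
      have qn: "real q \<le> real n / real m" using nqr(1) m by (simp add: le_divide_eq flip: of_nat_mult)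
      have qn1: "real q \<le> real n" using nqr m by (simp add: q_def div_le_dividend)
      have cn: "?c \<le> real n * (\<rho> + 2 * \<delta>)"
      proof -
        have "?c \<le> real n / real m * (a m + \<delta>)" using qn a0[of m] \<delta> by (intro mult_right_mono) auto
        also have "\<dots> = real n * (a m / real m + \<delta> / real m)" using m by (simp add: field_simps)
        also have "\<delta> / real m \<le> \<delta>" using m \<delta> by (simp add: divide_le_eq)
        finally have "?c \<le> real n * (a m / real m + \<delta>)" using n0 by (simp add: mult_left_mono add_left_mono order_trans)
        also have "\<dots> \<le> real n * (\<rho> + 2 * \<delta>)" using m n0 by (intro mult_left_mono) auto
        finally show ?thesis .
      qed
      have ic: "integrable (conv_pow \<mu> n) (\<lambda>g. max 0 (lnorm g - ?c))" using int by (intro integrable_max) auto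
      have "ennreal (measure_pmf.expectation (conv_pow \<mu> n) (\<lambda>g. max 0 (lnorm g - ?c))) = (\<integral>\<^sup>+g. ennreal (max 0 (lnorm g - ?c)) \<partial>conv_pow \<mu> n)"
        using ic by (intro nn_integral_eq_integral[symmetric]) auto
      also have "\<dots> \<le> ennreal (1 / t + real q * \<delta> + B)" using key[OF nqr(2), of q] nqr(1) by (simp add: max.commute)
      finally have E: "measure_pmf.expectation (conv_pow \<mu> n) (\<lambda>g. max 0 (lnorm g - ?c)) \<le> 1 / t + real q * \<delta> + B"
        using t \<delta> B by (subst (asm) ennreal_le_iff) auto
      have pt: "max 0 (lnorm g / real n - \<rho>) \<le> max 0 (lnorm g - ?c) / real n + 2 * \<delta>" for g
      proof -
        have "lnorm g / real n - \<rho> = (lnorm g - real n * (\<rho> + 2 * \<delta>)) / real n + 2 * \<delta>" using n0 by (simp add: field_simps)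
        also have "\<dots> \<le> max 0 (lnorm g - ?c) / real n + 2 * \<delta>" using cn n0 by (intro add_right_mono divide_right_mono) auto
        finally show ?thesis using n0 \<delta> by simp
      qed
      have "measure_pmf.expectation (conv_pow \<mu> n) (\<lambda>g. max 0 (lnorm g / real n - \<rho>)) \<le>
         measure_pmf.expectation (conv_pow \<mu> n) (\<lambda>g. max 0 (lnorm g - ?c) / real n + 2 * \<delta>)"
        using pt int ic by (intro integral_mono integrable_max Bochner_Integration.integrable_add) auto
      also have "\<dots> = measure_pmf.expectation (conv_pow \<mu> n) (\<lambda>g. max 0 (lnorm g - ?c)) / real n + 2 * \<delta>"
        using ic by (subst Bochner_Integration.integral_add) auto
      also have "\<dots> \<le> (1 / t + real q * \<delta> + B) / real n + 2 * \<delta>" using E n0 by (intro add_right_mono divide_right_mono) auto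
      also have "(1 / t + real q * \<delta> + B) / real n = (1 / t + B) / real n + (real q / real n) * \<delta>" using n0 by (simp add: field_simps)
      also have "(1 / t + B) / real n \<le> \<delta>"
      proof -
        have "(1 / t + B) / \<delta> < real n" using N n by linarith
        then show ?thesis using \<delta> n0 by (simp add: divide_less_eq divide_le_eq mult.commute less_imp_le)
      qed
      also have "(real q / real n) * \<delta> \<le> 1 * \<delta>" using qn1 n0 \<delta> by (intro mult_right_mono) (auto simp: divide_le_eq)
      finally show ?thesis using \<delta> by simp
    qed
    then show ?thesis by (intro exI[of _ "max 1 N"]) auto
  qed
  have e10: "\<eta> / 10 > 0" using \<eta> by simp
  from upper[OF e10] obtain n0 where n0: "\<And>n. n \<ge> n0 \<Longrightarrow> n > 0"
     "\<And>n. n \<ge> n0 \<Longrightarrow> measure_pmf.expectation (conv_pow \<mu> n) (\<lambda>g. max 0 (lnorm g / real n - \<rho>)) \<le> \<eta> / 2" by auto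
  have "measure_pmf.expectation (conv_pow \<mu> n) (\<lambda>g. \<bar>lnorm g / real n - \<rho>\<bar>) \<le> \<eta>" if n: "n \<ge> n0" for n
  proof -
    have im: "integrable (conv_pow \<mu> n) (\<lambda>g. max 0 (lnorm g / real n - \<rho>))" using int by (intro integrable_max) auto
    have "measure_pmf.expectation (conv_pow \<mu> n) (\<lambda>g. \<bar>lnorm g / real n - \<rho>\<bar>) =
       measure_pmf.expectation (conv_pow \<mu> n) (\<lambda>g. 2 * max 0 (lnorm g / real n - \<rho>) - (lnorm g / real n - \<rho>))"
      by (intro Bochner_Integration.integral_cong) (auto simp: max_def abs_if)
    also have "\<dots> = 2 * measure_pmf.expectation (conv_pow \<mu> n) (\<lambda>g. max 0 (lnorm g / real n - \<rho>)) - (a n / real n - \<rho>)"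
      using im int by (simp add: a_def)
    also have "\<dots> \<le> 2 * (\<eta> / 2) - 0" using n0[OF n] chi(2)[of n] by (intro diff_mono mult_left_mono) auto
    finally show ?thesis by simp
  qed
  then show ?thesis using int \<open>lyap v \<mu> = \<rho>\<close> by auto
qed

text \<open>Up to small probability the trace lies between \<open>d\<close> times the norm and the
  norm, so the logarithms differ by at most \<open>- ln d\<close>, negligible after division by
  \<open>n\<close>.\<close>

lemma lyap_prob:
  assumes fin: "(\<integral>\<^sup>+g. ennreal (lnorm g) \<partial>\<mu>) < \<infinity>" and \<epsilon>: "\<epsilon> > 0" and \<eta>: "\<eta> > 0"
  shows "\<exists>n0. \<forall>n\<ge>n0. measure (conv_pow \<mu> n) {g. \<not> (trace g \<noteq> 0 \<and> \<bar>ln (v (trace g)) / real n - lyap v \<mu>\<bar> < \<epsilon>)} \<le> \<eta>"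
proof -
  have \<eta>2: "\<eta> / 2 > 0" using \<eta> by simp
  obtain d n1 where d: "d > 0" "d \<le> 1" "\<And>n. n \<ge> n1 \<Longrightarrow> measure (conv_pow \<mu> n) {g. v (trace g) < d * mnorm v g} \<le> \<eta> / 2"
    using trace_comparable_norm[OF \<eta>2] by auto
  \<comment> \<open>The mean deviation that Markov's inequality at level
    \<open>\<epsilon> / 2\<close> turns into probability \<open>\<eta> / 2\<close>.\<close>
  have "\<epsilon> / 2 * (\<eta> / 2) > 0" using \<epsilon> \<eta> by simp
  from lnorm_conv_L1[OF fin this] obtain n2 where n2: "\<And>n. n \<ge> n2 \<Longrightarrow> integrable (conv_pow \<mu> n) lnorm"
     "\<And>n. n \<ge> n2 \<Longrightarrow> measure_pmf.expectation (conv_pow \<mu> n) (\<lambda>g. \<bar>lnorm g / real n - lyap v \<mu>\<bar>) \<le> \<epsilon> / 2 * (\<eta> / 2)" by auto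
  obtain N :: nat where N: "- ln d / (\<epsilon> / 2) < real N" using reals_Archimedean2 by blast
  have "measure (conv_pow \<mu> n) {g. \<not> (trace g \<noteq> 0 \<and> \<bar>ln (v (trace g)) / real n - lyap v \<mu>\<bar> < \<epsilon>)} \<le> \<eta>"
    if n: "n \<ge> max (max n1 n2) (max 1 N)" for n
  proof -
    have n0: "real n > 0" using n by simp
    have dn: "- ln d / real n < \<epsilon> / 2"
    proof -
      have "- ln d / (\<epsilon> / 2) < real n" using N n by linarith
      then show ?thesis using \<epsilon> n0 by (simp add: field_simps)
    qed
    let ?S1 = "{g. v (trace g) < d * mnorm v g}" and ?S2 = "{g. \<bar>lnorm g / real n - lyap v \<mu>\<bar> \<ge> \<epsilon> / 2}"
    have sub: "g \<in> ?S1 \<union> ?S2" if g: "g \<in> SL2" and bad: "\<not> (trace g \<noteq> 0 \<and> \<bar>ln (v (trace g)) / real n - lyap v \<mu>\<bar> < \<epsilon>)" for g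
    proof (rule ccontr)
      assume c: "g \<notin> ?S1 \<union> ?S2"
      have mp: "mnorm v g > 0" by (rule mnorm_SL2_pos[OF g])
      have low: "d * mnorm v g \<le> v (trace g)" using c by auto
      have tp: "v (trace g) > 0" using low mp d(1) by (smt (verit) mult_pos_pos)
      have "ln (d * mnorm v g) \<le> ln (v (trace g))" using low mp d(1) tp by simp
      then have l1: "ln d + lnorm g \<le> ln (v (trace g))" using mp d(1) by (simp add: ln_mult)
      have l2: "ln (v (trace g)) \<le> lnorm g" using v_trace_le_mnorm[of g] tp mp by simp
      have "ln (v (trace g)) / real n \<le> lnorm g / real n" using l2 n0 by (simp add: divide_right_mono)
      moreover have "lnorm g / real n - \<epsilon> / 2 < ln (v (trace g)) / real n"
      proof -
        have "(ln d + lnorm g) / real n \<le> ln (v (trace g)) / real n" using l1 n0 by (simp add: divide_right_mono)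
        then show ?thesis using dn by (simp add: add_divide_distrib)
      qed
      moreover have "\<bar>lnorm g / real n - lyap v \<mu>\<bar> < \<epsilon> / 2" using c by auto
      ultimately have "\<bar>ln (v (trace g)) / real n - lyap v \<mu>\<bar> < \<epsilon>" by linarith
      then show False using bad tp by auto
    qed
    have "measure (conv_pow \<mu> n) {g. \<not> (trace g \<noteq> 0 \<and> \<bar>ln (v (trace g)) / real n - lyap v \<mu>\<bar> < \<epsilon>)} \<le> measure (conv_pow \<mu> n) (?S1 \<union> ?S2)"
    proof (rule measure_pmf.finite_measure_mono_AE)
      show "AE g in conv_pow \<mu> n. g \<in> {g. \<not> (trace g \<noteq> 0 \<and> \<bar>ln (v (trace g)) / real n - lyap v \<mu>\<bar> < \<epsilon>)} \<longrightarrow> g \<in> ?S1 \<union> ?S2"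
        unfolding AE_measure_pmf_iff mem_Collect_eq by (intro ballI impI) (rule sub[OF conv_in_SL2])
    qed simp
    also have "\<dots> \<le> measure (conv_pow \<mu> n) ?S1 + measure (conv_pow \<mu> n) ?S2" by (rule measure_Un_le) auto
    also have "measure (conv_pow \<mu> n) ?S2 \<le> \<eta> / 2"
    proof -
      have ia: "integrable (conv_pow \<mu> n) (\<lambda>g. \<bar>lnorm g / real n - lyap v \<mu>\<bar>)" using n2(1)[of n] n by simp
      have "measure (conv_pow \<mu> n) {g \<in> space (conv_pow \<mu> n). \<bar>lnorm g / real n - lyap v \<mu>\<bar> \<ge> \<epsilon> / 2} \<le>
        measure_pmf.expectation (conv_pow \<mu> n) (\<lambda>g. \<bar>lnorm g / real n - lyap v \<mu>\<bar>) / (\<epsilon> / 2)"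
        using ia \<epsilon> by (intro integral_Markov_inequality_measure[where A = UNIV]) auto
      also have "\<dots> \<le> (\<epsilon> / 2 * (\<eta> / 2)) / (\<epsilon> / 2)" using n2(2)[of n] n \<epsilon> by (intro divide_right_mono) auto
      also have "\<dots> = \<eta> / 2" using \<epsilon> by simp
      finally show ?thesis by simp
    qed
    also have "measure (conv_pow \<mu> n) ?S1 + \<eta> / 2 \<le> \<eta> / 2 + \<eta> / 2" using d(3)[of n] n by simp
    finally show ?thesis by simp
  qed
  then show ?thesis by blast
qed

end

section \<open>The main theorem\<close>

lemma pmf_prob_tendsto_1:
  fixes p :: "nat \<Rightarrow> 'a pmf"
  assumes "\<And>\<eta>. \<eta> > 0 \<Longrightarrow> \<exists>n0. \<forall>n\<ge>n0. measure (p n) {g. \<not> Q n g} \<le> \<eta>"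
  shows "(\<lambda>n. measure (p n) {g. Q n g}) \<longlonglongrightarrow> 1"
proof (rule LIMSEQ_I)
  fix e :: real assume e: "e > 0"
  then have "e / 2 > 0" by simp
  from assms[OF this] obtain n0 where n0: "\<And>n. n \<ge> n0 \<Longrightarrow> measure (p n) {g. \<not> Q n g} \<le> e / 2" by auto
  have "measure (p n) {g. \<not> Q n g} = 1 - measure (p n) {g. Q n g}" for n
    using measure_pmf.prob_compl[of "{g. Q n g}" "p n"] by (simp add: Collect_neg_eq Compl_eq_Diff_UNIV)
  note compl = this
  have "norm (measure (p n) {g. Q n g} - 1) < e" if "n \<ge> n0" for n
  proof -
    have "measure (p n) {g. Q n g} \<le> 1" by simp
    then show ?thesis using n0[OF that] e unfolding compl real_norm_def by linarith
  qed
  then show "\<exists>n0. \<forall>n\<ge>n0. norm (measure (p n) {g. Q n g} - 1) < e" by blast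
qed

text \<open>Integrals against the pushed-forward restricted measures are expectations over
  \<open>conv_pow\<close> of a function set to 0 off the hyperbolic elements.\<close>

lemma (in nonelem_walk) weak_conv_fixed_point:
  assumes F: "\<And>g. F g \<in> berkP1 v"
    and conv: "\<And>f C. continuous_map (berk_top v) euclideanreal f \<Longrightarrow> (\<And>p. p \<in> berkP1 v \<Longrightarrow> \<bar>f p\<bar> \<le> C) \<Longrightarrow>
      (\<lambda>n. measure_pmf.expectation (conv_pow \<mu> n) (\<lambda>g. if hyperbolic v g then f (F g) else 0)) \<longlonglongrightarrow> (\<integral>p. f p \<partial>\<nu>)"
  shows "weak_conv (berk_top v)
     (\<lambda>n. distr (restrict_space (Omega_P \<mu>) {\<omega> \<in> space (Omega_P \<mu>). hyperbolic v (rprod \<omega> n)}) berk_borel (\<lambda>\<omega>. F (rprod \<omega> n))) \<nu>"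
  unfolding weak_conv_def
proof (intro allI impI)
  fix f assume f: "continuous_map (berk_top v) euclideanreal f \<and> bounded (f ` topspace (berk_top v))"
  then obtain C where C: "\<And>p. p \<in> berkP1 v \<Longrightarrow> \<bar>f p\<bar> \<le> C" by (auto simp: bounded_iff topspace_berk_top)
  let ?P = "Omega_P \<mu>"
  let ?H = "\<lambda>n. {\<omega> \<in> space ?P. hyperbolic v (rprod \<omega> n)}"
  have fm: "f \<in> borel_measurable berk_borel" using f continuous_real_measurable by blast
  have "(\<integral>p. f p \<partial>distr (restrict_space ?P (?H n)) berk_borel (\<lambda>\<omega>. F (rprod \<omega> n))) =
      measure_pmf.expectation (conv_pow \<mu> n) (\<lambda>g. if hyperbolic v g then f (F g) else 0)" for n
  proof -
    have Hm: "?H n \<in> sets ?P"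
      using measurable_sets[OF rprod_measurable[where n = n and \<mu> = \<mu>], of "{g \<in> set_pmf (conv_pow \<mu> n). hyperbolic v g}"]
      by (rule back_subst[of "\<lambda>A. A \<in> sets ?P"]) (auto simp: rprod_mem)
    have Fm: "(\<lambda>\<omega>. F (rprod \<omega> n)) \<in> restrict_space ?P (?H n) \<rightarrow>\<^sub>M berk_borel"
      by (intro measurable_restrict_space1 rprod_measurable_fun) (simp add: topspace_berk_top F)
    have "(\<integral>p. f p \<partial>distr (restrict_space ?P (?H n)) berk_borel (\<lambda>\<omega>. F (rprod \<omega> n))) = (\<integral>\<omega>. f (F (rprod \<omega> n)) \<partial>restrict_space ?P (?H n))"
      by (rule integral_distr[OF Fm fm])
    also have "\<dots> = (\<integral>\<omega>. indicator (?H n) \<omega> *\<^sub>R f (F (rprod \<omega> n)) \<partial>?P)"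
      using Hm by (intro integral_restrict_space) simp
    also have "\<dots> = (\<integral>\<omega>. (\<lambda>g. if hyperbolic v g then f (F g) else 0) (rprod \<omega> n) \<partial>?P)"
      by (intro Bochner_Integration.integral_cong) (auto simp: indicator_def)
    also have "\<dots> = measure_pmf.expectation (conv_pow \<mu> n) (\<lambda>g. if hyperbolic v g then f (F g) else 0)"
      by (rule integral_rprod)
    finally show ?thesis .
  qed
  then show "(\<lambda>n. \<integral>p. f p \<partial>distr (restrict_space ?P (?H n)) berk_borel (\<lambda>\<omega>. F (rprod \<omega> n))) \<longlonglongrightarrow> (\<integral>p. f p \<partial>\<nu>)"
    using conv[of f C] f C by simp
qed

theorem theorem3p10:
  fixes v :: "'k::field \<Rightarrow> real" and \<mu> :: "'k mat2 pmf"
  assumes k: "complete_nontrivial_nonarch_field v"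
    and supp: "set_pmf \<mu> \<subseteq> SL2"
    and nonel: "non_elementary v (gen_group (set_pmf \<mu>))"
  defines "P \<equiv> Omega_P \<mu>"
  defines "\<Omega>n \<equiv> (\<lambda>n. {\<omega> \<in> space P. hyperbolic v (rprod \<omega> n)})"
  shows "((\<lambda>n. measure P (\<Omega>n n)) \<longlonglongrightarrow> 1)
    \<and> (\<exists>\<nu>. stationary v \<mu> \<nu>)
    \<and> (\<forall>\<nu>. stationary v \<mu> \<nu> \<longrightarrow> weak_conv (berk_top v)
           (\<lambda>n. distr (restrict_space P (\<Omega>n n)) (borel_of_top (berk_top v))
                   (\<lambda>\<omega>. berk_emb v (att v (rprod \<omega> n)))) \<nu>)
    \<and> (\<exists>\<nu>. stationary v (check_mu \<mu>) \<nu>)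
    \<and> (\<forall>\<nu>. stationary v (check_mu \<mu>) \<nu> \<longrightarrow> weak_conv (berk_top v)
           (\<lambda>n. distr (restrict_space P (\<Omega>n n)) (borel_of_top (berk_top v))
                   (\<lambda>\<omega>. berk_emb v (rep v (rprod \<omega> n)))) \<nu>)
    \<and> ((\<integral>\<^sup>+ g. ennreal (ln (mnorm v g)) \<partial>measure_pmf \<mu>) < \<infinity> \<longrightarrow>
         (\<forall>\<epsilon>>0. (\<lambda>n. measure P {\<omega> \<in> space P. trace (rprod \<omega> n) \<noteq> 0 \<and>
             \<bar>ln (v (trace (rprod \<omega> n))) / real n - lyap v \<mu>\<bar> < \<epsilon>}) \<longlonglongrightarrow> 1))"
proof -
  interpret W: nonelem_walk v \<mu>
    by unfold_locales (use k supp nonel in \<open>auto simp: complete_nontrivial_nonarch_field_def\<close>)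
  interpret C: nonelem_walk v "check_mu \<mu>" by (rule W.nonelem_walk_check)
  have "(\<lambda>n. measure (conv_pow \<mu> n) {g. hyperbolic v g}) \<longlonglongrightarrow> 1"
    using W.hyperbolic_prob[of _ 1] by (intro pmf_prob_tendsto_1) (simp add: hyperbolic_def not_less)
  then have 1: "(\<lambda>n. measure P (\<Omega>n n)) \<longlonglongrightarrow> 1"
    unfolding P_def \<Omega>n_def measure_rprod .
  have 2: "\<exists>\<nu>. stationary v \<mu> \<nu>" using W.limit_pt_exists W.limit_pt_stationary by blast
  have 3: "\<exists>\<nu>. stationary v (check_mu \<mu>) \<nu>" using C.limit_pt_exists C.limit_pt_stationary by blast
  have 4: "weak_conv (berk_top v) (\<lambda>n. distr (restrict_space P (\<Omega>n n)) (borel_of_top (berk_top v))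
       (\<lambda>\<omega>. berk_emb v (att v (rprod \<omega> n)))) \<nu>" if st: "stationary v \<mu> \<nu>" for \<nu>
    unfolding P_def \<Omega>n_def
    by (rule W.weak_conv_fixed_point[where F = "\<lambda>g. berk_emb v (att v g)", OF W.berk_emb_mem W.att_expectation_tendsto[OF st]])
  have 5: "weak_conv (berk_top v) (\<lambda>n. distr (restrict_space P (\<Omega>n n)) (borel_of_top (berk_top v))
       (\<lambda>\<omega>. berk_emb v (rep v (rprod \<omega> n)))) \<nu>" if st: "stationary v (check_mu \<mu>) \<nu>" for \<nu>
    unfolding P_def \<Omega>n_def
  proof (rule W.weak_conv_fixed_point[where F = "\<lambda>g. berk_emb v (rep v g)", OF W.berk_emb_mem])
    fix f C assume f: "continuous_map (berk_top v) euclideanreal f" "\<And>p. p \<in> berkP1 v \<Longrightarrow> \<bar>f p\<bar> \<le> C"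
    \<comment> \<open>The repelling point of \<open>g\<close> is the attracting point of its
      inverse, and both have the same trace, hence are hyperbolic together.\<close>
    have "measure_pmf.expectation (conv_pow (check_mu \<mu>) n) (\<lambda>g. if hyperbolic v g then f (berk_emb v (att v g)) else 0) =
       measure_pmf.expectation (conv_pow \<mu> n) (\<lambda>g. if hyperbolic v g then f (berk_emb v (rep v g)) else 0)" for n
      unfolding conv_pow_check_mu[OF supp] integral_map_pmf
      using W.conv_in_SL2 by (intro integral_cong_AE) (auto simp: AE_measure_pmf_iff hyperbolic_def W.rep_eq_att_adj2)
    then show "(\<lambda>n. measure_pmf.expectation (conv_pow \<mu> n) (\<lambda>g. if hyperbolic v g then f (berk_emb v (rep v g)) else 0)) \<longlonglongrightarrow> (\<integral>p. f p \<partial>\<nu>)"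
      using C.att_expectation_tendsto[OF st f] by simp
  qed
  have 6: "(\<lambda>n. measure P {\<omega> \<in> space P. trace (rprod \<omega> n) \<noteq> 0 \<and>
             \<bar>ln (v (trace (rprod \<omega> n))) / real n - lyap v \<mu>\<bar> < \<epsilon>}) \<longlonglongrightarrow> 1"
    if fin: "(\<integral>\<^sup>+ g. ennreal (ln (mnorm v g)) \<partial>measure_pmf \<mu>) < \<infinity>" and \<epsilon>: "\<epsilon> > 0" for \<epsilon>
  proof -
    have "(\<lambda>n. measure (conv_pow \<mu> n) {g. trace g \<noteq> 0 \<and> \<bar>ln (v (trace g)) / real n - lyap v \<mu>\<bar> < \<epsilon>}) \<longlonglongrightarrow> 1"
      by (rule pmf_prob_tendsto_1, rule W.lyap_prob[OF fin \<epsilon>])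
    moreover have "measure P {\<omega> \<in> space P. trace (rprod \<omega> n) \<noteq> 0 \<and> \<bar>ln (v (trace (rprod \<omega> n))) / real n - lyap v \<mu>\<bar> < \<epsilon>} =
       measure (conv_pow \<mu> n) {g. trace g \<noteq> 0 \<and> \<bar>ln (v (trace g)) / real n - lyap v \<mu>\<bar> < \<epsilon>}" for n
      unfolding P_def by (rule measure_rprod)
    ultimately show ?thesis by (simp only:)
  qed
  show ?thesis using 1 2 3 4 5 6 by blast
qed

end
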